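(* Let $n\ge1$, let $a_0\ge0$, let $a:(0,\infty)\to\mathbb R$ be bounded on every set $[\epsilon,\infty)$, $\epsilon>0$, and integrable on $(0,1)$, and put $A(t)=a_0+\int_0^ta(r)\,dr$. Assume that 1. the initial data satisfy $u_0\in L^1(\mathbb R^n)\cap H^s(\mathbb R^n)$ for some $s\ge0$; 2. for some $\alpha>0$, the Laplace transform $\tilde a$ can be extended to the half plane $\{z\in\mathbb C:\Re z\ge-\alpha\}$, and either $a_0>0$ and $a_0+\Re\,\tilde a(i\omega)>0$ for all $\omega\in\mathbb R$, or $\Re\,\tilde a(-\alpha+i\omega)\ge0$ for all $\omega\in\mathbb R$. Set $k(t)=\sqrt{tA(t)}$. Let $u\in C([0,\infty),H^s(\mathbb R^n))$ be the unique distributional solution of $$u_t=a_0\Delta u+\int_0^ta(t-r)\Delta u(\cdot,r)\,dr,\qquad u(\cdot,0)=u_0 .$$ Then, as $T\to\infty$, $$u_{T,k}(\cdot,t)\to U_0\,u_\infty(\cdot,t)\quad\text{in }H^s(\mathbb R^n),$$ where $U_0=\int_{\mathbb R^n}u_0(x)\,dx$ and $\hat u_\infty(\xi,t)=e^{-|\xi|^2t}$, that is, $u_\infty$ is the fundamental solution of the heat equation. The convergence is uniform on any compact subinterval of $(0,\infty)$.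
   Context: $\tilde a(z)=\int_0^\infty e^{-zt}a(t)\,dt$ is the Laplace transform. Fourier transform: $\hat f(\xi)=\int_{\mathbb R^n}e^{-ix\cdot\xi}f(x)\,dx$. The solution $u$: its Fourier transform is $\hat u(\xi,t)=z(|\xi|^2,t)\hat u_0(\xi)$, where for $\lambda\ge0$ the function $z(\lambda,\cdot)$ is the solution of $z(\lambda,t)+\lambda\int_0^tA(t-r)z(\lambda,r)\,dr=1$. Scaling: $u_{T,k}(x,t)=k(T)^nu(k(T)x,Tt)$.
   Formalization: "The Laplace transform can be extended to Re z ≥ −α" is taken as absolute convergence of its integral there (continuation alone fails: a=cos(t²), a₀=10, s large), and A is assumed not identically zero (a₀=0, a=0 makes k=0 and the claim false). *)

theory Defs
  imports "HOL-Analysis.Analysis"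
begin

text \<open>
  Functions on $\mathbb R^n$ have type \<open>real ^ 'n \<Rightarrow> complex\<close> and represent classes modulo
  Lebesgue-null sets. Integrals are over \<open>lborel\<close>; this loses no classes, since every Lebesgue
  measurable function agrees almost everywhere with a Borel measurable one.
\<close>

section \<open>Fourier transform and Sobolev spaces\<close>

definition L2 :: "(real ^ 'n \<Rightarrow> complex) set" where
  "L2 = {f \<in> borel_measurable lborel. integrable lborel (\<lambda>x. (norm (f x))\<^sup>2)}"

definition fourier :: "(real ^ 'n \<Rightarrow> complex) \<Rightarrow> real ^ 'n \<Rightarrow> complex" where
  "fourier f \<xi> = (LINT x|lborel. cis (- (x \<bullet> \<xi>)) * f x)"

text \<open>
  The integral above need not exist for square integrable functions. Their transform is the limit
  in the mean of the transforms of the truncations to balls (which are integrable); it is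
  determined up to a null set.
\<close>

definition has_fourier_L2 :: "(real ^ 'n \<Rightarrow> complex) \<Rightarrow> (real ^ 'n \<Rightarrow> complex) \<Rightarrow> bool" where
  "has_fourier_L2 f g \<longleftrightarrow> f \<in> L2 \<and> g \<in> L2 \<and>
     ((\<lambda>R. LINT \<xi>|lborel. (norm (fourier (\<lambda>x. indicator (ball 0 R) x *\<^sub>R f x) \<xi> - g \<xi>))\<^sup>2)
        \<longlongrightarrow> 0) at_top"

definition fourier_L2 :: "(real ^ 'n \<Rightarrow> complex) \<Rightarrow> real ^ 'n \<Rightarrow> complex" where
  "fourier_L2 f = (SOME g. has_fourier_L2 f g)"

text \<open>$H^s(\mathbb R^n)$ for $s \ge 0$, a subspace of $L^2(\mathbb R^n)$.\<close>

definition sobolev :: "real \<Rightarrow> (real ^ 'n \<Rightarrow> complex) set" where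
  "sobolev s = {f. \<exists>g. has_fourier_L2 f g \<and>
     integrable lborel (\<lambda>\<xi>. (1 + (norm \<xi>)\<^sup>2) powr s * (norm (g \<xi>))\<^sup>2)}"

definition sobolev_norm :: "real \<Rightarrow> (real ^ 'n \<Rightarrow> complex) \<Rightarrow> real" where
  "sobolev_norm s f =
     sqrt (LINT \<xi>|lborel. (1 + (norm \<xi>)\<^sup>2) powr s * (norm (fourier_L2 f \<xi>))\<^sup>2)"

text \<open>$C([0,\infty), H^s(\mathbb R^n))$; the value of a function \<open>u\<close> at time $t$ and place $x$ is \<open>u t x\<close>.\<close>

definition continuous_sobolev :: "real \<Rightarrow> (real \<Rightarrow> real ^ 'n \<Rightarrow> complex) \<Rightarrow> bool" where
  "continuous_sobolev s u \<longleftrightarrow> (\<forall>t\<ge>0. u t \<in> sobolev s) \<and>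
     (\<forall>t\<ge>0. ((\<lambda>r. sobolev_norm s (\<lambda>x. u r x - u t x)) \<longlongrightarrow> 0) (at t within {0..}))"

section \<open>Distributional solutions\<close>

definition dir_deriv ::
    "'a \<Rightarrow> ('a::real_normed_vector \<Rightarrow> 'b::real_normed_vector) \<Rightarrow> 'a \<Rightarrow> 'b" where
  "dir_deriv v f p = frechet_derivative f (at p) v"

primrec cont_differentiable ::
    "nat \<Rightarrow> ('a::euclidean_space \<Rightarrow> 'b::real_normed_vector) \<Rightarrow> bool" where
  "cont_differentiable 0 f \<longleftrightarrow> continuous_on UNIV f"
| "cont_differentiable (Suc m) f \<longleftrightarrow>
     (\<forall>p. f differentiable (at p)) \<and> (\<forall>b\<in>Basis. cont_differentiable m (dir_deriv b f))"

text \<open>Test functions on the open set $(0,\infty) \times \mathbb R^n$, extended by zero.\<close>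

definition test_function :: "(real \<times> (real ^ 'n) \<Rightarrow> complex) \<Rightarrow> bool" where
  "test_function \<phi> \<longleftrightarrow> (\<forall>m. cont_differentiable m \<phi>) \<and>
     compact (closure {p. \<phi> p \<noteq> 0}) \<and> closure {p. \<phi> p \<noteq> 0} \<subseteq> {0<..} \<times> UNIV"

definition time_deriv :: "(real \<times> (real ^ 'n) \<Rightarrow> complex) \<Rightarrow> real \<times> (real ^ 'n) \<Rightarrow> complex" where
  "time_deriv \<phi> = dir_deriv (1, 0) \<phi>"

definition space_laplacian :: "(real \<times> (real ^ 'n) \<Rightarrow> complex) \<Rightarrow> real \<times> (real ^ 'n) \<Rightarrow> complex" where
  "space_laplacian \<phi> p = (\<Sum>b\<in>Basis. dir_deriv (0, b) (dir_deriv (0, b) \<phi>) p)"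

text \<open>
  $u_t = a_0 \Delta u + \int_0^t a(t-r) \Delta u(\cdot,r)\,dr$ in the distributions on
  $(0,\infty) \times \mathbb R^n$, for \<open>u\<close> continuous with values in $L^2$: all derivatives are
  moved to the test function, and the time integral of the distributions $a(t-r)\Delta u(\cdot,r)$
  is taken after pairing with the test function at time \<open>t\<close>.
\<close>

definition distributional_solution ::
    "real \<Rightarrow> (real \<Rightarrow> real) \<Rightarrow> (real \<Rightarrow> real ^ 'n \<Rightarrow> complex) \<Rightarrow> bool" where
  "distributional_solution a\<^sub>0 a u \<longleftrightarrow> (\<forall>\<phi>. test_function \<phi> \<longrightarrow>
     - (LINT t:{0<..}|lborel. (LINT x|lborel. u t x * time_deriv \<phi> (t, x))) =
       (LINT t:{0<..}|lborel.
          a\<^sub>0 *\<^sub>R (LINT x|lborel. u t x * space_laplacian \<phi> (t, x)) +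
          (LINT r:{0<..<t}|lborel.
             a (t - r) *\<^sub>R (LINT x|lborel. u r x * space_laplacian \<phi> (t, x)))))"

section \<open>Kernel and scaling\<close>

text \<open>Only the values of the kernel \<open>a\<close> on $(0,\infty)$ matter.\<close>

definition laplace :: "(real \<Rightarrow> real) \<Rightarrow> complex \<Rightarrow> complex" where
  "laplace a z = (LINT t:{0<..}|lborel. exp (- z * of_real t) * of_real (a t))"

text \<open>
  The Laplace transform extends to the half plane $\Re z \ge -\alpha$ as a Laplace transform, i.e.
  its integral converges (in the sense of Lebesgue) there. A mere analytic continuation is not
  enough: the transform of $\cos(t^2)$ is entire, but this kernel does not decay.
\<close>

definition laplace_extends :: "(real \<Rightarrow> real) \<Rightarrow> real \<Rightarrow> bool" where
  "laplace_extends a \<alpha> \<longleftrightarrow>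
     (\<forall>z. Re z \<ge> - \<alpha> \<longrightarrow>
        set_integrable lborel {0<..} (\<lambda>t. exp (- z * of_real t) * of_real (a t)))"

definition integrated_kernel :: "real \<Rightarrow> (real \<Rightarrow> real) \<Rightarrow> real \<Rightarrow> real" where
  "integrated_kernel a\<^sub>0 a t = a\<^sub>0 + (LINT r:{0<..<t}|lborel. a r)"

definition diffusion_scale :: "real \<Rightarrow> (real \<Rightarrow> real) \<Rightarrow> real \<Rightarrow> real" where
  "diffusion_scale a\<^sub>0 a t = sqrt (t * integrated_kernel a\<^sub>0 a t)"

definition rescaled ::
    "(real \<Rightarrow> real) \<Rightarrow> (real \<Rightarrow> real ^ 'n \<Rightarrow> complex) \<Rightarrow> real \<Rightarrow> real \<Rightarrow> real ^ 'n \<Rightarrow> complex" where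
  "rescaled k u T t x = (k T) ^ CARD('n) *\<^sub>R u (T * t) (k T *\<^sub>R x)"

end

(*
  On the Fourier side the equation becomes the scalar Volterra equation
  z' = -mu (a0 z + a * z), z(0) = 1, with mu = |xi|^2, and the weak formulation forces the transform
  of u(t) to be z(|xi|^2, t) times the transform of u0.  Either positivity assumption makes the
  quadratic form attached to the kernel nonnegative (Bochner), also after multiplication by a small
  exponential, and an energy argument yields |z(mu, t)| <= 2 exp(-kappa min(1, mu) t).  Moreover
  z(mu, t) = exp(-mu J t) + O(mu) uniformly in t, where J = a0 + int a is the limit of A.  After
  rescaling, mu = |xi|^2 / k^2 with k^2 = T A(T), so the frequencies |xi| <= k converge to the heat
  symbol under a Gaussian majorant, while those with |xi| > k contribute at most a power of T times
  exp(-2 kappa c T).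
*)
theory Submission
  imports Defs "HOL-Probability.Probability"
begin

section \<open>Integration over Euclidean space\<close>

text \<open>The two positivity assumptions call for different energy arguments. In the first, strict
  positivity improves to a uniform lower bound \<delta>, and a weight exp(\<gamma> t) with small
  \<gamma> spends at most half of it. In the second, the real part may vanish and cannot dominate
  the term \<gamma> y^2 that the weight creates. That term is cancelled by passing from the weighted
  kernel b to b - \<gamma> \<open>tail b\<close>, still of positive type because \<gamma> \<le>
  \<alpha>/2 leaves enough exponential damping. The rate contains min(1, \<mu>) since coercivity is
  proportional to \<mu> while the weight is limited by the fixed margin \<alpha>. Nondegeneracy
  excludes A = 0, for which k vanishes, and makes J positive in the second case. On the Fourier side
  the obstacle is one of supports: test functions have compact support in x, whereas the Laplacian
  acts as a multiplier on transforms of functions with bounded support in \<xi>. Smooth cutoffs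
  mediate, and a dual form of Plancherel's inequality bounds their error by the norm of the
  transform of u(t), the quantity known to depend continuously on t.\<close>

lemma nn_integral_lborel_affine:
  fixes t :: "'a::euclidean_space"
  assumes [measurable]: "f \<in> borel_measurable borel" and c: "c \<noteq> 0"
  shows "(\<integral>\<^sup>+x. f x \<partial>lborel) = ennreal (\<bar>c\<bar> ^ DIM('a)) * (\<integral>\<^sup>+x. f (t + c *\<^sub>R x) \<partial>lborel)"
  by (subst lborel_affine[OF c, of t])
     (simp add: nn_integral_density nn_integral_distr nn_integral_cmult ennreal_power)

lemma integrable_lborel_affine:
  fixes f :: "'a::euclidean_space \<Rightarrow> 'b :: {banach, second_countable_topology}"
  assumes f: "integrable lborel f" and c: "c \<noteq> 0"
  shows "integrable lborel (\<lambda>x. f (t + c *\<^sub>R x))"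
proof -
  have [measurable]: "f \<in> borel_measurable borel" using f by auto
  have "(\<integral>\<^sup>+x. norm (f x) \<partial>lborel) = ennreal (\<bar>c\<bar> ^ DIM('a)) * (\<integral>\<^sup>+x. norm (f (t + c *\<^sub>R x)) \<partial>lborel)"
    by (rule nn_integral_lborel_affine) (use c in auto)
  moreover have "(\<integral>\<^sup>+x. norm (f x) \<partial>lborel) < \<infinity>"
    using f by (simp add: integrable_iff_bounded)
  moreover have "ennreal (\<bar>c\<bar> ^ DIM('a)) \<noteq> 0" using c by simp
  ultimately show ?thesis
    unfolding integrable_iff_bounded by (auto simp: ennreal_mult_less_top)
qed

lemma integrable_lborel_affine_iff:
  fixes f :: "'a::euclidean_space \<Rightarrow> 'b :: {banach, second_countable_topology}"
  assumes c: "c \<noteq> 0"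
  shows "integrable lborel (\<lambda>x. f (t + c *\<^sub>R x)) \<longleftrightarrow> integrable lborel f"
proof
  assume "integrable lborel (\<lambda>x. f (t + c *\<^sub>R x))"
  from integrable_lborel_affine[OF this, of "1/c" "- (1/c) *\<^sub>R t"] c
  show "integrable lborel f" by (simp add: algebra_simps)
qed (use c in \<open>auto intro: integrable_lborel_affine\<close>)

lemma integral_lborel_affine:
  fixes f :: "'a::euclidean_space \<Rightarrow> 'b :: {banach, second_countable_topology}"
  assumes c: "c \<noteq> 0"
  shows "(LINT x|lborel. f x) = (\<bar>c\<bar> ^ DIM('a)) *\<^sub>R (LINT x|lborel. f (t + c *\<^sub>R x))"
proof cases
  assume f: "integrable lborel f"
  then have [measurable]: "f \<in> borel_measurable borel" by auto
  show ?thesis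
    using c f integrable_lborel_affine[OF f c, of t]
    by (subst lborel_affine[OF c, of t]) (simp add: integral_density integral_distr)
next
  \<comment> \<open>Both integrals then take the default value 0, so the identity persists.\<close>
  assume "\<not> integrable lborel f" with c show ?thesis
    by (simp add: integrable_lborel_affine_iff not_integrable_integral_eq)
qed

lemmas integral_lborel_reflect = integral_lborel_affine[where c="-1", simplified]
lemmas integral_lborel_shift = integral_lborel_affine[where c=1, simplified]
lemmas integrable_lborel_reflect_iff = integrable_lborel_affine_iff[where c="-1", simplified]
lemmas integrable_lborel_shift_iff = integrable_lborel_affine_iff[where c=1, simplified]

text \<open>\<open>lborel\<close> is the image of a product of one-dimensional measures under the
  coordinate map, so products of functions of single coordinates integrate factor by factor. This
  reduces the n-dimensional Gaussian to the real one.\<close>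

lemma
  fixes f :: "'a::euclidean_space \<Rightarrow> real \<Rightarrow> 'b::{real_normed_field,banach,second_countable_topology}"
  assumes f: "\<And>b. b \<in> Basis \<Longrightarrow> integrable lborel (f b)"
  shows integrable_lborel_prod: "integrable lborel (\<lambda>x. \<Prod>b\<in>Basis. f b (x \<bullet> b))"
    and integral_lborel_prod:
      "(LINT x|lborel. (\<Prod>b\<in>Basis. f b (x \<bullet> b))) = (\<Prod>b\<in>Basis. LINT x|lborel. f b x)"
proof -
  interpret product_sigma_finite "\<lambda>_::'a. lborel :: real measure" by standard
  have [measurable]: "f b \<in> borel_measurable borel" if "b \<in> Basis" for b
    using f[OF that] by auto
  have eq: "(\<Prod>b\<in>Basis. f b ((\<Sum>b\<in>Basis. x b *\<^sub>R b) \<bullet> b)) = (\<Prod>b\<in>Basis. f b (x b))" for x :: "'a \<Rightarrow> real"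
    by (intro prod.cong) (auto simp: inner_sum_left inner_Basis if_distrib cong: if_cong)
  show "integrable lborel (\<lambda>x. \<Prod>b\<in>Basis. f b (x \<bullet> b))"
    unfolding lborel_eq[where ?'a='a]
    by (subst integrable_distr_eq) (auto simp: eq intro!: product_integrable_prod f)
  show "(LINT x|lborel. (\<Prod>b\<in>Basis. f b (x \<bullet> b))) = (\<Prod>b\<in>Basis. LINT x|lborel. f b x)"
    unfolding lborel_eq[where ?'a='a]
    by (subst integral_distr) (auto simp: eq intro!: product_integral_prod f)
qed

text \<open>The function f(x) g(y) is integrable on the product space, and K changes it only by a
  bounded factor. One statement thus serves \<open>cis\<close> in the multiplication formula,
  \<open>heat\<close> in convolutions and the exponential kernel behind
  \<open>set_integrable_tail\<close>.\<close>

lemma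
  fixes f :: "'a::euclidean_space \<Rightarrow> complex" and g :: "'b::euclidean_space \<Rightarrow> complex"
  assumes f: "integrable lborel f" and g: "integrable lborel g"
    and [measurable]: "(\<lambda>p. K (fst p) (snd p)) \<in> borel_measurable (borel \<Otimes>\<^sub>M borel)"
    and K: "\<And>x y. norm (K x y :: complex) \<le> C"
  shows integrable_bounded_kernel: "integrable (lborel \<Otimes>\<^sub>M lborel) (\<lambda>(x, y). f x * (K x y * g y))"
    and Fubini_bounded_kernel:
      "(LINT x|lborel. f x * (LINT y|lborel. K x y * g y)) = (LINT y|lborel. (LINT x|lborel. K x y * f x) * g y)"
    and integrable_kernel_left: "integrable lborel (\<lambda>x. f x * (LINT y|lborel. K x y * g y))"
proof -
  have [measurable]: "f \<in> borel_measurable borel" "g \<in> borel_measurable borel" using f g by auto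
  have "integrable (lborel \<Otimes>\<^sub>M lborel) (\<lambda>(x, y). f x * g y)"
  proof (rule lborel_pair.Fubini_integrable)
    show "integrable lborel (\<lambda>x. LINT y|lborel. norm (case (x, y) of (x, y) \<Rightarrow> f x * g y))"
      using f by (simp add: norm_mult)
  qed (use f g in \<open>auto intro!: integrable_mult_right\<close>)
  then have "integrable (lborel \<Otimes>\<^sub>M lborel) (\<lambda>p. C *\<^sub>R norm (f (fst p) * g (snd p)))"
    by (auto simp: case_prod_unfold)
  then have I: "integrable (lborel \<Otimes>\<^sub>M lborel) (\<lambda>p. f (fst p) * (K (fst p) (snd p) * g (snd p)))"
  proof (rule Bochner_Integration.integrable_bound)
    have "norm (f x * (K x y * g y)) \<le> norm (C *\<^sub>R norm (f x * g y))" for x y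
    proof -
      have "norm (f x * (K x y * g y)) = norm (K x y) * norm (f x * g y)" by (simp add: norm_mult)
      also have "\<dots> \<le> C * norm (f x * g y)" by (intro mult_right_mono K) simp
      finally show ?thesis by simp
    qed
    then show "AE p in lborel \<Otimes>\<^sub>M lborel. norm (f (fst p) * (K (fst p) (snd p) * g (snd p)))
        \<le> norm (C *\<^sub>R norm (f (fst p) * g (snd p)))"
      by simp
  qed measurable
  then show I': "integrable (lborel \<Otimes>\<^sub>M lborel) (\<lambda>(x, y). f x * (K x y * g y))"
    by (simp add: case_prod_unfold)
  show "integrable lborel (\<lambda>x. f x * (LINT y|lborel. K x y * g y))"
    using lborel_pair.integrable_fst'[OF I] by simp
  have "(LINT x|lborel. f x * (LINT y|lborel. K x y * g y)) = (LINT x|lborel. (LINT y|lborel. f x * (K x y * g y)))"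
    by simp
  also have "\<dots> = (LINT y|lborel. (LINT x|lborel. f x * (K x y * g y)))"
    using lborel_pair.Fubini_integral[OF I'] by simp
  also have "\<dots> = (LINT y|lborel. (LINT x|lborel. K x y * f x) * g y)"
    by (simp add: mult.left_commute flip: integral_mult_left_zero mult.assoc) (simp add: mult_ac)
  finally show "(LINT x|lborel. f x * (LINT y|lborel. K x y * g y)) = (LINT y|lborel. (LINT x|lborel. K x y * f x) * g y)" .
qed

section \<open>The Fourier transform of integrable functions\<close>

definition ft :: "('a::euclidean_space \<Rightarrow> complex) \<Rightarrow> 'a \<Rightarrow> complex" where
  "ft f \<xi> = (LINT x|lborel. cis (- (x \<bullet> \<xi>)) * f x)"

lemma fourier_eq_ft: "fourier = ft"
  by (simp add: fun_eq_iff fourier_def ft_def)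

lemma borel_measurable_cis [measurable]: "cis \<in> borel_measurable borel"
  by (intro borel_measurable_continuous_onI continuous_intros)

lemma integrable_cis_mult:
  assumes "integrable lborel (f :: 'a::euclidean_space \<Rightarrow> complex)"
  shows "integrable lborel (\<lambda>x. cis (c * (x \<bullet> \<xi>)) * f x)" "integrable lborel (\<lambda>x. cis (- (x \<bullet> \<xi>)) * f x)"
     "integrable lborel (\<lambda>x. cis ((x \<bullet> \<xi>)) * f x)"
  by (rule Bochner_Integration.integrable_bound[OF assms]; use assms in \<open>auto simp: norm_mult\<close>)+

lemma borel_measurable_ft [measurable]:
  assumes [measurable]: "f \<in> borel_measurable borel"
  shows "ft f \<in> borel_measurable borel"
  unfolding ft_def by measurable

lemma norm_ft_le: "norm (ft f \<xi>) \<le> (LINT x|lborel. norm (f x))"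
proof -
  have "norm (ft f \<xi>) \<le> (LINT x|lborel. norm (cis (- (x \<bullet> \<xi>)) * f x))"
    unfolding ft_def by (rule integral_norm_bound)
  then show ?thesis by (simp add: norm_mult)
qed

lemma continuous_ft:
  assumes f: "integrable lborel (f :: 'a::euclidean_space \<Rightarrow> complex)"
  shows "continuous_on UNIV (ft f)"
  unfolding continuous_on_sequentially comp_def
proof safe
  fix \<xi> X assume X: "X \<longlonglongrightarrow> (\<xi>::'a)"
  have [measurable]: "f \<in> borel_measurable borel" using f by auto
  show "(\<lambda>n. ft f (X n)) \<longlonglongrightarrow> ft f \<xi>"
    unfolding ft_def
  proof (rule integral_dominated_convergence[where w="\<lambda>x. norm (f x)"])
    show "AE x in lborel. (\<lambda>n. cis (- (x \<bullet> X n)) * f x) \<longlonglongrightarrow> cis (- (x \<bullet> \<xi>)) * f x"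
    proof (intro AE_I2 tendsto_mult tendsto_const)
      fix x
      have "continuous_on UNIV (\<lambda>y::'a. cis (- (x \<bullet> y)))" by (intro continuous_intros)
      then have "isCont (\<lambda>y. cis (- (x \<bullet> y))) \<xi>" by (simp add: continuous_on_eq_continuous_at)
      then show "(\<lambda>n. cis (- (x \<bullet> X n))) \<longlonglongrightarrow> cis (- (x \<bullet> \<xi>))"
        using X by (rule isCont_tendsto_compose)
    qed
  qed (use f in \<open>auto simp: norm_mult\<close>)
qed

text \<open>The multiplication formula: the kernel is symmetric in its two arguments, so exchanging
  the integrals moves the transform to the other factor. Every duality argument below starts
  here.\<close>

lemma ft_swap:
  assumes f: "integrable lborel (f :: 'a::euclidean_space \<Rightarrow> complex)" and h: "integrable lborel h"
  shows "(LINT \<xi>|lborel. ft f \<xi> * h \<xi>) = (LINT x|lborel. f x * ft h x)"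
proof -
  have "(LINT x|lborel. f x * (LINT y|lborel. cis (- (y \<bullet> x)) * h y))
      = (LINT y|lborel. (LINT x|lborel. cis (- (y \<bullet> x)) * f x) * h y)"
    by (rule Fubini_bounded_kernel[OF f h, where C=1]) auto
  then show ?thesis by (simp add: ft_def inner_commute)
qed

section \<open>Gaussians\<close>

definition gs :: "real \<Rightarrow> 'a::euclidean_space \<Rightarrow> real" where
  "gs \<epsilon> x = exp (- (\<epsilon> * (norm x)\<^sup>2 / 2))"

text \<open>The transform of \<open>gs \<epsilon>\<close>. As the transform carries no
  normalisation, the mass is (2 pi)^n for every \<epsilon>, not 1; this is the source of the powers
  of 2 pi in the limits below.\<close>

definition heat :: "real \<Rightarrow> 'a::euclidean_space \<Rightarrow> real" where
  "heat \<epsilon> x = sqrt (2 * pi / \<epsilon>) ^ DIM('a) * exp (- ((norm x)\<^sup>2 / (2 * \<epsilon>)))"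

lemma gs_pos [simp]: "gs \<epsilon> x > 0" "gs \<epsilon> x \<ge> 0" "\<epsilon> \<ge> 0 \<Longrightarrow> gs \<epsilon> x \<le> 1"
  and heat_nonneg [simp]: "\<epsilon> > 0 \<Longrightarrow> heat \<epsilon> x \<ge> 0"
  by (auto simp: gs_def heat_def)

lemma borel_measurable_gs [measurable]: "gs \<epsilon> \<in> borel_measurable borel"
  and borel_measurable_heat [measurable]: "heat \<epsilon> \<in> borel_measurable borel"
  unfolding gs_def heat_def by measurable

text \<open>The characteristic function of the standard normal law, rescaled by r = sqrt \<epsilon>.
  Evaluating it at - t / r accounts both for the scale and for the opposite sign convention in the
  exponent.\<close>

lemma gaussian_real:
  fixes t \<epsilon> :: real assumes e: "\<epsilon> > 0"
  shows "integrable lborel (\<lambda>x. complex_of_real (exp (- (\<epsilon> * x\<^sup>2 / 2))))"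
    "(LINT x|lborel. cis (- (x * t)) * of_real (exp (- (\<epsilon> * x\<^sup>2 / 2))))
      = of_real (sqrt (2 * pi / \<epsilon>) * exp (- (t\<^sup>2 / (2 * \<epsilon>))))"
proof -
  define r where "r = sqrt \<epsilon>"
  have r: "r > 0" "r\<^sup>2 = \<epsilon>" using e by (auto simp: r_def)
  have nd: "sqrt (2 * pi) * std_normal_density y = exp (- (y\<^sup>2 / 2))" for y
    by (simp add: std_normal_density_def)
  have i1: "integrable lborel (\<lambda>x. complex_of_real (exp (- (x\<^sup>2 / 2))))"
    unfolding nd[symmetric] by (intro integrable_of_real integrable_mult_right) simp
  from lborel_integrable_real_affine[OF i1, of r 0] r
  show int: "integrable lborel (\<lambda>x. complex_of_real (exp (- (\<epsilon> * x\<^sup>2 / 2))))"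
    by (simp add: power_mult_distrib)
  have "complex_of_real (exp (- ((-t/r)\<^sup>2) / 2)) = char std_normal_distribution (- t/r)"
    by (simp add: char_std_normal_distribution)
  also have "\<dots> = (LINT x|lborel. std_normal_density x *\<^sub>R cis (x * (-t/r)))"
    unfolding char_def by (subst integral_density) (auto simp: cis_conv_exp mult_ac)
  also have "\<dots> = \<bar>r\<bar> *\<^sub>R (LINT x|lborel. std_normal_density (0 + r * x) *\<^sub>R cis ((0 + r * x) * (-t/r)))"
    by (rule lborel_integral_real_affine) (use r in simp)
  also have "(\<lambda>x. std_normal_density (0 + r * x) *\<^sub>R cis ((0 + r * x) * (-t/r)))
      = (\<lambda>x. of_real (1 / sqrt (2 * pi)) * (cis (- (x * t)) * of_real (exp (- (\<epsilon> * x\<^sup>2 / 2)))))"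
    using r by (auto simp: std_normal_density_def power_mult_distrib scaleR_conv_of_real)
  also have "(LINT x|lborel. \<dots> x) = of_real (1 / sqrt (2 * pi)) * (LINT x|lborel. cis (- (x * t)) * of_real (exp (- (\<epsilon> * x\<^sup>2 / 2))))"
    by (rule integral_mult_right_zero)
  finally have *: "complex_of_real (exp (- ((-t/r)\<^sup>2) / 2)) = of_real (r / sqrt (2 * pi)) *
      (LINT x|lborel. cis (- (x * t)) * of_real (exp (- (\<epsilon> * x\<^sup>2 / 2))))"
    using r by (simp add: scaleR_conv_of_real)
  have **: "of_real (sqrt (2*pi) / r) * of_real (r / sqrt (2*pi)) = (1::complex)"
    using r by (simp flip: of_real_mult)
  have "of_real (sqrt (2*pi) / r) * complex_of_real (exp (- ((-t/r)\<^sup>2) / 2)) =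
    (of_real (sqrt (2*pi) / r) * of_real (r / sqrt (2*pi))) * (LINT x|lborel. cis (- (x * t)) * of_real (exp (- (\<epsilon> * x\<^sup>2 / 2))))"
    unfolding * by (simp only: mult.assoc)
  then have "(LINT x|lborel. cis (- (x * t)) * of_real (exp (- (\<epsilon> * x\<^sup>2 / 2)))) =
      of_real (sqrt (2*pi) / r) * complex_of_real (exp (- ((-t/r)\<^sup>2) / 2))"
    unfolding ** by simp
  also have "\<dots> = of_real (sqrt (2 * pi / \<epsilon>) * exp (- (t\<^sup>2 / (2 * \<epsilon>))))"
    using r e by (simp add: power_divide real_sqrt_divide mult.commute flip: r_def)
  finally show "(LINT x|lborel. cis (- (x * t)) * of_real (exp (- (\<epsilon> * x\<^sup>2 / 2))))
      = of_real (sqrt (2 * pi / \<epsilon>) * exp (- (t\<^sup>2 / (2 * \<epsilon>))))" .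
qed

lemma gs_prod: "gs \<epsilon> (x::'a::euclidean_space) = (\<Prod>b\<in>Basis. exp (- (\<epsilon> * (x \<bullet> b)\<^sup>2 / 2)))"
proof -
  have "(norm x)\<^sup>2 = (\<Sum>b\<in>Basis. (x \<bullet> b)\<^sup>2)"
    by (simp add: norm_eq_sqrt_inner euclidean_inner[of x x] power2_eq_square sum_nonneg)
  then show ?thesis
    by (simp add: gs_def exp_sum[symmetric] sum_negf sum_divide_distrib sum_distrib_left)
qed

lemma integrable_gs_complex: "\<epsilon> > 0 \<Longrightarrow> integrable lborel (\<lambda>x::'a::euclidean_space. complex_of_real (gs \<epsilon> x))"
  unfolding gs_prod of_real_prod by (intro integrable_lborel_prod gaussian_real)

lemma integrable_gs: "\<epsilon> > 0 \<Longrightarrow> integrable lborel (gs \<epsilon> :: 'a::euclidean_space \<Rightarrow> real)"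
  using integrable_gs_complex[of \<epsilon>] by (simp add: complex_of_real_integrable_eq)

lemma cis_inner_prod: "cis (- (x \<bullet> v)) = (\<Prod>b\<in>Basis. cis (- ((x \<bullet> b) * (v \<bullet> (b::'a::euclidean_space)))))"
  by (subst euclidean_inner) (simp add: cis_conv_exp exp_sum[symmetric] sum_negf sum_distrib_left)

lemma ft_gs:
  assumes e: "\<epsilon> > 0"
  shows "ft (\<lambda>x::'a::euclidean_space. complex_of_real (gs \<epsilon> x)) v = of_real (heat \<epsilon> v)"
proof -
  have i: "integrable lborel (\<lambda>x. cis (- (x * t)) * complex_of_real (exp (- (\<epsilon> * x\<^sup>2 / 2))))" for t
    by (rule Bochner_Integration.integrable_bound[OF gaussian_real(1)[OF e]]) (auto simp: norm_mult)
  have "ft (\<lambda>x::'a. complex_of_real (gs \<epsilon> x)) v =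
    (LINT x|lborel. (\<Prod>b\<in>Basis. cis (- ((x \<bullet> b) * (v \<bullet> (b::'a)))) * of_real (exp (- (\<epsilon> * (x \<bullet> b)\<^sup>2 / 2)))))"
    unfolding ft_def by (simp add: cis_inner_prod gs_prod prod.distrib)
  also have "\<dots> = (\<Prod>b\<in>Basis. (LINT x|lborel. cis (- (x * (v \<bullet> (b::'a)))) * of_real (exp (- (\<epsilon> * x\<^sup>2 / 2)))))"
    by (rule integral_lborel_prod) (rule i)
  also have "\<dots> = (\<Prod>b\<in>Basis. of_real (sqrt (2 * pi / \<epsilon>) * exp (- ((v \<bullet> b)\<^sup>2 / (2 * \<epsilon>)))))"
    using e by (intro prod.cong refl gaussian_real)
  also have "\<dots> = of_real (sqrt (2 * pi / \<epsilon>) ^ DIM('a) * (\<Prod>b\<in>Basis. exp (- ((v \<bullet> (b::'a))\<^sup>2 / (2 * \<epsilon>)))))"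
    by (simp add: prod.distrib)
  also have "(\<Prod>b\<in>Basis. exp (- ((v \<bullet> (b::'a))\<^sup>2 / (2 * \<epsilon>)))) = exp (- ((norm v)\<^sup>2 / (2 * \<epsilon>)))"
    using gs_prod[of "1/\<epsilon>" v] by (simp add: gs_def mult.commute)
  finally show ?thesis by (simp add: heat_def)
qed

lemma integrable_heat: "\<epsilon> > 0 \<Longrightarrow> integrable lborel (heat \<epsilon> :: 'a::euclidean_space \<Rightarrow> real)"
  using integrable_gs[of "1/\<epsilon>", where ?'a='a] unfolding heat_def gs_def by (simp add: mult.commute)

lemma integral_heat:
  assumes e: "\<epsilon> > 0"
  shows "(LINT x::'a::euclidean_space|lborel. heat \<epsilon> x) = (2 * pi) ^ DIM('a)"
proof -
  have *: "ft (\<lambda>x::'a. complex_of_real (gs (1/\<epsilon>) x)) 0 = of_real (LINT x::'a|lborel. gs (1/\<epsilon>) x)"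
    by (simp add: ft_def)
  have "complex_of_real (LINT x::'a|lborel. gs (1/\<epsilon>) x) = of_real (heat (1/\<epsilon>) (0::'a))"
    using ft_gs[of "1/\<epsilon>" "0::'a"] * e by simp
  then have "(LINT x::'a|lborel. gs (1/\<epsilon>) x) = heat (1/\<epsilon>) (0::'a)"
    by (simp only: of_real_eq_iff)
  then have "(LINT x::'a|lborel. gs (1/\<epsilon>) x) = sqrt (2 * pi * \<epsilon>) ^ DIM('a)"
    by (simp add: heat_def)
  then have "(LINT x::'a|lborel. heat \<epsilon> x) = sqrt (2 * pi / \<epsilon>) ^ DIM('a) * sqrt (2 * pi * \<epsilon>) ^ DIM('a)"
    unfolding heat_def gs_def by (simp add: mult.commute)
  also have "\<dots> = (2 * pi) ^ DIM('a)"
  proof -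
    have "sqrt (2 * pi / \<epsilon>) * sqrt (2 * pi * \<epsilon>) = 2 * pi"
    proof -
      have "2 * pi / \<epsilon> * (2 * pi * \<epsilon>) = (2 * pi)\<^sup>2" using e by (simp add: power2_eq_square)
      then have "sqrt (2 * pi / \<epsilon> * (2 * pi * \<epsilon>)) = \<bar>2 * pi\<bar>" by (simp only: real_sqrt_abs)
      then show ?thesis by (simp only: real_sqrt_mult[symmetric]) simp
    qed
    then show ?thesis by (simp only: power_mult_distrib[symmetric])
  qed
  finally show ?thesis .
qed

lemma heat_scale:
  assumes e: "\<epsilon> > 0"
  shows "sqrt \<epsilon> ^ DIM('a) * heat \<epsilon> (sqrt \<epsilon> *\<^sub>R w) = heat 1 (w :: 'a::euclidean_space)"
proof -
  have "sqrt \<epsilon> * sqrt (2 * pi / \<epsilon>) = sqrt (2 * pi)" using e by (simp flip: real_sqrt_mult)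
  then have "sqrt \<epsilon> ^ DIM('a) * sqrt (2 * pi / \<epsilon>) ^ DIM('a) = sqrt (2 * pi) ^ DIM('a)"
    by (simp flip: power_mult_distrib)
  moreover have "(norm (sqrt \<epsilon> *\<^sub>R w))\<^sup>2 / (2 * \<epsilon>) = (norm w)\<^sup>2 / 2"
    using e by (simp add: power_mult_distrib)
  ultimately show ?thesis by (simp add: heat_def flip: mult.assoc)
qed

section \<open>Gaussian regularisation, Parseval's identity and Bessel's inequality\<close>

lemma heat_commute: "heat \<epsilon> (x - y) = heat \<epsilon> (y - x)"
  by (simp add: heat_def norm_minus_commute)

lemma heat_le: "\<epsilon> > 0 \<Longrightarrow> heat \<epsilon> x \<le> sqrt (2 * pi / \<epsilon>) ^ DIM('a)" for x :: "'a::euclidean_space"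
  by (simp add: heat_def mult_left_le)

lemma nn_integral_heat:
  fixes x :: "'a::euclidean_space"
  assumes "\<epsilon> > 0"
  shows "(\<integral>\<^sup>+y. ennreal (heat \<epsilon> (x - y)) \<partial>lborel) = ennreal ((2 * pi) ^ DIM('a))"
proof -
  have "nn_integral lborel (\<lambda>y::'a. ennreal (heat \<epsilon> y)) = ennreal ((2 * pi) ^ DIM('a))"
    using assms by (subst nn_integral_eq_integral) (auto simp: integrable_heat integral_heat)
  moreover have "nn_integral lborel (\<lambda>y::'a. ennreal (heat \<epsilon> y)) = (\<integral>\<^sup>+y. ennreal (heat \<epsilon> (x - y)) \<partial>lborel)"
    using nn_integral_lborel_affine[of "\<lambda>y::'a. ennreal (heat \<epsilon> y)" "-1" x] by simp
  ultimately show ?thesis by simp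
qed

lemma integrable_heat_shift:
  "\<epsilon> > 0 \<Longrightarrow> integrable lborel (\<lambda>y. heat \<epsilon> (x - y))" for x :: "'a::euclidean_space"
  by (simp add: integrable_lborel_reflect_iff integrable_heat)

text \<open>The Gaussian factor makes Fubini applicable. As \<epsilon> tends to 0 this turns into
  Fourier inversion up to the factor (2 pi)^n; the reflection of \<xi> supplies the inverse
  kernel.\<close>

lemma ft_gs_ft:
  fixes k :: "'a::euclidean_space \<Rightarrow> complex"
  assumes k: "integrable lborel k" and e: "\<epsilon> > 0"
  shows "ft (\<lambda>\<xi>. of_real (gs \<epsilon> \<xi>) * ft k (- \<xi>)) x = (LINT y|lborel. of_real (heat \<epsilon> (x - y)) * k y)"
proof -
  have [measurable]: "k \<in> borel_measurable borel" using k by auto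
  have "ft (\<lambda>\<xi>. of_real (gs \<epsilon> \<xi>) * ft k (- \<xi>)) x
    = (LINT \<xi>|lborel. (cis (- (\<xi> \<bullet> x)) * of_real (gs \<epsilon> \<xi>)) * (LINT y|lborel. cis (y \<bullet> \<xi>) * k y))"
    by (simp add: ft_def mult.assoc)
  also have "\<dots> = (LINT y|lborel. (LINT \<xi>|lborel. cis (y \<bullet> \<xi>) * (cis (- (\<xi> \<bullet> x)) * of_real (gs \<epsilon> \<xi>))) * k y)"
    by (rule Fubini_bounded_kernel[where C=1])
       (auto intro!: integrable_cis_mult integrable_gs_complex e k)
  also have "(\<lambda>y. (LINT \<xi>|lborel. cis (y \<bullet> \<xi>) * (cis (- (\<xi> \<bullet> x)) * of_real (gs \<epsilon> \<xi>))))
      = (\<lambda>y. ft (\<lambda>\<xi>. complex_of_real (gs \<epsilon> \<xi>)) (x - y))"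
    unfolding ft_def by (simp add: mult.assoc[symmetric] cis_mult inner_diff_right inner_commute)
  finally show ?thesis using e by (simp add: ft_gs)
qed

text \<open>A bilinear version, in which the reflected transform of k stands in for a conjugate: k =
  cnj f produces |\<open>ft f\<close>|^2 by \<open>ft_cnj\<close>, and other choices of k serve the
  quadratic forms of convolution kernels.\<close>

lemma gs_Parseval:
  fixes f k :: "'a::euclidean_space \<Rightarrow> complex"
  assumes f: "integrable lborel f" and k: "integrable lborel k" and e: "\<epsilon> > 0"
  shows "(LINT \<xi>|lborel. of_real (gs \<epsilon> \<xi>) * (ft f \<xi> * ft k (- \<xi>)))
      = (LINT x|lborel. f x * (LINT y|lborel. of_real (heat \<epsilon> (x - y)) * k y))"
proof -
  have [measurable]: "k \<in> borel_measurable borel" using k by auto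
  have h: "integrable lborel (\<lambda>\<xi>. complex_of_real (gs \<epsilon> \<xi>) * ft k (- \<xi>))"
  proof (rule Bochner_Integration.integrable_bound)
    show "integrable lborel (\<lambda>\<xi>. (LINT x|lborel. norm (k x)) *\<^sub>R complex_of_real (gs \<epsilon> (\<xi>::'a)))"
      using e by (intro integrable_scaleR_right integrable_gs_complex)
    show "AE \<xi> in lborel. norm (complex_of_real (gs \<epsilon> \<xi>) * ft k (- \<xi>))
        \<le> norm ((LINT x|lborel. norm (k x)) *\<^sub>R complex_of_real (gs \<epsilon> \<xi>))"
      by (auto simp: norm_mult mult.commute intro!: mult_right_mono norm_ft_le order_trans[OF norm_ft_le])
  qed measurable
  have "(LINT \<xi>|lborel. of_real (gs \<epsilon> \<xi>) * (ft f \<xi> * ft k (- \<xi>))) = (LINT \<xi>|lborel. ft f \<xi> * (of_real (gs \<epsilon> \<xi>) * ft k (- \<xi>)))"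
    by (simp add: mult.left_commute)
  then show ?thesis unfolding ft_swap[OF f h] ft_gs_ft[OF k e] .
qed

lemma ft_cnj: "ft (\<lambda>x. cnj (f x)) (- \<xi>) = cnj (ft f \<xi>)"
proof -
  have "cis (x \<bullet> \<xi>) * cnj (f x) = cnj (cis (- (x \<bullet> \<xi>)) * f x)" for x
    by (simp only: complex_cnj_mult cis_cnj) simp
  then have "ft (\<lambda>x. cnj (f x)) (- \<xi>) = (LINT x|lborel. cnj (cis (- (x \<bullet> \<xi>)) * f x))"
    by (simp only: ft_def inner_minus_right minus_minus)
  also have "\<dots> = cnj (ft f \<xi>)" unfolding ft_def by (simp only: Bochner_Integration.integral_cnj)
  finally show ?thesis .
qed

text \<open>For k = cnj f the right side of \<open>gs_Parseval\<close> is bounded uniformly in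
  \<epsilon> by Schur's test: the inequality between arithmetic and geometric mean separates f(x)
  from f(y), and \<open>heat\<close> has the same mass in either variable. Fatou's lemma then
  removes the Gaussian factor.\<close>

theorem Bessel_ft:
  fixes f :: "'a::euclidean_space \<Rightarrow> complex"
  assumes f: "integrable lborel f" and f2: "integrable lborel (\<lambda>x. (norm (f x))\<^sup>2)"
  shows "integrable lborel (\<lambda>\<xi>. (norm (ft f \<xi>))\<^sup>2)"
    and "(LINT \<xi>|lborel. (norm (ft f \<xi>))\<^sup>2) \<le> (2 * pi) ^ DIM('a) * (LINT x|lborel. (norm (f x))\<^sup>2)"
proof -
  have [measurable]: "f \<in> borel_measurable borel" using f by auto
  have [measurable]: "(\<lambda>x. cnj (f x)) \<in> borel_measurable borel"
    using borel_measurable_integrable[of lborel "\<lambda>x. cnj (f x)"] f by simp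
  define N where "N = (2 * pi) ^ DIM('a) * (LINT x|lborel. (norm (f x))\<^sup>2)"
  have N: "N \<ge> 0" by (simp add: N_def)
  have nnN: "ennreal N = ennreal ((2 * pi) ^ DIM('a)) * (\<integral>\<^sup>+x. ennreal ((norm (f x))\<^sup>2) \<partial>lborel)"
    unfolding N_def using f2 by (subst nn_integral_eq_integral) (auto simp: ennreal_mult)
  have nn: "(\<integral>\<^sup>+x. (\<integral>\<^sup>+y. ennreal (norm (f x) * (heat \<epsilon> (x - y) * norm (f y))) \<partial>lborel) \<partial>lborel) \<le> ennreal N"
    if e: "\<epsilon> > 0" for \<epsilon>
  proof -
    have am: "a * (h * b) \<le> a\<^sup>2 * h / 2 + h * b\<^sup>2/2" if "h \<ge> 0" for a b h :: real
    proof -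
      have "h * (a - b)\<^sup>2 \<ge> 0" using that by simp
      then show ?thesis by (simp add: power2_eq_square algebra_simps)
    qed
    have "(\<integral>\<^sup>+x. (\<integral>\<^sup>+y. ennreal (norm (f x) * (heat \<epsilon> (x - y) * norm (f y))) \<partial>lborel) \<partial>lborel)
      \<le> (\<integral>\<^sup>+x. (\<integral>\<^sup>+y. ennreal ((norm (f x))\<^sup>2/2) * ennreal (heat \<epsilon> (x - y))
           + ennreal (heat \<epsilon> (x - y)) * ennreal ((norm (f y))\<^sup>2/2) \<partial>lborel) \<partial>lborel)"
      by (intro nn_integral_mono) (use am e in \<open>auto simp flip: ennreal_mult ennreal_plus intro!: ennreal_leI\<close>)
    also have "\<dots> = (\<integral>\<^sup>+x. (\<integral>\<^sup>+y. ennreal ((norm (f x))\<^sup>2/2) * ennreal (heat \<epsilon> (x - y)) \<partial>lborel) \<partial>lborel)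
        + (\<integral>\<^sup>+x. (\<integral>\<^sup>+y. ennreal (heat \<epsilon> (x - y)) * ennreal ((norm (f y))\<^sup>2/2) \<partial>lborel) \<partial>lborel)"
      by (subst nn_integral_add[symmetric]; (measurable)?) (intro nn_integral_cong nn_integral_add; measurable)
    also have "(\<integral>\<^sup>+x. (\<integral>\<^sup>+y. ennreal ((norm (f x))\<^sup>2/2) * ennreal (heat \<epsilon> (x - y)) \<partial>lborel) \<partial>lborel)
        = (\<integral>\<^sup>+x. ennreal ((norm (f x))\<^sup>2/2) \<partial>lborel) * ennreal ((2 * pi) ^ DIM('a))"
      by (simp add: nn_integral_cmult nn_integral_heat e nn_integral_multc)
    also have "(\<integral>\<^sup>+x. (\<integral>\<^sup>+y. ennreal (heat \<epsilon> (x - y)) * ennreal ((norm (f y))\<^sup>2/2) \<partial>lborel) \<partial>lborel)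
       = (\<integral>\<^sup>+y. (\<integral>\<^sup>+x. ennreal (heat \<epsilon> (x - y)) * ennreal ((norm (f y))\<^sup>2/2) \<partial>lborel) \<partial>lborel)"
      by (rule lborel_pair.Fubini') measurable
    also have "\<dots> = (\<integral>\<^sup>+x. ennreal ((norm (f x))\<^sup>2/2) \<partial>lborel) * ennreal ((2 * pi) ^ DIM('a))"
      by (subst heat_commute) (simp add: nn_integral_multc nn_integral_heat e mult.commute nn_integral_cmult)
    also have "(\<integral>\<^sup>+x. ennreal ((norm (f x))\<^sup>2/2) \<partial>lborel) = (\<integral>\<^sup>+x. ennreal (1/2) * ennreal ((norm (f x))\<^sup>2) \<partial>lborel)"
      by (intro nn_integral_cong) (simp flip: ennreal_mult del: ennreal_half)
    also have "\<dots> = ennreal (1/2) * (\<integral>\<^sup>+x. ennreal ((norm (f x))\<^sup>2) \<partial>lborel)"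
      by (rule nn_integral_cmult) measurable
    finally have "(\<integral>\<^sup>+x. (\<integral>\<^sup>+y. ennreal (norm (f x) * (heat \<epsilon> (x - y) * norm (f y))) \<partial>lborel) \<partial>lborel)
      \<le> (ennreal (1/2) + ennreal (1/2)) * ennreal N"
      unfolding nnN by (simp add: algebra_simps)
    also have "ennreal (1/2) + ennreal (1/2) = 1" by (subst ennreal_plus[symmetric]) auto
    finally show ?thesis by simp
  qed
  have reg: "(\<integral>\<^sup>+\<xi>. ennreal (gs \<epsilon> \<xi> * (norm (ft f \<xi>))\<^sup>2) \<partial>lborel) \<le> ennreal N" if e: "\<epsilon> > 0" for \<epsilon>
  proof -
    have i: "integrable lborel (\<lambda>\<xi>. gs \<epsilon> \<xi> * (norm (ft f \<xi>))\<^sup>2)"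
    proof (rule Bochner_Integration.integrable_bound)
      show "integrable lborel (\<lambda>\<xi>::'a. gs \<epsilon> \<xi> * (LINT x|lborel. norm (f x))\<^sup>2)"
        using e by (intro integrable_mult_left) (simp add: integrable_gs)
    qed (auto intro!: mult_left_mono power_mono norm_ft_le AE_I2)
    have "complex_of_real (LINT \<xi>|lborel. gs \<epsilon> \<xi> * (norm (ft f \<xi>))\<^sup>2)
        = (LINT \<xi>|lborel. of_real (gs \<epsilon> \<xi>) * (ft f \<xi> * ft (\<lambda>x. cnj (f x)) (- \<xi>)))"
      by (simp add: ft_cnj flip: integral_complex_of_real complex_norm_square)
    also have "\<dots> = (LINT x|lborel. f x * (LINT y|lborel. of_real (heat \<epsilon> (x - y)) * cnj (f y)))"
      using f e by (intro gs_Parseval) auto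
    also have "ennreal (norm \<dots>) \<le> (\<integral>\<^sup>+x. ennreal (norm (f x * (LINT y|lborel. of_real (heat \<epsilon> (x - y)) * cnj (f y)))) \<partial>lborel)"
    proof (rule integral_norm_bound_ennreal)
      show "integrable lborel (\<lambda>x. f x * (LINT y|lborel. of_real (heat \<epsilon> (x - y)) * cnj (f y)))"
        using e f by (intro integrable_kernel_left[where C="sqrt (2 * pi / \<epsilon>) ^ DIM('a)"]) (auto simp: heat_le)
    qed
    also have "\<dots> \<le> (\<integral>\<^sup>+x. (\<integral>\<^sup>+y. ennreal (norm (f x) * (heat \<epsilon> (x - y) * norm (f y))) \<partial>lborel) \<partial>lborel)"
    proof (intro nn_integral_mono)
      fix x
      have i: "integrable lborel (\<lambda>y. of_real (heat \<epsilon> (x - y)) * cnj (f y))"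
      proof (rule Bochner_Integration.integrable_bound)
        show "integrable lborel (\<lambda>y. (sqrt (2 * pi / \<epsilon>) ^ DIM('a)) *\<^sub>R f y)" using f by simp
      qed (use e in \<open>auto simp: norm_mult intro!: mult_right_mono heat_le AE_I2\<close>)
      have "ennreal (norm (f x * (LINT y|lborel. of_real (heat \<epsilon> (x - y)) * cnj (f y))))
         = ennreal (norm (f x)) * ennreal (norm (LINT y|lborel. of_real (heat \<epsilon> (x - y)) * cnj (f y)))"
        by (simp add: norm_mult ennreal_mult)
      also have "\<dots> \<le> ennreal (norm (f x)) * (\<integral>\<^sup>+y. ennreal (norm (of_real (heat \<epsilon> (x - y)) * cnj (f y))) \<partial>lborel)"
        by (intro mult_left_mono integral_norm_bound_ennreal i) simp
      also have "\<dots> = (\<integral>\<^sup>+y. ennreal (norm (f x)) * ennreal (norm (of_real (heat \<epsilon> (x - y)) * cnj (f y))) \<partial>lborel)"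
        by (rule nn_integral_cmult[symmetric]) measurable
      finally show "ennreal (norm (f x * (LINT y|lborel. of_real (heat \<epsilon> (x - y)) * cnj (f y))))
        \<le> (\<integral>\<^sup>+y. ennreal (norm (f x) * (heat \<epsilon> (x - y) * norm (f y))) \<partial>lborel)"
        using e by (simp add: norm_mult ennreal_mult)
    qed
    also have "\<dots> \<le> ennreal N" by (rule nn[OF e])
    finally have "ennreal \<bar>LINT \<xi>|lborel. gs \<epsilon> \<xi> * (norm (ft f \<xi>))\<^sup>2\<bar> \<le> ennreal N" by simp
    then have "(LINT \<xi>|lborel. gs \<epsilon> \<xi> * (norm (ft f \<xi>))\<^sup>2) \<le> N" using N by (simp add: ennreal_le_iff)
    then show ?thesis using i N by (subst nn_integral_eq_integral) (auto simp: ennreal_leI)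
  qed
  define e :: "nat \<Rightarrow> real" where "e n = 1 / Suc n" for n
  have e: "e \<longlonglongrightarrow> 0" "\<And>n. e n > 0" unfolding e_def using LIMSEQ_inverse_real_of_nat by (auto simp: inverse_eq_divide)
  have "(\<integral>\<^sup>+\<xi>. ennreal ((norm (ft f \<xi>))\<^sup>2) \<partial>lborel)
     = (\<integral>\<^sup>+\<xi>. liminf (\<lambda>n. ennreal (gs (e n) \<xi> * (norm (ft f \<xi>))\<^sup>2)) \<partial>lborel)"
  proof (intro nn_integral_cong)
    fix \<xi> :: 'a
    have "(\<lambda>n. gs (e n) \<xi>) \<longlonglongrightarrow> exp (- (0 * (norm \<xi>)\<^sup>2 / 2))"
      unfolding gs_def by (intro tendsto_intros e) simp
    then have "(\<lambda>n. ennreal (gs (e n) \<xi> * (norm (ft f \<xi>))\<^sup>2)) \<longlonglongrightarrow> ennreal (1 * (norm (ft f \<xi>))\<^sup>2)"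
      by (intro tendsto_intros) simp
    from lim_imp_Liminf[OF sequentially_bot this]
    show "ennreal ((norm (ft f \<xi>))\<^sup>2) = liminf (\<lambda>n. ennreal (gs (e n) \<xi> * (norm (ft f \<xi>))\<^sup>2))"
      by simp
  qed
  also have "\<dots> \<le> liminf (\<lambda>n. (\<integral>\<^sup>+\<xi>. ennreal (gs (e n) \<xi> * (norm (ft f \<xi>))\<^sup>2) \<partial>lborel))"
    by (rule nn_integral_liminf) measurable
  also have "\<dots> \<le> liminf (\<lambda>n. ennreal N)"
    by (intro Liminf_mono always_eventually allI reg e)
  finally have fin: "(\<integral>\<^sup>+\<xi>. ennreal ((norm (ft f \<xi>))\<^sup>2) \<partial>lborel) \<le> ennreal N"
    by (simp add: Liminf_const)
  then show i: "integrable lborel (\<lambda>\<xi>. (norm (ft f \<xi>))\<^sup>2)"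
    unfolding integrable_iff_bounded using le_less_trans[OF fin, of \<infinity>] by simp
  show "(LINT \<xi>|lborel. (norm (ft f \<xi>))\<^sup>2) \<le> (2 * pi) ^ DIM('a) * (LINT x|lborel. (norm (f x))\<^sup>2)"
    using fin N unfolding N_def[symmetric] by (subst (asm) nn_integral_eq_integral[OF i]) (auto simp: ennreal_le_iff)
qed

text \<open>Moves \<epsilon> from the kernel into the argument of \<phi>, so that dominated
  convergence can use the fixed weight \<open>heat 1\<close>.\<close>

lemma heat_conv_rescale:
  fixes \<phi> :: "'a::euclidean_space \<Rightarrow> complex"
  assumes e: "\<epsilon> > 0"
  shows "(LINT y|lborel. of_real (heat \<epsilon> (x - y)) * \<phi> y) = (LINT w|lborel. of_real (heat 1 w) * \<phi> (x - sqrt \<epsilon> *\<^sub>R w))"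
proof -
  have "(LINT y|lborel. of_real (heat \<epsilon> (x - y)) * \<phi> y)
     = (\<bar>- sqrt \<epsilon>\<bar> ^ DIM('a)) *\<^sub>R (LINT w|lborel. of_real (heat \<epsilon> (sqrt \<epsilon> *\<^sub>R w)) * \<phi> (x - sqrt \<epsilon> *\<^sub>R w))"
    using e by (subst integral_lborel_affine[where t=x and c="- sqrt \<epsilon>"]) auto
  also have "\<dots> = (LINT w|lborel. (sqrt \<epsilon> ^ DIM('a)) *\<^sub>R (of_real (heat \<epsilon> (sqrt \<epsilon> *\<^sub>R w)) * \<phi> (x - sqrt \<epsilon> *\<^sub>R w)))"
    using e by simp
  also have "(\<lambda>w. (sqrt \<epsilon> ^ DIM('a)) *\<^sub>R (of_real (heat \<epsilon> (sqrt \<epsilon> *\<^sub>R w)) * \<phi> (x - sqrt \<epsilon> *\<^sub>R w)))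
     = (\<lambda>w. of_real (heat 1 w) * \<phi> (x - sqrt \<epsilon> *\<^sub>R w))"
    using e by (simp flip: heat_scale[OF e] add: scaleR_conv_of_real mult.assoc)
  finally show ?thesis .
qed

text \<open>Continuity is asked at the single point x because the lemma is also applied to a
  function with jumps, where the limit is identified off finitely many points.\<close>

lemma heat_conv_tendsto:
  fixes \<phi> :: "'a::euclidean_space \<Rightarrow> complex"
  assumes [measurable]: "\<phi> \<in> borel_measurable borel" and B: "\<And>y. norm (\<phi> y) \<le> B" and c: "isCont \<phi> x"
    and e: "e \<longlonglongrightarrow> 0" "\<And>n. e n > (0::real)"
  shows "(\<lambda>n. LINT y|lborel. of_real (heat (e n) (x - y)) * \<phi> y) \<longlonglongrightarrow> (2 * pi) ^ DIM('a) * \<phi> x"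
proof -
  have "(\<lambda>n. LINT w|lborel. of_real (heat 1 w) * \<phi> (x - sqrt (e n) *\<^sub>R w))
      \<longlonglongrightarrow> (LINT w::'a|lborel. of_real (heat 1 w) * \<phi> x)"
  proof (rule integral_dominated_convergence[where w="\<lambda>w::'a. B * heat 1 w" and M=lborel and f="\<lambda>w::'a. of_real (heat 1 w) * \<phi> x" and s="\<lambda>n w. of_real (heat 1 w) * \<phi> (x - sqrt (e n) *\<^sub>R w)"])
    show "integrable lborel (\<lambda>w::'a. B * heat 1 w)" using integrable_heat[of 1, where ?'a='a] by simp
    show "AE w in lborel. (\<lambda>n. of_real (heat 1 w) * \<phi> (x - sqrt (e n) *\<^sub>R w)) \<longlonglongrightarrow> of_real (heat 1 w) * \<phi> x"
    proof (intro AE_I2 tendsto_mult tendsto_const isCont_tendsto_compose[OF c])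
      fix w
      have "(\<lambda>n. x - sqrt (e n) *\<^sub>R w) \<longlonglongrightarrow> x - sqrt 0 *\<^sub>R w" by (intro tendsto_intros e)
      then show "(\<lambda>n. x - sqrt (e n) *\<^sub>R w) \<longlonglongrightarrow> x" by simp
    qed
  qed (auto simp: norm_mult mult.commute[of B] intro!: mult_left_mono B)
  also have "(LINT w::'a|lborel. of_real (heat 1 w) * \<phi> x) = (2 * pi) ^ DIM('a) * \<phi> x"
    using integral_heat[of 1, where ?'a='a] by simp
  finally show ?thesis using e by (simp add: heat_conv_rescale)
qed

lemma norm_heat_conv_le:
  fixes \<phi> :: "'a::euclidean_space \<Rightarrow> complex"
  assumes B: "\<And>y. norm (\<phi> y) \<le> B" and e: "\<epsilon> > 0"
  shows "norm (LINT y|lborel. of_real (heat \<epsilon> (x - y)) * \<phi> y) \<le> (2 * pi) ^ DIM('a) * B"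
proof -
  have "norm (LINT y|lborel. of_real (heat \<epsilon> (x - y)) * \<phi> y) \<le> (LINT y|lborel. norm (of_real (heat \<epsilon> (x - y)) * \<phi> y))"
    by (rule integral_norm_bound)
  also have "\<dots> \<le> (LINT y|lborel. heat \<epsilon> (x - y) * B)"
    using e order_trans[OF norm_ge_zero B] by (intro integral_mono') (auto simp: norm_mult integrable_heat_shift intro!: mult_left_mono B)
  also have "\<dots> = (LINT y::'a|lborel. heat \<epsilon> y) * B"
    using integral_lborel_reflect[of "heat \<epsilon>" x] by simp
  finally show ?thesis using e by (simp add: integral_heat)
qed

section \<open>Square integrable functions\<close>

lemma norm_add_sq_le: "(norm (a + b))\<^sup>2 \<le> 2 * (norm a)\<^sup>2 + 2 * (norm b)\<^sup>2"
  and norm_diff_sq_le: "(norm (a - b))\<^sup>2 \<le> 2 * (norm a)\<^sup>2 + 2 * (norm b)\<^sup>2"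
  for a b :: "'a::real_normed_vector"
proof -
  have *: "(x + y)\<^sup>2 \<le> 2 * x\<^sup>2 + 2 * y\<^sup>2" for x y :: real
    using zero_le_power2[of "x - y"] by (simp add: power2_eq_square algebra_simps)
  show "(norm (a + b))\<^sup>2 \<le> 2 * (norm a)\<^sup>2 + 2 * (norm b)\<^sup>2"
    by (rule order_trans[OF power_mono *]) (auto simp: norm_triangle_ineq)
  show "(norm (a - b))\<^sup>2 \<le> 2 * (norm a)\<^sup>2 + 2 * (norm b)\<^sup>2"
    by (rule order_trans[OF power_mono *]) (auto simp: norm_triangle_ineq4)
qed

lemma ball_borel [measurable]: "ball x r \<in> sets borel" "cball x r \<in> sets borel"
  for x :: "'a::metric_space"
  by auto

lemma integrable_norm_mult_sq:
  fixes f g :: "'a \<Rightarrow> complex"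
  assumes [measurable]: "f \<in> borel_measurable M" "g \<in> borel_measurable M"
    and f: "integrable M (\<lambda>x. (norm (f x))\<^sup>2)" and g: "integrable M (\<lambda>x. (norm (g x))\<^sup>2)"
  shows "integrable M (\<lambda>x. f x * g x)"
proof (rule Bochner_Integration.integrable_bound)
  show "integrable M (\<lambda>x. (norm (f x))\<^sup>2 + (norm (g x))\<^sup>2)" using f g by simp
  have "a * b \<le> a\<^sup>2 + b\<^sup>2" if "a \<ge> 0" "b \<ge> 0" for a b :: real
    using zero_le_power2[of "a - b"] mult_nonneg_nonneg[OF that]
    unfolding power2_eq_square left_diff_distrib right_diff_distrib by (simp add: mult.commute)
  then show "AE x in M. norm (f x * g x) \<le> norm ((norm (f x))\<^sup>2 + (norm (g x))\<^sup>2)"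
    by (simp add: norm_mult)
qed measurable

lemma Cauchy_Schwarz_integral:
  fixes f g :: "'a \<Rightarrow> complex"
  assumes [measurable]: "f \<in> borel_measurable M" "g \<in> borel_measurable M"
    and f: "integrable M (\<lambda>x. (norm (f x))\<^sup>2)" and g: "integrable M (\<lambda>x. (norm (g x))\<^sup>2)"
  shows "norm (LINT x|M. f x * g x) \<le> sqrt (LINT x|M. (norm (f x))\<^sup>2) * sqrt (LINT x|M. (norm (g x))\<^sup>2)"
proof -
  let ?F = "LINT x|M. (norm (f x))\<^sup>2" and ?G = "LINT x|M. (norm (g x))\<^sup>2"
  have "ennreal (norm (LINT x|M. f x * g x)) \<le> (\<integral>\<^sup>+x. ennreal (norm (f x)) * ennreal (norm (g x)) \<partial>M)"
    using integral_norm_bound_ennreal[OF integrable_norm_mult_sq[OF assms]] by (simp add: norm_mult ennreal_mult)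
  then have "(ennreal (norm (LINT x|M. f x * g x)))\<^sup>2 \<le> (\<integral>\<^sup>+x. ennreal (norm (f x)) * ennreal (norm (g x)) \<partial>M)\<^sup>2"
    by (intro power_mono) auto
  also have "\<dots> \<le> (\<integral>\<^sup>+x. (ennreal (norm (f x)))\<^sup>2 \<partial>M) * (\<integral>\<^sup>+x. (ennreal (norm (g x)))\<^sup>2 \<partial>M)"
    by (rule Cauchy_Schwarz_nn_integral) measurable
  also have "\<dots> = ennreal ?F * ennreal ?G"
    using f g by (simp add: ennreal_power nn_integral_eq_integral)
  finally have "(norm (LINT x|M. f x * g x))\<^sup>2 \<le> ?F * ?G"
    by (simp add: ennreal_power ennreal_mult[symmetric] ennreal_le_iff)
  then have "norm (LINT x|M. f x * g x) \<le> sqrt (?F * ?G)" by (simp add: real_le_rsqrt)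
  then show ?thesis by (simp add: real_sqrt_mult)
qed

lemma L2D:
  assumes "f \<in> L2"
  shows "f \<in> borel_measurable borel" "integrable lborel (\<lambda>x. (norm (f x))\<^sup>2)"
  using assms by (auto simp: L2_def)

lemma L2I: "f \<in> borel_measurable borel \<Longrightarrow> integrable lborel (\<lambda>x. (norm (f x))\<^sup>2) \<Longrightarrow> f \<in> L2"
  by (simp add: L2_def)

lemma L2_diff: "f \<in> L2 \<Longrightarrow> g \<in> L2 \<Longrightarrow> (\<lambda>x. f x - g x) \<in> L2"
  and L2_add: "f \<in> L2 \<Longrightarrow> g \<in> L2 \<Longrightarrow> (\<lambda>x. f x + g x) \<in> L2"
proof -
  assume f: "f \<in> L2" and g: "g \<in> L2"
  note [measurable] = L2D(1)[OF f] L2D(1)[OF g]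
  have i: "integrable lborel (\<lambda>x. 2 * (norm (f x))\<^sup>2 + 2 * (norm (g x))\<^sup>2)" using f g by (auto simp: L2_def)
  show "(\<lambda>x. f x - g x) \<in> L2"
    by (intro L2I Bochner_Integration.integrable_bound[OF i]; (measurable)?) (auto intro: norm_diff_sq_le)
  show "(\<lambda>x. f x + g x) \<in> L2"
    by (intro L2I Bochner_Integration.integrable_bound[OF i]; (measurable)?) (auto intro: norm_add_sq_le)
qed

lemma L2_cmult: "f \<in> L2 \<Longrightarrow> (\<lambda>x. c * f x) \<in> L2"
  by (auto simp: L2_def norm_mult power_mult_distrib)

lemma L2_bounded_mult:
  assumes f: "f \<in> L2" and [measurable]: "m \<in> borel_measurable borel" and B: "\<And>x. norm (m x) \<le> B"
  shows "(\<lambda>x. m x * f x) \<in> L2"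
proof (rule L2I)
  note [measurable] = L2D(1)[OF f]
  show "(\<lambda>x. m x * f x) \<in> borel_measurable borel" by measurable
  have i: "integrable lborel (\<lambda>x. B\<^sup>2 * (norm (f x))\<^sup>2)" using L2D(2)[OF f] by simp
  show "integrable lborel (\<lambda>x. (norm (m x * f x))\<^sup>2)"
    by (intro Bochner_Integration.integrable_bound[OF i]; (measurable)?)
       (auto simp: norm_mult power_mult_distrib intro!: mult_right_mono power_mono B)
qed

definition nrm2 :: "('a::euclidean_space \<Rightarrow> complex) \<Rightarrow> real" where
  "nrm2 f = sqrt (LINT x|lborel. (norm (f x))\<^sup>2)"

lemma nrm2_nonneg [simp]: "nrm2 f \<ge> 0" and nrm2_sq: "(nrm2 f)\<^sup>2 = (LINT x|lborel. (norm (f x))\<^sup>2)"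
  by (simp_all add: nrm2_def)

lemma L2_pairing:
  assumes "f \<in> L2" "g \<in> L2"
  shows "integrable lborel (\<lambda>x. f x * g x)" "norm (LINT x|lborel. f x * g x) \<le> nrm2 f * nrm2 g"
  unfolding nrm2_def
  by (intro integrable_norm_mult_sq Cauchy_Schwarz_integral; use assms in \<open>simp add: L2_def\<close>)+

lemma L2_cnj: "f \<in> L2 \<Longrightarrow> (\<lambda>x. cnj (f x)) \<in> L2"
  unfolding L2_def by (auto intro!: borel_measurable_continuous_on[of cnj] continuous_intros)

section \<open>The Fourier transform of square integrable functions\<close>

abbreviation trunc :: "real \<Rightarrow> (real ^ 'n \<Rightarrow> complex) \<Rightarrow> real ^ 'n \<Rightarrow> complex" where
  "trunc R f \<equiv> (\<lambda>x. indicator (ball 0 R) x *\<^sub>R f x)"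

lemma L2_bounded_support_integrable:
  assumes h: "h \<in> L2" and R: "\<And>x. norm x > R \<Longrightarrow> h x = 0"
  shows "integrable lborel (h :: real ^ 'n \<Rightarrow> complex)"
proof -
  have "integrable lborel (\<lambda>x. h x * of_real (indicator (cball 0 R) x))"
  proof (rule integrable_norm_mult_sq)
    have "integrable lborel (indicator (cball 0 R) :: real ^ 'n \<Rightarrow> real)"
      by (rule integrable_real_indicator) (use emeasure_lborel_cball_finite[of "0::real ^ 'n" R] in auto)
    then show "integrable lborel (\<lambda>x::real ^ 'n. (norm (complex_of_real (indicator (cball 0 R) x)))\<^sup>2)"
      by (rule Bochner_Integration.integrable_bound) (auto simp: indicator_def)
  qed (use L2D[OF h] in auto)
  also have "(\<lambda>x. h x * of_real (indicator (cball 0 R) x)) = h"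
    using R by (fastforce simp: indicator_def fun_eq_iff not_le)
  finally show ?thesis .
qed

lemma trunc_L2:
  assumes "f \<in> L2"
  shows "trunc R f \<in> L2" "integrable lborel (trunc R f)"
proof -
  have "(\<lambda>x. of_real (indicator (ball 0 R) x) * f x) \<in> L2"
    by (rule L2_bounded_mult[where B=1]) (use assms in \<open>auto simp: indicator_def\<close>)
  then show *: "trunc R f \<in> L2" by (simp add: scaleR_conv_of_real)
  show "integrable lborel (trunc R f)"
    by (rule L2_bounded_support_integrable[OF *, of R]) (auto simp: indicator_def)
qed

lemma ft_L2:
  assumes "h \<in> L2" "integrable lborel h"
  shows "ft h \<in> L2" "nrm2 (ft h) \<le> sqrt ((2 * pi) ^ CARD('n)) * nrm2 (h :: real ^ 'n \<Rightarrow> complex)"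
proof -
  note [measurable] = L2D(1)[OF assms(1)]
  show "ft h \<in> L2" by (rule L2I) (use Bessel_ft assms in \<open>auto simp: L2_def\<close>)
  show "nrm2 (ft h) \<le> sqrt ((2 * pi) ^ CARD('n)) * nrm2 h"
    using Bessel_ft(2)[of h] assms unfolding nrm2_def by (simp add: L2_def flip: real_sqrt_mult)
qed

lemma ft_diff: "integrable lborel f \<Longrightarrow> integrable lborel g \<Longrightarrow> ft (\<lambda>x. f x - g x) \<xi> = ft f \<xi> - ft g \<xi>"
  and ft_add: "integrable lborel f \<Longrightarrow> integrable lborel g \<Longrightarrow> ft (\<lambda>x. f x + g x) \<xi> = ft f \<xi> + ft g \<xi>"
  unfolding ft_def by (simp_all add: right_diff_distrib distrib_left integrable_cis_mult)

lemma ft_cmult: "ft (\<lambda>x. c * f x) \<xi> = c * ft f \<xi>"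
  unfolding ft_def by (simp add: mult.left_commute)

lemma nrm2_sq_diff_le:
  assumes "f \<in> L2" "g \<in> L2"
  shows "(LINT x|lborel. (norm (f x - g x))\<^sup>2) \<le> 2 * (LINT x|lborel. (norm (f x))\<^sup>2) + 2 * (LINT x|lborel. (norm (g x))\<^sup>2)"
proof -
  have "(LINT x|lborel. (norm (f x - g x))\<^sup>2) \<le> (LINT x|lborel. 2 * (norm (f x))\<^sup>2 + 2 * (norm (g x))\<^sup>2)"
    by (intro integral_mono norm_diff_sq_le L2D L2_diff assms Bochner_Integration.integrable_add integrable_mult_right)
  then show ?thesis using L2D(2)[OF assms(1)] L2D(2)[OF assms(2)] by simp
qed

lemma has_fourier_L2_D:
  assumes "has_fourier_L2 f g"
  shows "f \<in> L2" "g \<in> L2" "((\<lambda>R. LINT \<xi>|lborel. (norm (ft (trunc R f) \<xi> - g \<xi>))\<^sup>2) \<longlongrightarrow> 0) at_top"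
  using assms by (auto simp: has_fourier_L2_def fourier_eq_ft)

lemma has_fourier_L2_diff:
  assumes a: "has_fourier_L2 f g" and b: "has_fourier_L2 f' g'"
  shows "has_fourier_L2 (\<lambda>x. f x - f' x) (\<lambda>\<xi>. g \<xi> - g' \<xi>)"
  unfolding has_fourier_L2_def fourier_eq_ft
proof (intro conjI L2_diff)
  note A = has_fourier_L2_D[OF a] and B = has_fourier_L2_D[OF b]
  have lim: "((\<lambda>R. 2 * (LINT \<xi>|lborel. (norm (ft (trunc R f) \<xi> - g \<xi>))\<^sup>2)
     + 2 * (LINT \<xi>|lborel. (norm (ft (trunc R f') \<xi> - g' \<xi>))\<^sup>2)) \<longlongrightarrow> 2 * 0 + 2 * 0) at_top"
    by (intro tendsto_intros A B)
  show "((\<lambda>R. LINT \<xi>|lborel. (norm (ft (trunc R (\<lambda>x. f x - f' x)) \<xi> - (g \<xi> - g' \<xi>)))\<^sup>2) \<longlongrightarrow> 0) at_top"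
  proof (rule tendsto_sandwich[OF _ _ tendsto_const lim[simplified]])
    show "\<forall>\<^sub>F R in at_top. (LINT \<xi>|lborel. (norm (ft (trunc R (\<lambda>x. f x - f' x)) \<xi> - (g \<xi> - g' \<xi>)))\<^sup>2)
      \<le> 2 * (LINT \<xi>|lborel. (norm (ft (trunc R f) \<xi> - g \<xi>))\<^sup>2) + 2 * (LINT \<xi>|lborel. (norm (ft (trunc R f') \<xi> - g' \<xi>))\<^sup>2)"
    proof (intro always_eventually allI)
      fix R
      have eq: "ft (trunc R (\<lambda>x. f x - f' x)) \<xi> = ft (trunc R f) \<xi> - ft (trunc R f') \<xi>" for \<xi>
        by (subst ft_diff[symmetric]) (auto simp: trunc_L2 A B scaleR_right_diff_distrib)
      have "(LINT \<xi>|lborel. (norm (ft (trunc R (\<lambda>x. f x - f' x)) \<xi> - (g \<xi> - g' \<xi>)))\<^sup>2)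
        = (LINT \<xi>|lborel. (norm ((ft (trunc R f) \<xi> - g \<xi>) - (ft (trunc R f') \<xi> - g' \<xi>)))\<^sup>2)"
      proof -
        have "ft (trunc R (\<lambda>x. f x - f' x)) \<xi> - (g \<xi> - g' \<xi>) = (ft (trunc R f) \<xi> - g \<xi>) - (ft (trunc R f') \<xi> - g' \<xi>)" for \<xi>
          by (simp only: eq) simp
        then show ?thesis by (simp only:)
      qed
      also have "\<dots> \<le> 2 * (LINT \<xi>|lborel. (norm (ft (trunc R f) \<xi> - g \<xi>))\<^sup>2) + 2 * (LINT \<xi>|lborel. (norm (ft (trunc R f') \<xi> - g' \<xi>))\<^sup>2)"
        by (intro nrm2_sq_diff_le L2_diff ft_L2 trunc_L2 A B)
      finally show "(LINT \<xi>|lborel. (norm (ft (trunc R (\<lambda>x. f x - f' x)) \<xi> - (g \<xi> - g' \<xi>)))\<^sup>2)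
        \<le> 2 * (LINT \<xi>|lborel. (norm (ft (trunc R f) \<xi> - g \<xi>))\<^sup>2) + 2 * (LINT \<xi>|lborel. (norm (ft (trunc R f') \<xi> - g' \<xi>))\<^sup>2)" .
    qed
  qed simp
qed (use has_fourier_L2_D a b in auto)

lemma has_fourier_L2_cmult:
  assumes a: "has_fourier_L2 f g"
  shows "has_fourier_L2 (\<lambda>x. c * f x) (\<lambda>\<xi>. c * g \<xi>)"
  unfolding has_fourier_L2_def fourier_eq_ft
proof (intro conjI L2_cmult)
  note A = has_fourier_L2_D[OF a]
  have "ft (trunc R (\<lambda>x. c * f x)) \<xi> - c * g \<xi> = c * (ft (trunc R f) \<xi> - g \<xi>)" for R \<xi>
    using ft_cmult[of c "trunc R f" \<xi>] by (simp add: algebra_simps)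
  then have "(LINT \<xi>|lborel. (norm (ft (trunc R (\<lambda>x. c * f x)) \<xi> - c * g \<xi>))\<^sup>2)
    = (norm c)\<^sup>2 * (LINT \<xi>|lborel. (norm (ft (trunc R f) \<xi> - g \<xi>))\<^sup>2)" for R
    by (simp add: norm_mult power_mult_distrib)
  then show "((\<lambda>R. LINT \<xi>|lborel. (norm (ft (trunc R (\<lambda>x. c * f x)) \<xi> - c * g \<xi>))\<^sup>2) \<longlongrightarrow> 0) at_top"
    using tendsto_mult_left[OF A(3), of "(norm c)\<^sup>2"] by simp
qed (use has_fourier_L2_D a in auto)

lemma has_fourier_L2_unique:
  assumes a: "has_fourier_L2 f g" and b: "has_fourier_L2 f g'"
  shows "AE \<xi> in lborel. g \<xi> = g' \<xi>"
proof -
  note A = has_fourier_L2_D[OF a] and B = has_fourier_L2_D[OF b]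
  have "((\<lambda>R. 2 * (LINT \<xi>|lborel. (norm (ft (trunc R f) \<xi> - g' \<xi>))\<^sup>2)
     + 2 * (LINT \<xi>|lborel. (norm (ft (trunc R f) \<xi> - g \<xi>))\<^sup>2)) \<longlongrightarrow> 2 * 0 + 2 * 0) at_top"
    by (intro tendsto_intros A B)
  moreover have "(LINT \<xi>|lborel. (norm (g \<xi> - g' \<xi>))\<^sup>2) \<le> 2 * (LINT \<xi>|lborel. (norm (ft (trunc R f) \<xi> - g' \<xi>))\<^sup>2)
     + 2 * (LINT \<xi>|lborel. (norm (ft (trunc R f) \<xi> - g \<xi>))\<^sup>2)" for R
    using nrm2_sq_diff_le[of "\<lambda>\<xi>. ft (trunc R f) \<xi> - g' \<xi>" "\<lambda>\<xi>. ft (trunc R f) \<xi> - g \<xi>"]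
    by (simp add: L2_diff ft_L2 trunc_L2 A B)
  ultimately have "(LINT \<xi>|lborel. (norm (g \<xi> - g' \<xi>))\<^sup>2) \<le> 0"
    by (intro tendsto_lowerbound[where F=at_top]) auto
  then have "(LINT \<xi>|lborel. (norm (g \<xi> - g' \<xi>))\<^sup>2) = 0" by (intro antisym) simp_all
  then show ?thesis
    using integral_nonneg_eq_0_iff_AE[of lborel "\<lambda>\<xi>. (norm (g \<xi> - g' \<xi>))\<^sup>2"] L2D(2)[OF L2_diff[OF A(2) B(2)]] by simp
qed

lemma has_fourier_L2_cong_AE:
  assumes a: "has_fourier_L2 f g" and f': "f' \<in> L2" "AE x in lborel. f x = f' x"
    and g': "g' \<in> L2" "AE x in lborel. g x = g' x"
  shows "has_fourier_L2 f' g'"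
  unfolding has_fourier_L2_def fourier_eq_ft
proof (intro conjI f' g')
  note A = has_fourier_L2_D[OF a]
  note [measurable] = L2D(1)[OF f'(1)] L2D(1)[OF A(1)] L2D(1)[OF A(2)] L2D(1)[OF g'(1)]
  have "ft (trunc R f) \<xi> = ft (trunc R f') \<xi>" for R \<xi>
    unfolding ft_def
  proof (rule integral_cong_AE)
    note [measurable] = L2D(1)[OF trunc_L2(1)[OF A(1), of R]] L2D(1)[OF trunc_L2(1)[OF f'(1), of R]]
    show "(\<lambda>x. cis (- (x \<bullet> \<xi>)) * trunc R f x) \<in> borel_measurable lborel" by measurable
    show "(\<lambda>x. cis (- (x \<bullet> \<xi>)) * trunc R f' x) \<in> borel_measurable lborel" by measurable
    show "AE x in lborel. cis (- (x \<bullet> \<xi>)) * trunc R f x = cis (- (x \<bullet> \<xi>)) * trunc R f' x"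
      using f'(2) by eventually_elim simp
  qed
  then have "(LINT \<xi>|lborel. (norm (ft (trunc R f) \<xi> - g \<xi>))\<^sup>2) = (LINT \<xi>|lborel. (norm (ft (trunc R f') \<xi> - g' \<xi>))\<^sup>2)" for R
    by (intro integral_cong_AE) (use g'(2) in auto)
  then show "((\<lambda>R. LINT \<xi>|lborel. (norm (ft (trunc R f') \<xi> - g' \<xi>))\<^sup>2) \<longlongrightarrow> 0) at_top"
    using A(3) by simp
qed

lemma trunc_tendsto:
  assumes f: "f \<in> L2"
  shows "((\<lambda>R. LINT x|lborel. (norm (trunc R f x - f x))\<^sup>2) \<longlongrightarrow> 0) at_top"
proof -
  note [measurable] = L2D(1)[OF f]
  have "((\<lambda>R. LINT x|lborel. (norm (trunc R f x - f x))\<^sup>2) \<longlongrightarrow> (LINT x::real^'a|lborel. 0)) at_top"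
  proof (rule integral_dominated_convergence_at_top[where w="\<lambda>x. (norm (f x))\<^sup>2" and f="\<lambda>_. 0"
        and s="\<lambda>R x. (norm (trunc R f x - f x))\<^sup>2" and M="lborel :: (real^'a) measure"])
    show "AE x in lborel. ((\<lambda>R. (norm (trunc R f x - f x))\<^sup>2) \<longlongrightarrow> 0) at_top"
    proof (intro AE_I2)
      fix x :: "real ^ 'a"
      have "\<forall>\<^sub>F R in at_top. (norm (trunc R f x - f x))\<^sup>2 = 0"
        using eventually_gt_at_top[of "norm x"] by eventually_elim simp
      then show "((\<lambda>R. (norm (trunc R f x - f x))\<^sup>2) \<longlongrightarrow> 0) at_top"
        by (rule tendsto_eventually)
    qed
  qed (use L2D[OF f] in \<open>auto simp: indicator_def\<close>)
  then show ?thesis by simp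
qed

text \<open>Consistency of the two transforms: Bessel's inequality, applied to the truncation error,
  turns convergence of the truncations into convergence of their transforms.\<close>

lemma has_fourier_L2_ft:
  assumes f: "f \<in> L2" "integrable lborel f"
  shows "has_fourier_L2 f (ft f)"
  unfolding has_fourier_L2_def fourier_eq_ft
proof (intro conjI ft_L2 f)
  have lim: "((\<lambda>R. (2 * pi) ^ CARD('a) * (LINT x|lborel. (norm (trunc R f x - f x))\<^sup>2)) \<longlongrightarrow> (2 * pi) ^ CARD('a) * 0) at_top"
    by (intro tendsto_intros trunc_tendsto f)
  show "((\<lambda>R. LINT \<xi>|lborel. (norm (ft (trunc R f) \<xi> - ft f \<xi>))\<^sup>2) \<longlongrightarrow> 0) at_top"
  proof (rule tendsto_sandwich[OF _ _ tendsto_const lim[unfolded mult_zero_right]])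
    have "(LINT \<xi>|lborel. (norm (ft (trunc R f) \<xi> - ft f \<xi>))\<^sup>2) \<le> (2 * pi) ^ CARD('a) * (LINT x|lborel. (norm (trunc R f x - f x))\<^sup>2)" for R
      using Bessel_ft(2)[of "\<lambda>x. trunc R f x - f x"] L2D(2)[OF L2_diff[OF trunc_L2(1) f(1)]] f
      by (simp add: ft_diff trunc_L2)
    then show "\<forall>\<^sub>F R in at_top. (LINT \<xi>|lborel. (norm (ft (trunc R f) \<xi> - ft f \<xi>))\<^sup>2)
       \<le> (2 * pi) ^ CARD('a) * (LINT x|lborel. (norm (trunc R f x - f x))\<^sup>2)" by simp
  qed simp
qed

lemma L2_tendsto_pairing:
  assumes F: "\<And>R. F R \<in> L2" and g: "g \<in> L2" and h: "h \<in> L2"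
    and lim: "((\<lambda>R. LINT \<xi>|lborel. (norm (F R \<xi> - g \<xi>))\<^sup>2) \<longlongrightarrow> 0) A"
  shows "((\<lambda>R. LINT \<xi>|lborel. F R \<xi> * h \<xi>) \<longlongrightarrow> (LINT \<xi>|lborel. g \<xi> * h \<xi>)) A"
proof (rule LIM_zero_cancel, rule Lim_null_comparison)
  have "((\<lambda>R. sqrt (LINT \<xi>|lborel. (norm (F R \<xi> - g \<xi>))\<^sup>2) * nrm2 h) \<longlongrightarrow> sqrt 0 * nrm2 h) A"
    by (intro tendsto_intros lim)
  then show "((\<lambda>R. nrm2 (\<lambda>\<xi>. F R \<xi> - g \<xi>) * nrm2 h) \<longlongrightarrow> 0) A" by (simp add: nrm2_def)
  have "norm ((LINT \<xi>|lborel. F R \<xi> * h \<xi>) - (LINT \<xi>|lborel. g \<xi> * h \<xi>)) \<le> nrm2 (\<lambda>\<xi>. F R \<xi> - g \<xi>) * nrm2 h" for R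
    using L2_pairing(2)[OF L2_diff[OF F g] h]
    by (simp add: left_diff_distrib L2_pairing F g h)
  then show "\<forall>\<^sub>F R in A. norm ((LINT \<xi>|lborel. F R \<xi> * h \<xi>) - (LINT \<xi>|lborel. g \<xi> * h \<xi>)) \<le> nrm2 (\<lambda>\<xi>. F R \<xi> - g \<xi>) * nrm2 h"
    by simp
qed

text \<open>\<open>ft_swap\<close> holds for each truncation, and both sides pass to the limit in
  L2. Integrability makes \<open>ft h\<close> an honest integral, square integrability keeps it in
  L2.\<close>

lemma has_fourier_L2_pairing:
  assumes a: "has_fourier_L2 f g" and h: "h \<in> L2" "integrable lborel h"
  shows "(LINT \<xi>|lborel. g \<xi> * h \<xi>) = (LINT x|lborel. f x * ft h x)"
proof -
  note A = has_fourier_L2_D[OF a]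
  have "((\<lambda>R. LINT \<xi>|lborel. ft (trunc R f) \<xi> * h \<xi>) \<longlongrightarrow> (LINT \<xi>|lborel. g \<xi> * h \<xi>)) at_top"
    by (rule L2_tendsto_pairing) (auto intro: ft_L2 trunc_L2 A h)
  moreover have "((\<lambda>R. LINT x|lborel. trunc R f x * ft h x) \<longlongrightarrow> (LINT x|lborel. f x * ft h x)) at_top"
    by (rule L2_tendsto_pairing) (auto intro: ft_L2 trunc_L2 trunc_tendsto A h)
  moreover have "(LINT \<xi>|lborel. ft (trunc R f) \<xi> * h \<xi>) = (LINT x|lborel. trunc R f x * ft h x)" for R
    by (rule ft_swap) (auto intro: trunc_L2 A h)
  ultimately show ?thesis
    by (simp only:) (rule tendsto_unique[OF trivial_limit_at_top_linorder])
qed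

text \<open>The factor k^n is exactly the Jacobian, so on the Fourier side only a dilation remains.
  Truncation at radius R becomes truncation at radius k R, which still tends to infinity.\<close>

lemma has_fourier_L2_scale:
  assumes a: "has_fourier_L2 f (g :: real ^ 'n \<Rightarrow> complex)" and k: "k > 0"
  shows "has_fourier_L2 (\<lambda>x. (k ^ CARD('n)) *\<^sub>R f (k *\<^sub>R x)) (\<lambda>\<xi>. g ((1/k) *\<^sub>R \<xi>))"
  unfolding has_fourier_L2_def fourier_eq_ft
proof (intro conjI)
  note A = has_fourier_L2_D[OF a]
  note [measurable] = L2D(1)[OF A(1)] L2D(1)[OF A(2)]
  have sc: "integrable lborel (\<lambda>x. (norm (h (c *\<^sub>R x)))\<^sup>2)" if "h \<in> L2" "c > 0" for c and h :: "real ^ 'n \<Rightarrow> complex"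
    using integrable_lborel_affine[OF L2D(2)[OF that(1)], of c 0] that(2) by simp
  show "(\<lambda>x. (k ^ CARD('n)) *\<^sub>R f (k *\<^sub>R x)) \<in> L2"
    using sc[OF A(1) k] by (intro L2I) (auto simp: power_mult_distrib)
  show "(\<lambda>\<xi>. g ((1/k) *\<^sub>R \<xi>)) \<in> L2"
    using sc[OF A(2), of "1/k"] k by (intro L2I) auto
  have eq: "ft (trunc R (\<lambda>x. (k ^ CARD('n)) *\<^sub>R f (k *\<^sub>R x))) \<xi> = ft (trunc (k * R) f) ((1/k) *\<^sub>R \<xi>)" for R \<xi>
  proof -
    have "ft (trunc (k * R) f) ((1/k) *\<^sub>R \<xi>) = (k ^ CARD('n)) *\<^sub>R
       (LINT x|lborel. cis (- ((k *\<^sub>R x) \<bullet> ((1/k) *\<^sub>R \<xi>))) * (indicator (ball 0 (k * R)) (k *\<^sub>R x) *\<^sub>R f (k *\<^sub>R x)))"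
      unfolding ft_def using k by (subst integral_lborel_affine[where c=k and t=0]) auto
    also have "\<dots> = (LINT x|lborel. (k ^ CARD('n)) *\<^sub>R (cis (- ((k *\<^sub>R x) \<bullet> ((1/k) *\<^sub>R \<xi>))) * (indicator (ball 0 (k * R)) (k *\<^sub>R x) *\<^sub>R f (k *\<^sub>R x))))"
      by (rule integral_scaleR_right[symmetric])
    also have "\<dots> = ft (trunc R (\<lambda>x. (k ^ CARD('n)) *\<^sub>R f (k *\<^sub>R x))) \<xi>"
      unfolding ft_def using k by (intro Bochner_Integration.integral_cong) (auto simp: indicator_def)
    finally show ?thesis ..
  qed
  have "(LINT \<xi>|lborel. (norm (ft (trunc (k * R) f) ((1/k) *\<^sub>R \<xi>) - g ((1/k) *\<^sub>R \<xi>)))\<^sup>2)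
      = (k ^ CARD('n)) * (LINT \<xi>|lborel. (norm (ft (trunc (k * R) f) \<xi> - g \<xi>))\<^sup>2)" for R
    using k integral_lborel_affine[where c="k" and t=0 and f="\<lambda>\<xi>. (norm (ft (trunc (k * R) f) ((1/k) *\<^sub>R \<xi>) - g ((1/k) *\<^sub>R \<xi>)))\<^sup>2"] by simp
  moreover have "((\<lambda>R. (k ^ CARD('n)) * (LINT \<xi>|lborel. (norm (ft (trunc (k * R) f) \<xi> - g \<xi>))\<^sup>2)) \<longlongrightarrow> (k ^ CARD('n)) * 0) at_top"
    using k by (intro tendsto_intros filterlim_compose[OF A(3)] filterlim_tendsto_pos_mult_at_top[OF tendsto_const] filterlim_ident)
  ultimately show "((\<lambda>R. LINT \<xi>|lborel. (norm (ft (trunc R (\<lambda>x. (k ^ CARD('n)) *\<^sub>R f (k *\<^sub>R x))) \<xi> - g ((1/k) *\<^sub>R \<xi>)))\<^sup>2) \<longlongrightarrow> 0) at_top"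
    unfolding eq by simp
qed

text \<open>\<open>fourier_L2\<close> is a choice by \<open>SOME\<close>, meaningful as soon as one
  transform is exhibited. Uniqueness up to null sets then lets any transform compute
  \<open>sobolev_norm\<close>.\<close>

lemma has_fourier_L2_fourier_L2: "has_fourier_L2 f g \<Longrightarrow> has_fourier_L2 f (fourier_L2 f)"
  unfolding fourier_L2_def by (rule someI[where P="has_fourier_L2 f"])

lemma sobolev_norm_eq:
  assumes "has_fourier_L2 f g"
  shows "sobolev_norm s f = sqrt (LINT \<xi>|lborel. (1 + (norm \<xi>)\<^sup>2) powr s * (norm (g \<xi>))\<^sup>2)"
proof -
  have h: "has_fourier_L2 f (fourier_L2 f)" using assms by (rule has_fourier_L2_fourier_L2)
  note [measurable] = L2D(1)[OF has_fourier_L2_D(2)[OF h]] L2D(1)[OF has_fourier_L2_D(2)[OF assms]]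
  have "AE \<xi> in lborel. fourier_L2 f \<xi> = g \<xi>" using has_fourier_L2_unique[OF h assms] .
  then show ?thesis unfolding sobolev_norm_def
    by (intro arg_cong[where f=sqrt] integral_cong_AE) auto
qed

section \<open>Duality between a function and its transform\<close>

lemma integral_mult_middle:
  fixes K :: "'b::{real_normed_field,banach,second_countable_topology}"
  shows "(LINT x|M. f x * (K * g x)) = K * (LINT x|M. f x * g x)"
proof -
  have "(\<lambda>x. f x * (K * g x)) = (\<lambda>x. K * (f x * g x))" by (simp add: fun_eq_iff)
  then show ?thesis by simp
qed

text \<open>A majorant, uniform in \<epsilon> \<le> 1, for dominated convergence against a merely
  square integrable function. On the support of \<phi> one has |x| \<le> \<rho> + |w|, so half of
  the Gaussian in w can be exchanged for Gaussian decay in x.\<close>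

lemma heat_conv_gaussian_bound:
  fixes \<phi> :: "'a::euclidean_space \<Rightarrow> complex"
  assumes [measurable]: "\<phi> \<in> borel_measurable borel" and B: "\<And>y. norm (\<phi> y) \<le> B"
    and \<rho>: "\<And>y. norm y > \<rho> \<Longrightarrow> \<phi> y = 0"
  shows "\<exists>D. \<forall>\<epsilon> x. 0 < \<epsilon> \<and> \<epsilon> \<le> 1 \<longrightarrow> norm (LINT y|lborel. of_real (heat \<epsilon> (x - y)) * \<phi> y) \<le> D * gs (1/4) x"
proof (intro exI allI impI)
  fix \<epsilon> :: real and x :: 'a assume e: "0 < \<epsilon> \<and> \<epsilon> \<le> 1"
  have B0: "B \<ge> 0" using order_trans[OF norm_ge_zero B] .
  define K where "K = B * exp (\<rho>\<^sup>2/4) * sqrt (2 * pi) ^ DIM('a)"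
  have pt: "norm (of_real (heat 1 w) * \<phi> (x - sqrt \<epsilon> *\<^sub>R w)) \<le> (K * gs (1/4) x) * gs (1/2) w" for w
  proof (cases "\<phi> (x - sqrt \<epsilon> *\<^sub>R w) = 0")
    case True then show ?thesis using B0 by (simp add: K_def)
  next
    case False
    then have "norm (x - sqrt \<epsilon> *\<^sub>R w) \<le> \<rho>" using \<rho> by force
    moreover have "norm x \<le> norm (x - sqrt \<epsilon> *\<^sub>R w) + sqrt \<epsilon> * norm w"
      using norm_triangle_ineq[of "x - sqrt \<epsilon> *\<^sub>R w" "sqrt \<epsilon> *\<^sub>R w"] e by simp
    moreover have "sqrt \<epsilon> * norm w \<le> norm w" using e by (intro mult_left_le_one_le) auto
    ultimately have "norm x \<le> \<rho> + norm w" by linarith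
    then have "(norm x)\<^sup>2 \<le> (\<rho> + norm w)\<^sup>2" by (intro power_mono) auto
    also have "\<dots> \<le> 2 * \<rho>\<^sup>2 + 2 * (norm w)\<^sup>2"
      using zero_le_power2[of "\<rho> - norm w"] unfolding power2_eq_square left_diff_distrib right_diff_distrib
      by (simp add: algebra_simps)
    finally have "(norm x)\<^sup>2 / 8 \<le> \<rho>\<^sup>2/4 + (norm w)\<^sup>2/4" by simp
    \<comment> \<open>Inserting this factor performs the exchange: exp(-|w|^2/2) loses its half to
      it and exp(-|x|^2/8), which is \<open>gs (1/4) x\<close>, is gained.\<close>
    then have 1: "1 \<le> exp (\<rho>\<^sup>2/4 + (norm w)\<^sup>2/4 - (norm x)\<^sup>2 / 8)" by simp
    have "norm (of_real (heat 1 w) * \<phi> (x - sqrt \<epsilon> *\<^sub>R w)) \<le> heat 1 w * (B * 1)"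
      by (simp add: norm_mult mult_left_mono B)
    also have "\<dots> \<le> heat 1 w * (B * exp (\<rho>\<^sup>2/4 + (norm w)\<^sup>2/4 - (norm x)\<^sup>2 / 8))"
      using 1 B0 by (intro mult_left_mono) auto
    also have "\<dots> = B * sqrt (2 * pi) ^ DIM('a) * (exp (- ((norm w)\<^sup>2/2)) * exp (\<rho>\<^sup>2/4 + (norm w)\<^sup>2/4 - (norm x)\<^sup>2 / 8))"
      by (simp add: heat_def mult_ac)
    also have "exp (- ((norm w)\<^sup>2/2)) * exp (\<rho>\<^sup>2/4 + (norm w)\<^sup>2/4 - (norm x)\<^sup>2 / 8)
      = exp (\<rho>\<^sup>2/4) * gs (1/4) x * gs (1/2) w"
      unfolding gs_def exp_add[symmetric] by (simp add: field_simps)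
    finally show ?thesis by (simp add: K_def mult_ac)
  qed
  have "norm (LINT y|lborel. of_real (heat \<epsilon> (x - y)) * \<phi> y)
     = norm (LINT w|lborel. of_real (heat 1 w) * \<phi> (x - sqrt \<epsilon> *\<^sub>R w))"
    using e by (simp add: heat_conv_rescale)
  also have "\<dots> \<le> (LINT w|lborel. norm (of_real (heat 1 w) * \<phi> (x - sqrt \<epsilon> *\<^sub>R w)))"
    by (rule integral_norm_bound)
  also have "\<dots> \<le> (LINT w::'a|lborel. (K * gs (1/4) x) * gs (1/2) w)"
    by (intro integral_mono' integrable_mult_right integrable_gs pt) (use B0 in \<open>auto simp: K_def\<close>)
  also have "\<dots> = (K * (LINT w::'a|lborel. gs (1/2) w)) * gs (1/4) x" by simp
  finally show "norm (LINT y|lborel. of_real (heat \<epsilon> (x - y)) * \<phi> y)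
    \<le> (B * exp (\<rho>\<^sup>2/4) * sqrt (2 * pi) ^ DIM('a) * (LINT w::'a|lborel. gs (1/2) w)) * gs (1/4) x"
    by (simp add: K_def)
qed

lemma gs_L2: "\<epsilon> > 0 \<Longrightarrow> (\<lambda>x. complex_of_real (gs \<epsilon> x)) \<in> L2"
proof (rule L2I)
  assume e: "\<epsilon> > 0"
  have *: "(\<lambda>x::real ^ 'n. (norm (complex_of_real (gs \<epsilon> x)))\<^sup>2) = gs (2 * \<epsilon>)"
    by (simp add: gs_def power2_eq_square fun_eq_iff flip: exp_add)
  show "integrable lborel (\<lambda>x::real ^ 'n. (norm (complex_of_real (gs \<epsilon> x)))\<^sup>2)"
    unfolding * using e by (simp add: integrable_gs)
qed simp

text \<open>
  The half of Plancherel's theorem that is not contained in Bessel's inequality, in dual form: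
  \<open>\<phi>\<close> is the limit of transforms of functions whose norms are controlled by Bessel's inequality.
\<close>

lemma pairing_le_fourier_norm_compact:
  fixes f g :: "real ^ 'n \<Rightarrow> complex"
  assumes a: "has_fourier_L2 f g" and c: "continuous_on UNIV \<phi>" and \<rho>: "\<And>y. norm y > \<rho> \<Longrightarrow> \<phi> y = 0"
  shows "norm (LINT x|lborel. f x * \<phi> x) \<le> nrm2 g * nrm2 \<phi>"
proof -
  note A = has_fourier_L2_D[OF a]
  note [measurable] = L2D(1)[OF A(1)] L2D(1)[OF A(2)]
  have [measurable]: "\<phi> \<in> borel_measurable borel" using c by (rule borel_measurable_continuous_onI)
  have "bounded (\<phi> ` cball 0 \<rho>)"
    by (intro compact_imp_bounded compact_continuous_image continuous_on_subset[OF c]) auto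
  then obtain B0 where B0: "\<And>y. y \<in> cball 0 \<rho> \<Longrightarrow> norm (\<phi> y) \<le> B0" unfolding bounded_iff by blast
  define B where "B = max B0 0"
  have B: "norm (\<phi> y) \<le> B" for y
    using B0[of y] \<rho>[of y] by (cases "norm y > \<rho>") (auto simp: B_def)
  have \<phi>L2: "\<phi> \<in> L2"
  proof -
    have "integrable lborel (\<lambda>x. B\<^sup>2 * indicator (cball 0 \<rho>) (x :: real ^ 'n))"
      by (intro integrable_mult_right integrable_real_indicator)
         (use emeasure_lborel_cball_finite[of "0::real ^ 'n" \<rho>] in auto)
    then have "integrable lborel (\<lambda>x. (norm (\<phi> x))\<^sup>2)"
    proof (rule Bochner_Integration.integrable_bound)
      show "AE x in lborel. norm ((norm (\<phi> x))\<^sup>2) \<le> norm (B\<^sup>2 * indicator (cball 0 \<rho>) x)"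
        using B \<rho> by (auto simp: indicator_def not_le power_mono)
    qed measurable
    then show ?thesis by (intro L2I) auto
  qed
  have \<phi>1: "integrable lborel \<phi>" by (rule L2_bounded_support_integrable[OF \<phi>L2 \<rho>])
  define e :: "nat \<Rightarrow> real" where "e n = 1 / Suc n" for n
  have e: "e \<longlonglongrightarrow> 0" "\<And>n. e n > 0" "\<And>n. e n \<le> 1"
    unfolding e_def using LIMSEQ_inverse_real_of_nat by (auto simp: inverse_eq_divide)
  \<comment> \<open>Regularised inversion: the transform of h n is a heat convolution of \<phi>,
    hence tends to (2 pi)^n \<phi>, while Bessel's inequality bounds the norm of h n itself.\<close>
  define h where "h n \<xi> = of_real (gs (e n) \<xi>) * ft \<phi> (- \<xi>)" for n \<xi>
  have ftm: "(\<lambda>\<xi>. ft \<phi> (- \<xi>)) \<in> L2" "nrm2 (\<lambda>\<xi>. ft \<phi> (- \<xi>)) = nrm2 (ft \<phi>)"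
  proof -
    note q = L2D[OF ft_L2(1)[OF \<phi>L2 \<phi>1]]
    show "(\<lambda>\<xi>. ft \<phi> (- \<xi>)) \<in> L2"
      using q integrable_lborel_reflect_iff[of "\<lambda>\<xi>. (norm (ft \<phi> \<xi>))\<^sup>2" 0] by (intro L2I) auto
    show "nrm2 (\<lambda>\<xi>. ft \<phi> (- \<xi>)) = nrm2 (ft \<phi>)"
      using integral_lborel_reflect[of "\<lambda>\<xi>. (norm (ft \<phi> \<xi>))\<^sup>2" 0] by (simp add: nrm2_def)
  qed
  have hL2: "h n \<in> L2" for n
    unfolding h_def by (rule L2_bounded_mult[OF ftm(1), where B=1]) (use e in \<open>auto simp: less_imp_le\<close>)
  have h1: "integrable lborel (h n)" for n
    unfolding h_def using L2_pairing(1)[OF gs_L2[OF e(2)] ftm(1)] by simp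
  have nh: "nrm2 (h n) \<le> sqrt ((2 * pi) ^ CARD('n)) * nrm2 \<phi>" for n
  proof -
    have "nrm2 (h n) \<le> nrm2 (\<lambda>\<xi>. ft \<phi> (- \<xi>))"
      unfolding nrm2_def
    proof (intro real_sqrt_le_mono integral_mono L2D(2) hL2 ftm power_mono)
      fix \<xi> show "norm (h n \<xi>) \<le> norm (ft \<phi> (- \<xi>))"
        using e(2,3)[of n] by (simp add: h_def norm_mult less_imp_le mult_left_le_one_le)
    qed auto
    then show ?thesis using ft_L2(2)[OF \<phi>L2 \<phi>1] ftm(2) by simp
  qed
  have fth: "ft (h n) x = (LINT y|lborel. of_real (heat (e n) (x - y)) * \<phi> y)" for n x
    unfolding h_def by (rule ft_gs_ft[OF \<phi>1 e(2)])
  obtain D where "\<forall>\<epsilon> x. 0 < \<epsilon> \<and> \<epsilon> \<le> 1 \<longrightarrow> norm (LINT y|lborel. of_real (heat \<epsilon> (x - y)) * \<phi> y) \<le> D * gs (1/4) x"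
    using heat_conv_gaussian_bound[of \<phi> B \<rho>, OF _ B \<rho>] by auto
  then have D: "\<And>\<epsilon> x. 0 < \<epsilon> \<Longrightarrow> \<epsilon> \<le> 1 \<Longrightarrow> norm (LINT y|lborel. of_real (heat \<epsilon> (x - y)) * \<phi> y) \<le> D * gs (1/4) x"
    by simp
  have lim: "(\<lambda>n. LINT x|lborel. f x * ft (h n) x) \<longlonglongrightarrow> (LINT x|lborel. f x * ((2 * pi) ^ CARD('n) * \<phi> x))"
  proof (rule integral_dominated_convergence[where w="\<lambda>x. D * norm (f x * of_real (gs (1/4) x))"])
    show "integrable lborel (\<lambda>x. D * norm (f x * of_real (gs (1/4) x)))"
      by (intro integrable_mult_right integrable_norm L2_pairing A gs_L2) simp
    show "AE x in lborel. (\<lambda>n. f x * ft (h n) x) \<longlonglongrightarrow> f x * ((2 * pi) ^ CARD('n) * \<phi> x)"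
    proof (intro AE_I2 tendsto_mult tendsto_const)
      fix x
      show "(\<lambda>n. ft (h n) x) \<longlonglongrightarrow> (2 * pi) ^ CARD('n) * \<phi> x"
        unfolding fth using heat_conv_tendsto[of \<phi> B x e] B e c by (simp add: continuous_on_eq_continuous_at)
    qed
    show "AE x in lborel. norm (f x * ft (h n) x) \<le> D * norm (f x * of_real (gs (1/4) x))" for n
      unfolding fth using D[OF e(2,3)] by (auto simp: norm_mult mult.left_commute[of D] intro!: mult_left_mono)
    show "(\<lambda>x. f x * ft (h n) x) \<in> borel_measurable lborel" for n
      unfolding h_def by measurable
  qed measurable
  have le: "norm (LINT x|lborel. f x * ft (h n) x) \<le> nrm2 g * (sqrt ((2 * pi) ^ CARD('n)) * nrm2 \<phi>)" for n
  proof -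
    have "norm (LINT x|lborel. f x * ft (h n) x) = norm (LINT \<xi>|lborel. g \<xi> * h n \<xi>)"
      by (simp add: has_fourier_L2_pairing[OF a hL2 h1])
    also have "\<dots> \<le> nrm2 g * nrm2 (h n)" by (rule L2_pairing(2)[OF A(2) hL2])
    also have "\<dots> \<le> nrm2 g * (sqrt ((2 * pi) ^ CARD('n)) * nrm2 \<phi>)" by (intro mult_left_mono nh) simp
    finally show ?thesis .
  qed
  \<comment> \<open>The limit carries P^2 and Bessel's inequality costs P, so the estimate gains a
    factor 1 / P; since P \<ge> 1, the constant 1 follows.\<close>
  define P where "P = sqrt ((2 * pi) ^ CARD('n))"
  have P: "P > 0" "P * P = (2 * pi) ^ CARD('n)" by (simp_all add: P_def)
  have "1 \<le> (2 * pi) ^ CARD('n)" using pi_gt3 by (intro one_le_power) simp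
  then have P1: "P \<ge> 1" unfolding P_def by simp
  have "norm (LINT x|lborel. f x * ((2 * pi) ^ CARD('n) * \<phi> x)) \<le> nrm2 g * (P * nrm2 \<phi>)"
    by (rule LIMSEQ_le_const2[OF tendsto_norm[OF lim]]) (use le in \<open>auto simp: P_def\<close>)
  also have "(LINT x|lborel. f x * ((2 * pi) ^ CARD('n) * \<phi> x)) = of_real (P * P) * (LINT x|lborel. f x * \<phi> x)"
    unfolding P(2) integral_mult_middle by simp
  finally have "P * (P * norm (LINT x|lborel. f x * \<phi> x)) \<le> P * (nrm2 g * nrm2 \<phi>)"
    using P(1) by (simp add: norm_mult mult_ac)
  then have "P * norm (LINT x|lborel. f x * \<phi> x) \<le> nrm2 g * nrm2 \<phi>" using P(1) by simp
  moreover have "1 * norm (LINT x|lborel. f x * \<phi> x) \<le> P * norm (LINT x|lborel. f x * \<phi> x)"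
    using P1 by (intro mult_right_mono) auto
  ultimately show ?thesis by simp
qed

text \<open>Multiplication by piecewise linear radial plateaus keeps \<phi> continuous, gives it
  bounded support and does not increase its norm; dominated convergence then recovers the full
  pairing.\<close>

lemma pairing_le_fourier_norm:
  fixes f g :: "real ^ 'n \<Rightarrow> complex"
  assumes a: "has_fourier_L2 f g" and c: "continuous_on UNIV \<phi>" and \<phi>: "\<phi> \<in> L2"
  shows "norm (LINT x|lborel. f x * \<phi> x) \<le> nrm2 g * nrm2 \<phi>"
proof -
  note A = has_fourier_L2_D[OF a]
  define m :: "nat \<Rightarrow> real ^ 'n \<Rightarrow> complex" where "m n x = of_real (max 0 (min 1 (real n + 1 - norm x)))" for n x
  have m1: "norm (m n x) \<le> 1" for n x by (auto simp: m_def)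
  have mc: "continuous_on UNIV (m n)" for n unfolding m_def by (intro continuous_intros)
  note [measurable] = L2D(1)[OF A(1)] L2D(1)[OF \<phi>] borel_measurable_continuous_onI[OF mc]
  have mL2: "(\<lambda>x. m n x * \<phi> x) \<in> L2" for n
    by (rule L2_bounded_mult[OF \<phi> _ m1]) measurable
  have "norm (LINT x|lborel. f x * (m n x * \<phi> x)) \<le> nrm2 g * nrm2 \<phi>" for n
  proof -
    have "norm (LINT x|lborel. f x * (m n x * \<phi> x)) \<le> nrm2 g * nrm2 (\<lambda>x. m n x * \<phi> x)"
    proof (rule pairing_le_fourier_norm_compact[OF a])
      show "continuous_on UNIV (\<lambda>x. m n x * \<phi> x)" by (intro continuous_intros mc c)
      show "m n y * \<phi> y = 0" if "norm y > real n + 1" for y using that by (simp add: m_def)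
    qed
    also have "nrm2 (\<lambda>x. m n x * \<phi> x) \<le> nrm2 \<phi>"
      unfolding nrm2_def
      by (intro real_sqrt_le_mono integral_mono L2D(2) mL2 \<phi> power_mono)
         (auto simp: norm_mult intro!: mult_left_le_one_le m1)
    finally show ?thesis by (simp add: mult_left_mono)
  qed
  moreover have "(\<lambda>n. LINT x|lborel. f x * (m n x * \<phi> x)) \<longlonglongrightarrow> (LINT x|lborel. f x * \<phi> x)"
  proof (rule integral_dominated_convergence[where w="\<lambda>x. norm (f x * \<phi> x)"])
    show "integrable lborel (\<lambda>x. norm (f x * \<phi> x))" by (intro integrable_norm L2_pairing A \<phi>)
    show "AE x in lborel. norm (f x * (m n x * \<phi> x)) \<le> norm (f x * \<phi> x)" for n
      using m1 by (auto simp: norm_mult intro!: mult_left_mono mult_left_le_one_le)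
    show "AE x in lborel. (\<lambda>n. f x * (m n x * \<phi> x)) \<longlonglongrightarrow> f x * \<phi> x"
    proof (intro AE_I2 tendsto_eventually)
      fix x :: "real ^ 'n"
      have "\<forall>\<^sub>F n in sequentially. real n > norm x" by real_asymp
      then show "\<forall>\<^sub>F n in sequentially. f x * (m n x * \<phi> x) = f x * \<phi> x"
        by eventually_elim (simp add: m_def)
    qed
  qed measurable
  ultimately show ?thesis
    using LIMSEQ_le_const2[OF tendsto_norm] by blast
qed

section \<open>Convolutions on the half line\<close>

lemma
  fixes \<beta> Y :: "'a::euclidean_space \<Rightarrow> complex"
  assumes b: "integrable lborel \<beta>" and Y: "integrable lborel Y"
  shows integrable_conv: "integrable lborel (\<lambda>t. LINT s|lborel. \<beta> s * Y (t - s))"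
    and ft_conv: "ft (\<lambda>t. LINT s|lborel. \<beta> s * Y (t - s)) \<omega> = ft \<beta> \<omega> * ft Y \<omega>"
proof -
  have [measurable]: "\<beta> \<in> borel_measurable borel" "Y \<in> borel_measurable borel" using b Y by auto
  have sh: "(LINT t|lborel. h (t - s)) = (LINT t|lborel. h t)" for h :: "'a \<Rightarrow> 'b::{banach,second_countable_topology}" and s
    using integral_lborel_shift[of h "- s"] by simp
  have shi: "integrable lborel (\<lambda>t. Y (t - s))" for s
    using integrable_lborel_shift_iff[of Y "- s"] Y by simp
  have I: "integrable (lborel \<Otimes>\<^sub>M lborel) (\<lambda>(s, t). \<beta> s * Y (t - s))"
  proof (rule lborel_pair.Fubini_integrable)
    show "integrable lborel (\<lambda>s. LINT t|lborel. norm (case (s, t) of (s, t) \<Rightarrow> \<beta> s * Y (t - s)))"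
      using b sh[of "\<lambda>t. norm (Y t)"] by (simp add: norm_mult)
  qed (use shi in auto)
  have I': "integrable (lborel \<Otimes>\<^sub>M lborel) (\<lambda>(s, t). cis (- (t \<bullet> \<omega>)) * (\<beta> s * Y (t - s)))"
    by (rule Bochner_Integration.integrable_bound[OF I]) (auto simp: norm_mult)
  show "integrable lborel (\<lambda>t. LINT s|lborel. \<beta> s * Y (t - s))"
    using lborel_pair.integrable_snd[OF I] .
  have "ft (\<lambda>t. LINT s|lborel. \<beta> s * Y (t - s)) \<omega> = (LINT t|lborel. (LINT s|lborel. cis (- (t \<bullet> \<omega>)) * (\<beta> s * Y (t - s))))"
    unfolding ft_def by simp
  also have "\<dots> = (LINT s|lborel. (LINT t|lborel. cis (- (t \<bullet> \<omega>)) * (\<beta> s * Y (t - s))))"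
    by (rule lborel_pair.Fubini_integral[OF I'])
  also have "(\<lambda>s. (LINT t|lborel. cis (- (t \<bullet> \<omega>)) * (\<beta> s * Y (t - s)))) = (\<lambda>s. (cis (- (s \<bullet> \<omega>)) * \<beta> s) * ft Y \<omega>)"
  proof
    fix s
    have "(LINT t|lborel. cis (- (t \<bullet> \<omega>)) * (\<beta> s * Y (t - s)))
       = (LINT t|lborel. (cis (- (s \<bullet> \<omega>)) * \<beta> s) * (cis (- ((t - s) \<bullet> \<omega>)) * Y (t - s)))"
    proof (intro Bochner_Integration.integral_cong refl)
      fix t
      have "cis (- (t \<bullet> \<omega>)) = cis (- (s \<bullet> \<omega>)) * cis (- ((t - s) \<bullet> \<omega>))"
        by (simp add: cis_mult inner_diff_left)
      then show "cis (- (t \<bullet> \<omega>)) * (\<beta> s * Y (t - s)) = (cis (- (s \<bullet> \<omega>)) * \<beta> s) * (cis (- ((t - s) \<bullet> \<omega>)) * Y (t - s))"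
        by (simp only: mult_ac)
    qed
    also have "\<dots> = (cis (- (s \<bullet> \<omega>)) * \<beta> s) * (LINT t|lborel. (cis (- ((t - s) \<bullet> \<omega>)) * Y (t - s)))"
      by (rule integral_mult_right_zero)
    also have "(LINT t|lborel. (cis (- ((t - s) \<bullet> \<omega>)) * Y (t - s))) = ft Y \<omega>"
      unfolding ft_def by (rule sh)
    finally show "(LINT t|lborel. cis (- (t \<bullet> \<omega>)) * (\<beta> s * Y (t - s))) = (cis (- (s \<bullet> \<omega>)) * \<beta> s) * ft Y \<omega>" .
  qed
  also have "(LINT s|lborel. (cis (- (s \<bullet> \<omega>)) * \<beta> s) * ft Y \<omega>) = ft \<beta> \<omega> * ft Y \<omega>"
    by (simp add: ft_def)
  finally show "ft (\<lambda>t. LINT s|lborel. \<beta> s * Y (t - s)) \<omega> = ft \<beta> \<omega> * ft Y \<omega>" .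
qed

text \<open>Over the open interval only kernel values at positive arguments enter. Vector values are
  allowed because the operator acts on the scalar solutions as well as on complex pairings with
  u(t).\<close>

definition conv :: "(real \<Rightarrow> real) \<Rightarrow> (real \<Rightarrow> 'b::{banach,second_countable_topology}) \<Rightarrow> real \<Rightarrow> 'b" where
  "conv b y t = (LINT r:{0<..<t}|lborel. b (t - r) *\<^sub>R y r)"

text \<open>Extending both factors by zero gives a convolution on the whole line, where translation
  arguments and \<open>ft_conv\<close> apply.\<close>

lemma conv_eq_UNIV:
  "conv b y t = (LINT s|lborel. (indicator {0<..} s * b s) *\<^sub>R (indicator {0<..} (t - s) *\<^sub>R y (t - s)))"
proof -
  have "conv b y t = (LINT r|lborel. indicator {0<..<t} r *\<^sub>R (b (t - r) *\<^sub>R y r))"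
    by (simp add: conv_def set_lebesgue_integral_def)
  also have "\<dots> = (LINT s|lborel. indicator {0<..<t} (t - s) *\<^sub>R (b (t - (t - s)) *\<^sub>R y (t - s)))"
    by (rule integral_lborel_reflect)
  also have "\<dots> = (LINT s|lborel. (indicator {0<..} s * b s) *\<^sub>R (indicator {0<..} (t - s) *\<^sub>R y (t - s)))"
    by (intro Bochner_Integration.integral_cong) (auto simp: indicator_def)
  finally show ?thesis .
qed

lemma conv_cong:
  assumes "\<And>r. 0 < r \<Longrightarrow> r < t \<Longrightarrow> y r = y' r"
  shows "conv b y t = conv b y' t"
  unfolding conv_def set_lebesgue_integral_def
  by (intro Bochner_Integration.integral_cong) (use assms in \<open>auto simp: indicator_def\<close>)

text \<open>A continuous extension from [0,\<tau>] to the line. It provides measurability and a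
  global bound for functions about which nothing is known at negative times or at infinity.\<close>

definition clamped :: "real \<Rightarrow> (real \<Rightarrow> 'b) \<Rightarrow> real \<Rightarrow> 'b" where
  "clamped \<tau> y t = y (max 0 (min \<tau> t))"

lemma clamped_eq: "0 \<le> t \<Longrightarrow> t \<le> \<tau> \<Longrightarrow> clamped \<tau> y t = y t"
  by (simp add: clamped_def)

lemma continuous_clamped:
  fixes y :: "real \<Rightarrow> 'b::topological_space"
  assumes "continuous_on {0..\<tau>} y" "0 \<le> \<tau>"
  shows "continuous_on UNIV (clamped \<tau> y)"
  unfolding clamped_def
  by (rule continuous_on_compose2[OF assms(1)]) (use assms(2) in \<open>auto intro!: continuous_intros\<close>)

lemma bounded_clamped:
  fixes y :: "real \<Rightarrow> 'b::real_normed_vector"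
  assumes "continuous_on {0..\<tau>} y" "0 \<le> \<tau>"
  obtains B where "B \<ge> 0" "\<And>t. norm (clamped \<tau> y t) \<le> B"
proof -
  have "bounded (y ` {0..\<tau>})"
    by (intro compact_imp_bounded compact_continuous_image assms) auto
  then obtain B where "\<forall>x\<in>{0..\<tau>}. norm (y x) \<le> B" unfolding bounded_iff by blast
  then have "norm (clamped \<tau> y t) \<le> B" for t using assms(2) by (simp add: clamped_def)
  moreover from this[of 0] have "B \<ge> 0" using norm_ge_zero order_trans by blast
  ultimately show ?thesis using that by blast
qed

text \<open>The kernel is only integrable, but the function it is convolved with has a single jump.\<close>

lemma continuous_conv_step:
  fixes \<beta> :: "real \<Rightarrow> real" and Y :: "real \<Rightarrow> 'b::{banach,second_countable_topology}"
  assumes b: "integrable lborel \<beta>" and [measurable]: "Y \<in> borel_measurable borel"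
    and B: "\<And>t. norm (Y t) \<le> B" and c: "\<And>t. t \<notin> S \<Longrightarrow> isCont Y t" and S: "finite S"
  shows "continuous_on UNIV (\<lambda>t. LINT s|lborel. \<beta> s *\<^sub>R Y (t - s))"
  unfolding continuous_on_sequentially comp_def
proof safe
  fix t X assume X: "X \<longlonglongrightarrow> (t::real)"
  have [measurable]: "\<beta> \<in> borel_measurable borel" using b by auto
  show "(\<lambda>n. LINT s|lborel. \<beta> s *\<^sub>R Y (X n - s)) \<longlonglongrightarrow> (LINT s|lborel. \<beta> s *\<^sub>R Y (t - s))"
  proof (rule integral_dominated_convergence[where w="\<lambda>s. B * norm (\<beta> s)"])
    have "(\<lambda>s. t - s) ` S \<in> null_sets lborel" using S by (intro finite_imp_null_set_lborel) auto
    then have "AE s in lborel. s \<notin> (\<lambda>s. t - s) ` S" by (rule AE_not_in)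
    then show "AE s in lborel. (\<lambda>n. \<beta> s *\<^sub>R Y (X n - s)) \<longlonglongrightarrow> \<beta> s *\<^sub>R Y (t - s)"
    proof eventually_elim
      fix s assume "s \<notin> (\<lambda>s. t - s) ` S"
      then have "t - s \<notin> S" by force
      moreover have "(\<lambda>n. X n - s) \<longlonglongrightarrow> t - s" by (intro tendsto_intros X)
      ultimately show "(\<lambda>n. \<beta> s *\<^sub>R Y (X n - s)) \<longlonglongrightarrow> \<beta> s *\<^sub>R Y (t - s)"
        by (intro tendsto_scaleR tendsto_const isCont_tendsto_compose[OF c])
    qed
  qed (use b B in \<open>auto simp: mult.commute[of B] intro!: mult_left_mono\<close>)
qed

lemma isCont_indicator_mult:
  fixes f :: "real \<Rightarrow> 'b::real_normed_vector"
  assumes "isCont f t" "t \<noteq> 0"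
  shows "isCont (\<lambda>t. indicator {0<..} t *\<^sub>R f t) t"
proof (cases "t > 0")
  case True
  then have "\<forall>\<^sub>F s in nhds t. indicator {0<..} s *\<^sub>R f s = f s"
    using eventually_nhds_in_open[OF open_greaterThan, of t 0] by (auto elim!: eventually_mono)
  then show ?thesis using assms(1) by (simp add: isCont_cong)
next
  case False
  with assms have "t \<in> {..<0}" by auto
  then have ev: "\<forall>\<^sub>F s in nhds t. indicator {0<..} s *\<^sub>R f s = 0"
    using eventually_nhds_in_open[OF open_lessThan, of t 0] by (auto elim!: eventually_mono simp: indicator_def)
  show ?thesis using isCont_cong[OF ev] by simp
qed

lemma conv_L1_kernel:
  assumes b: "set_integrable lborel {0<..} b"
  shows "integrable lborel (\<lambda>s. indicator {0<..} s * (b s :: real))"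
  using b by (simp add: set_integrable_def)

text \<open>Continuity is local, and before time \<tau> the convolution sees y only on [0,\<tau>],
  so y may be clamped there. The integrable kernel smooths the single jump at 0.\<close>

lemma continuous_on_conv:
  fixes y :: "real \<Rightarrow> 'b::{banach,second_countable_topology}"
  assumes b: "set_integrable lborel {0<..} b" and y: "continuous_on {0..} y"
  shows "continuous_on {0..} (conv b y)"
proof -
  have H: "continuous_on {0..<\<tau>} (conv b y)" if \<tau>: "\<tau> > 0" for \<tau>
  proof -
    have yt: "continuous_on {0..\<tau>} y" using y by (rule continuous_on_subset) auto
    let ?Y = "\<lambda>t. indicator {0<..} t *\<^sub>R clamped \<tau> y t"
    have c: "continuous_on UNIV (clamped \<tau> y)" using yt \<tau> by (intro continuous_clamped) auto
    obtain B where B: "B \<ge> 0" "\<And>t. norm (clamped \<tau> y t) \<le> B" using bounded_clamped[OF yt] \<tau> by auto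
    have [measurable]: "clamped \<tau> y \<in> borel_measurable borel" using c by (rule borel_measurable_continuous_onI)
    have "continuous_on UNIV (\<lambda>t. LINT s|lborel. (indicator {0<..} s * b s) *\<^sub>R ?Y (t - s))"
      using c by (intro continuous_conv_step[OF conv_L1_kernel[OF b], where B=B and S="{0}"] isCont_indicator_mult)
         (auto simp: continuous_on_eq_continuous_at B indicator_def)
    then have "continuous_on {0..<\<tau>} (conv b (clamped \<tau> y))"
      unfolding conv_eq_UNIV[abs_def] by (rule continuous_on_subset) auto
    then show ?thesis
      by (rule continuous_on_eq) (auto intro!: conv_cong clamped_eq)
  qed
  show ?thesis
    unfolding continuous_on_def
  proof
    fix t :: real assume t: "t \<in> {0..}"
    have "at t within {0..} = at t within {0..<t + 1}"
      by (rule at_within_nhd[of t "{..<t+1}"]) auto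
    then show "(conv b y \<longlongrightarrow> conv b y t) (at t within {0..})" 
      using H[of "t + 1"] t by (simp add: continuous_on_def)
  qed
qed

lemma norm_conv_le:
  fixes y :: "real \<Rightarrow> 'b::{banach,second_countable_topology}"
  assumes b: "set_integrable lborel {0<..} b" and y: "\<And>r. 0 < r \<Longrightarrow> r < t \<Longrightarrow> norm (y r) \<le> B" and B: "B \<ge> 0"
  shows "norm (conv b y t) \<le> (LINT s:{0<..}|lborel. \<bar>b s\<bar>) * B"
proof -
  have "norm (conv b y t) \<le> (LINT s|lborel. norm ((indicator {0<..} s * b s) *\<^sub>R (indicator {0<..} (t - s) *\<^sub>R y (t - s))))"
    unfolding conv_eq_UNIV by (rule integral_norm_bound)
  also have "\<dots> \<le> (LINT s|lborel. \<bar>indicator {0<..} s * b s\<bar> * B)"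
    using y B by (intro integral_mono' integrable_mult_left integrable_abs conv_L1_kernel[OF b])
       (auto simp: indicator_def intro!: mult_left_mono)
  also have "\<dots> = (LINT s:{0<..}|lborel. \<bar>b s\<bar>) * B"
    by (simp add: set_lebesgue_integral_def abs_mult)
  finally show ?thesis .
qed

section \<open>Kernels of positive type\<close>

text \<open>Parseval's identity, with a Gaussian factor that is removed in the limit.\<close>

theorem positive_type:
  assumes b: "set_integrable lborel {0<..} b"
    and C: "AE \<omega> in lborel. \<kappa> + (LINT t:{0<..}|lborel. b t * cos (\<omega> * t)) \<ge> 0"
    and y: "continuous_on {0..\<tau>} y" and \<tau>: "0 \<le> \<tau>"
  shows "(LINT t:{0..\<tau>}|lborel. y t * (\<kappa> * y t + conv b y t)) \<ge> (0::real)"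
proof -
  define \<beta> where "\<beta> s = indicator {0<..} s * b s" for s
  define Y where "Y t = indicator {0<..\<tau>} t * clamped \<tau> y t" for t
  \<comment> \<open>On (0,\<tau>] this is the bracket of the claim. Beyond \<tau> it may be nonzero,
    but it will be integrated against Y, which vanishes there.\<close>
  define c where "c t = \<kappa> * Y t + (LINT s|lborel. \<beta> s * Y (t - s))" for t
  have \<beta>: "integrable lborel \<beta>" unfolding \<beta>_def by (rule conv_L1_kernel[OF b])
  have cY: "continuous_on UNIV (clamped \<tau> y)" using y \<tau> by (rule continuous_clamped)
  obtain B where B: "B \<ge> 0" "\<And>t. norm (clamped \<tau> y t) \<le> B" using bounded_clamped[OF y \<tau>] by auto
  have [measurable]: "clamped \<tau> y \<in> borel_measurable borel" "\<beta> \<in> borel_measurable borel"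
    using cY \<beta> by (auto intro: borel_measurable_continuous_onI)
  have [measurable]: "Y \<in> borel_measurable borel" unfolding Y_def by measurable
  have YB: "norm (Y t) \<le> B" for t using B by (simp add: Y_def indicator_def)
  have Y: "integrable lborel Y"
  proof (rule Bochner_Integration.integrable_bound)
    show "integrable lborel (\<lambda>t. B * indicator {0<..\<tau>} t)"
      by (intro integrable_mult_right integrable_real_indicator) (auto simp: \<tau>)
  qed (use B in \<open>auto simp: Y_def indicator_def\<close>)
  have c_eq: "c t = \<kappa> * y t + conv b y t" if "0 < t" "t \<le> \<tau>" for t
  proof -
    have "c t - \<kappa> * Y t = (LINT s|lborel. (indicator {0<..} s * b s) *\<^sub>R (indicator {0<..} (t - s) *\<^sub>R clamped \<tau> y (t - s)))"
      unfolding c_def \<beta>_def Y_def add_diff_cancel_left' using that by (intro Bochner_Integration.integral_cong) (auto simp: indicator_def)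
    also have "\<dots> = conv b (clamped \<tau> y) t" by (rule conv_eq_UNIV[symmetric])
    also have "\<dots> = conv b y t" using that by (intro conv_cong clamped_eq) auto
    finally show ?thesis using that by (simp add: Y_def clamped_eq)
  qed
  have contY: "isCont Y t" if t: "t \<noteq> 0" "t \<noteq> \<tau>" for t
  proof (cases "t \<in> {0<..<\<tau>}")
    case True
    then have "\<forall>\<^sub>F s in nhds t. Y s = clamped \<tau> y s"
      using eventually_nhds_in_open[OF open_greaterThanLessThan True]
      by (auto elim!: eventually_mono simp: Y_def)
    then show ?thesis using cY by (simp add: isCont_cong continuous_on_eq_continuous_at)
  next
    case False
    then have "t \<in> - {0..\<tau>}" using t by auto
    then have "\<forall>\<^sub>F s in nhds t. Y s = 0"
      using eventually_nhds_in_open[OF open_Compl[OF closed_atLeastAtMost], of t 0 \<tau>] by (auto elim!: eventually_mono simp: Y_def indicator_def)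
    then show ?thesis by (simp add: isCont_cong)
  qed
  have "continuous_on UNIV (\<lambda>t. LINT s|lborel. \<beta> s * Y (t - s))"
    using continuous_conv_step[OF \<beta> _ YB contY, of "{0, \<tau>}"] by auto
  then have cc: "isCont c t" if "t \<noteq> 0" "t \<noteq> \<tau>" for t
    unfolding c_def using contY[OF that] by (intro continuous_intros) (auto simp: continuous_on_eq_continuous_at)
  have [measurable]: "c \<in> borel_measurable borel" unfolding c_def by measurable
  define b' Y' c' where "b' s = complex_of_real (\<beta> s)" and "Y' s = complex_of_real (Y s)" and "c' s = complex_of_real (c s)" for s
  have b'1: "integrable lborel b'" and Y'1: "integrable lborel Y'" using \<beta> Y by (auto simp: b'_def[abs_def] Y'_def[abs_def])
  have c'_eq: "c' = (\<lambda>t. \<kappa> * Y' t + (LINT s|lborel. b' s * Y' (t - s)))"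
    by (auto simp: c'_def c_def b'_def Y'_def simp flip: of_real_mult)
  have c'1: "integrable lborel c'" unfolding c'_eq by (intro Bochner_Integration.integrable_add integrable_conv[OF b'1 Y'1] integrable_mult_right Y'1)
  have ftc: "ft c' \<omega> = (\<kappa> + ft b' \<omega>) * ft Y' \<omega>" for \<omega>
    unfolding c'_eq using ft_add[of "\<lambda>t. \<kappa> * Y' t" "\<lambda>t. LINT s|lborel. b' s * Y' (t - s)" \<omega>]
      integrable_conv[OF b'1 Y'1] Y'1 ft_conv[OF b'1 Y'1, of \<omega>]
    by (simp add: ft_cmult distrib_right)
  define D where "D = \<bar>\<kappa>\<bar> * B + (LINT s|lborel. \<bar>\<beta> s\<bar>) * B"
  have cB: "norm (c' t) \<le> D" for t
  proof -
    have "norm (LINT s|lborel. \<beta> s * Y (t - s)) \<le> (LINT s|lborel. norm (\<beta> s * Y (t - s)))" by (rule integral_norm_bound)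
    also have "\<dots> \<le> (LINT s|lborel. \<bar>\<beta> s\<bar> * B)"
      using \<beta> YB B(1) by (intro integral_mono') (auto simp: abs_mult intro!: mult_left_mono)
    finally have "\<bar>LINT s|lborel. \<beta> s * Y (t - s)\<bar> \<le> (LINT s|lborel. \<bar>\<beta> s\<bar>) * B" by simp
    moreover have "\<bar>\<kappa> * Y t\<bar> \<le> \<bar>\<kappa>\<bar> * B" using YB[of t] by (simp add: abs_mult mult_left_mono)
    ultimately show ?thesis unfolding c'_def norm_of_real c_def D_def by simp
  qed
  have Reb: "Re (ft b' (- \<omega>)) = (LINT t:{0<..}|lborel. b t * cos (\<omega> * t))" for \<omega>
  proof -
    have "Re (ft b' (- \<omega>)) = (LINT t|lborel. Re (cis (- (t \<bullet> - \<omega>)) * b' t))"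
      unfolding ft_def by (rule integral_Re[symmetric]) (rule integrable_cis_mult[OF b'1])
    then show ?thesis by (simp add: b'_def \<beta>_def set_lebesgue_integral_def mult_ac)
  qed
  have ftY: "ft Y' \<omega> * ft Y' (- \<omega>) = of_real ((norm (ft Y' \<omega>))\<^sup>2)" for \<omega>
  proof -
    have "(\<lambda>x. cnj (Y' x)) = Y'" by (auto simp: Y'_def)
    then have "ft Y' (- \<omega>) = cnj (ft Y' \<omega>)" using ft_cnj[of Y' \<omega>] by simp
    then show ?thesis by (simp add: complex_norm_square del: of_real_power)
  qed
  define e :: "nat \<Rightarrow> real" where "e n = 1 / Suc n" for n
  have e: "e \<longlonglongrightarrow> 0" "\<And>n. e n > 0"
    unfolding e_def using LIMSEQ_inverse_real_of_nat by (auto simp: inverse_eq_divide)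
  \<comment> \<open>In frequency the form is the integral of a Gaussian times
    |\<open>ft Y'\<close>|^2 times \<kappa> + \<open>ft b'\<close>. Only the real part of the last
    factor has a sign; its imaginary part is irrelevant because the spatial form is real.\<close>
  have nonneg: "Re (LINT x|lborel. Y' x * (LINT y|lborel. of_real (heat (e n) (x - y)) * c' y)) \<ge> 0" for n
  proof -
    have "(LINT x|lborel. Y' x * (LINT y|lborel. of_real (heat (e n) (x - y)) * c' y))
       = (LINT \<omega>|lborel. of_real (gs (e n) \<omega>) * (ft Y' \<omega> * ft c' (- \<omega>)))"
      by (rule gs_Parseval[symmetric]) (rule Y'1 c'1 e)+
    also have "\<dots> = (LINT \<omega>|lborel. of_real (gs (e n) \<omega> * (norm (ft Y' \<omega>))\<^sup>2) * (\<kappa> + ft b' (- \<omega>)))"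
      unfolding ftc using ftY by (intro Bochner_Integration.integral_cong refl) (simp add: mult_ac)
    finally have eq: "(LINT x|lborel. Y' x * (LINT y|lborel. of_real (heat (e n) (x - y)) * c' y)) = \<dots>" .
    show ?thesis
    proof (cases "integrable lborel (\<lambda>\<omega>. of_real (gs (e n) \<omega> * (norm (ft Y' \<omega>))\<^sup>2) * (\<kappa> + ft b' (- \<omega>)))")
      case True
      have "0 \<le> (LINT \<omega>|lborel. Re (of_real (gs (e n) \<omega> * (norm (ft Y' \<omega>))\<^sup>2) * (\<kappa> + ft b' (- \<omega>))))"
      proof (rule integral_nonneg_AE)
        show "AE \<omega> in lborel. 0 \<le> Re (of_real (gs (e n) \<omega> * (norm (ft Y' \<omega>))\<^sup>2) * (\<kappa> + ft b' (- \<omega>)))"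
          using C by eventually_elim (simp add: Reb del: of_real_mult)
      qed
      then show ?thesis unfolding eq by (simp only: integral_Re[OF True])
    next
      case False then show ?thesis unfolding eq by (simp add: not_integrable_integral_eq)
    qed
  qed
  have lim: "(\<lambda>n. LINT x|lborel. Y' x * (LINT y|lborel. of_real (heat (e n) (x - y)) * c' y))
    \<longlonglongrightarrow> (LINT x|lborel. Y' x * ((2 * pi) ^ DIM(real) * c' x))"
  proof (rule integral_dominated_convergence[where w="\<lambda>x. ((2 * pi) ^ DIM(real) * D) * norm (Y' x)"])
    have [measurable]: "c' \<in> borel_measurable borel" "Y' \<in> borel_measurable borel" using c'1 Y'1 by auto
    show "(\<lambda>x. Y' x * (LINT y|lborel. of_real (heat (e n) (x - y)) * c' y)) \<in> borel_measurable lborel" for n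
      by measurable
    show "(\<lambda>x. Y' x * ((2 * pi) ^ DIM(real) * c' x)) \<in> borel_measurable lborel" by measurable
    show "integrable lborel (\<lambda>x. ((2 * pi) ^ DIM(real) * D) * norm (Y' x))"
      using Y'1 by simp
    show "AE x in lborel. (\<lambda>n. Y' x * (LINT y|lborel. of_real (heat (e n) (x - y)) * c' y))
       \<longlonglongrightarrow> Y' x * ((2 * pi) ^ DIM(real) * c' x)"
      using AE_lborel_singleton[of 0] AE_lborel_singleton[of \<tau>]
    proof (eventually_elim, intro tendsto_mult[OF tendsto_const])
      fix x assume "x \<noteq> 0" "x \<noteq> \<tau>"
      then have "isCont c' x" unfolding c'_def using cc by (intro continuous_of_real) auto
      then show "(\<lambda>n. LINT y|lborel. of_real (heat (e n) (x - y)) * c' y) \<longlonglongrightarrow> (2 * pi) ^ DIM(real) * c' x"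
        by (intro heat_conv_tendsto[where B=D] cB e) auto
    qed
    show "AE x in lborel. norm (Y' x * (LINT y|lborel. of_real (heat (e n) (x - y)) * c' y))
      \<le> ((2 * pi) ^ DIM(real) * D) * norm (Y' x)" for n
      using norm_heat_conv_le[where \<phi>=c', OF cB e(2)[of n]]
      by (auto simp: norm_mult mult.commute[of "norm (Y' _)"] intro!: mult_right_mono)
  qed
  have "0 \<le> Re (LINT x|lborel. Y' x * ((2 * pi) ^ DIM(real) * c' x))"
    by (rule LIMSEQ_le_const[OF tendsto_Re[OF lim]]) (use nonneg in auto)
  also have "(LINT x|lborel. Y' x * ((2 * pi) ^ DIM(real) * c' x)) = of_real (2 * pi * (LINT x|lborel. Y x * c x))"
    unfolding integral_mult_middle by (simp add: Y'_def c'_def flip: of_real_mult)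
  finally have "0 \<le> 2 * pi * (LINT x|lborel. Y x * c x)" by simp
  then have "0 \<le> (LINT x|lborel. Y x * c x)" using pi_gt_zero by (auto simp: zero_le_mult_iff)
  also have "(LINT x|lborel. Y x * c x) = (LINT t:{0..\<tau>}|lborel. y t * (\<kappa> * y t + conv b y t))"
    unfolding set_lebesgue_integral_def
  proof (rule integral_cong_AE)
    have ae: "AE t in lborel. Y t * c t = indicator {0..\<tau>} t *\<^sub>R (y t * (\<kappa> * y t + conv b y t))"
      using AE_lborel_singleton[of 0]
    proof eventually_elim
      fix t :: real assume "t \<noteq> 0"
      then show "Y t * c t = indicator {0..\<tau>} t *\<^sub>R (y t * (\<kappa> * y t + conv b y t))"
        using c_eq[of t] by (auto simp: Y_def indicator_def clamped_eq)
    qed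
    then show "AE t in lborel. Y t * c t = indicator {0..\<tau>} t *\<^sub>R (y t * (\<kappa> * y t + conv b y t))" .
    \<comment> \<open>Measurability of the integrand is inherited from Y c, from which it can differ
      only at 0, where Y is cut off.\<close>
    have "(\<lambda>t. indicator {0..\<tau>} t *\<^sub>R (y t * (\<kappa> * y t + conv b y t))) = (\<lambda>t. if t = 0 then indicator {0..\<tau>} t *\<^sub>R (y t * (\<kappa> * y t + conv b y t)) else Y t * c t)"
    proof
      fix t :: real
      show "indicator {0..\<tau>} t *\<^sub>R (y t * (\<kappa> * y t + conv b y t)) = (if t = 0 then indicator {0..\<tau>} t *\<^sub>R (y t * (\<kappa> * y t + conv b y t)) else Y t * c t)"
        using c_eq[of t] by (auto simp: Y_def indicator_def clamped_eq)
    qed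
    also have "\<dots> = (\<lambda>t. if t = 0 then indicator {0..\<tau>} 0 *\<^sub>R (y 0 * (\<kappa> * y 0 + conv b y 0)) else Y t * c t)" by auto
    also have "\<dots> \<in> borel_measurable lborel" by measurable
    finally show "(\<lambda>t. indicator {0..\<tau>} t *\<^sub>R (y t * (\<kappa> * y t + conv b y t))) \<in> borel_measurable lborel" .
  qed measurable
  finally show ?thesis .
qed

section \<open>The scalar Volterra equation\<close>

text \<open>Convolution with the measure \<open>a\<^sub>0\<close> times the Dirac mass plus
  \<open>a\<close>.\<close>

definition volt :: "real \<Rightarrow> (real \<Rightarrow> real) \<Rightarrow> (real \<Rightarrow> 'b::{banach,second_countable_topology}) \<Rightarrow> real \<Rightarrow> 'b" where
  "volt a\<^sub>0 a y t = a\<^sub>0 *\<^sub>R y t + conv a y t"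

text \<open>This is the convolution of A with y, so z = 1 - \<mu> \<open>volt_int\<close> z is the
  scalar Volterra equation in integrated form.\<close>

definition volt_int :: "real \<Rightarrow> (real \<Rightarrow> real) \<Rightarrow> (real \<Rightarrow> 'b::{banach,second_countable_topology}) \<Rightarrow> real \<Rightarrow> 'b" where
  "volt_int a\<^sub>0 a y t = integral {0..t} (volt a\<^sub>0 a y)"

primrec volt_iter :: "real \<Rightarrow> (real \<Rightarrow> real) \<Rightarrow> nat \<Rightarrow> real \<Rightarrow> real" where
  "volt_iter a\<^sub>0 a 0 = (\<lambda>_. 1)"
| "volt_iter a\<^sub>0 a (Suc m) = volt_int a\<^sub>0 a (volt_iter a\<^sub>0 a m)"

text \<open>The Neumann series of the equation. As a power series in \<mu> it is measurable in
  \<mu>, and it can be matched term by term with the factors |\<xi>|^(2m) that the Laplacian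
  produces.\<close>

definition volt_sol :: "real \<Rightarrow> (real \<Rightarrow> real) \<Rightarrow> real \<Rightarrow> real \<Rightarrow> real" where
  "volt_sol a\<^sub>0 a \<mu> t = (\<Sum>m. (- \<mu>) ^ m * volt_iter a\<^sub>0 a m t)"

section \<open>Picard iteration for the Volterra operator\<close>

lemma conv_integrable:
  fixes y :: "real \<Rightarrow> 'b::{banach,second_countable_topology}"
  assumes b: "set_integrable lborel {0<..} b" and y: "continuous_on {0..} y"
  shows "integrable lborel (\<lambda>r. indicator {0<..<t} r *\<^sub>R (b (t - r) *\<^sub>R y r))"
proof (cases "t \<le> 0")
  case True then show ?thesis by simp
next
  case False
  then have yt: "continuous_on {0..t} y" "0 \<le> t" using y by (auto intro: continuous_on_subset)
  obtain B where B: "B \<ge> 0" "\<And>s. norm (clamped t y s) \<le> B" using bounded_clamped[OF yt] by auto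
  have [measurable]: "clamped t y \<in> borel_measurable borel"
    using continuous_clamped[OF yt] by (rule borel_measurable_continuous_onI)
  define \<beta> where "\<beta> s = indicator {0<..} s * b s" for s
  have \<beta>: "integrable lborel \<beta>" unfolding \<beta>_def by (rule conv_L1_kernel[OF b])
  then have \<beta>t: "integrable lborel (\<lambda>r. \<beta> (t - r))" by (simp add: integrable_lborel_reflect_iff)
  then have [measurable]: "(\<lambda>r. \<beta> (t - r)) \<in> borel_measurable borel" by auto
  have eq: "indicator {0<..<t} r *\<^sub>R (b (t - r) *\<^sub>R y r) = indicator {0<..<t} r *\<^sub>R (\<beta> (t - r) *\<^sub>R clamped t y r)" for r
    by (auto simp: indicator_def \<beta>_def clamped_eq)
  show ?thesis unfolding eq
  proof (rule Bochner_Integration.integrable_bound[OF integrable_mult_right[OF \<beta>t, of B]])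
    show "AE r in lborel. norm (indicator {0<..<t} r *\<^sub>R (\<beta> (t - r) *\<^sub>R clamped t y r)) \<le> norm (B * \<beta> (t - r))"
      using B by (auto simp: indicator_def abs_mult mult.commute[of B] intro!: mult_left_mono)
  qed measurable
qed

lemma conv_diff:
  fixes y :: "real \<Rightarrow> 'b::{banach,second_countable_topology}"
  assumes "set_integrable lborel {0<..} b" "continuous_on {0..} y" "continuous_on {0..} y'"
  shows "conv b (\<lambda>r. y r - y' r) t = conv b y t - conv b y' t"
  unfolding conv_def set_lebesgue_integral_def
  using conv_integrable[OF assms(1,2), of t] conv_integrable[OF assms(1,3), of t]
  by (simp add: scaleR_diff_right)

lemma conv_scaleR:
  "conv b (\<lambda>r. y r *\<^sub>R v) t = conv b y t *\<^sub>R (v :: 'b::{banach,second_countable_topology})"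
  if "set_integrable lborel {0<..} b" "continuous_on {0..} (y::real \<Rightarrow> real)"
  unfolding conv_def set_lebesgue_integral_def
  using conv_integrable[OF that, of t] by (simp flip: integral_scaleR_left scaleR_scaleR)

context
  fixes a\<^sub>0 :: real and a :: "real \<Rightarrow> real" and M :: real
  assumes a: "set_integrable lborel {0<..} a" and a0: "0 \<le> a\<^sub>0"
    and M_def: "M = a\<^sub>0 + (LINT s:{0<..}|lborel. \<bar>a s\<bar>)"
begin

lemma M_nonneg: "M \<ge> 0"
  unfolding M_def set_lebesgue_integral_def using a0 by (intro add_nonneg_nonneg integral_nonneg_AE) auto

lemma continuous_volt: "continuous_on {0..} y \<Longrightarrow> continuous_on {0..} (volt a\<^sub>0 a y)"
  unfolding volt_def by (intro continuous_intros continuous_on_conv[OF a])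

lemma norm_volt_le:
  assumes "\<And>r. 0 < r \<Longrightarrow> r \<le> t \<Longrightarrow> norm (y r) \<le> B" "B \<ge> 0" "t > 0"
  shows "norm (volt a\<^sub>0 a y t) \<le> M * B"
proof -
  have "norm (volt a\<^sub>0 a y t) \<le> norm (a\<^sub>0 *\<^sub>R y t) + norm (conv a y t)"
    unfolding volt_def by (rule norm_triangle_ineq)
  also have "\<dots> \<le> a\<^sub>0 * B + (LINT s:{0<..}|lborel. \<bar>a s\<bar>) * B"
    using a0 assms by (intro add_mono norm_conv_le[OF a]) (auto intro: mult_left_mono)
  finally show ?thesis by (simp add: M_def distrib_right)
qed

lemma volt_integrable_on: "continuous_on {0..} y \<Longrightarrow> volt a\<^sub>0 a y integrable_on {0..t}"
  by (rule integrable_continuous_real, rule continuous_on_subset[OF continuous_volt]) auto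

lemma continuous_volt_int: 
  fixes y :: "real \<Rightarrow> 'b::euclidean_space"
  assumes "continuous_on {0..} y"
  shows "continuous_on {0..} (volt_int a\<^sub>0 a y)"
    and "t > 0 \<Longrightarrow> (volt_int a\<^sub>0 a y has_vector_derivative volt a\<^sub>0 a y t) (at t)"
proof -
  have c: "continuous_on {0..T} (volt a\<^sub>0 a y)" for T
    using continuous_volt[OF assms] by (rule continuous_on_subset) auto
  have cT: "continuous_on {0..T} (volt_int a\<^sub>0 a y)" for T
    unfolding volt_int_def by (rule indefinite_integral_continuous_1[OF integrable_continuous_real[OF c]])
  show "continuous_on {0..} (volt_int a\<^sub>0 a y)"
    unfolding continuous_on_def
  proof
    fix t :: real assume t: "t \<in> {0..}"
    have "at t within {0..} = at t within {0..t + 1}"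
      by (rule at_within_nhd[of t "{..<t+1}"]) auto
    then show "(volt_int a\<^sub>0 a y \<longlongrightarrow> volt_int a\<^sub>0 a y t) (at t within {0..})"
      using cT[of "t + 1"] t by (simp add: continuous_on_def)
  qed
  assume t: "t > 0"
  have "(volt_int a\<^sub>0 a y has_vector_derivative volt a\<^sub>0 a y t) (at t within {0..t + 1})"
    unfolding volt_int_def by (rule integral_has_vector_derivative[OF c]) (use t in auto)
  then show "(volt_int a\<^sub>0 a y has_vector_derivative volt a\<^sub>0 a y t) (at t)"
    using t by (simp add: at_within_Icc_at)
qed

text \<open>Each application gains a factor t / (m + 1); iterated, these factors build the
  factorials that make the series converge for all t and \<mu>.\<close>

lemma norm_volt_int_le:
  fixes y :: "real \<Rightarrow> 'b::euclidean_space"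
  assumes y: "continuous_on {0..} y" and B: "\<And>r. 0 \<le> r \<Longrightarrow> r \<le> t \<Longrightarrow> norm (y r) \<le> K * r ^ m" and K: "K \<ge> 0" and t: "t \<ge> 0"
  shows "norm (volt_int a\<^sub>0 a y t) \<le> M * K * t ^ Suc m / Suc m"
proof -
  have "norm (integral {0..t} (volt a\<^sub>0 a y)) \<le> integral {0..t} (\<lambda>s. M * K * s ^ m)"
  proof (cases "t = 0")
    case False
    \<comment> \<open>\<open>norm_volt_le\<close> speaks of s > 0, so the integrand is reset at the
      single point 0.\<close>
    have "norm (integral {0..t} (\<lambda>s. if s = 0 then 0 else volt a\<^sub>0 a y s)) \<le> integral {0..t} (\<lambda>s. M * K * s ^ m)"
    proof (rule integral_norm_bound_integral)
      show "(\<lambda>s. if s = 0 then 0 else volt a\<^sub>0 a y s) integrable_on {0..t}"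
        by (rule integrable_spike[OF volt_integrable_on[OF y], where S="{0}"]) auto
      show "(\<lambda>s. M * K * s ^ m) integrable_on {0..t}"
        by (intro integrable_continuous_real continuous_intros)
      fix s assume s: "s \<in> {0..t}"
      show "norm (if s = 0 then 0 else volt a\<^sub>0 a y s) \<le> M * K * s ^ m"
      proof (cases "s = 0")
        case False
        have "norm (y r) \<le> K * s ^ m" if "0 < r" "r \<le> s" for r
        proof -
          have "norm (y r) \<le> K * r ^ m" using B[of r] that s by auto
          also have "\<dots> \<le> K * s ^ m" using that K by (intro mult_left_mono power_mono) auto
          finally show ?thesis .
        qed
        then show ?thesis using norm_volt_le[of s y "K * s ^ m"] K s False by (simp add: mult_ac)
      qed (use K M_nonneg in simp)
    qed
    also have "integral {0..t} (\<lambda>s. if s = 0 then 0 else volt a\<^sub>0 a y s) = integral {0..t} (volt a\<^sub>0 a y)"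
      by (rule integral_spike[where S="{0}"]) auto
    finally show ?thesis .
  qed simp
  also have "integral {0..t} (\<lambda>s. M * K * s ^ m) = M * K * t ^ Suc m / Suc m"
  proof -
    have "((\<lambda>s. M * K * s ^ m) has_integral (M * K * t ^ Suc m / Suc m - M * K * 0 ^ Suc m / Suc m)) {0..t}"
    proof (rule fundamental_theorem_of_calculus[OF t])
      fix x
      have "((\<lambda>s. M * K * s ^ Suc m / Suc m) has_real_derivative M * K * x ^ m) (at x within {0..t})"
        by (auto intro!: derivative_eq_intros simp del: of_nat_Suc power_Suc)
      then show "((\<lambda>s. M * K * s ^ Suc m / Suc m) has_vector_derivative M * K * x ^ m) (at x within {0..t})"
        by (simp only: has_real_derivative_iff_has_vector_derivative)
    qed
    from integral_unique[OF this] show ?thesis by simp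
  qed
  finally show ?thesis by (simp add: volt_int_def)
qed

lemma volt_int_diff:
  fixes y y' :: "real \<Rightarrow> 'b::euclidean_space"
  assumes "continuous_on {0..} y" "continuous_on {0..} y'"
  shows "volt_int a\<^sub>0 a (\<lambda>r. y r - y' r) t = volt_int a\<^sub>0 a y t - volt_int a\<^sub>0 a y' t"
proof -
  have "volt a\<^sub>0 a (\<lambda>r. y r - y' r) = (\<lambda>s. volt a\<^sub>0 a y s - volt a\<^sub>0 a y' s)"
    by (simp add: volt_def conv_diff[OF a] assms scaleR_diff_right fun_eq_iff)
  then show ?thesis
    unfolding volt_int_def by (simp add: Henstock_Kurzweil_Integration.integral_diff volt_integrable_on assms)
qed

lemma volt_int_scaleR:
  assumes y: "continuous_on {0..} (y::real \<Rightarrow> real)"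
  shows "volt_int a\<^sub>0 a (\<lambda>r. y r *\<^sub>R (v::'b::euclidean_space)) t = volt_int a\<^sub>0 a y t *\<^sub>R v"
proof -
  have "volt a\<^sub>0 a (\<lambda>r. y r *\<^sub>R v) = (\<lambda>s. volt a\<^sub>0 a y s *\<^sub>R v)"
    by (simp add: volt_def conv_scaleR[OF a y] scaleR_left_distrib fun_eq_iff)
  then show ?thesis
    unfolding volt_int_def
    by (simp add: integral_unique[OF has_integral_scaleR_left[OF integrable_integral[OF volt_integrable_on[OF y]]]])
qed

lemma continuous_volt_iter: "continuous_on {0..} (volt_iter a\<^sub>0 a m)"
  by (induction m) (auto intro!: continuous_volt_int continuous_intros)

lemma volt_iter_le:
  "t \<ge> 0 \<Longrightarrow> \<bar>volt_iter a\<^sub>0 a m t\<bar> \<le> (M * t) ^ m / fact m"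
proof (induction m arbitrary: t)
  case (Suc m)
  have "norm (volt_int a\<^sub>0 a (volt_iter a\<^sub>0 a m) t) \<le> M * (M ^ m / fact m) * t ^ Suc m / Suc m"
    using Suc M_nonneg by (intro norm_volt_int_le continuous_volt_iter) (auto simp: power_mult_distrib)
  then show ?case by (simp add: power_mult_distrib field_simps)
qed simp

lemma volt_int_const: "volt_int a\<^sub>0 a (\<lambda>_. v::'b::euclidean_space) t = volt_iter a\<^sub>0 a 1 t *\<^sub>R v"
  using volt_int_scaleR[of "\<lambda>_. 1" v] by simp

text \<open>Meant for f m t the pairing of the transform of u(t) with |\<xi>|^(2m) h: the weak
  equation links level m to level m + 1 only, and iterating this hierarchy yields the series. The
  factorial in the iterated kernels beats the geometric growth of f m, so the solution is identified
  without an equation at individual frequencies.\<close>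

lemma volt_expansion:
  fixes f :: "nat \<Rightarrow> real \<Rightarrow> 'b::euclidean_space"
  assumes f: "\<And>m. continuous_on {0..} (f m)"
    and eq: "\<And>m t. t \<ge> 0 \<Longrightarrow> f m t = f m 0 - volt_int a\<^sub>0 a (f (Suc m)) t"
    and B: "\<And>m t. 0 \<le> t \<Longrightarrow> t \<le> T \<Longrightarrow> norm (f m t) \<le> C * R ^ m" and R: "R \<ge> 0" and C: "C \<ge> 0"
    and t: "0 \<le> t" "t \<le> T"
  shows "(\<lambda>m. ((-1) ^ m * volt_iter a\<^sub>0 a m t) *\<^sub>R f m 0) sums f 0 t"
proof -
  \<comment> \<open>The remainder after N iterations started at level j. Raising N by one applies
    the operator once to the remainder of level j + 1, hence the induction over all levels at
    once.\<close>
  define g where "g N j s = f j s - (\<Sum>m<N. ((-1) ^ m * volt_iter a\<^sub>0 a m s) *\<^sub>R f (j + m) 0)" for N j s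
  have gc: "continuous_on {0..} (g N j)" for N j
    unfolding g_def by (intro continuous_intros f continuous_volt_iter)
  have step: "g (Suc N) j s = - volt_int a\<^sub>0 a (g N (Suc j)) s" if s: "s \<ge> 0" for N j s
  proof -
    have lin: "volt_int a\<^sub>0 a (\<lambda>s. \<Sum>m<N. ((-1) ^ m * volt_iter a\<^sub>0 a m s) *\<^sub>R f (Suc j + m) 0) s
       = (\<Sum>m<N. ((-1) ^ m * volt_iter a\<^sub>0 a (Suc m) s) *\<^sub>R f (Suc j + m) 0)" for N
    proof (induction N)
      case 0 then show ?case by (simp add: volt_int_const[of "0::'b", simplified])
    next
      case (Suc N)
      let ?u = "\<lambda>s. \<Sum>m<N. ((-1) ^ m * volt_iter a\<^sub>0 a m s) *\<^sub>R f (Suc j + m) 0"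
      let ?w = "\<lambda>s. volt_iter a\<^sub>0 a N s *\<^sub>R (- ((-1) ^ N *\<^sub>R f (Suc j + N) 0))"
      have "volt_int a\<^sub>0 a (\<lambda>s. ?u s - ?w s) s = volt_int a\<^sub>0 a ?u s - volt_int a\<^sub>0 a ?w s"
        by (rule volt_int_diff) (intro continuous_intros continuous_volt_iter)+
      also have "volt_int a\<^sub>0 a ?w s = volt_iter a\<^sub>0 a (Suc N) s *\<^sub>R (- ((-1) ^ N *\<^sub>R f (Suc j + N) 0))"
        by (simp only: volt_int_scaleR[OF continuous_volt_iter] volt_iter.simps)
      finally show ?case using Suc by (simp add: mult.commute)
    qed
    have "g (Suc N) j s = - volt_int a\<^sub>0 a (f (Suc j)) s - (\<Sum>m<N. ((-1) ^ Suc m * volt_iter a\<^sub>0 a (Suc m) s) *\<^sub>R f (Suc j + m) 0)"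
      unfolding g_def using eq[OF s, of j] by (subst sum.lessThan_Suc_shift) (simp add: algebra_simps)
    also have "\<dots> = - (volt_int a\<^sub>0 a (f (Suc j)) s - (\<Sum>m<N. ((-1) ^ m * volt_iter a\<^sub>0 a (Suc m) s) *\<^sub>R f (Suc j + m) 0))"
      by (simp add: sum_negf)
    also have "\<dots> = - volt_int a\<^sub>0 a (g N (Suc j)) s"
      unfolding g_def lin[symmetric]
      by (subst volt_int_diff[OF f]) (intro continuous_intros continuous_volt_iter, simp)
    finally show ?thesis .
  qed
  have bound: "norm (g N j s) \<le> C * R ^ (j + N) * M ^ N / fact N * s ^ N" if "0 \<le> s" "s \<le> T" for N j s
    using that
  proof (induction N arbitrary: j s)
    case 0 then show ?case using B[of s j] by (simp add: g_def)
  next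
    case (Suc N)
    have "norm (volt_int a\<^sub>0 a (g N (Suc j)) s) \<le> M * (C * R ^ (Suc j + N) * M ^ N / fact N) * s ^ Suc N / Suc N"
      using Suc.prems C R M_nonneg by (intro norm_volt_int_le gc Suc.IH) auto
    also have "\<dots> = C * R ^ (j + Suc N) * M ^ Suc N / fact (Suc N) * s ^ Suc N"
      by (simp add: field_simps)
    finally show ?case using step[OF Suc.prems(1), of N j] by simp
  qed
  have "(\<lambda>N. C * ((R * M * t) ^ N / fact N)) \<longlonglongrightarrow> C * 0"
    by (intro tendsto_intros) (use summable_LIMSEQ_zero[OF summable_exp_generic, of "R * M * t"] in \<open>simp add: divide_inverse mult.commute scaleR_conv_of_real\<close>)
  moreover have "norm (g N 0 t) \<le> C * ((R * M * t) ^ N / fact N)" for N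
    using bound[OF t, of N 0] by (simp add: power_mult_distrib field_simps)
  ultimately have "(\<lambda>N. g N 0 t) \<longlonglongrightarrow> 0"
    by (intro Lim_null_comparison[of "\<lambda>N. g N 0 t"]) auto
  then have "(\<lambda>N. f 0 t - g N 0 t) \<longlonglongrightarrow> f 0 t - 0" by (intro tendsto_intros)
  then show ?thesis by (simp add: sums_def g_def)
qed

lemma volt_sol_sums:
  assumes t: "t \<ge> 0"
  shows "(\<lambda>m. (- \<mu>) ^ m * volt_iter a\<^sub>0 a m t) sums volt_sol a\<^sub>0 a \<mu> t"
proof -
  have "summable (\<lambda>m. (- \<mu>) ^ m * volt_iter a\<^sub>0 a m t)"
  proof (rule summable_comparison_test'[where N=0])
    show "summable (\<lambda>m. inverse (fact m) * (\<bar>\<mu>\<bar> * (M * t)) ^ m)" by (rule summable_exp)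
    show "norm ((- \<mu>) ^ m * volt_iter a\<^sub>0 a m t) \<le> inverse (fact m) * (\<bar>\<mu>\<bar> * (M * t)) ^ m" for m
      using mult_left_mono[OF volt_iter_le[OF t, of m], of "\<bar>\<mu>\<bar> ^ m"]
      by (simp add: abs_mult power_abs power_mult_distrib field_simps)
  qed
  then show ?thesis unfolding volt_sol_def by (rule summable_sums)
qed

lemma
  shows continuous_volt_sol: "continuous_on {0..} (volt_sol a\<^sub>0 a \<mu>)"
    and volt_sol_eq: "t \<ge> 0 \<Longrightarrow> volt_sol a\<^sub>0 a \<mu> t = 1 - \<mu> * volt_int a\<^sub>0 a (volt_sol a\<^sub>0 a \<mu>) t"
proof -
  define S where "S N t = (\<Sum>m<N. (- \<mu>) ^ m * volt_iter a\<^sub>0 a m t)" for N t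
  have Sc: "continuous_on {0..} (S N)" for N unfolding S_def by (intro continuous_intros continuous_volt_iter)
  have lim: "uniform_limit {0..T} S (volt_sol a\<^sub>0 a \<mu>) sequentially" if T: "T \<ge> 0" for T
    unfolding S_def volt_sol_def
  proof (rule Weierstrass_m_test)
    show "summable (\<lambda>m. inverse (fact m) * (\<bar>\<mu>\<bar> * (M * T)) ^ m)" by (rule summable_exp)
    fix m t assume t: "t \<in> {0..T}"
    have "\<bar>volt_iter a\<^sub>0 a m t\<bar> \<le> (M * T) ^ m / fact m"
      using t M_nonneg by (intro order_trans[OF volt_iter_le] divide_right_mono power_mono mult_left_mono) auto
    from mult_left_mono[OF this, of "\<bar>\<mu>\<bar> ^ m"]
    show "norm ((- \<mu>) ^ m * volt_iter a\<^sub>0 a m t) \<le> inverse (fact m) * (\<bar>\<mu>\<bar> * (M * T)) ^ m"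
      by (simp add: abs_mult power_abs power_mult_distrib field_simps)
  qed
  have cT: "continuous_on {0..T} (volt_sol a\<^sub>0 a \<mu>)" if T: "T \<ge> 0" for T
    by (rule uniform_limit_theorem[OF _ lim[OF T]]) (auto intro!: always_eventually continuous_on_subset[OF Sc])
  show c: "continuous_on {0..} (volt_sol a\<^sub>0 a \<mu>)"
    unfolding continuous_on_def
  proof
    fix t :: real assume t: "t \<in> {0..}"
    have "at t within {0..} = at t within {0..t + 1}"
      by (rule at_within_nhd[of t "{..<t+1}"]) auto
    then show "(volt_sol a\<^sub>0 a \<mu> \<longlongrightarrow> volt_sol a\<^sub>0 a \<mu> t) (at t within {0..})"
      using cT[of "t + 1"] t by (simp add: continuous_on_def)
  qed
  assume t: "t \<ge> 0"
  have step: "S (Suc N) t = 1 - \<mu> * volt_int a\<^sub>0 a (S N) t" for N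
  proof -
    have "volt_int a\<^sub>0 a (\<lambda>s. \<Sum>m<N. (- \<mu>) ^ m * volt_iter a\<^sub>0 a m s) t = (\<Sum>m<N. (- \<mu>) ^ m * volt_iter a\<^sub>0 a (Suc m) t)" for N
    proof (induction N)
      case 0 then show ?case using volt_int_const[of "0::real"] by simp
    next
      case (Suc N)
      let ?u = "\<lambda>s. \<Sum>m<N. (- \<mu>) ^ m * volt_iter a\<^sub>0 a m s"
      let ?w = "\<lambda>s. volt_iter a\<^sub>0 a N s *\<^sub>R (- ((- \<mu>) ^ N))"
      have "volt_int a\<^sub>0 a (\<lambda>s. ?u s - ?w s) t = volt_int a\<^sub>0 a ?u t - volt_int a\<^sub>0 a ?w t"
        by (rule volt_int_diff) (intro continuous_intros continuous_volt_iter)+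
      also have "volt_int a\<^sub>0 a ?w t = volt_iter a\<^sub>0 a (Suc N) t *\<^sub>R (- ((- \<mu>) ^ N))"
        by (simp only: volt_int_scaleR[OF continuous_volt_iter] volt_iter.simps)
      finally show ?case using Suc by (simp add: mult.commute)
    qed
    then show ?thesis
      unfolding S_def[abs_def] by (subst sum.lessThan_Suc_shift) (simp add: sum_distrib_left sum_negf mult.assoc)
  qed
  have "(\<lambda>N. volt_int a\<^sub>0 a (S N) t) \<longlonglongrightarrow> volt_int a\<^sub>0 a (volt_sol a\<^sub>0 a \<mu>) t"
  proof (rule LIMSEQ_I)
    fix r :: real assume r: "r > 0"
    define d where "d = r / (M * t + 1)"
    have Mt: "M * t \<ge> 0" using M_nonneg t by simp
    then have d: "d > 0" using r by (simp add: d_def)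
    from lim[OF t] d obtain N0 where N0: "\<And>N s. N \<ge> N0 \<Longrightarrow> s \<in> {0..t} \<Longrightarrow> dist (S N s) (volt_sol a\<^sub>0 a \<mu> s) < d"
      unfolding uniform_limit_iff eventually_sequentially by meson
    show "\<exists>no. \<forall>n\<ge>no. norm (volt_int a\<^sub>0 a (S n) t - volt_int a\<^sub>0 a (volt_sol a\<^sub>0 a \<mu>) t) < r"
    proof (intro exI allI impI)
      fix n assume n: "n \<ge> N0"
      have "norm (volt_int a\<^sub>0 a (\<lambda>s. S n s - volt_sol a\<^sub>0 a \<mu> s) t) \<le> M * d * t ^ Suc 0 / Suc 0"
        using N0[OF n] d t by (intro norm_volt_int_le continuous_intros Sc c) (auto simp: dist_real_def less_imp_le)
      also have "\<dots> < r"
      proof -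
        have "M * t * d < (M * t + 1) * d" using d by (simp add: algebra_simps)
        also have "\<dots> = r" using Mt by (simp add: d_def)
        finally show ?thesis by (simp add: mult_ac)
      qed
      finally show "norm (volt_int a\<^sub>0 a (S n) t - volt_int a\<^sub>0 a (volt_sol a\<^sub>0 a \<mu>) t) < r"
        by (simp add: volt_int_diff Sc c)
    qed
  qed
  then have "(\<lambda>N. S (Suc N) t) \<longlonglongrightarrow> 1 - \<mu> * volt_int a\<^sub>0 a (volt_sol a\<^sub>0 a \<mu>) t"
    unfolding step by (intro tendsto_intros)
  moreover have "(\<lambda>N. S (Suc N) t) \<longlonglongrightarrow> volt_sol a\<^sub>0 a \<mu> t"
    using volt_sol_sums[OF t, of \<mu>] unfolding sums_def S_def by (rule LIMSEQ_Suc)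
  ultimately show "volt_sol a\<^sub>0 a \<mu> t = 1 - \<mu> * volt_int a\<^sub>0 a (volt_sol a\<^sub>0 a \<mu>) t"
    by (rule LIMSEQ_unique[symmetric])
qed

lemma volt_sol_0: "volt_sol a\<^sub>0 a \<mu> 0 = 1"
  using volt_sol_eq[of 0 \<mu>] by (simp add: volt_int_def)

lemma volt_sol_deriv:
  assumes t: "t > 0"
  shows "(volt_sol a\<^sub>0 a \<mu> has_real_derivative - \<mu> * volt a\<^sub>0 a (volt_sol a\<^sub>0 a \<mu>) t) (at t)"
proof -
  have "((\<lambda>t. 1 - \<mu> * volt_int a\<^sub>0 a (volt_sol a\<^sub>0 a \<mu>) t) has_real_derivative - \<mu> * volt a\<^sub>0 a (volt_sol a\<^sub>0 a \<mu>) t) (at t)"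
    using continuous_volt_int(2)[OF continuous_volt_sol t]
    by (auto intro!: derivative_eq_intros simp: has_real_derivative_iff_has_vector_derivative[symmetric])
  then show ?thesis
    by (rule DERIV_cong_ev[THEN iffD1, rotated -1])
       (use t eventually_nhds_in_open[OF open_greaterThan, of t 0] in \<open>auto elim!: eventually_mono simp: volt_sol_eq\<close>)
qed

lemma borel_measurable_volt_sol:
  assumes t: "t \<ge> 0"
  shows "(\<lambda>\<mu>. volt_sol a\<^sub>0 a \<mu> t) \<in> borel_measurable borel"
  unfolding volt_sol_def by measurable

end

section \<open>Energy estimates\<close>

lemma set_integral_Icc_eq_integral:
  fixes f :: "real \<Rightarrow> real"
  assumes "continuous_on {a..b} f"
  shows "(LINT t:{a..b}|lborel. f t) = integral {a..b} f"
  by (rule set_borel_integral_eq_integral(2)) (use borel_integrable_atLeastAtMost'[OF assms] in simp)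

lemma positive_type_integral:
  assumes b: "set_integrable lborel {0<..} b"
    and C: "AE \<omega> in lborel. \<kappa> + (LINT t:{0<..}|lborel. b t * cos (\<omega> * t)) \<ge> 0"
    and y: "continuous_on {0..} y" and \<tau>: "0 \<le> \<tau>"
  shows "integral {0..\<tau>} (\<lambda>t. y t * (\<kappa> * y t + conv b y t)) \<ge> (0::real)"
proof -
  have "continuous_on {0..} (\<lambda>t. y t * (\<kappa> * y t + conv b y t))"
    by (intro continuous_intros y continuous_on_conv[OF b])
  then have "continuous_on {0..\<tau>} (\<lambda>t. y t * (\<kappa> * y t + conv b y t))"
    by (rule continuous_on_subset) auto
  moreover have "continuous_on {0..\<tau>} y" using y by (rule continuous_on_subset) auto
  ultimately show ?thesis
    using positive_type[OF b C _ \<tau>, of y] by (simp add: set_integral_Icc_eq_integral)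
qed

text \<open>An exponential weight is multiplicative along t = (t - r) + r. Hence the weighted
  solution satisfies an equation of the same type with the weighted kernel.\<close>

lemma conv_exp:
  "conv (\<lambda>s. exp (\<gamma> * s) * b s) (\<lambda>r. exp (\<gamma> * r) * y r) t = exp (\<gamma> * t) * (conv b y t :: real)"
proof -
  have eq: "exp (\<gamma> * (t - r)) * b (t - r) * (exp (\<gamma> * r) * y r) = exp (\<gamma> * t) * (b (t - r) * y r)" for r
  proof -
    have "exp (\<gamma> * (t - r)) * exp (\<gamma> * r) = exp (\<gamma> * t)" by (simp add: algebra_simps flip: exp_add)
    then show ?thesis by (metis mult.assoc mult.left_commute)
  qed
  show ?thesis unfolding conv_def real_scaleR_def eq by simp
qed

lemma conv_mult_kernel: "conv (\<lambda>s. c * b s) y t = c * (conv b y t :: real)"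
  unfolding conv_def set_lebesgue_integral_def by (simp add: mult.left_commute[of _ c] mult.assoc)

lemma conv_diff_kernel:
  fixes y :: "real \<Rightarrow> real"
  assumes "set_integrable lborel {0<..} b" "set_integrable lborel {0<..} b'" "continuous_on {0..} y"
  shows "conv (\<lambda>s. b s - b' s) y t = conv b y t - conv b' y t"
  using conv_integrable[OF assms(1,3), of t] conv_integrable[OF assms(2,3), of t]
  unfolding conv_def set_lebesgue_integral_def by (simp add: left_diff_distrib right_diff_distrib mult.assoc)

lemma set_integrable_exp_weight:
  fixes a :: "real \<Rightarrow> real"
  assumes a: "set_integrable lborel {0<..} (\<lambda>s. exp (\<alpha> * s) * a s)" and g: "\<gamma> \<le> \<alpha>"
  shows "set_integrable lborel {0<..} (\<lambda>s. exp (\<gamma> * s) * a s)"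
proof -
  have I: "integrable lborel (\<lambda>s. indicator {0<..} s * (exp (\<alpha> * s) * a s))"
    using a by (simp add: set_integrable_def)
  then have [measurable]: "(\<lambda>s. indicator {0<..} s * (exp (\<alpha> * s) * a s)) \<in> borel_measurable borel" by auto
  have eq: "indicator {0<..} s * (exp (\<gamma> * s) * a s)
      = exp ((\<gamma> - \<alpha>) * s) * (indicator {0<..} s * (exp (\<alpha> * s) * a s))" for s
    by (simp add: left_diff_distrib exp_diff)
  have "integrable lborel (\<lambda>s. exp ((\<gamma> - \<alpha>) * s) * (indicator {0<..} s * (exp (\<alpha> * s) * a s)))"
  proof (rule Bochner_Integration.integrable_bound[OF I])
    show "AE s in lborel. norm (exp ((\<gamma> - \<alpha>) * s) * (indicator {0<..} s * (exp (\<alpha> * s) * a s)))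
        \<le> norm (indicator {0<..} s * (exp (\<alpha> * s) * a s))"
    proof (rule AE_I2)
      fix s :: real
      show "norm (exp ((\<gamma> - \<alpha>) * s) * (indicator {0<..} s * (exp (\<alpha> * s) * a s)))
        \<le> norm (indicator {0<..} s * (exp (\<alpha> * s) * a s))"
        using g by (cases "s > 0") (auto simp: abs_mult mult_le_0_iff intro!: mult_left_le_one_le)
    qed
  qed measurable
  then show ?thesis unfolding set_integrable_def real_scaleR_def eq .
qed

lemma integral_set_integrable_mult_bounded:
  fixes b m :: "real \<Rightarrow> real"
  assumes b: "set_integrable lborel {0<..} b" and [measurable]: "m \<in> borel_measurable borel"
    and B: "\<And>s. s > 0 \<Longrightarrow> \<bar>m s\<bar> \<le> B"
  shows "set_integrable lborel {0<..} (\<lambda>s. b s * m s)"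
    and "\<bar>LINT s:{0<..}|lborel. b s * m s\<bar> \<le> (LINT s:{0<..}|lborel. \<bar>b s\<bar>) * B"
proof -
  have I: "integrable lborel (\<lambda>s. indicator {0<..} s * b s)" by (rule conv_L1_kernel[OF b])
  then have [measurable]: "(\<lambda>s. indicator {0<..} s * b s) \<in> borel_measurable borel" by auto
  have I': "integrable lborel (\<lambda>s. (indicator {0<..} s * b s) * m s)"
  proof (rule Bochner_Integration.integrable_bound[OF integrable_mult_left[OF I, of B]])
    show "AE s in lborel. norm ((indicator {0<..} s * b s) * m s) \<le> norm ((indicator {0<..} s * b s) * B)"
      using B by (auto simp: abs_mult indicator_def intro!: mult_left_mono order_trans[OF B])
  qed measurable
  then show *: "set_integrable lborel {0<..} (\<lambda>s. b s * m s)" by (simp add: set_integrable_def mult.assoc)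
  have "\<bar>LINT s|lborel. (indicator {0<..} s * b s) * m s\<bar> \<le> (LINT s|lborel. \<bar>(indicator {0<..} s * b s) * m s\<bar>)"
    using integral_norm_bound[of lborel "\<lambda>s. (indicator {0<..} s * b s) * m s"] by simp
  also have "\<dots> \<le> (LINT s|lborel. \<bar>indicator {0<..} s * b s\<bar> * B)"
    using B by (intro integral_mono integrable_abs I' integrable_mult_left I)
       (auto simp: abs_mult indicator_def intro!: mult_left_mono)
  also have "\<dots> = (LINT s|lborel. \<bar>indicator {0<..} s * b s\<bar>) * B" by (rule integral_mult_left_zero)
  finally show "\<bar>LINT s:{0<..}|lborel. b s * m s\<bar> \<le> (LINT s:{0<..}|lborel. \<bar>b s\<bar>) * B"
    by (simp add: set_lebesgue_integral_def mult.assoc abs_mult)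
qed

text \<open>Decay of z at rate \<gamma> means boundedness of y, so the balance of y^2 is recorded;
  the weight adds \<gamma> y to the derivative. Derivatives are available for t > 0 only, whence the
  interior form of the fundamental theorem.\<close>

lemma energy_identity:
  fixes \<mu> :: real
  assumes a: "set_integrable lborel {0<..} a" and a0: "0 \<le> a\<^sub>0"
    and b: "set_integrable lborel {0<..} (\<lambda>s. exp (\<gamma> * s) * a s)" and \<tau>: "\<tau> \<ge> 0"
  defines "y \<equiv> \<lambda>t. exp (\<gamma> * t) * volt_sol a\<^sub>0 a \<mu> t"
  defines "y' \<equiv> \<lambda>t. \<gamma> * y t - \<mu> * (a\<^sub>0 * y t + conv (\<lambda>s. exp (\<gamma> * s) * a s) y t)"
  shows "continuous_on {0..} y" "continuous_on {0..} y'" "y 0 = 1"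
    "(y' has_integral y \<tau> - 1) {0..\<tau>}"
    "((\<lambda>t. 2 * (y t * y' t)) has_integral (y \<tau>)\<^sup>2 - 1) {0..\<tau>}"
proof -
  note V = a a0 refl
  show yc: "continuous_on {0..} y" unfolding y_def by (intro continuous_intros continuous_volt_sol[OF V])
  show y'c: "continuous_on {0..} y'" unfolding y'_def by (intro continuous_intros yc continuous_on_conv[OF b])
  show y0: "y 0 = 1" by (simp add: y_def volt_sol_0[OF V])
  have der: "(y has_real_derivative y' t) (at t)" if t: "t > 0" for t
  proof -
    have "(y has_real_derivative exp (\<gamma> * t) * (- \<mu> * volt a\<^sub>0 a (volt_sol a\<^sub>0 a \<mu>) t) + (exp (\<gamma> * t) * \<gamma>) * volt_sol a\<^sub>0 a \<mu> t) (at t)"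
      unfolding y_def by (rule derivative_eq_intros volt_sol_deriv[OF V t] refl | simp)+
    also have "exp (\<gamma> * t) * (- \<mu> * volt a\<^sub>0 a (volt_sol a\<^sub>0 a \<mu>) t) + (exp (\<gamma> * t) * \<gamma>) * volt_sol a\<^sub>0 a \<mu> t = y' t"
      unfolding y'_def y_def conv_exp volt_def by (simp add: algebra_simps)
    finally show ?thesis .
  qed
  have c': "continuous_on {0..\<tau>} y" using yc by (rule continuous_on_subset) auto
  have "(y' has_integral y \<tau> - y 0) {0..\<tau>}"
    by (rule fundamental_theorem_of_calculus_interior[OF \<tau> c'])
       (auto simp flip: has_real_derivative_iff_has_vector_derivative intro!: der)
  then show "(y' has_integral y \<tau> - 1) {0..\<tau>}" by (simp add: y0)
  have "((\<lambda>t. 2 * (y t * y' t)) has_integral (y \<tau>)\<^sup>2 - (y 0)\<^sup>2) {0..\<tau>}"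
  proof (rule fundamental_theorem_of_calculus_interior[OF \<tau>])
    show "continuous_on {0..\<tau>} (\<lambda>t. (y t)\<^sup>2)" by (intro continuous_intros c')
    fix t assume "t \<in> {0<..<\<tau>}"
    then show "((\<lambda>t. (y t)\<^sup>2) has_vector_derivative 2 * (y t * y' t)) (at t)"
      unfolding has_real_derivative_iff_has_vector_derivative[symmetric]
      by (auto intro!: derivative_eq_intros der)
  qed
  then show "((\<lambda>t. 2 * (y t * y' t)) has_integral (y \<tau>)\<^sup>2 - 1) {0..\<tau>}" by (simp add: y0)
qed

text \<open>Hypothesis \<open>C\<close> says that \<mu> times the weighted kernel, diminished by
  \<gamma> times the Dirac mass, is of positive type. The energy y^2 then never exceeds its initial
  value 1.\<close>

lemma volt_sol_decay_coercive:
  assumes a: "set_integrable lborel {0<..} a" and a0: "0 \<le> a\<^sub>0"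
    and b: "set_integrable lborel {0<..} (\<lambda>s. exp (\<gamma> * s) * a s)"
    and C: "\<And>\<omega>. \<mu> * (a\<^sub>0 + (LINT s:{0<..}|lborel. exp (\<gamma> * s) * a s * cos (\<omega> * s))) \<ge> \<gamma>" and \<tau>: "\<tau> \<ge> 0"
  shows "\<bar>volt_sol a\<^sub>0 a \<mu> \<tau>\<bar> \<le> exp (- (\<gamma> * \<tau>))"
proof -
  define y where "y t = exp (\<gamma> * t) * volt_sol a\<^sub>0 a \<mu> t" for t
  define b' where "b' s = \<mu> * (exp (\<gamma> * s) * a s)" for s
  have b'i: "set_integrable lborel {0<..} b'" using b unfolding b'_def by simp
  note E = energy_identity[OF a a0 b \<tau>, of \<mu>, folded y_def]
  have P: "integral {0..\<tau>} (\<lambda>t. y t * ((\<mu> * a\<^sub>0 - \<gamma>) * y t + conv b' y t)) \<ge> 0"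
  proof (rule positive_type_integral[OF b'i _ E(1) \<tau>], intro AE_I2)
    fix \<omega>
    have "(LINT t:{0<..}|lborel. b' t * cos (\<omega> * t)) = \<mu> * (LINT s:{0<..}|lborel. exp (\<gamma> * s) * a s * cos (\<omega> * s))"
      unfolding b'_def by (simp add: mult.assoc)
    then show "\<mu> * a\<^sub>0 - \<gamma> + (LINT t:{0<..}|lborel. b' t * cos (\<omega> * t)) \<ge> 0"
      using C[of \<omega>] by (simp add: distrib_left)
  qed
  have eq: "2 * (y t * (\<gamma> * y t - \<mu> * (a\<^sub>0 * y t + conv (\<lambda>s. exp (\<gamma> * s) * a s) y t)))
     = - 2 * (y t * ((\<mu> * a\<^sub>0 - \<gamma>) * y t + conv b' y t))" for t
    unfolding b'_def conv_mult_kernel by (simp add: algebra_simps)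
  have "(y \<tau>)\<^sup>2 - 1 = - 2 * integral {0..\<tau>} (\<lambda>t. y t * ((\<mu> * a\<^sub>0 - \<gamma>) * y t + conv b' y t))"
    using integral_unique[OF E(5)] unfolding eq by simp
  then have "(y \<tau>)\<^sup>2 \<le> 1" using P by simp
  then have "\<bar>y \<tau>\<bar> \<le> 1" by (simp add: abs_square_le_1)
  then show ?thesis by (simp add: y_def abs_mult exp_minus field_simps)
qed

subsection \<open>Tails of the kernel\<close>

lemma integral_conv_eq:
  fixes b y :: "real \<Rightarrow> real"
  assumes b: "set_integrable lborel {0<..} b" and y: "continuous_on {0..} y" and t: "t \<ge> 0"
  shows "integral {0..t} (conv b y) = (LINT r:{0<..<t}|lborel. (LINT s:{0<..<t - r}|lborel. b s) * y r)"
proof -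
  have yt: "continuous_on {0..t} y" using y by (rule continuous_on_subset) auto
  define \<beta> where "\<beta> s = indicator {0<..} s * b s" for s
  define Y where "Y r = indicator {0<..<t} r * clamped t y r" for r
  obtain B where B: "B \<ge> 0" "\<And>s. norm (clamped t y s) \<le> B" using bounded_clamped[OF yt t] by auto
  have [measurable]: "clamped t y \<in> borel_measurable borel"
    using continuous_clamped[OF yt t] by (rule borel_measurable_continuous_onI)
  have \<beta>: "integrable lborel \<beta>" unfolding \<beta>_def by (rule conv_L1_kernel[OF b])
  have [measurable]: "Y \<in> borel_measurable borel" unfolding Y_def by measurable
  have Y: "integrable lborel Y"
  proof (rule Bochner_Integration.integrable_bound)
    show "integrable lborel (\<lambda>r. B * indicator {0<..<t} r)"
      by (intro integrable_mult_right integrable_real_indicator) (auto simp: t)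
  qed (use B in \<open>auto simp: Y_def indicator_def\<close>)
  have [measurable]: "\<beta> \<in> borel_measurable borel" "Y \<in> borel_measurable borel" using \<beta> Y by auto
  have sh: "(LINT s|lborel. h (s - r)) = (LINT s|lborel. h s)" for h :: "real \<Rightarrow> real" and r
    using integral_lborel_shift[of h "- r"] by simp
  have shi: "integrable lborel (\<lambda>s. \<beta> (s - r))" for r
    using integrable_lborel_shift_iff[of \<beta> "- r"] \<beta> by simp
  have I: "integrable (lborel \<Otimes>\<^sub>M lborel) (\<lambda>(r, s). Y r * \<beta> (s - r))"
  proof (rule lborel_pair.Fubini_integrable)
    show "integrable lborel (\<lambda>r. LINT s|lborel. norm (case (r, s) of (r, s) \<Rightarrow> Y r * \<beta> (s - r)))"
      using Y sh[of "\<lambda>t. norm (\<beta> t)"] by (simp add: abs_mult)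
  qed (use shi in auto)
  have I': "integrable (lborel \<Otimes>\<^sub>M lborel) (\<lambda>(r, s). indicator {..<t} s * (Y r * \<beta> (s - r)))"
    by (rule Bochner_Integration.integrable_bound[OF I]) (auto simp: indicator_def)
  have "integral {0..t} (conv b y) = (LINT s:{0..t}|lborel. conv b y s)"
    by (rule set_integral_Icc_eq_integral[symmetric], rule continuous_on_subset[OF continuous_on_conv[OF b y]]) auto
  also have "\<dots> = (LINT s|lborel. (LINT r|lborel. indicator {..<t} s * (Y r * \<beta> (s - r))))"
    unfolding set_lebesgue_integral_def
  proof (rule integral_cong_AE)
    have "continuous_on {0..t} (conv b y)" by (rule continuous_on_subset[OF continuous_on_conv[OF b y]]) auto
    from borel_measurable_continuous_on_indicator[OF _ this]
    show "(\<lambda>s. indicator {0..t} s *\<^sub>R conv b y s) \<in> borel_measurable lborel" by simp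
    show "(\<lambda>s. LINT r|lborel. indicator {..<t} s * (Y r * \<beta> (s - r))) \<in> borel_measurable lborel" by measurable
    show "AE s in lborel. indicator {0..t} s *\<^sub>R conv b y s = (LINT r|lborel. indicator {..<t} s * (Y r * \<beta> (s - r)))"
      using AE_lborel_singleton[of t]
    proof eventually_elim
      fix s assume s: "s \<noteq> t"
      show "indicator {0..t} s *\<^sub>R conv b y s = (LINT r|lborel. indicator {..<t} s * (Y r * \<beta> (s - r)))"
      proof (cases "0 \<le> s \<and> s < t")
        case True
        then have "conv b y s = (LINT r|lborel. indicator {..<t} s * (Y r * \<beta> (s - r)))"
          unfolding conv_def set_lebesgue_integral_def
          by (intro Bochner_Integration.integral_cong) (auto simp: indicator_def Y_def \<beta>_def clamped_eq)
        then show ?thesis using True by simp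
      next
        case False
        have "(LINT r|lborel. indicator {..<t} s * (Y r * \<beta> (s - r))) = (LINT r::real|lborel. 0)"
          using False s by (intro Bochner_Integration.integral_cong) (auto simp: indicator_def Y_def \<beta>_def)
        then show ?thesis using False s by auto
      qed
    qed
  qed
  also have "\<dots> = (LINT r|lborel. (LINT s|lborel. indicator {..<t} s * (Y r * \<beta> (s - r))))"
    by (rule lborel_pair.Fubini_integral[OF I'])
  also have "\<dots> = (LINT r:{0<..<t}|lborel. (LINT s:{0<..<t - r}|lborel. b s) * y r)"
    unfolding set_lebesgue_integral_def
  proof (intro Bochner_Integration.integral_cong refl)
    fix r
    have "(LINT s|lborel. indicator {..<t} s * (Y r * \<beta> (s - r))) = (LINT s|lborel. Y r * (indicator {..<t - r} (s - r) * \<beta> (s - r)))"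
      by (intro Bochner_Integration.integral_cong) (auto simp: indicator_def)
    also have "\<dots> = Y r * (LINT s|lborel. (indicator {..<t - r} (s - r) * \<beta> (s - r)))" by simp
    also have "(LINT s|lborel. (indicator {..<t - r} (s - r) * \<beta> (s - r))) = (LINT s|lborel. indicator {..<t - r} s * \<beta> s)"
      by (rule sh)
    also have "\<dots> = (LINT s|lborel. indicator {0<..<t - r} s *\<^sub>R b s)"
      by (intro Bochner_Integration.integral_cong) (auto simp: indicator_def \<beta>_def)
    finally show "(LINT s|lborel. indicator {..<t} s * (Y r * \<beta> (s - r)))
       = indicator {0<..<t} r *\<^sub>R ((LINT s|lborel. indicator {0<..<t - r} s *\<^sub>R b s) * y r)"
      by (auto simp: Y_def indicator_def clamped_eq)
  qed
  finally show ?thesis .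
qed

definition tail :: "(real \<Rightarrow> real) \<Rightarrow> real \<Rightarrow> real" where
  "tail b t = (LINT s:{t..}|lborel. b s)"

lemma tail_split:
  assumes b: "set_integrable lborel {0<..} b" and t: "t > 0"
  shows "tail b t = (LINT s:{0<..}|lborel. b s) - (LINT s:{0<..<t}|lborel. b s)"
proof -
  have "set_integrable lborel {0<..<t} b" "set_integrable lborel {t..} b"
    using t by (auto intro: set_integrable_subset[OF b])
  then have "(LINT s:{0<..<t} \<union> {t..}|lborel. b s) = (LINT s:{0<..<t}|lborel. b s) + (LINT s:{t..}|lborel. b s)"
    by (intro set_integral_Un) auto
  moreover have "{0<..<t} \<union> {t..} = {0<..}" using t by auto
  ultimately show ?thesis by (simp add: tail_def)
qed

text \<open>The tail is the full mass minus the mass on (0,t), and convolving with the latter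
  amounts to integrating the convolution b * y in time. In this way the primitive of y
  enters.\<close>

lemma conv_tail:
  assumes b: "set_integrable lborel {0<..} b" and y: "continuous_on {0..} y" and t: "t \<ge> 0"
  shows "conv (tail b) y t = (LINT s:{0<..}|lborel. b s) * integral {0..t} y - integral {0..t} (conv b y)"
proof -
  define J where "J = (LINT s:{0<..}|lborel. b s)"
  have yt: "continuous_on {0..t} y" using y by (rule continuous_on_subset) auto
  have yi: "set_integrable lborel {0<..<t} y"
    by (rule set_integrable_subset[OF borel_integrable_atLeastAtMost'[OF yt]]) auto
  have iy: "(LINT r:{0<..<t}|lborel. y r) = integral {0..t} y"
    using set_borel_integral_eq_integral(2)[OF yi] integral_open_interval_real[of 0 t y] by simp
  have P: "\<bar>LINT s:{0<..<u}|lborel. b s\<bar> \<le> (LINT s:{0<..}|lborel. \<bar>b s\<bar>)" for u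
  proof -
    have "(LINT s:{0<..<u}|lborel. b s) = (LINT s:{0<..}|lborel. b s * indicator {..<u} s)"
      unfolding set_lebesgue_integral_def by (intro Bochner_Integration.integral_cong) (auto simp: indicator_def)
    also have "\<bar>\<dots>\<bar> \<le> (LINT s:{0<..}|lborel. \<bar>b s\<bar>) * 1"
      by (rule integral_set_integrable_mult_bounded(2)[OF b]) (auto simp: indicator_def)
    finally show ?thesis by simp
  qed
  have Pm: "(\<lambda>r. (LINT s:{0<..<t - r}|lborel. b s)) \<in> borel_measurable borel"
  proof -
    have [measurable]: "(\<lambda>s. indicator {0<..} s * b s) \<in> borel_measurable borel"
      using conv_L1_kernel[OF b] by auto
    have "(\<lambda>r. (LINT s:{0<..<t - r}|lborel. b s)) = (\<lambda>r. (LINT s|lborel. (if s < t - r then 1 else 0) * (indicator {0<..} s * b s)))"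
      unfolding set_lebesgue_integral_def
      by (intro ext Bochner_Integration.integral_cong) (auto simp: indicator_def)
    also have "\<dots> \<in> borel_measurable borel" by measurable
    finally show ?thesis .
  qed
  have Pi: "set_integrable lborel {0<..<t} (\<lambda>r. (LINT s:{0<..<t - r}|lborel. b s) * y r)"
    unfolding set_integrable_def
  proof (rule Bochner_Integration.integrable_bound)
    show "integrable lborel (\<lambda>r. (LINT s:{0<..}|lborel. \<bar>b s\<bar>) * (indicator {0<..<t} r *\<^sub>R y r))"
      using yi unfolding set_integrable_def by (rule integrable_mult_right)
    have [measurable]: "(\<lambda>r. indicator {0<..<t} r *\<^sub>R y r) \<in> borel_measurable borel"
      using yi unfolding set_integrable_def by auto
    note [measurable] = Pm
    have "(\<lambda>r. (LINT s:{0<..<t - r}|lborel. b s) * (indicator {0<..<t} r *\<^sub>R y r)) \<in> borel_measurable borel" by measurable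
    then show "(\<lambda>r. indicator {0<..<t} r *\<^sub>R ((LINT s:{0<..<t - r}|lborel. b s) * y r)) \<in> borel_measurable lborel"
      by (simp add: mult_ac)
    show "AE r in lborel. norm (indicator {0<..<t} r *\<^sub>R ((LINT s:{0<..<t - r}|lborel. b s) * y r))
        \<le> norm ((LINT s:{0<..}|lborel. \<bar>b s\<bar>) * (indicator {0<..<t} r *\<^sub>R y r))"
      by (auto simp: abs_mult indicator_def intro!: mult_right_mono order_trans[OF P])
  qed
  have "conv (tail b) y t = (LINT r:{0<..<t}|lborel. J * y r - (LINT s:{0<..<t - r}|lborel. b s) * y r)"
    unfolding conv_def set_lebesgue_integral_def[where A="{0<..<t}"]
    by (intro Bochner_Integration.integral_cong) (auto simp: indicator_def tail_split[OF b] J_def left_diff_distrib)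
  also have "\<dots> = (LINT r:{0<..<t}|lborel. J * y r) - (LINT r:{0<..<t}|lborel. (LINT s:{0<..<t - r}|lborel. b s) * y r)"
    by (rule set_integral_diff) (use yi Pi in auto)
  also have "\<dots> = J * integral {0..t} y - integral {0..t} (conv b y)"
    using integral_conv_eq[OF b y t] iy by simp
  finally show ?thesis by (simp add: J_def)
qed

text \<open>
  The positivity of \<open>b - \<gamma> (tail b)\<close> lets the primitive \<open>Y\<close> of \<open>y\<close> enter the energy balance: by the
  equation, \<open>\<mu> (tail b * y) = \<Lambda> Y + y - 1\<close>, and the contributions of \<open>y\<^sup>2\<close> cancel.
\<close>

lemma volt_sol_decay_tail:
  assumes a: "set_integrable lborel {0<..} a" and a0: "0 \<le> a\<^sub>0"
    and b: "set_integrable lborel {0<..} (\<lambda>s. exp (\<gamma> * s) * a s)"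
    and bt: "set_integrable lborel {0<..} (tail (\<lambda>s. exp (\<gamma> * s) * a s))"
    and C: "AE \<omega> in lborel. (LINT s:{0<..}|lborel. (exp (\<gamma> * s) * a s - \<gamma> * tail (\<lambda>s. exp (\<gamma> * s) * a s) s) * cos (\<omega> * s)) \<ge> 0"
    and \<gamma>: "\<gamma> \<ge> 0" and \<mu>: "\<mu> \<ge> 0" and \<tau>: "\<tau> \<ge> 0"
    and \<Lambda>: "\<mu> * (a\<^sub>0 + (LINT s:{0<..}|lborel. exp (\<gamma> * s) * a s)) \<ge> 2 * \<gamma>"
  shows "\<bar>volt_sol a\<^sub>0 a \<mu> \<tau>\<bar> \<le> 2 * exp (- (\<gamma> * \<tau>))"
proof -
  define y where "y t = exp (\<gamma> * t) * volt_sol a\<^sub>0 a \<mu> t" for t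
  define b' where "b' s = exp (\<gamma> * s) * a s" for s
  define J where "J = (LINT s:{0<..}|lborel. b' s)"
  define L where "L = \<mu> * (a\<^sub>0 + J) - \<gamma>"
  define Y where "Y t = integral {0..t} y" for t
  \<comment> \<open>Here the 2 in hypothesis \<open>\<Lambda>\<close> is spent: one \<gamma> is
    already inside L, the other is needed to complete the square at the end.\<close>
  have L: "L \<ge> \<gamma>" using \<Lambda> by (simp add: L_def J_def b'_def)
  note E = energy_identity[OF a a0 b _, of _ \<mu>, folded y_def b'_def[abs_def]]
  note b1 = b[folded b'_def[abs_def]] and bt1 = bt[folded b'_def[abs_def]]
  have yc: "continuous_on {0..} y" by (rule E(1)[OF \<tau>])
  have yt: "continuous_on {0..t} y" for t using yc by (rule continuous_on_subset) auto
  have yi: "y integrable_on {0..t}" for t using yt by (rule integrable_continuous_real)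
  have ct: "continuous_on {0..t} (conv b' y)" for t
    by (rule continuous_on_subset[OF continuous_on_conv[OF b1 yc]]) auto
  have ci: "conv b' y integrable_on {0..t}" for t using ct by (rule integrable_continuous_real)
  have tl: "\<mu> * conv (tail b') y t = L * Y t + y t - 1" if t: "t \<ge> 0" for t
  proof -
    have "y t - 1 = integral {0..t} (\<lambda>t. \<gamma> * y t - \<mu> * (a\<^sub>0 * y t + conv b' y t))"
      using integral_unique[OF E(4)[OF t]] by simp
    also have "\<dots> = integral {0..t} (\<lambda>t. (\<gamma> - \<mu> * a\<^sub>0) * y t - \<mu> * conv b' y t)"
      by (intro arg_cong[where f="integral {0..t}"] ext) (simp add: algebra_simps)
    also have "\<dots> = (\<gamma> - \<mu> * a\<^sub>0) * Y t - \<mu> * integral {0..t} (conv b' y)"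
      unfolding Y_def using yi[of t] ci[of t]
      by (simp add: Henstock_Kurzweil_Integration.integral_diff integrable_on_mult_right)
    finally have "\<mu> * integral {0..t} (conv b' y) = (\<gamma> - \<mu> * a\<^sub>0) * Y t - y t + 1" by simp
    moreover have "\<mu> * conv (tail b') y t = \<mu> * (J * Y t) - \<mu> * integral {0..t} (conv b' y)"
      using conv_tail[OF b1 yc t] by (simp add: J_def Y_def right_diff_distrib)
    ultimately show ?thesis by (simp add: L_def algebra_simps)
  qed
  define h where "h s = \<mu> * (b' s - \<gamma> * tail b' s)" for s
  have hi: "set_integrable lborel {0<..} h"
    unfolding h_def using b1 bt1 by (intro set_integrable_mult_right set_integral_diff) auto
  have hC: "(LINT s:{0<..}|lborel. h s * cos (\<omega> * s)) = \<mu> * (LINT s:{0<..}|lborel. (b' s - \<gamma> * tail b' s) * cos (\<omega> * s))" for \<omega>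
    unfolding h_def by (simp add: mult.assoc)
  have P: "integral {0..\<tau>} (\<lambda>t. y t * (0 * y t + conv h y t)) \<ge> 0"
  proof (rule positive_type_integral[OF hi _ yc \<tau>])
    show "AE \<omega> in lborel. 0 \<le> 0 + (LINT s:{0<..}|lborel. h s * cos (\<omega> * s))"
      using C by eventually_elim (simp add: hC b'_def[abs_def] \<mu>)
  qed
  have hconv: "conv h y t = \<mu> * conv b' y t - \<gamma> * (L * Y t + y t - 1)" if "t \<ge> 0" for t
  proof -
    have "conv h y t = \<mu> * (conv b' y t - \<gamma> * conv (tail b') y t)"
      unfolding h_def conv_mult_kernel using b1 bt1 yc
      by (subst conv_diff_kernel) (auto simp: conv_mult_kernel)
    then show ?thesis unfolding tl[OF that, symmetric] by (simp add: algebra_simps)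
  qed
  have Yc: "continuous_on {0..\<tau>} Y"
    unfolding Y_def by (rule indefinite_integral_continuous_1[OF yi])
  have YI: "((\<lambda>t. y t * (\<gamma> * (L * Y t - 1))) has_integral \<gamma> * (L * (Y \<tau>)\<^sup>2 / 2 - Y \<tau>) - \<gamma> * (L * (Y 0)\<^sup>2 / 2 - Y 0)) {0..\<tau>}"
  proof (rule fundamental_theorem_of_calculus_interior[OF \<tau>])
    show "continuous_on {0..\<tau>} (\<lambda>t. \<gamma> * (L * (Y t)\<^sup>2 / 2 - Y t))" by (intro continuous_intros Yc) auto
    fix t assume t: "t \<in> {0<..<\<tau>}"
    have "(Y has_vector_derivative y t) (at t within {0..\<tau>})"
      unfolding Y_def by (rule integral_has_vector_derivative[OF yt]) (use t in auto)
    then have "(Y has_real_derivative y t) (at t)"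
      using t by (simp add: at_within_Icc_at has_real_derivative_iff_has_vector_derivative)
    then show "((\<lambda>t. \<gamma> * (L * (Y t)\<^sup>2 / 2 - Y t)) has_vector_derivative y t * (\<gamma> * (L * Y t - 1))) (at t)"
      unfolding has_real_derivative_iff_has_vector_derivative[symmetric]
      by (auto intro!: derivative_eq_intros simp: algebra_simps)
  qed
  have Y0: "Y 0 = 0" by (simp add: Y_def)
  \<comment> \<open>By \<open>hconv\<close> the dangerous 2 \<gamma> y^2 is absorbed into the form
    of h. What remains besides that form is a total derivative in Y and a term with the good
    sign.\<close>
  have pt: "2 * (y t * (\<gamma> * y t - \<mu> * (a\<^sub>0 * y t + conv b' y t)))
      = - 2 * (y t * (0 * y t + conv h y t)) - 2 * (y t * (\<gamma> * (L * Y t - 1))) - 2 * (\<mu> * a\<^sub>0 * (y t)\<^sup>2)" if "t \<ge> 0" for t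
    unfolding hconv[OF that] by (simp add: algebra_simps power2_eq_square)
  have hc: "continuous_on {0..\<tau>} (\<lambda>t. y t * (0 * y t + conv h y t))"
    by (intro continuous_intros yt continuous_on_subset[OF continuous_on_conv[OF hi yc]]) auto
  have "((\<lambda>t. - 2 * (y t * (0 * y t + conv h y t)) - 2 * (y t * (\<gamma> * (L * Y t - 1))) - 2 * (\<mu> * a\<^sub>0 * (y t)\<^sup>2))
     has_integral - 2 * integral {0..\<tau>} (\<lambda>t. y t * (0 * y t + conv h y t)) - 2 * (\<gamma> * (L * (Y \<tau>)\<^sup>2 / 2 - Y \<tau>))
       - 2 * (\<mu> * a\<^sub>0 * integral {0..\<tau>} (\<lambda>t. (y t)\<^sup>2))) {0..\<tau>}"
    using YI unfolding Y0
    by (intro has_integral_diff has_integral_mult_right integrable_integral integrable_continuous_real hc continuous_intros yt) simp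
  moreover have "((\<lambda>t. - 2 * (y t * (0 * y t + conv h y t)) - 2 * (y t * (\<gamma> * (L * Y t - 1))) - 2 * (\<mu> * a\<^sub>0 * (y t)\<^sup>2))
     has_integral (y \<tau>)\<^sup>2 - 1) {0..\<tau>}"
    using E(5)[OF \<tau>] by (rule has_integral_eq[rotated]) (simp add: pt)
  ultimately have "(y \<tau>)\<^sup>2 - 1 = - 2 * integral {0..\<tau>} (\<lambda>t. y t * (0 * y t + conv h y t)) - 2 * (\<gamma> * (L * (Y \<tau>)\<^sup>2 / 2 - Y \<tau>))
       - 2 * (\<mu> * a\<^sub>0 * integral {0..\<tau>} (\<lambda>t. (y t)\<^sup>2))"
    by (rule has_integral_unique[rotated])
  moreover have "\<mu> * a\<^sub>0 * integral {0..\<tau>} (\<lambda>t. (y t)\<^sup>2) \<ge> 0"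
    using \<mu> a0 by (intro mult_nonneg_nonneg integral_nonneg integrable_continuous_real continuous_intros yt) auto
  \<comment> \<open>Since L \<ge> \<gamma>, the left side is at most 2 \<gamma> Y - (\<gamma> Y)^2 =
    1 - (\<gamma> Y - 1)^2. Hence y^2 \<le> 2, and the constant 2 in the lemma is a generous
    rounding of sqrt 2.\<close>
  moreover have "- 2 * (\<gamma> * (L * (Y \<tau>)\<^sup>2 / 2 - Y \<tau>)) \<le> 1"
  proof -
    have "\<gamma> * (\<gamma> * (Y \<tau>)\<^sup>2) \<le> \<gamma> * (L * (Y \<tau>)\<^sup>2)" using L \<gamma> by (intro mult_left_mono mult_right_mono) auto
    moreover have "0 \<le> (\<gamma> * Y \<tau> - 1)\<^sup>2" by simp
    ultimately show ?thesis by (simp add: power2_eq_square algebra_simps)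
  qed
  ultimately have "(y \<tau>)\<^sup>2 \<le> 2\<^sup>2" using P by simp
  then have "\<bar>y \<tau>\<bar> \<le> 2" using power2_le_imp_le[of "\<bar>y \<tau>\<bar>" 2] by simp
  then show ?thesis by (simp add: y_def abs_mult exp_minus field_simps)
qed

section \<open>Kernels with nonnegative cosine transform\<close>

text \<open>The real part of the Laplace transform at i \<omega>. With a weight exp(\<alpha> s)
  inside b it is the real part on the line Re z = - \<alpha>.\<close>

definition costrans :: "(real \<Rightarrow> real) \<Rightarrow> real \<Rightarrow> real" where
  "costrans b \<omega> = (LINT s:{0<..}|lborel. b s * cos (\<omega> * s))"

lemma costrans_minus [simp]: "costrans b (- \<omega>) = costrans b \<omega>"
  by (simp add: costrans_def)

lemma abs_costrans_le:
  "set_integrable lborel {0<..} b \<Longrightarrow> \<bar>costrans b \<omega>\<bar> \<le> (LINT s:{0<..}|lborel. \<bar>b s\<bar>)"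
  unfolding costrans_def using integral_set_integrable_mult_bounded(2)[of b "\<lambda>s. cos (\<omega> * s)" 1] by simp

lemma costrans_eq_Re_ft:
  assumes b: "set_integrable lborel {0<..} b"
  shows "costrans b \<omega> = Re (ft (\<lambda>s. of_real (indicator {0<..} s * b s)) \<omega>)"
proof -
  have "integrable lborel (\<lambda>s. complex_of_real (indicator {0<..} s * b s))"
    using conv_L1_kernel[OF b] by (rule integrable_of_real)
  then have "Re (ft (\<lambda>s. of_real (indicator {0<..} s * b s)) \<omega>)
     = (LINT s|lborel. Re (cis (- (s \<bullet> \<omega>)) * of_real (indicator {0<..} s * b s)))"
    unfolding ft_def by (intro integral_Re[symmetric] integrable_cis_mult)
  then show ?thesis
    by (simp add: costrans_def set_lebesgue_integral_def mult_ac)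
qed

lemma continuous_costrans:
  assumes b: "set_integrable lborel {0<..} b"
  shows "continuous_on UNIV (costrans b)"
  unfolding costrans_eq_Re_ft[OF b, abs_def]
  by (intro continuous_intros continuous_ft integrable_of_real conv_L1_kernel b)

section \<open>Damped cosines and sines, and the multipliers built from them\<close>

lemma
  fixes d x :: real
  assumes d: "d > 0"
  shows integrable_exp_half_line: "set_integrable lborel {0<..} (\<lambda>s. exp (- (d * s)))"
    and laplace_cos: "(LINT s:{0<..}|lborel. exp (- (d * s)) * cos (x * s)) = d / (d\<^sup>2 + x\<^sup>2)"
    and laplace_sin: "(LINT s:{0<..}|lborel. exp (- (d * s)) * sin (x * s)) = x / (d\<^sup>2 + x\<^sup>2)"
proof -
  show i: "set_integrable lborel {0<..} (\<lambda>s. exp (- (d * s)))"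
    using integrable_I0i_exp_mscale[OF d] by (simp add: mult.commute)
  have ein: "einterval 0 \<infinity> = {0<..}" by (auto simp: einterval_def)
  have D: "d\<^sup>2 + x\<^sup>2 > 0" using d by (simp add: add_pos_nonneg)
  have lim0: "((\<lambda>s. exp (- (d * s)) * g s) \<longlongrightarrow> 0) at_top" if g: "\<And>s. \<bar>g s\<bar> \<le> K" for g :: "real \<Rightarrow> real" and K
  proof (rule Lim_null_comparison)
    show "\<forall>\<^sub>F s in at_top. norm (exp (- (d * s)) * g s) \<le> exp (- (d * s)) * K"
      using g by (simp add: abs_mult)
    have "((\<lambda>s. exp (- (d * s))) \<longlongrightarrow> 0) at_top" using d by real_asymp
    from tendsto_mult_left_zero[OF this, of K] show "((\<lambda>s. exp (- (d * s)) * K) \<longlongrightarrow> 0) at_top" .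
  qed
  have sc: "\<bar>p * sin y + q * cos y\<bar> \<le> \<bar>p\<bar> + \<bar>q\<bar>" for p q y :: real
  proof -
    have "\<bar>p * sin y\<bar> \<le> \<bar>p\<bar>" "\<bar>q * cos y\<bar> \<le> \<bar>q\<bar>" by (simp_all add: abs_mult mult_left_le)
    then show ?thesis by linarith
  qed
  have *: "(LINT s:{0<..}|lborel. f s) = - F 0"
    if F: "\<And>s. (F has_real_derivative f s) (at s)" and f: "set_integrable lborel {0<..} f" and c: "\<And>s. isCont f s"
      and l: "(F \<longlongrightarrow> 0) at_top" for F f :: "real \<Rightarrow> real"
  proof -
    have "(LBINT s=0..\<infinity>. f s) = 0 - F 0"
    proof (rule interval_integral_FTC_integrable)
      show "((F \<circ> real_of_ereal) \<longlongrightarrow> F 0) (at_right 0)"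
        unfolding zero_ereal_def ereal_tendsto_simps1
        using DERIV_isCont[OF F, of 0] by (simp add: isCont_def filterlim_at_split)
      show "((F \<circ> real_of_ereal) \<longlongrightarrow> 0) (at_left \<infinity>)" unfolding ereal_tendsto_simps1 by (rule l)
    qed (use F f c in \<open>auto simp: ein has_real_derivative_iff_has_vector_derivative[symmetric]\<close>)
    then show ?thesis by (simp add: interval_lebesgue_integral_def ein)
  qed
  have si: "set_integrable lborel {0<..} (\<lambda>s. exp (- (d * s)) * cos (x * s))" "set_integrable lborel {0<..} (\<lambda>s. exp (- (d * s)) * sin (x * s))"
    by (rule integral_set_integrable_mult_bounded(1)[OF i, where B=1]; simp)+
  \<comment> \<open>Coefficients of the primitive exp(-d s) (p sin(x s) - r cos(x s)). The relations
    \<open>pr\<close> express that differentiation gives back the integrand, for the cosine as well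
    as for the sine.\<close>
  define p r where "p = x / (d\<^sup>2 + x\<^sup>2)" and "r = d / (d\<^sup>2 + x\<^sup>2)"
  have pr: "r * d + p * x = 1" "r * x = p * d"
    using D d by (auto simp: p_def r_def power2_eq_square simp flip: add_divide_distrib)
  have "(LINT s:{0<..}|lborel. exp (- (d * s)) * cos (x * s)) = - (exp (- (d * 0)) * (p * sin (x * 0) + (- r) * cos (x * 0)))"
  proof (rule *[OF _ si(1)])
    fix s
    have "exp (- (d * s)) * (- d) * (p * sin (x * s) + (- r) * cos (x * s))
      + exp (- (d * s)) * (p * (x * cos (x * s)) + (- r) * (- (x * sin (x * s))))
      = exp (- (d * s)) * (cos (x * s) * (r * d + p * x) + sin (x * s) * (r * x - p * d))"
      by (simp add: algebra_simps)
    then show "((\<lambda>s. exp (- (d * s)) * (p * sin (x * s) + (- r) * cos (x * s)))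
        has_real_derivative exp (- (d * s)) * cos (x * s)) (at s)"
      unfolding pr by (auto intro!: derivative_eq_intros simp: mult_ac)
  qed (auto intro!: continuous_intros lim0 sc[of p _ "- r", simplified])
  then show "(LINT s:{0<..}|lborel. exp (- (d * s)) * cos (x * s)) = d / (d\<^sup>2 + x\<^sup>2)" by (simp add: r_def)
  have "(LINT s:{0<..}|lborel. exp (- (d * s)) * sin (x * s)) = - (exp (- (d * 0)) * ((- r) * sin (x * 0) + (- p) * cos (x * 0)))"
  proof (rule *[OF _ si(2)])
    fix s
    have "exp (- (d * s)) * (- d) * ((- r) * sin (x * s) + (- p) * cos (x * s))
      + exp (- (d * s)) * ((- r) * (x * cos (x * s)) + (- p) * (- (x * sin (x * s))))
      = exp (- (d * s)) * (sin (x * s) * (r * d + p * x) - cos (x * s) * (r * x - p * d))"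
      by (simp add: algebra_simps)
    then show "((\<lambda>s. exp (- (d * s)) * ((- r) * sin (x * s) + (- p) * cos (x * s)))
        has_real_derivative exp (- (d * s)) * sin (x * s)) (at s)"
      unfolding pr by (auto intro!: derivative_eq_intros simp: mult_ac)
  qed (auto intro!: continuous_intros lim0 sc[of "- r" _ "- p", simplified])
  then show "(LINT s:{0<..}|lborel. exp (- (d * s)) * sin (x * s)) = x / (d\<^sup>2 + x\<^sup>2)" by (simp add: p_def)
qed

text \<open>An even function, so its transform is real. Integrating a kernel against it averages the
  cosine transform of the kernel with weight \<open>damped_ft\<close>. The choice q = - \<gamma> /
  \<omega> will encode the subtraction of \<gamma> times the tail, q = 0 plain damping.\<close>

definition damped :: "real \<Rightarrow> real \<Rightarrow> real \<Rightarrow> real \<Rightarrow> real" where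
  "damped d \<omega> q s = exp (- (d * \<bar>s\<bar>)) * (cos (\<omega> * s) + q * sin (\<omega> * \<bar>s\<bar>))"

lemma damped_bound: "\<bar>damped d \<omega> q s\<bar> \<le> (1 + \<bar>q\<bar>) * exp (- (d * \<bar>s\<bar>))"
proof -
  have "\<bar>cos (\<omega> * s) + q * sin (\<omega> * \<bar>s\<bar>)\<bar> \<le> \<bar>cos (\<omega> * s)\<bar> + \<bar>q * sin (\<omega> * \<bar>s\<bar>)\<bar>" by (rule abs_triangle_ineq)
  also have "\<dots> \<le> 1 + \<bar>q\<bar>" by (intro add_mono) (simp_all add: abs_mult mult_left_le)
  finally show ?thesis by (simp add: damped_def abs_mult)
qed

lemma continuous_damped: "continuous_on UNIV (damped d \<omega> q)"
  unfolding damped_def by (intro continuous_intros)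

lemma integrable_even:
  fixes h :: "real \<Rightarrow> 'b::{banach,second_countable_topology}"
  assumes even: "\<And>s. h (- s) = h s" and h: "set_integrable lborel {0<..} h"
  shows "integrable lborel h" "(LINT s|lborel. h s) = 2 *\<^sub>R (LINT s:{0<..}|lborel. h s)"
proof -
  have i1: "integrable lborel (\<lambda>s. indicator {0<..} s *\<^sub>R h s)" using h by (simp add: set_integrable_def)
  have i2: "integrable lborel (\<lambda>s. indicator {0<..} (- s) *\<^sub>R h s)"
    using integrable_lborel_reflect_iff[of "\<lambda>s. indicator {0<..} s *\<^sub>R h s" 0] i1 even by simp
  define k where "k s = indicator {0<..} s *\<^sub>R h s + indicator {0<..} (- s) *\<^sub>R h s" for s
  have k: "integrable lborel k" using i1 i2 unfolding k_def by simp
  then have [measurable]: "k \<in> borel_measurable borel" by auto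
  \<comment> \<open>The hypothesis controls h only off the origin; patching one value transfers
    measurability from k.\<close>
  have hk: "h = (\<lambda>s. if s = 0 then h 0 else k s)"
    by (auto simp: k_def indicator_def fun_eq_iff)
  have [measurable]: "h \<in> borel_measurable borel" by (subst hk) measurable
  have ae: "AE s in lborel. k s = h s"
    using AE_lborel_singleton[of 0] by eventually_elim (auto simp: k_def indicator_def)
  show "integrable lborel h" using k by (rule integrable_cong_AE_imp) (use ae in auto)
  have "(LINT s|lborel. h s) = (LINT s|lborel. k s)" by (rule integral_cong_AE) (use ae in auto)
  also have "\<dots> = (LINT s|lborel. indicator {0<..} s *\<^sub>R h s) + (LINT s|lborel. indicator {0<..} (- s) *\<^sub>R h s)"
    unfolding k_def using i1 i2 by simp
  also have "(LINT s|lborel. indicator {0<..} (- s) *\<^sub>R h s) = (LINT s|lborel. indicator {0<..} s *\<^sub>R h s)"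
    using integral_lborel_reflect[of "\<lambda>s. indicator {0<..} s *\<^sub>R h s" 0] even by simp
  finally show "(LINT s|lborel. h s) = 2 *\<^sub>R (LINT s:{0<..}|lborel. h s)"
    by (simp add: set_lebesgue_integral_def scaleR_2)
qed

definition damped_ft :: "real \<Rightarrow> real \<Rightarrow> real \<Rightarrow> real \<Rightarrow> real" where
  "damped_ft d \<omega> q \<eta> = (d + q * (\<omega> + \<eta>)) / (d\<^sup>2 + (\<omega> + \<eta>)\<^sup>2) + (d + q * (\<omega> - \<eta>)) / (d\<^sup>2 + (\<omega> - \<eta>)\<^sup>2)"

lemma
  assumes d: "d > 0"
  shows integrable_damped: "integrable lborel (\<lambda>s. complex_of_real (damped d \<omega> q s))"
    and ft_damped: "ft (\<lambda>s. complex_of_real (damped d \<omega> q s)) \<eta> = of_real (damped_ft d \<omega> q \<eta>)"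
proof -
  note i = integrable_exp_half_line[OF d]
  have gi: "set_integrable lborel {0<..} (\<lambda>s. exp (- (d * s)) * m s)" if "m \<in> borel_measurable borel" "\<And>s. \<bar>m s\<bar> \<le> B" for m B
    using that by (intro integral_set_integrable_mult_bounded(1)[OF i, where B=B]) auto
  have cs: "\<bar>cos (\<omega> * s) + q * sin (\<omega> * s)\<bar> \<le> 1 + \<bar>q\<bar>" for s
  proof -
    have "\<bar>cos (\<omega> * s)\<bar> \<le> 1" "\<bar>q * sin (\<omega> * s)\<bar> \<le> \<bar>q\<bar>" by (simp_all add: abs_mult mult_left_le)
    then show ?thesis by linarith
  qed
  have pos: "(\<lambda>s. indicator {0<..} s *\<^sub>R damped d \<omega> q s) = (\<lambda>s. indicator {0<..} s *\<^sub>R (exp (- (d * s)) * (cos (\<omega> * s) + q * sin (\<omega> * s))))"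
    by (auto simp: damped_def indicator_def fun_eq_iff)
  have I0: "set_integrable lborel {0<..} (damped d \<omega> q)"
    unfolding set_integrable_def pos using gi[OF _ cs] by (simp add: set_integrable_def)
  have ev: "damped d \<omega> q (- s) = damped d \<omega> q s" for s by (simp add: damped_def)
  have Ir: "integrable lborel (damped d \<omega> q)" by (rule integrable_even(1)[OF ev I0])
  then show I: "integrable lborel (\<lambda>s. complex_of_real (damped d \<omega> q s))" by (rule integrable_of_real)
  \<comment> \<open>Adding the reflected integrand cancels the odd sine part of
    \<open>cis\<close>.\<close>
  have "ft (\<lambda>s. complex_of_real (damped d \<omega> q s)) \<eta> = (LINT s|lborel. of_real (damped d \<omega> q s * cos (\<eta> * s)))"
  proof -
    let ?f = "\<lambda>s. cis (- (s \<bullet> \<eta>)) * complex_of_real (damped d \<omega> q s)"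
    have fi: "integrable lborel ?f" by (rule integrable_cis_mult[OF I])
    have fi': "integrable lborel (\<lambda>s. ?f (- s))"
      using integrable_lborel_reflect_iff[of ?f 0] fi by simp
    have "2 * ft (\<lambda>s. complex_of_real (damped d \<omega> q s)) \<eta> = (LINT s|lborel. ?f s) + (LINT s|lborel. ?f (- s))"
      using integral_lborel_reflect[of ?f 0] by (simp add: ft_def)
    also have "\<dots> = (LINT s|lborel. ?f s + ?f (- s))" using fi fi' by simp
    also have "\<dots> = (LINT s|lborel. 2 * of_real (damped d \<omega> q s * cos (\<eta> * s)))"
      by (intro Bochner_Integration.integral_cong refl) (simp add: ev complex_eq_iff mult.commute)
    finally show ?thesis by simp
  qed
  also have "\<dots> = of_real (LINT s|lborel. damped d \<omega> q s * cos (\<eta> * s))" by (rule integral_complex_of_real)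
  also have "(LINT s|lborel. damped d \<omega> q s * cos (\<eta> * s)) = 2 *\<^sub>R (LINT s:{0<..}|lborel. damped d \<omega> q s * cos (\<eta> * s))"
    using integral_set_integrable_mult_bounded(1)[OF I0, of "\<lambda>s. cos (\<eta> * s)" 1]
    by (intro integrable_even) (auto simp: ev)
  also have "(LINT s:{0<..}|lborel. damped d \<omega> q s * cos (\<eta> * s))
     = (LINT s:{0<..}|lborel. (1/2) * (((exp (- (d * s)) * cos ((\<omega> + \<eta>) * s) + exp (- (d * s)) * cos ((\<omega> - \<eta>) * s))
        + q * (exp (- (d * s)) * sin ((\<omega> + \<eta>) * s) + exp (- (d * s)) * sin ((\<omega> - \<eta>) * s)))))"
    unfolding set_lebesgue_integral_def
  proof (intro Bochner_Integration.integral_cong refl)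
    fix s
    have c: "cos ((\<omega> + \<eta>) * s) + cos ((\<omega> - \<eta>) * s) = 2 * (cos (\<omega> * s) * cos (\<eta> * s))"
      "sin ((\<omega> + \<eta>) * s) + sin ((\<omega> - \<eta>) * s) = 2 * (sin (\<omega> * s) * cos (\<eta> * s))"
      by (simp_all add: distrib_right left_diff_distrib cos_add cos_diff sin_add sin_diff)
    have "exp (- (d * s)) * (cos (\<omega> * s) + q * sin (\<omega> * s)) * cos (\<eta> * s) =
      (1/2) * (exp (- (d * s)) * (2 * (cos (\<omega> * s) * cos (\<eta> * s))) + q * (exp (- (d * s)) * (2 * (sin (\<omega> * s) * cos (\<eta> * s)))))"
      by (simp add: algebra_simps)
    then show "indicator {0<..} s *\<^sub>R (damped d \<omega> q s * cos (\<eta> * s)) = indicator {0<..} s *\<^sub>R ((1/2) * ((exp (- (d * s)) * cos ((\<omega> + \<eta>) * s) + exp (- (d * s)) * cos ((\<omega> - \<eta>) * s))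
        + q * (exp (- (d * s)) * sin ((\<omega> + \<eta>) * s) + exp (- (d * s)) * sin ((\<omega> - \<eta>) * s))))"
      unfolding c[symmetric] by (auto simp: damped_def indicator_def distrib_left)
  qed
  also have "\<dots> = (1/2) * ((d / (d\<^sup>2 + (\<omega> + \<eta>)\<^sup>2) + d / (d\<^sup>2 + (\<omega> - \<eta>)\<^sup>2))
     + q * ((\<omega> + \<eta>) / (d\<^sup>2 + (\<omega> + \<eta>)\<^sup>2) + (\<omega> - \<eta>) / (d\<^sup>2 + (\<omega> - \<eta>)\<^sup>2)))"
    using gi[of "\<lambda>s. cos (_ * s)" 1] gi[of "\<lambda>s. sin (_ * s)" 1]
    by (simp add: laplace_cos[OF d] laplace_sin[OF d] set_integral_add)
  also have "2 *\<^sub>R \<dots> = damped_ft d \<omega> q \<eta>"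
  proof -
    have "2 *\<^sub>R ((1/2) * Z) = Z" for Z :: real by simp
    then show ?thesis by (simp only:) (simp add: damped_ft_def add_divide_distrib distrib_left)
  qed
  finally show "ft (\<lambda>s. complex_of_real (damped d \<omega> q s)) \<eta> = of_real (damped_ft d \<omega> q \<eta>)" .
qed

text \<open>Over the common denominator the difference A - B = 4 \<omega> \<eta> cancels the
  1/\<omega> in q, and the numerator becomes (d - \<gamma>)(A + B) + 4 \<gamma> \<eta>^2. This is
  the point of the choice q = - \<gamma> / \<omega> and of the condition \<gamma> \<le> d.\<close>

lemma damped_ft_nonneg:
  assumes d: "d > 0" and g: "0 \<le> \<gamma>" "\<gamma> \<le> d" and w: "\<omega> \<noteq> 0"
  shows "damped_ft d \<omega> (- \<gamma> / \<omega>) \<eta> \<ge> 0"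
proof -
  define A where "A = d\<^sup>2 + (\<omega> + \<eta>)\<^sup>2"
  define B where "B = d\<^sup>2 + (\<omega> - \<eta>)\<^sup>2"
  have AB: "A > 0" "B > 0" using d by (auto simp: A_def B_def add_pos_nonneg)
  have "damped_ft d \<omega> (- \<gamma> / \<omega>) \<eta> = ((d - \<gamma>) - \<gamma> * \<eta> / \<omega>) / A + ((d - \<gamma>) + \<gamma> * \<eta> / \<omega>) / B"
    using w by (simp add: damped_ft_def A_def B_def field_simps)
  also have "\<dots> = ((d - \<gamma>) * (A + B) + \<gamma> * \<eta> / \<omega> * (A - B)) / (A * B)"
    using AB w by (simp add: field_simps)
  also have "A - B = 4 * \<omega> * \<eta>" by (simp add: A_def B_def power2_eq_square algebra_simps)
  also have "\<gamma> * \<eta> / \<omega> * (4 * \<omega> * \<eta>) = 4 * \<gamma> * \<eta>\<^sup>2" using w by (simp add: power2_eq_square)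
  finally show ?thesis using AB g by simp
qed

text \<open>Parseval's identity between b and \<open>damped\<close>. The Gaussian factor makes the
  frequency integral absolutely convergent without decay estimates for
  \<open>damped_ft\<close>.\<close>

lemma multiplier_tendsto:
  assumes b: "set_integrable lborel {0<..} b" and d: "d > 0"
    and e: "e \<longlonglongrightarrow> 0" "\<And>n. e n > (0::real)"
  shows "(\<lambda>n. LINT \<eta>|lborel. gs (e n) \<eta> * damped_ft d \<omega> q (- \<eta>) * costrans b \<eta>)
    \<longlonglongrightarrow> 2 * pi * (LINT s:{0<..}|lborel. b s * damped d \<omega> q s)"
proof -
  define b' where "b' s = complex_of_real (indicator {0<..} s * b s)" for s
  define g where "g s = complex_of_real (damped d \<omega> q s)" for s
  have b': "integrable lborel b'" unfolding b'_def using conv_L1_kernel[OF b] by (rule integrable_of_real)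
  have g: "integrable lborel g" unfolding g_def by (rule integrable_damped[OF d])
  note [measurable] = borel_measurable_integrable[OF b'] borel_measurable_integrable[OF g]
  have gB: "norm (g s) \<le> 1 + \<bar>q\<bar>" for s
  proof -
    have "\<bar>damped d \<omega> q s\<bar> \<le> (1 + \<bar>q\<bar>) * exp (- (d * \<bar>s\<bar>))" by (rule damped_bound)
    also have "\<dots> \<le> (1 + \<bar>q\<bar>) * 1" using d by (intro mult_left_mono) auto
    finally show ?thesis by (simp add: g_def)
  qed
  define h where "h n \<xi> = complex_of_real (gs (e n) \<xi>) * ft g (- \<xi>)" for n \<xi>
  have h: "integrable lborel (h n)" for n
  proof (rule Bochner_Integration.integrable_bound)
    show "integrable lborel (\<lambda>\<xi>. (LINT x|lborel. norm (g x)) *\<^sub>R complex_of_real (gs (e n) (\<xi>::real)))"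
      using e by (intro integrable_scaleR_right integrable_gs_complex)
    show "AE \<xi> in lborel. norm (h n \<xi>) \<le> norm ((LINT x|lborel. norm (g x)) *\<^sub>R complex_of_real (gs (e n) \<xi>))"
      by (auto simp: h_def norm_mult mult.commute intro!: mult_right_mono norm_ft_le order_trans[OF norm_ft_le])
    show "h n \<in> borel_measurable lborel" unfolding h_def by measurable
  qed
  have fth: "ft (h n) x = (LINT y|lborel. of_real (heat (e n) (x - y)) * g y)" for n x
    unfolding h_def by (rule ft_gs_ft[OF g e(2)])
  have lim: "(\<lambda>n. LINT x|lborel. b' x * ft (h n) x) \<longlonglongrightarrow> (LINT x|lborel. b' x * ((2 * pi) ^ DIM(real) * g x))"
  proof (rule integral_dominated_convergence[where w="\<lambda>x. ((2 * pi) ^ DIM(real) * (1 + \<bar>q\<bar>)) * norm (b' x)"])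
    show "integrable lborel (\<lambda>x. ((2 * pi) ^ DIM(real) * (1 + \<bar>q\<bar>)) * norm (b' x))"
      by (intro integrable_mult_right integrable_norm b')
    show "AE x in lborel. (\<lambda>n. b' x * ft (h n) x) \<longlonglongrightarrow> b' x * ((2 * pi) ^ DIM(real) * g x)"
    proof (intro AE_I2 tendsto_mult tendsto_const)
      fix x
      have "isCont g x" unfolding g_def using continuous_damped[of d \<omega> q]
        by (intro continuous_of_real) (auto simp: continuous_on_eq_continuous_at)
      then show "(\<lambda>n. ft (h n) x) \<longlonglongrightarrow> (2 * pi) ^ DIM(real) * g x"
        unfolding fth by (intro heat_conv_tendsto[where B="1 + \<bar>q\<bar>"] gB e) auto
    qed
    show "AE x in lborel. norm (b' x * ft (h n) x) \<le> ((2 * pi) ^ DIM(real) * (1 + \<bar>q\<bar>)) * norm (b' x)" for n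
      unfolding fth using norm_heat_conv_le[where \<phi>=g, OF gB e(2)[of n]]
      by (auto simp: norm_mult mult.commute[of "norm (b' _)"] intro!: mult_right_mono)
    show "(\<lambda>x. b' x * ft (h n) x) \<in> borel_measurable lborel" for n unfolding h_def by measurable
  qed measurable
  have eq: "Re (LINT x|lborel. b' x * ft (h n) x) = (LINT \<eta>|lborel. gs (e n) \<eta> * damped_ft d \<omega> q (- \<eta>) * costrans b \<eta>)" for n
  proof -
    have "integrable lborel (\<lambda>\<eta>. ft b' \<eta> * h n \<eta>)"
    proof (rule Bochner_Integration.integrable_bound)
      show "integrable lborel (\<lambda>\<eta>. (LINT x|lborel. norm (b' x)) *\<^sub>R h n \<eta>)" by (intro integrable_scaleR_right h)
      show "AE \<eta> in lborel. norm (ft b' \<eta> * h n \<eta>) \<le> norm ((LINT x|lborel. norm (b' x)) *\<^sub>R h n \<eta>)"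
        by (auto simp: norm_mult intro!: mult_right_mono norm_ft_le)
      show "(\<lambda>\<eta>. ft b' \<eta> * h n \<eta>) \<in> borel_measurable lborel" unfolding h_def by measurable
    qed
    moreover have "(LINT x|lborel. b' x * ft (h n) x) = (LINT \<eta>|lborel. ft b' \<eta> * h n \<eta>)"
      by (rule ft_swap[OF b' h, symmetric])
    ultimately have "Re (LINT x|lborel. b' x * ft (h n) x) = (LINT \<eta>|lborel. Re (ft b' \<eta> * h n \<eta>))"
      by (simp only: integral_Re)
    also have "\<dots> = (LINT \<eta>|lborel. gs (e n) \<eta> * damped_ft d \<omega> q (- \<eta>) * costrans b \<eta>)"
    proof (intro Bochner_Integration.integral_cong refl)
      fix \<eta>
      have "ft g (- \<eta>) = of_real (damped_ft d \<omega> q (- \<eta>))" unfolding g_def by (rule ft_damped[OF d])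
      then show "Re (ft b' \<eta> * h n \<eta>) = gs (e n) \<eta> * damped_ft d \<omega> q (- \<eta>) * costrans b \<eta>"
        by (simp add: h_def costrans_eq_Re_ft[OF b] b'_def[abs_def])
    qed
    finally show ?thesis .
  qed
  have "Re (LINT x|lborel. b' x * ((2 * pi) ^ DIM(real) * g x)) = 2 * pi * (LINT s:{0<..}|lborel. b s * damped d \<omega> q s)"
  proof -
    have "(LINT x|lborel. b' x * g x) = of_real (LINT s:{0<..}|lborel. b s * damped d \<omega> q s)"
      unfolding set_lebesgue_integral_def integral_complex_of_real[symmetric]
      by (intro Bochner_Integration.integral_cong) (auto simp: b'_def g_def)
    then show ?thesis unfolding integral_mult_middle by simp
  qed
  then show ?thesis using tendsto_Re[OF lim] by (simp add: eq)
qed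

lemma borel_measurable_damped_ft [measurable]: "damped_ft d \<omega> q \<in> borel_measurable borel"
  unfolding damped_ft_def by measurable

lemma integrable_gs_damped_ft:
  assumes b: "set_integrable lborel {0<..} b" and d: "d > 0" and e: "\<epsilon> > 0"
  shows "integrable lborel (\<lambda>\<eta>. gs \<epsilon> \<eta> * damped_ft d \<omega> q (- \<eta>) * costrans b \<eta>)"
proof -
  define K where "K = (LINT s|lborel. norm (complex_of_real (damped d \<omega> q s)))"
  define N where "N = (LINT s:{0<..}|lborel. \<bar>b s\<bar>)"
  have K: "\<bar>damped_ft d \<omega> q \<eta>\<bar> \<le> K" for \<eta>
    using norm_ft_le[of "\<lambda>s. complex_of_real (damped d \<omega> q s)" \<eta>] unfolding ft_damped[OF d] K_def by simp
  have [measurable]: "costrans b \<in> borel_measurable borel"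
    by (rule borel_measurable_continuous_onI[OF continuous_costrans[OF b]])
  show ?thesis
  proof (rule Bochner_Integration.integrable_bound)
    show "integrable lborel (\<lambda>\<eta>::real. gs \<epsilon> \<eta> * (K * N))" using e by (simp add: integrable_gs)
    have "\<bar>gs \<epsilon> \<eta> * damped_ft d \<omega> q (- \<eta>) * costrans b \<eta>\<bar> \<le> gs \<epsilon> \<eta> * (K * N)" for \<eta>
      unfolding abs_mult mult.assoc using K abs_costrans_le[OF b] 
      by (intro mult_mono) (auto simp: N_def intro: order_trans[OF abs_ge_zero])
    then show "AE \<eta> in lborel. norm (gs \<epsilon> \<eta> * damped_ft d \<omega> q (- \<eta>) * costrans b \<eta>) \<le> norm (gs \<epsilon> \<eta> * (K * N))"
      by (intro AE_I2, unfold real_norm_def) (rule order_trans[OF _ abs_ge_self])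
  qed measurable
qed

text \<open>All factors are nonnegative and \<open>gs \<epsilon>\<close> increases as \<epsilon>
  decreases, so the integral at \<epsilon> = 1 bounds the limit from below. Besides the sign this
  yields a positive quantity that can be compared for different d.\<close>

lemma multiplier_lower_bound:
  assumes b: "set_integrable lborel {0<..} b" and d: "d > 0"
    and C: "\<And>\<eta>. costrans b \<eta> \<ge> 0" and D: "\<And>\<eta>. damped_ft d \<omega> q \<eta> \<ge> 0"
  shows "(LINT \<eta>|lborel. gs 1 \<eta> * damped_ft d \<omega> q (- \<eta>) * costrans b \<eta>) \<le> 2 * pi * (LINT s:{0<..}|lborel. b s * damped d \<omega> q s)"
    and "(LINT s:{0<..}|lborel. b s * damped d \<omega> q s) \<ge> 0"
proof -
  define e :: "nat \<Rightarrow> real" where "e n = 1 / Suc n" for n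
  have e: "e \<longlonglongrightarrow> 0" "\<And>n. e n > 0" "\<And>n. e n \<le> 1"
    unfolding e_def using LIMSEQ_inverse_real_of_nat by (auto simp: inverse_eq_divide)
  have "(LINT \<eta>|lborel. gs 1 \<eta> * damped_ft d \<omega> q (- \<eta>) * costrans b \<eta>)
     \<le> (LINT \<eta>|lborel. gs (e n) \<eta> * damped_ft d \<omega> q (- \<eta>) * costrans b \<eta>)" for n
  proof (intro integral_mono integrable_gs_damped_ft b d e mult_right_mono C D)
    fix \<eta> :: real show "gs 1 \<eta> \<le> gs (e n) \<eta>"
      using e(3)[of n] mult_right_mono[of "e n" 1 "\<eta>\<^sup>2"] by (simp add: gs_def)
  qed simp
  then show *: "(LINT \<eta>|lborel. gs 1 \<eta> * damped_ft d \<omega> q (- \<eta>) * costrans b \<eta>) \<le> 2 * pi * (LINT s:{0<..}|lborel. b s * damped d \<omega> q s)"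
    by (intro LIMSEQ_le_const[OF multiplier_tendsto[OF b d e(1,2)]]) auto
  have "0 \<le> (LINT \<eta>|lborel. gs 1 \<eta> * damped_ft d \<omega> q (- \<eta>) * costrans b \<eta>)"
    using C D by (intro integral_nonneg_AE) auto
  with * have "0 \<le> 2 * pi * (LINT s:{0<..}|lborel. b s * damped d \<omega> q s)" by linarith
  then show "(LINT s:{0<..}|lborel. b s * damped d \<omega> q s) \<ge> 0" using pi_gt_zero by (auto simp: zero_le_mult_iff)
qed

section \<open>Cosine transforms of tails and strict lower bounds\<close>

lemma integral_Ioc_cos:
  fixes s \<omega> :: real
  assumes "\<omega> \<noteq> 0" "s > 0"
  shows "(LINT t:{0<..s}|lborel. cos (\<omega> * t)) = sin (\<omega> * s) / \<omega>"
proof -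
  have "(LINT t:{0<..s}|lborel. cos (\<omega> * t)) = (LINT t:{0..s}|lborel. cos (\<omega> * t))"
    unfolding set_lebesgue_integral_def
  proof (rule integral_cong_AE)
    show "AE t in lborel. indicator {0<..s} t *\<^sub>R cos (\<omega> * t) = indicator {0..s} t *\<^sub>R cos (\<omega> * t)"
      using AE_lborel_singleton[of 0]
    proof eventually_elim
      fix t :: real assume "t \<noteq> 0"
      then have "0 < t \<longleftrightarrow> 0 \<le> t" by linarith
      then show "indicator {0<..s} t *\<^sub>R cos (\<omega> * t) = indicator {0..s} t *\<^sub>R cos (\<omega> * t)"
        by (simp add: indicator_def)
    qed
  qed measurable
  also have "\<dots> = integral {0..s} (\<lambda>t. cos (\<omega> * t))"
    by (intro set_integral_Icc_eq_integral continuous_intros)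
  also have "\<dots> = sin (\<omega> * s) / \<omega> - sin (\<omega> * 0) / \<omega>"
  proof (rule integral_unique, rule fundamental_theorem_of_calculus)
    fix t
    show "((\<lambda>t. sin (\<omega> * t) / \<omega>) has_vector_derivative cos (\<omega> * t)) (at t within {0..s})"
      unfolding has_real_derivative_iff_has_vector_derivative[symmetric]
      using assms by (auto intro!: derivative_eq_intros)
  qed (use assms in simp)
  finally show ?thesis by simp
qed

text \<open>Writing exp(-d s) = exp(-d t) exp(-d (s - t)) for t \<le> s presents the tail as a
  bounded kernel applied to \<open>\<beta>\<close> and damped in t, so the general Fubini lemma
  applies. Exchanging the integrals leaves the integral of cos(\<omega> t) over (0,s], which is
  sin(\<omega> s)/\<omega>.\<close>

lemma
  assumes \<beta>: "set_integrable lborel {0<..} \<beta>" and d: "d > 0"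
  defines "b \<equiv> \<lambda>s. exp (- (d * s)) * \<beta> s"
  shows set_integrable_tail: "set_integrable lborel {0<..} (tail b)"
    and costrans_tail: "\<omega> \<noteq> 0 \<Longrightarrow> costrans (tail b) \<omega> = (LINT s:{0<..}|lborel. b s * (sin (\<omega> * s) / \<omega>))"
proof -
  define g where "g s = complex_of_real (indicator {0<..} s * \<beta> s)" for s
  define f where "f m t = complex_of_real (indicator {0<..} t * (exp (- (d * t)) * m t))" for m :: "real \<Rightarrow> real" and t
  define K where "K t s = complex_of_real (if 0 < t \<and> t \<le> s then exp (- (d * (s - t))) else 0)" for t s
  have g: "integrable lborel g" unfolding g_def using conv_L1_kernel[OF \<beta>] by (rule integrable_of_real)
  have f: "integrable lborel (f m)" if "m \<in> borel_measurable borel" "\<And>s. \<bar>m s\<bar> \<le> 1" for m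
    unfolding f_def
    using integral_set_integrable_mult_bounded(1)[OF integrable_exp_half_line[OF d] that(1)] that(2)
    by (intro integrable_of_real) (auto simp: set_integrable_def)
  have Km: "(\<lambda>p. K (fst p) (snd p)) \<in> borel_measurable (borel \<Otimes>\<^sub>M borel)"
    unfolding K_def by measurable
  have KB: "norm (K t s) \<le> 1" for t s using d by (auto simp: K_def)
  have pt: "f m t * (LINT s|lborel. K t s * g s) = of_real (indicator {0<..} t * (tail b t * m t))" for m t
  proof (cases "t > 0")
    case True
    have "f m t * (LINT s|lborel. K t s * g s) = (LINT s|lborel. of_real (m t * (indicator {t..} s * b s)))"
      unfolding integral_mult_right_zero[symmetric]
    proof (intro Bochner_Integration.integral_cong refl)
      fix s
      have "exp (- (d * t)) * exp (- (d * (s - t))) = exp (- (d * s))" by (simp add: algebra_simps flip: exp_add)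
      then show "f m t * (K t s * g s) = of_real (m t * (indicator {t..} s * b s))"
        unfolding f_def K_def g_def b_def of_real_mult[symmetric] of_real_eq_iff using True
        by (auto simp: indicator_def)
    qed
    also have "\<dots> = of_real (m t * tail b t)"
      unfolding integral_complex_of_real by (simp add: tail_def set_lebesgue_integral_def)
    finally show ?thesis using True by simp
  qed (simp add: f_def)
  have "integrable lborel (\<lambda>t. f (\<lambda>_. 1) t * (LINT s|lborel. K t s * g s))"
    by (rule integrable_kernel_left[OF f g Km KB]) auto
  then have "integrable lborel (\<lambda>t. indicator {0<..} t * (tail b t * 1))"
    unfolding pt complex_of_real_integrable_eq .
  then show "set_integrable lborel {0<..} (tail b)" by (simp add: set_integrable_def)
  assume w: "\<omega> \<noteq> 0"
  let ?m = "\<lambda>t. cos (\<omega> * t)"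
  have "(LINT t|lborel. f ?m t * (LINT s|lborel. K t s * g s)) = (LINT s|lborel. (LINT t|lborel. K t s * f ?m t) * g s)"
    by (rule Fubini_bounded_kernel[OF f g Km KB]) auto
  also have "(\<lambda>s. (LINT t|lborel. K t s * f ?m t) * g s) = (\<lambda>s. of_real (indicator {0<..} s * (b s * (sin (\<omega> * s) / \<omega>))))"
  proof
    fix s
    show "(LINT t|lborel. K t s * f ?m t) * g s = of_real (indicator {0<..} s * (b s * (sin (\<omega> * s) / \<omega>)))"
    proof (cases "s > 0")
      case True
      have "(LINT t|lborel. K t s * f ?m t) = (LINT t|lborel. of_real (exp (- (d * s)) * (indicator {0<..s} t * cos (\<omega> * t))))"
      proof (intro Bochner_Integration.integral_cong refl)
        fix t
        have "exp (- (d * (s - t))) * exp (- (d * t)) = exp (- (d * s))" by (simp add: algebra_simps flip: exp_add)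
        then show "K t s * f ?m t = of_real (exp (- (d * s)) * (indicator {0<..s} t * cos (\<omega> * t)))"
          unfolding f_def K_def of_real_mult[symmetric] of_real_eq_iff
          by (auto simp: indicator_def)
      qed
      also have "\<dots> = of_real (exp (- (d * s)) * (sin (\<omega> * s) / \<omega>))"
        unfolding integral_complex_of_real integral_Ioc_cos[OF w True, symmetric] by (simp add: set_lebesgue_integral_def)
      finally show ?thesis using True by (simp add: g_def b_def)
    qed (simp add: g_def)
  qed
  finally have "complex_of_real (costrans (tail b) \<omega>) = of_real (LINT s:{0<..}|lborel. b s * (sin (\<omega> * s) / \<omega>))"
    unfolding pt integral_complex_of_real by (simp add: costrans_def set_lebesgue_integral_def)
  then show "costrans (tail b) \<omega> = (LINT s:{0<..}|lborel. b s * (sin (\<omega> * s) / \<omega>))"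
    by (simp only: of_real_eq_iff)
qed

text \<open>Subtracting \<gamma> \<open>tail b\<close> replaces cos(\<omega> s) by cos(\<omega> s) -
  (\<gamma>/\<omega>) sin(\<omega> s). With the damping already in b this is \<open>\<beta>\<close>
  integrated against \<open>damped\<close> for q = - \<gamma> / \<omega>, whose transform is
  nonnegative. The frequency 0 is a null set for the positivity test that follows.\<close>

lemma costrans_minus_tail_nonneg:
  assumes \<beta>: "set_integrable lborel {0<..} \<beta>" and d: "d > 0"
    and C: "\<And>\<eta>. costrans \<beta> \<eta> \<ge> 0" and g: "0 \<le> \<gamma>" "\<gamma> \<le> d" and w: "\<omega> \<noteq> 0"
  defines "b \<equiv> \<lambda>s. exp (- (d * s)) * \<beta> s"
  shows "(LINT s:{0<..}|lborel. (b s - \<gamma> * tail b s) * cos (\<omega> * s)) \<ge> 0"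
proof -
  have "set_integrable lborel {0<..} (\<lambda>s. \<beta> s * (if s > 0 then exp (- (d * s)) else 0))"
    using d by (intro integral_set_integrable_mult_bounded(1)[OF \<beta>, where B=1]) auto
  moreover have "(\<lambda>s. indicator {0<..} s *\<^sub>R (\<beta> s * (if s > 0 then exp (- (d * s)) else 0))) = (\<lambda>s. indicator {0<..} s *\<^sub>R b s)"
    by (auto simp: b_def indicator_def fun_eq_iff)
  ultimately have b: "set_integrable lborel {0<..} b" by (simp add: set_integrable_def)
  have bt: "set_integrable lborel {0<..} (tail b)" unfolding b_def by (rule set_integrable_tail[OF \<beta> d])
  have bc: "set_integrable lborel {0<..} (\<lambda>s. b s * cos (\<omega> * s))"
    and tc: "set_integrable lborel {0<..} (\<lambda>s. tail b s * cos (\<omega> * s))"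
    and bs: "set_integrable lborel {0<..} (\<lambda>s. b s * sin (\<omega> * s))"
    by (rule integral_set_integrable_mult_bounded(1)[where B=1]; simp add: b bt)+
  have "(LINT s:{0<..}|lborel. (b s - \<gamma> * tail b s) * cos (\<omega> * s))
     = (LINT s:{0<..}|lborel. b s * cos (\<omega> * s) - \<gamma> * (tail b s * cos (\<omega> * s)))"
    by (simp add: left_diff_distrib mult.assoc)
  also have "\<dots> = (LINT s:{0<..}|lborel. b s * cos (\<omega> * s)) - \<gamma> * costrans (tail b) \<omega>"
    using bc tc by (subst set_integral_diff) (auto simp: costrans_def)
  also have "costrans (tail b) \<omega> = (LINT s:{0<..}|lborel. b s * (sin (\<omega> * s) / \<omega>))"
    unfolding b_def by (rule costrans_tail[OF \<beta> d w])
  also have "\<gamma> * \<dots> = (LINT s:{0<..}|lborel. (\<gamma> / \<omega>) * (b s * sin (\<omega> * s)))" by simp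
  also have "(LINT s:{0<..}|lborel. b s * cos (\<omega> * s)) - \<dots> = (LINT s:{0<..}|lborel. b s * cos (\<omega> * s) - (\<gamma> / \<omega>) * (b s * sin (\<omega> * s)))"
    using bc bs by (subst set_integral_diff) auto
  also have "\<dots> = (LINT s:{0<..}|lborel. \<beta> s * damped d \<omega> (- \<gamma> / \<omega>) s)"
    unfolding set_lebesgue_integral_def
    by (intro Bochner_Integration.integral_cong refl) (auto simp: damped_def b_def indicator_def algebra_simps)
  also have "\<dots> \<ge> 0"
    by (rule multiplier_lower_bound(2)[OF \<beta> d C damped_ft_nonneg[OF d g w]])
  finally show ?thesis .
qed

text \<open>For d between \<alpha>/2 and \<alpha> the weight 2 d / (d^2 + \<eta>^2) dominates
  \<alpha> / (\<alpha>^2 + \<eta>^2), so one integral, independent of d, bounds all these Laplace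
  transforms. It vanishes only if the nonnegative cosine transform vanishes almost
  everywhere.\<close>

lemma laplace_lower_bound:
  assumes \<beta>: "set_integrable lborel {0<..} \<beta>" and \<alpha>: "\<alpha> > 0"
    and C: "\<And>\<eta>. costrans \<beta> \<eta> \<ge> 0"
  obtains m where "m \<ge> 0" "\<And>d. \<alpha> / 2 \<le> d \<Longrightarrow> d \<le> \<alpha> \<Longrightarrow> m \<le> (LINT s:{0<..}|lborel. exp (- (d * s)) * \<beta> s)"
    "m = 0 \<Longrightarrow> AE \<eta> in lborel. costrans \<beta> \<eta> = 0"
proof -
  define I where "I = (LINT \<eta>|lborel. gs 1 \<eta> * (\<alpha> / (\<alpha>\<^sup>2 + \<eta>\<^sup>2)) * costrans \<beta> \<eta>)"
  have pos: "\<alpha>\<^sup>2 + \<eta>\<^sup>2 > 0" for \<eta> using \<alpha> by (simp add: add_pos_nonneg)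
  have D: "damped_ft d 0 0 \<eta> = 2 * (d / (d\<^sup>2 + \<eta>\<^sup>2))" for d \<eta> by (simp add: damped_ft_def)
  have Ii: "integrable lborel (\<lambda>\<eta>. gs 1 \<eta> * (\<alpha> / (\<alpha>\<^sup>2 + \<eta>\<^sup>2)) * costrans \<beta> \<eta>)"
    using integrable_mult_right[OF integrable_gs_damped_ft[OF \<beta> \<alpha>, of 1 0 0], of "1/2"] by (simp add: D mult_ac)
  have nn: "gs 1 \<eta> * (\<alpha> / (\<alpha>\<^sup>2 + \<eta>\<^sup>2)) * costrans \<beta> \<eta> \<ge> 0" for \<eta>
    using C \<alpha> by simp
  show ?thesis
  proof (rule that[of "I / (2 * pi)"])
    show "I / (2 * pi) \<ge> 0" unfolding I_def using nn by (intro divide_nonneg_nonneg integral_nonneg_AE) auto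
    show "AE \<eta> in lborel. costrans \<beta> \<eta> = 0" if "I / (2 * pi) = 0"
    proof -
      have "I = 0" using that by simp
      then have "AE \<eta> in lborel. gs 1 \<eta> * (\<alpha> / (\<alpha>\<^sup>2 + \<eta>\<^sup>2)) * costrans \<beta> \<eta> = 0"
        unfolding I_def using integral_nonneg_eq_0_iff_AE[OF Ii] nn by simp
      then show ?thesis
      proof eventually_elim
        fix \<eta> assume "gs 1 \<eta> * (\<alpha> / (\<alpha>\<^sup>2 + \<eta>\<^sup>2)) * costrans \<beta> \<eta> = 0"
        moreover have "gs 1 \<eta> \<noteq> 0" by (metis gs_pos(1) less_irrefl)
        moreover have "\<alpha> / (\<alpha>\<^sup>2 + \<eta>\<^sup>2) \<noteq> 0" using \<alpha> pos[of \<eta>] by simp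
        ultimately show "costrans \<beta> \<eta> = 0" by simp
      qed
    qed
    fix d assume d: "\<alpha> / 2 \<le> d" "d \<le> \<alpha>"
    then have d0: "d > 0" using \<alpha> by linarith
    have "I \<le> (LINT \<eta>|lborel. gs 1 \<eta> * damped_ft d 0 0 (- \<eta>) * costrans \<beta> \<eta>)"
      unfolding I_def
    proof (intro integral_mono Ii integrable_gs_damped_ft \<beta> d0 mult_right_mono mult_left_mono C)
      fix \<eta>
      have dp: "d\<^sup>2 + \<eta>\<^sup>2 > 0" using d0 by (simp add: add_pos_nonneg)
      have "\<alpha> * d * d \<le> 2 * d * \<alpha> * \<alpha>" using d d0 \<alpha> by (simp add: mult_mono)
      moreover have "\<alpha> * \<eta>\<^sup>2 \<le> 2 * d * \<eta>\<^sup>2" using d by (intro mult_right_mono) auto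
      ultimately have "\<alpha> * (d\<^sup>2 + \<eta>\<^sup>2) \<le> 2 * d * (\<alpha>\<^sup>2 + \<eta>\<^sup>2)" by (simp add: power2_eq_square algebra_simps)
      then show "\<alpha> / (\<alpha>\<^sup>2 + \<eta>\<^sup>2) \<le> damped_ft d 0 0 (- \<eta>)"
        unfolding D using pos[of \<eta>] dp by (simp add: divide_le_eq le_divide_eq)
    qed simp_all
    also have "\<dots> \<le> 2 * pi * (LINT s:{0<..}|lborel. \<beta> s * damped d 0 0 s)"
      using d0 by (intro multiplier_lower_bound \<beta> C) (auto simp: D add_nonneg_nonneg)
    also have "(LINT s:{0<..}|lborel. \<beta> s * damped d 0 0 s) = (LINT s:{0<..}|lborel. exp (- (d * s)) * \<beta> s)"
      unfolding set_lebesgue_integral_def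
      by (intro Bochner_Integration.integral_cong refl) (auto simp: damped_def indicator_def)
    finally show "I / (2 * pi) \<le> (LINT s:{0<..}|lborel. exp (- (d * s)) * \<beta> s)"
      by (simp add: divide_le_eq mult.commute)
  qed
qed

text \<open>A uniqueness theorem for the cosine transform. Damping transfers the vanishing from
  \<open>\<beta>\<close> to every frequency of \<open>a\<close>; then both \<open>a\<close> and its
  negative are of positive type, and testing with the constant 1 on all intervals determines the
  integrated kernel.\<close>

lemma integral_kernel_zero:
  assumes \<beta>: "set_integrable lborel {0<..} \<beta>" and \<alpha>: "\<alpha> > 0"
    and C: "AE \<eta> in lborel. costrans \<beta> \<eta> = 0"
    and a: "set_integrable lborel {0<..} a" and eq: "\<And>s. a s = exp (- (\<alpha> * s)) * \<beta> s" and t: "t > 0"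
  shows "(LINT s:{0<..<t}|lborel. a s) = 0"
proof -
  define e :: "nat \<Rightarrow> real" where "e n = 1 / Suc n" for n
  have e: "e \<longlonglongrightarrow> 0" "\<And>n. e n > 0"
    unfolding e_def using LIMSEQ_inverse_real_of_nat by (auto simp: inverse_eq_divide)
  have Ca: "costrans a \<omega> = 0" for \<omega>
  proof -
    have "(LINT \<eta>|lborel. gs (e n) \<eta> * damped_ft \<alpha> \<omega> 0 (- \<eta>) * costrans \<beta> \<eta>) = 0" for n
      by (rule integral_eq_zero_AE) (use C in eventually_elim, simp)
    then have "2 * pi * (LINT s:{0<..}|lborel. \<beta> s * damped \<alpha> \<omega> 0 s) = 0"
      using multiplier_tendsto[OF \<beta> \<alpha> e, of \<omega> 0] LIMSEQ_unique[OF tendsto_const] by force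
    moreover have "costrans a \<omega> = (LINT s:{0<..}|lborel. \<beta> s * damped \<alpha> \<omega> 0 s)"
      unfolding costrans_def set_lebesgue_integral_def
      by (intro Bochner_Integration.integral_cong refl) (auto simp: damped_def indicator_def eq)
    ultimately show ?thesis by simp
  qed
  have c1: "continuous_on {0..} (conv a (\<lambda>_. 1::real))" by (intro continuous_on_conv[OF a] continuous_intros)
  \<comment> \<open>The two inequalities from \<open>a\<close> and from its negative pinch the
    quadratic form at y = 1. Differentiating in \<tau> afterwards gives the kernel integral
    itself.\<close>
  have I0: "integral {0..\<tau>} (conv a (\<lambda>_. 1::real)) = 0" if "\<tau> \<ge> 0" for \<tau>
  proof -
    have "integral {0..\<tau>} (\<lambda>t. 1 * (0 * 1 + conv a (\<lambda>_. 1::real) t)) \<ge> 0"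
      by (rule positive_type_integral[where \<kappa>=0 and y="\<lambda>_. 1::real", OF a _ _ that]) (auto simp: Ca[unfolded costrans_def])
    moreover have na: "set_integrable lborel {0<..} (\<lambda>s. (-1) * a s)" using a by (rule set_integrable_mult_right)
    moreover have nC: "(LINT s:{0<..}|lborel. (-1) * a s * cos (\<omega> * s)) = 0" for \<omega>
      unfolding mult.assoc set_integral_mult_right using Ca[of \<omega>] by (simp add: costrans_def)
    ultimately have "integral {0..\<tau>} (\<lambda>t. 1 * (0 * 1 + conv a (\<lambda>_. 1::real) t)) \<ge> 0" by simp
    moreover have "integral {0..\<tau>} (\<lambda>t. 1 * (0 * 1 + conv (\<lambda>s. (-1) * a s) (\<lambda>_. 1::real) t)) \<ge> 0"
      by (rule positive_type_integral[where \<kappa>=0 and y="\<lambda>_. 1::real", OF na _ _ that]) (simp_all only: nC, auto)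
    ultimately show ?thesis unfolding conv_mult_kernel by simp
  qed
  have c1t: "continuous_on {0..t + 1} (conv a (\<lambda>_. 1::real))" using c1 by (rule continuous_on_subset) auto
  have "((\<lambda>\<tau>. integral {0..\<tau>} (conv a (\<lambda>_. 1::real))) has_vector_derivative conv a (\<lambda>_. 1::real) t) (at t within {0..t + 1})"
    by (rule integral_has_vector_derivative[OF c1t]) (use t in auto)
  then have "((\<lambda>\<tau>. integral {0..\<tau>} (conv a (\<lambda>_. 1::real))) has_vector_derivative conv a (\<lambda>_. 1::real) t) (at t)"
    using t by (simp add: at_within_Icc_at)
  moreover have "((\<lambda>\<tau>. integral {0..\<tau>} (conv a (\<lambda>_. 1::real))) has_vector_derivative 0) (at t)"
  proof (rule has_vector_derivative_transform_within_open[of "\<lambda>_. 0" _ _ "{0<..}"])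
    show "((\<lambda>_. 0::real) has_vector_derivative 0) (at t)" by simp
  qed (use t I0 in auto)
  ultimately have "conv a (\<lambda>_. 1::real) t = 0" by (rule vector_derivative_unique_at)
  moreover have "conv a (\<lambda>_. 1::real) t = (LINT s:{0<..<t}|lborel. a s)"
    unfolding conv_eq_UNIV set_lebesgue_integral_def
    by (intro Bochner_Integration.integral_cong refl) (auto simp: indicator_def)
  ultimately show ?thesis by simp
qed

section \<open>Decay of the scalar solutions\<close>

lemma norm_cis_diff_le: "norm (cis x - cis y) \<le> \<bar>x - y\<bar>"
proof -
  have "norm (cis x - cis y) = norm (cis (x - y) - 1)"
  proof -
    have "cis x - cis y = cis y * (cis (x - y) - 1)" by (simp add: right_diff_distrib cis_mult)
    then show ?thesis by (simp add: norm_mult)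
  qed
  also have "\<dots> = 2 * \<bar>sin ((x - y) / 2)\<bar>"
    using dist_exp_i_1[of "x - y"] by (simp add: cis_conv_exp mult.commute)
  also have "\<dots> \<le> \<bar>x - y\<bar>" using abs_sin_x_le_abs_x[of "(x - y) / 2"] by simp
  finally show ?thesis .
qed

text \<open>
  The transform of a square integrable function with a first moment is square integrable and
  Lipschitz continuous, hence it vanishes at infinity.
\<close>

lemma ft_tendsto_0:
  fixes f :: "real \<Rightarrow> complex"
  assumes f: "integrable lborel f" and f2: "integrable lborel (\<lambda>x. (norm (f x))\<^sup>2)"
    and f1: "integrable lborel (\<lambda>x. \<bar>x\<bar> * norm (f x))" and \<delta>: "\<delta> > 0"
  obtains W where "\<And>\<omega>. \<omega> \<ge> W \<Longrightarrow> norm (ft f \<omega>) < \<delta>"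
proof -
  define L where "L = (LINT x|lborel. \<bar>x\<bar> * norm (f x))"
  have L: "L \<ge> 0" unfolding L_def by (intro integral_nonneg_AE) auto
  have [measurable]: "f \<in> borel_measurable borel" using f by auto
  have lip: "norm (ft f x - ft f y) \<le> L * \<bar>x - y\<bar>" for x y
  proof -
    have "ft f x - ft f y = (LINT s|lborel. (cis (- (s \<bullet> x)) - cis (- (s \<bullet> y))) * f s)"
      unfolding ft_def using integrable_cis_mult[OF f] by (simp add: left_diff_distrib)
    also have "norm \<dots> \<le> (LINT s|lborel. norm ((cis (- (s \<bullet> x)) - cis (- (s \<bullet> y))) * f s))"
      by (rule integral_norm_bound)
    also have "\<dots> \<le> (LINT s|lborel. \<bar>x - y\<bar> * (\<bar>s\<bar> * norm (f s)))"
    proof (intro integral_mono' integrable_mult_right f1)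
      fix s :: real
      have "norm (cis (- (s \<bullet> x)) - cis (- (s \<bullet> y))) \<le> \<bar>- (s \<bullet> x) - - (s \<bullet> y)\<bar>" by (rule norm_cis_diff_le)
      also have "\<dots> = \<bar>x - y\<bar> * \<bar>s\<bar>"
      proof -
        have "- (s \<bullet> x) - - (s \<bullet> y) = - ((x - y) * s)" by (simp add: algebra_simps)
        then show ?thesis by (simp only: abs_minus_cancel abs_mult)
      qed
      finally show "norm ((cis (- (s \<bullet> x)) - cis (- (s \<bullet> y))) * f s) \<le> \<bar>x - y\<bar> * (\<bar>s\<bar> * norm (f s))"
        unfolding norm_mult mult.assoc[symmetric] by (rule mult_right_mono) simp
    qed simp
    finally show ?thesis by (simp add: L_def mult.commute)
  qed
  \<comment> \<open>Where the transform reaches \<delta> it stays above \<delta>/2 on an interval of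
    this length, by the Lipschitz bound. Such an interval carries at least l0 (\<delta>/2)^2 of the
    square integral, too much beyond W. The 1 guards against L = 0.\<close>
  define l0 where "l0 = \<delta> / (2 * (L + 1))"
  have l: "l0 > 0" "L * l0 \<le> \<delta> / 2"
  proof -
    show lp: "l0 > 0" using L \<delta> by (simp add: l0_def)
    have "L * l0 \<le> (L + 1) * l0" using lp by (intro mult_right_mono) auto
    also have "\<dots> = \<delta> / 2"
    proof -
      have "x * (c / (2 * x)) = c / 2" if "x \<noteq> 0" for x c :: real using that by simp
      from this[of "L + 1" \<delta>] show ?thesis using L by (simp add: l0_def)
    qed
    finally show "L * l0 \<le> \<delta> / 2" .
  qed
  note F2 = Bessel_ft(1)[OF f f2]
  have "((\<lambda>W. LINT \<eta>|lborel. indicator {W..} \<eta> * (norm (ft f \<eta>))\<^sup>2) \<longlongrightarrow> (LINT \<eta>::real|lborel. 0)) at_top"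
  proof (rule integral_dominated_convergence_at_top[where w="\<lambda>\<eta>. (norm (ft f \<eta>))\<^sup>2"])
    show "AE \<eta> in lborel. ((\<lambda>W. indicator {W..} \<eta> * (norm (ft f \<eta>))\<^sup>2) \<longlongrightarrow> 0) at_top"
    proof (intro AE_I2 tendsto_eventually)
      fix \<eta> :: real
      show "\<forall>\<^sub>F W in at_top. indicator {W..} \<eta> * (norm (ft f \<eta>))\<^sup>2 = 0"
        using eventually_gt_at_top[of \<eta>] by eventually_elim (simp add: indicator_def)
    qed
  qed (use F2 in \<open>auto simp: indicator_def\<close>)
  then have "\<forall>\<^sub>F W in at_top. (LINT \<eta>|lborel. indicator {W..} \<eta> * (norm (ft f \<eta>))\<^sup>2) < l0 * (\<delta> / 2)\<^sup>2"
    using l \<delta> by (intro order_tendstoD) auto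
  then obtain W where W: "(LINT \<eta>|lborel. indicator {W..} \<eta> * (norm (ft f \<eta>))\<^sup>2) < l0 * (\<delta> / 2)\<^sup>2"
    by (auto simp: eventually_at_top_linorder)
  show ?thesis
  proof (rule that[of W], rule ccontr)
    fix \<omega> assume \<omega>: "\<omega> \<ge> W" and "\<not> norm (ft f \<omega>) < \<delta>"
    then have big: "norm (ft f \<omega>) \<ge> \<delta>" by simp
    have lower: "norm (ft f \<eta>) \<ge> \<delta> / 2" if "\<eta> \<in> {\<omega>..\<omega> + l0}" for \<eta>
    proof -
      have "norm (ft f \<omega>) \<le> norm (ft f \<eta>) + norm (ft f \<omega> - ft f \<eta>)"
        using norm_triangle_ineq[of "ft f \<eta>" "ft f \<omega> - ft f \<eta>"] by simp
      moreover have "norm (ft f \<omega> - ft f \<eta>) \<le> L * \<bar>\<omega> - \<eta>\<bar>" by (rule lip)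
      moreover have "L * \<bar>\<omega> - \<eta>\<bar> \<le> L * l0" using that L by (intro mult_left_mono) auto
      ultimately show ?thesis using l big by linarith
    qed
    have "l0 * (\<delta> / 2)\<^sup>2 = (LINT \<eta>|lborel. (\<delta> / 2)\<^sup>2 * indicator {\<omega>..\<omega> + l0} \<eta>)"
      using l by simp
    also have "\<dots> \<le> (LINT \<eta>|lborel. indicator {W..} \<eta> * (norm (ft f \<eta>))\<^sup>2)"
    proof (rule integral_mono)
      show "integrable lborel (\<lambda>\<eta>. (\<delta> / 2)\<^sup>2 * indicator {\<omega>..\<omega> + l0} \<eta>)"
        by (intro integrable_mult_right integrable_real_indicator) (use l in auto)
      show "integrable lborel (\<lambda>\<eta>. indicator {W..} \<eta> * (norm (ft f \<eta>))\<^sup>2)"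
        by (rule Bochner_Integration.integrable_bound[OF F2]) (auto simp: indicator_def)
      fix \<eta>
      show "(\<delta> / 2)\<^sup>2 * indicator {\<omega>..\<omega> + l0} \<eta> \<le> indicator {W..} \<eta> * (norm (ft f \<eta>))\<^sup>2"
        using lower[of \<eta>] \<delta> \<omega> by (auto simp: indicator_def intro!: power_mono)
    qed
    finally show False using W by simp
  qed
qed

text \<open>Convexity of exp between 0 and \<alpha> s. The factor \<gamma>/\<alpha> makes the effect
  of a small weight proportional to \<gamma>, controlled by the moment of order \<alpha>.\<close>

lemma exp_minus_one_le:
  fixes \<gamma> \<alpha> s :: real
  assumes "0 \<le> \<gamma>" "\<gamma> \<le> \<alpha>" "\<alpha> > 0" "s \<ge> 0"
  shows "exp (\<gamma> * s) - 1 \<le> \<gamma> / \<alpha> * exp (\<alpha> * s)"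
proof -
  define \<theta> where "\<theta> = \<gamma> / \<alpha>"
  have th: "0 \<le> \<theta>" "\<theta> \<le> 1" "\<theta> * \<alpha> = \<gamma>" using assms by (auto simp: \<theta>_def)
  have "convex_on UNIV (exp :: real \<Rightarrow> real)" by (rule exp_convex)
  from convex_onD[OF this th(1,2), of 0 "\<alpha> * s"]
  have "exp (\<theta> * (\<alpha> * s)) \<le> (1 - \<theta>) * 1 + \<theta> * exp (\<alpha> * s)" by simp
  also have "\<theta> * (\<alpha> * s) = \<gamma> * s" using th by (simp flip: mult.assoc)
  finally show ?thesis using th by (simp add: \<theta>_def[symmetric])
qed

section \<open>Decay under the two positivity assumptions\<close>

lemma exp_weight_zero:
  assumes "set_integrable lborel {0<..} (\<lambda>s. exp (\<alpha> * s) * a s)" "\<alpha> > 0"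
  shows "set_integrable lborel {0<..} (a :: real \<Rightarrow> real)"
  using set_integrable_exp_weight[OF assms(1), of 0] assms(2) by simp

text \<open>Near 0 the kernel is small in L1, and away from 0 it is bounded with exponential decay,
  so \<open>ft_tendsto_0\<close> applies to that part. Each piece costs at most a quarter of
  \<open>a\<^sub>0\<close> at high frequency; on the remaining compact range continuity yields a
  positive minimum, and evenness handles negative frequencies.\<close>

lemma costrans_coercive:
  assumes E: "set_integrable lborel {0<..} (\<lambda>s. exp (\<alpha> * s) * a s)" and \<alpha>: "\<alpha> > 0"
    and bd: "\<And>\<epsilon>. \<epsilon> > 0 \<Longrightarrow> bounded (a ` {\<epsilon>..})" and a0: "a\<^sub>0 > 0"
    and pos: "\<And>\<omega>. a\<^sub>0 + costrans a \<omega> > 0"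
  obtains \<delta> where "\<delta> > 0" "\<And>\<omega>. a\<^sub>0 + costrans a \<omega> \<ge> \<delta>"
proof -
  have a: "set_integrable lborel {0<..} a" by (rule exp_weight_zero[OF E \<alpha>])
  define a' where "a' s = indicator {0<..} s * a s" for s
  have a'i: "integrable lborel a'" unfolding a'_def by (rule conv_L1_kernel[OF a])
  then have [measurable]: "a' \<in> borel_measurable borel" by auto
  have "((\<lambda>n. LINT s|lborel. \<bar>a' s\<bar> * indicator {..<1 / Suc n} s)) \<longlonglongrightarrow> (LINT s::real|lborel. 0)"
  proof (rule integral_dominated_convergence[where w="\<lambda>s. \<bar>a' s\<bar>"])
    show "AE s in lborel. (\<lambda>n. \<bar>a' s\<bar> * indicator {..<1 / Suc n} s) \<longlonglongrightarrow> 0"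
    proof (intro AE_I2 tendsto_eventually)
      fix s :: real
      show "\<forall>\<^sub>F n in sequentially. \<bar>a' s\<bar> * indicator {..<1 / Suc n} s = 0"
      proof (cases "s > 0")
        case True
        then have "\<forall>\<^sub>F n in sequentially. 1 / Suc n < s" by real_asymp
        then show ?thesis by eventually_elim (simp add: indicator_def)
      qed (simp add: a'_def)
    qed
  qed (use a'i in \<open>auto simp: indicator_def\<close>)
  then have "\<forall>\<^sub>F n in sequentially. (LINT s|lborel. \<bar>a' s\<bar> * indicator {..<1 / Suc n} s) < a\<^sub>0 / 4"
    using a0 by (intro order_tendstoD) auto
  then obtain n where n: "(LINT s|lborel. \<bar>a' s\<bar> * indicator {..<1 / Suc n} s) < a\<^sub>0 / 4"
    by (auto simp: eventually_sequentially)
  define \<epsilon> :: real where "\<epsilon> = 1 / Suc n"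
  have \<epsilon>: "\<epsilon> > 0" by (simp add: \<epsilon>_def)
  define f where "f s = complex_of_real (indicator {\<epsilon>..} s * a' s)" for s
  have fr: "integrable lborel (\<lambda>s. indicator {\<epsilon>..} s * a' s)"
    by (rule Bochner_Integration.integrable_bound[OF a'i]) (auto simp: indicator_def)
  then have f: "integrable lborel f" unfolding f_def by (rule integrable_of_real)
  obtain B where B: "\<And>s. s \<ge> \<epsilon> \<Longrightarrow> \<bar>a s\<bar> \<le> B" using bd[OF \<epsilon>] by (auto simp: bounded_iff)
  have fB: "norm (f s) \<le> B * indicator {\<epsilon>..} s" for s
    using B[of s] \<epsilon> by (auto simp: f_def a'_def indicator_def)
  have f2: "integrable lborel (\<lambda>s. (norm (f s))\<^sup>2)"
  proof (rule Bochner_Integration.integrable_bound)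
    show "integrable lborel (\<lambda>s. B * norm (f s))" using f by simp
    have [measurable]: "f \<in> borel_measurable borel" using f by auto
    show "(\<lambda>s. (norm (f s))\<^sup>2) \<in> borel_measurable lborel" by measurable
    have "(norm (f s))\<^sup>2 \<le> B * norm (f s)" for s
      using fB[of s] by (cases "s \<ge> \<epsilon>") (auto simp: power2_eq_square indicator_def intro!: mult_right_mono)
    then show "AE s in lborel. norm ((norm (f s))\<^sup>2) \<le> norm (B * norm (f s))"
      by (intro AE_I2) (metis abs_ge_self abs_of_nonneg order_trans real_norm_def zero_le_power2)
  qed
  have f1: "integrable lborel (\<lambda>s. \<bar>s\<bar> * norm (f s))"
  proof (rule Bochner_Integration.integrable_bound)
    have [measurable]: "f \<in> borel_measurable borel" using f by auto
    show "(\<lambda>s. \<bar>s\<bar> * norm (f s)) \<in> borel_measurable lborel" by measurable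
    show "integrable lborel (\<lambda>s. (1/\<alpha>) * \<bar>indicator {0<..} s * (exp (\<alpha> * s) * a s)\<bar>)"
      using conv_L1_kernel[OF E] by (intro integrable_mult_right integrable_abs)
    show "AE s in lborel. norm (\<bar>s\<bar> * norm (f s)) \<le> norm ((1/\<alpha>) * \<bar>indicator {0<..} s * (exp (\<alpha> * s) * a s)\<bar>)"
    proof (rule AE_I2)
      fix s :: real
      have "\<alpha> * s \<le> exp (\<alpha> * s)" using exp_ge_add_one_self[of "\<alpha> * s"] by linarith
      then have "s \<le> exp (\<alpha> * s) / \<alpha>" using \<alpha> by (simp add: le_divide_eq mult.commute)
      then have "s * \<bar>a s\<bar> \<le> exp (\<alpha> * s) / \<alpha> * \<bar>a s\<bar>" by (rule mult_right_mono) simp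
      then show "norm (\<bar>s\<bar> * norm (f s)) \<le> norm ((1/\<alpha>) * \<bar>indicator {0<..} s * (exp (\<alpha> * s) * a s)\<bar>)"
        using \<alpha> \<epsilon> by (auto simp: f_def a'_def indicator_def abs_mult)
    qed
  qed
  obtain W where W: "\<And>\<omega>. \<omega> \<ge> W \<Longrightarrow> norm (ft f \<omega>) < a\<^sub>0 / 4"
    using ft_tendsto_0[OF f f2 f1, of "a\<^sub>0 / 4"] a0 by auto
  have large: "a\<^sub>0 + costrans a \<omega> \<ge> a\<^sub>0 / 2" if "\<omega> \<ge> W" for \<omega>
  proof -
    have ci: "integrable lborel (\<lambda>s. cis (- (s \<bullet> \<omega>)) * f s)" by (rule integrable_cis_mult[OF f])
    have c1: "integrable lborel (\<lambda>s. (indicator {..<\<epsilon>} s * a' s) * cos (\<omega> * s))"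
      by (rule Bochner_Integration.integrable_bound[OF a'i]) (auto simp: indicator_def abs_mult mult_left_le)
    have c2: "integrable lborel (\<lambda>s. (indicator {\<epsilon>..} s * a' s) * cos (\<omega> * s))"
      by (rule Bochner_Integration.integrable_bound[OF a'i]) (auto simp: indicator_def abs_mult mult_left_le)
    have "costrans a \<omega> = (LINT s|lborel. (indicator {..<\<epsilon>} s * a' s) * cos (\<omega> * s) + (indicator {\<epsilon>..} s * a' s) * cos (\<omega> * s))"
      unfolding costrans_def set_lebesgue_integral_def
      by (intro Bochner_Integration.integral_cong) (auto simp: a'_def indicator_def)
    also have "\<dots> = (LINT s|lborel. (indicator {..<\<epsilon>} s * a' s) * cos (\<omega> * s)) + (LINT s|lborel. (indicator {\<epsilon>..} s * a' s) * cos (\<omega> * s))"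
      using c1 c2 by simp
    also have "(LINT s|lborel. (indicator {\<epsilon>..} s * a' s) * cos (\<omega> * s)) = Re (ft f \<omega>)"
      unfolding ft_def integral_Re[OF ci, symmetric]
      by (intro Bochner_Integration.integral_cong) (auto simp: f_def mult_ac)
    finally have eq: "costrans a \<omega> = (LINT s|lborel. (indicator {..<\<epsilon>} s * a' s) * cos (\<omega> * s)) + Re (ft f \<omega>)" .
    have "\<bar>LINT s|lborel. (indicator {..<\<epsilon>} s * a' s) * cos (\<omega> * s)\<bar>
       \<le> (LINT s|lborel. \<bar>(indicator {..<\<epsilon>} s * a' s) * cos (\<omega> * s)\<bar>)"
      using integral_norm_bound[of lborel "\<lambda>s. (indicator {..<\<epsilon>} s * a' s) * cos (\<omega> * s)"] by simp
    also have "\<dots> \<le> (LINT s|lborel. \<bar>a' s\<bar> * indicator {..<\<epsilon>} s)"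
    proof (rule integral_mono)
      show "integrable lborel (\<lambda>s. \<bar>a' s\<bar> * indicator {..<\<epsilon>} s)"
        by (rule Bochner_Integration.integrable_bound[OF a'i]) (auto simp: indicator_def)
      show "integrable lborel (\<lambda>s. \<bar>(indicator {..<\<epsilon>} s * a' s) * cos (\<omega> * s)\<bar>)" by (rule integrable_abs[OF c1])
    qed (auto simp: indicator_def abs_mult mult_left_le)
    also have "\<dots> < a\<^sub>0 / 4" using n by (simp add: \<epsilon>_def)
    finally have "\<bar>LINT s|lborel. (indicator {..<\<epsilon>} s * a' s) * cos (\<omega> * s)\<bar> < a\<^sub>0 / 4" .
    moreover have "\<bar>Re (ft f \<omega>)\<bar> < a\<^sub>0 / 4" using W[OF that] abs_Re_le_cmod[of "ft f \<omega>"] by linarith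
    ultimately show ?thesis unfolding eq by linarith
  qed
  have "continuous_on {0..max W 0} (\<lambda>\<omega>. a\<^sub>0 + costrans a \<omega>)"
    by (intro continuous_intros continuous_on_subset[OF continuous_costrans[OF a]]) auto
  then have "\<exists>\<omega>0\<in>{0..max W 0}. \<forall>\<omega>\<in>{0..max W 0}. a\<^sub>0 + costrans a \<omega>0 \<le> a\<^sub>0 + costrans a \<omega>"
    by (intro continuous_attains_inf) auto
  then obtain \<omega>0 where \<omega>0: "\<And>\<omega>. \<omega> \<in> {0..max W 0} \<Longrightarrow> a\<^sub>0 + costrans a \<omega>0 \<le> a\<^sub>0 + costrans a \<omega>"
    by blast
  show ?thesis
  proof (rule that[of "min (a\<^sub>0 / 2) (a\<^sub>0 + costrans a \<omega>0)"])
    show "min (a\<^sub>0 / 2) (a\<^sub>0 + costrans a \<omega>0) > 0" using a0 pos by simp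
    fix \<omega>
    have "a\<^sub>0 + costrans a \<bar>\<omega>\<bar> \<ge> min (a\<^sub>0 / 2) (a\<^sub>0 + costrans a \<omega>0)"
      using \<omega>0[of "\<bar>\<omega>\<bar>"] large[of "\<bar>\<omega>\<bar>"] by (cases "\<bar>\<omega>\<bar> \<le> W") auto
    moreover have "costrans a \<bar>\<omega>\<bar> = costrans a \<omega>" by (cases "\<omega> \<ge> 0") auto
    ultimately show "a\<^sub>0 + costrans a \<omega> \<ge> min (a\<^sub>0 / 2) (a\<^sub>0 + costrans a \<omega>0)" by simp
  qed
qed

theorem volt_sol_decay_case1:
  assumes E: "set_integrable lborel {0<..} (\<lambda>s. exp (\<alpha> * s) * a s)" and \<alpha>: "\<alpha> > 0"
    and bd: "\<And>\<epsilon>. \<epsilon> > 0 \<Longrightarrow> bounded (a ` {\<epsilon>..})" and a0: "a\<^sub>0 > 0"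
    and pos: "\<And>\<omega>. a\<^sub>0 + costrans a \<omega> > 0"
  obtains \<kappa> where "\<kappa> > 0" "\<And>\<mu> t. \<mu> \<ge> 0 \<Longrightarrow> t \<ge> 0 \<Longrightarrow> \<bar>volt_sol a\<^sub>0 a \<mu> t\<bar> \<le> 2 * exp (- (\<kappa> * min 1 \<mu> * t))"
proof -
  have a: "set_integrable lborel {0<..} a" by (rule exp_weight_zero[OF E \<alpha>])
  obtain \<delta> where \<delta>: "\<delta> > 0" "\<And>\<omega>. a\<^sub>0 + costrans a \<omega> \<ge> \<delta>"
    using costrans_coercive[OF E \<alpha> bd a0 pos] by blast
  define N where "N = (LINT s:{0<..}|lborel. \<bar>exp (\<alpha> * s) * a s\<bar>)"
  have N: "N \<ge> 0" unfolding N_def set_lebesgue_integral_def by (intro integral_nonneg_AE) auto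
  \<comment> \<open>The weight changes the cosine transform by at most N \<gamma>/\<alpha>; this
    choice keeps the change below \<delta>/2. The 1 guards against N = 0.\<close>
  define \<gamma>0 where "\<gamma>0 = min \<alpha> (\<alpha> * \<delta> / (2 * (N + 1)))"
  have g0: "\<gamma>0 > 0" "\<gamma>0 \<le> \<alpha>" using \<alpha> \<delta> N by (auto simp: \<gamma>0_def)
  \<comment> \<open>The second entry gives \<gamma> \<le> \<mu> \<delta>/2, so the surviving half of
    the coercivity, multiplied by \<mu>, pays for the weight.\<close>
  define \<kappa> where "\<kappa> = min \<gamma>0 (\<delta> / 2)"
  have \<kappa>: "\<kappa> > 0" using g0 \<delta> by (simp add: \<kappa>_def)
  have dec: "\<bar>volt_sol a\<^sub>0 a \<mu> t\<bar> \<le> 2 * exp (- (\<kappa> * min 1 \<mu> * t))" if \<mu>: "\<mu> \<ge> 0" and t: "t \<ge> 0" for \<mu> t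
  proof -
    define \<gamma> where "\<gamma> = \<kappa> * min 1 \<mu>"
    have g: "0 \<le> \<gamma>" "\<gamma> \<le> \<gamma>0"
    proof -
      show "0 \<le> \<gamma>" using \<kappa> \<mu> by (simp add: \<gamma>_def)
      have "\<gamma> \<le> \<kappa> * 1" unfolding \<gamma>_def using \<kappa> by (intro mult_left_mono) auto
      then show "\<gamma> \<le> \<gamma>0" by (simp add: \<kappa>_def)
    qed
    have g\<mu>: "\<gamma> \<le> \<mu> * (\<delta> / 2)"
    proof -
      have "\<gamma> \<le> \<kappa> * \<mu>" unfolding \<gamma>_def using \<kappa> by (intro mult_left_mono) auto
      also have "\<dots> \<le> (\<delta> / 2) * \<mu>" using \<mu> by (intro mult_right_mono) (auto simp: \<kappa>_def)
      finally show ?thesis by (simp add: mult.commute)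
    qed
    have b: "set_integrable lborel {0<..} (\<lambda>s. exp (\<gamma> * s) * a s)"
      by (rule set_integrable_exp_weight[OF E]) (use g g0 in linarith)
    have close: "\<bar>costrans (\<lambda>s. exp (\<gamma> * s) * a s) \<omega> - costrans a \<omega>\<bar> \<le> \<delta> / 2" for \<omega>
    proof -
      have bc: "set_integrable lborel {0<..} (\<lambda>s. exp (\<gamma> * s) * a s * cos (\<omega> * s))" "set_integrable lborel {0<..} (\<lambda>s. a s * cos (\<omega> * s))"
        by (rule integral_set_integrable_mult_bounded(1)[where B=1]; simp add: a b)+
      have "costrans (\<lambda>s. exp (\<gamma> * s) * a s) \<omega> - costrans a \<omega> = (LINT s:{0<..}|lborel. exp (\<gamma> * s) * a s * cos (\<omega> * s) - a s * cos (\<omega> * s))"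
        unfolding costrans_def by (rule set_integral_diff(2)[symmetric]) (rule bc)+
      also have "\<dots> = (LINT s:{0<..}|lborel. (exp (\<alpha> * s) * a s) * (if s > 0 then exp (- (\<alpha> * s)) * (exp (\<gamma> * s) - 1) * cos (\<omega> * s) else 0))"
        unfolding set_lebesgue_integral_def
        by (intro Bochner_Integration.integral_cong refl) (auto simp: indicator_def exp_minus algebra_simps)
      also have "\<bar>\<dots>\<bar> \<le> N * (\<gamma> / \<alpha>)"
        unfolding N_def
      proof (rule integral_set_integrable_mult_bounded(2)[OF E])
        fix s :: real assume s: "s > 0"
        have "exp (- (\<alpha> * s)) * (exp (\<gamma> * s) - 1) \<le> exp (- (\<alpha> * s)) * (\<gamma> / \<alpha> * exp (\<alpha> * s))"
          using exp_minus_one_le[of \<gamma> \<alpha> s] g g0 \<alpha> s by (intro mult_left_mono) auto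
        also have "\<dots> = \<gamma> / \<alpha>" by (simp add: exp_minus)
        finally have 1: "exp (- (\<alpha> * s)) * (exp (\<gamma> * s) - 1) \<le> \<gamma> / \<alpha>" .
        have 2: "0 \<le> exp (- (\<alpha> * s)) * (exp (\<gamma> * s) - 1)" using g s by simp
        have "\<bar>exp (- (\<alpha> * s)) * (exp (\<gamma> * s) - 1) * cos (\<omega> * s)\<bar> = (exp (- (\<alpha> * s)) * (exp (\<gamma> * s) - 1)) * \<bar>cos (\<omega> * s)\<bar>"
          using 2 by (simp only: abs_mult[of _ "cos (\<omega> * s)"] abs_of_nonneg)
        also have "\<dots> \<le> exp (- (\<alpha> * s)) * (exp (\<gamma> * s) - 1)" using 2 by (intro mult_left_le) auto
        finally show "\<bar>if s > 0 then exp (- (\<alpha> * s)) * (exp (\<gamma> * s) - 1) * cos (\<omega> * s) else 0\<bar> \<le> \<gamma> / \<alpha>"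
          using 1 s by simp
      qed measurable
      also have "N * (\<gamma> / \<alpha>) \<le> (N + 1) * ((\<alpha> * \<delta> / (2 * (N + 1))) / \<alpha>)"
        using N g \<alpha> by (intro mult_mono divide_right_mono) (auto simp: \<gamma>0_def)
      also have "\<dots> = \<delta> / 2"
      proof -
        have "x * ((y * c / (2 * x)) / y) = c / 2" if "x \<noteq> 0" "y \<noteq> 0" for x y c :: real using that by simp
        from this[of "N + 1" \<alpha> \<delta>] show ?thesis using N \<alpha> by simp
      qed
      finally show ?thesis .
    qed
    have "\<bar>volt_sol a\<^sub>0 a \<mu> t\<bar> \<le> exp (- (\<gamma> * t))"
    proof (rule volt_sol_decay_coercive[OF a _ b _ t])
      fix \<omega>
      have "\<delta> / 2 \<le> a\<^sub>0 + costrans (\<lambda>s. exp (\<gamma> * s) * a s) \<omega>" using close[of \<omega>] \<delta>(2)[of \<omega>] by linarith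
      then have "\<mu> * (\<delta> / 2) \<le> \<mu> * (a\<^sub>0 + costrans (\<lambda>s. exp (\<gamma> * s) * a s) \<omega>)" using \<mu> by (rule mult_left_mono)
      then show "\<gamma> \<le> \<mu> * (a\<^sub>0 + (LINT s:{0<..}|lborel. exp (\<gamma> * s) * a s * cos (\<omega> * s)))"
        using g\<mu> unfolding costrans_def by linarith
    qed (use a0 in simp)
    \<comment> \<open>The spare factor 2 gives both cases the same bound.\<close>
    also have "\<dots> \<le> 2 * exp (- (\<gamma> * t))" by simp
    finally show ?thesis by (simp add: \<gamma>_def)
  qed
  show ?thesis by (rule that[OF \<kappa> dec])
qed

text \<open>With \<open>\<beta>\<close> the kernel on the critical line, the kernel weighted by
  exp(\<gamma> s) is \<open>\<beta>\<close> damped at rate d = \<alpha> - \<gamma>. Its positivity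
  survives the subtraction of the tail, and its mass is bounded below uniformly in \<gamma> \<le>
  \<alpha>/2.\<close>

theorem volt_sol_decay_case2:
  assumes E: "set_integrable lborel {0<..} (\<lambda>s. exp (\<alpha> * s) * a s)" and \<alpha>: "\<alpha> > 0" and a0: "a\<^sub>0 \<ge> 0"
    and C: "\<And>\<omega>. costrans (\<lambda>s. exp (\<alpha> * s) * a s) \<omega> \<ge> 0"
    and nd: "\<exists>t>0. integrated_kernel a\<^sub>0 a t \<noteq> 0"
  obtains \<kappa> where "\<kappa> > 0" "\<And>\<mu> t. \<mu> \<ge> 0 \<Longrightarrow> t \<ge> 0 \<Longrightarrow> \<bar>volt_sol a\<^sub>0 a \<mu> t\<bar> \<le> 2 * exp (- (\<kappa> * min 1 \<mu> * t))"
    "a\<^sub>0 + (LINT s:{0<..}|lborel. a s) > 0"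
proof -
  define \<beta> where "\<beta> s = exp (\<alpha> * s) * a s" for s
  have \<beta>: "set_integrable lborel {0<..} \<beta>" using E by (simp add: \<beta>_def[abs_def])
  have a: "set_integrable lborel {0<..} a" by (rule exp_weight_zero[OF E \<alpha>])
  have C': "costrans \<beta> \<eta> \<ge> 0" for \<eta> using C by (simp add: \<beta>_def[abs_def])
  have w: "exp (- (d * s)) * \<beta> s = exp ((\<alpha> - d) * s) * a s" for d s
    by (simp add: \<beta>_def left_diff_distrib exp_diff exp_minus field_simps)
  obtain m where m: "m \<ge> 0" "\<And>d. \<alpha> / 2 \<le> d \<Longrightarrow> d \<le> \<alpha> \<Longrightarrow> m \<le> (LINT s:{0<..}|lborel. exp (- (d * s)) * \<beta> s)"
    "m = 0 \<Longrightarrow> AE \<eta> in lborel. costrans \<beta> \<eta> = 0"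
    using laplace_lower_bound[OF \<beta> \<alpha> C'] by blast
  \<comment> \<open>If both terms vanished, the cosine transform of \<open>\<beta>\<close> would
    vanish almost everywhere, hence the integrated kernel on (0,\<infinity>), against
    nondegeneracy.\<close>
  have m': "a\<^sub>0 + m > 0"
  proof (rule ccontr)
    assume "\<not> a\<^sub>0 + m > 0"
    then have z: "a\<^sub>0 = 0" "m = 0" using a0 m(1) by auto
    have "(LINT s:{0<..<t}|lborel. a s) = 0" if "t > 0" for t
      by (rule integral_kernel_zero[OF \<beta> \<alpha> m(3)[OF z(2)] a _ that]) (simp add: w)
    then show False using nd z(1) by (auto simp: integrated_kernel_def)
  qed
  have low: "m \<le> (LINT s:{0<..}|lborel. exp (\<gamma> * s) * a s)" if "0 \<le> \<gamma>" "\<gamma> \<le> \<alpha> / 2" for \<gamma>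
    using m(2)[of "\<alpha> - \<gamma>"] that by (simp add: w)
  \<comment> \<open>The first entry gives \<gamma> \<le> \<alpha> - \<gamma>, the condition of the
    multiplier lemma; the second gives 2 \<gamma> \<le> \<mu> (\<open>a\<^sub>0\<close> + m), the
    condition for completing the square.\<close>
  define \<kappa> where "\<kappa> = min (\<alpha> / 2) ((a\<^sub>0 + m) / 2)"
  have \<kappa>: "\<kappa> > 0" using \<alpha> m' by (simp add: \<kappa>_def)
  have dec: "\<bar>volt_sol a\<^sub>0 a \<mu> t\<bar> \<le> 2 * exp (- (\<kappa> * min 1 \<mu> * t))" if \<mu>: "\<mu> \<ge> 0" and t: "t \<ge> 0" for \<mu> t
  proof -
    define \<gamma> where "\<gamma> = \<kappa> * min 1 \<mu>"
    define d where "d = \<alpha> - \<gamma>"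
    have g: "0 \<le> \<gamma>" "\<gamma> \<le> \<alpha> / 2"
    proof -
      show "0 \<le> \<gamma>" using \<kappa> \<mu> by (simp add: \<gamma>_def)
      have "\<gamma> \<le> \<kappa> * 1" unfolding \<gamma>_def using \<kappa> by (intro mult_left_mono) auto
      then show "\<gamma> \<le> \<alpha> / 2" by (simp add: \<kappa>_def)
    qed
    then have d: "d > 0" "\<gamma> \<le> d" using \<alpha> by (auto simp: d_def)
    have g\<mu>: "2 * \<gamma> \<le> \<mu> * (a\<^sub>0 + m)"
    proof -
      have "\<gamma> \<le> \<kappa> * \<mu>" unfolding \<gamma>_def using \<kappa> by (intro mult_left_mono) auto
      also have "\<dots> \<le> ((a\<^sub>0 + m) / 2) * \<mu>"
        using \<mu> by (intro mult_right_mono) (simp_all only: \<kappa>_def min.cobounded2)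
      finally show ?thesis by (simp only: mult.commute[of \<mu>])
    qed
    have beq: "(\<lambda>s. exp (\<gamma> * s) * a s) = (\<lambda>s. exp (- (d * s)) * \<beta> s)" by (simp add: w d_def)
    have b: "set_integrable lborel {0<..} (\<lambda>s. exp (\<gamma> * s) * a s)"
      by (rule set_integrable_exp_weight[OF E]) (use g \<alpha> in linarith)
    have "\<bar>volt_sol a\<^sub>0 a \<mu> t\<bar> \<le> 2 * exp (- (\<gamma> * t))"
    proof (rule volt_sol_decay_tail[OF a a0 b _ _ g(1) \<mu> t])
      show "set_integrable lborel {0<..} (tail (\<lambda>s. exp (\<gamma> * s) * a s))"
        unfolding beq by (rule set_integrable_tail[OF \<beta> d(1)])
      show "AE \<omega> in lborel. 0 \<le> (LINT s:{0<..}|lborel. (exp (\<gamma> * s) * a s - \<gamma> * tail (\<lambda>s. exp (\<gamma> * s) * a s) s) * cos (\<omega> * s))"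
        using AE_lborel_singleton[of 0]
      proof eventually_elim
        fix \<omega> :: real assume "\<omega> \<noteq> 0"
        from costrans_minus_tail_nonneg[OF \<beta> d(1) C' g(1) d(2) this]
        show "0 \<le> (LINT s:{0<..}|lborel. (exp (\<gamma> * s) * a s - \<gamma> * tail (\<lambda>s. exp (\<gamma> * s) * a s) s) * cos (\<omega> * s))"
          unfolding beq[symmetric] fun_cong[OF beq, symmetric] .
      qed
      have "\<mu> * (a\<^sub>0 + m) \<le> \<mu> * (a\<^sub>0 + (LINT s:{0<..}|lborel. exp (\<gamma> * s) * a s))"
        using low[OF g] \<mu> by (intro mult_left_mono) auto
      then show "2 * \<gamma> \<le> \<mu> * (a\<^sub>0 + (LINT s:{0<..}|lborel. exp (\<gamma> * s) * a s))" using g\<mu> by linarith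
    qed
    then show ?thesis by (simp add: \<gamma>_def)
  qed
  have J: "a\<^sub>0 + (LINT s:{0<..}|lborel. a s) > 0" using low[of 0] m' \<alpha> by simp
  show ?thesis by (rule that[of \<kappa>]) (fact \<kappa>, fact dec, fact J)
qed

text \<open>The memory term is replaced by its mass times z(x). As z' is of size \<mu>, the error is
  of order \<mu> plus an initial layer exp(-\<alpha> x). With the integrating factor exp(\<mu> J x)
  it enters multiplied by \<mu>; integration in time costs 1/(\<mu> J) for the first part and
  1/\<alpha> for the second, so a bound of order \<mu> holds uniformly in t.\<close>

lemma volt_sol_asymptotic:
  assumes E: "set_integrable lborel {0<..} (\<lambda>s. exp (\<alpha> * s) * a s)" and \<alpha>: "\<alpha> > 0" and a0: "a\<^sub>0 \<ge> 0"
    and z2: "\<And>\<mu> t. \<mu> \<ge> 0 \<Longrightarrow> t \<ge> 0 \<Longrightarrow> \<bar>volt_sol a\<^sub>0 a \<mu> t\<bar> \<le> 2"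
  defines "J \<equiv> a\<^sub>0 + (LINT s:{0<..}|lborel. a s)"
  assumes J: "J > 0"
  obtains C where "C \<ge> 0" "\<And>\<mu> t. \<mu> \<ge> 0 \<Longrightarrow> t \<ge> 0 \<Longrightarrow> \<bar>volt_sol a\<^sub>0 a \<mu> t - exp (- (\<mu> * J * t))\<bar> \<le> C * \<mu>"
proof -
  have a: "set_integrable lborel {0<..} a" by (rule exp_weight_zero[OF E \<alpha>])
  note V = a a0 refl
  define M where "M = a\<^sub>0 + (LINT s:{0<..}|lborel. \<bar>a s\<bar>)"
  have M: "M \<ge> 0" unfolding M_def by (rule M_nonneg[OF V])
  define N where "N = (LINT s:{0<..}|lborel. \<bar>exp (\<alpha> * s) * a s\<bar>)"
  have N: "N \<ge> 0" unfolding N_def set_lebesgue_integral_def by (intro integral_nonneg_AE) auto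
  define C1 where "C1 = 2 * N * M / \<alpha>"
  define C2 where "C2 = 2 * N"
  have C12: "C1 \<ge> 0" "C2 \<ge> 0" using N M \<alpha> by (auto simp: C1_def C2_def)
  have main: "\<bar>volt_sol a\<^sub>0 a \<mu> t - exp (- (\<mu> * J * t))\<bar> \<le> (C1 / J + C2 / \<alpha>) * \<mu>" if \<mu>: "\<mu> \<ge> 0" and t: "t \<ge> 0" for \<mu> t
  proof -
    define z where "z = volt_sol a\<^sub>0 a \<mu>"
    have zc: "continuous_on {0..} z" unfolding z_def by (rule continuous_volt_sol[OF V])
    have zB: "\<bar>z s\<bar> \<le> 2" if "s \<ge> 0" for s unfolding z_def using z2 \<mu> that by blast
    have zd: "(z has_real_derivative - \<mu> * volt a\<^sub>0 a z s) (at s)" if "s > 0" for s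
      unfolding z_def by (rule volt_sol_deriv[OF V that])
    have zd': "\<bar>- \<mu> * volt a\<^sub>0 a z s\<bar> \<le> 2 * \<mu> * M" if "s > 0" for s
      using mult_left_mono[OF norm_volt_le[OF V, of s z 2] \<mu>] zB that \<mu> by (simp add: abs_mult M_def mult_ac)
    have zlip: "\<bar>z (x - s) - z x\<bar> \<le> 2 * \<mu> * M * s" if s: "0 < s" "s < x" for s x
    proof -
      have "\<exists>l y. x - s < y \<and> y < x \<and> (z has_real_derivative l) (at y) \<and> z x - z (x - s) = (x - (x - s)) * l"
      proof (intro MVT continuous_on_subset[OF zc])
        fix y assume "x - s < y"
        then show "z differentiable (at y)" using zd[of y] s unfolding real_differentiable_def by auto
      qed (use s in auto)
      then obtain l y where y: "x - s < y" "(z has_real_derivative l) (at y)" "z x - z (x - s) = s * l" by auto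
      have "l = - \<mu> * volt a\<^sub>0 a z y" using DERIV_unique[OF y(2) zd] y(1) s by simp
      then have "\<bar>l\<bar> \<le> 2 * \<mu> * M" using zd'[of y] y(1) s by simp
      then have "\<bar>z x - z (x - s)\<bar> \<le> s * (2 * \<mu> * M)" unfolding y(3) using s by (simp add: abs_mult)
      then show ?thesis by (simp add: abs_minus_commute mult_ac)
    qed
    \<comment> \<open>For lags s < x the mean value theorem bounds the variation of z by 2 \<mu> M
      s. For s \<ge> x there is no history, and exp(\<alpha> (s - x)) \<ge> 1 produces the initial
      layer. The exponential moment of the kernel absorbs both.\<close>
    have err: "\<bar>(LINT s:{0<..}|lborel. a s) * z x - conv a z x\<bar> \<le> \<mu> * C1 + C2 * exp (- (\<alpha> * x))" if x: "x > 0" for x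
    proof -
      define k where "k s = indicator {0<..} (x - s) *\<^sub>R z (x - s)" for s
      have i1: "integrable lborel (\<lambda>s. (indicator {0<..} s * a s) * k s)"
      proof -
        have "integrable lborel (\<lambda>s. indicator {0<..<x} (x - s) *\<^sub>R (a (x - (x - s)) *\<^sub>R z (x - s)))"
          using integrable_lborel_reflect_iff[of "\<lambda>r. indicator {0<..<x} r *\<^sub>R (a (x - r) *\<^sub>R z r)" x] conv_integrable[OF a zc, of x]
          by simp
        also have "(\<lambda>s. indicator {0<..<x} (x - s) *\<^sub>R (a (x - (x - s)) *\<^sub>R z (x - s))) = (\<lambda>s. (indicator {0<..} s * a s) * k s)"
          by (auto simp: k_def indicator_def fun_eq_iff)
        finally show ?thesis .
      qed
      have i2: "integrable lborel (\<lambda>s. (indicator {0<..} s * a s) * z x)"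
        by (intro integrable_mult_left conv_L1_kernel[OF a])
      have "(LINT s:{0<..}|lborel. a s) * z x - conv a z x = (LINT s|lborel. (indicator {0<..} s * a s) * z x) - (LINT s|lborel. (indicator {0<..} s * a s) * k s)"
        unfolding conv_eq_UNIV k_def by (simp add: set_lebesgue_integral_def)
      also have "\<dots> = (LINT s|lborel. (indicator {0<..} s * a s) * z x - (indicator {0<..} s * a s) * k s)"
        using i1 i2 by simp
      finally have eq: "(LINT s:{0<..}|lborel. a s) * z x - conv a z x = \<dots>" .
      have "\<bar>(LINT s:{0<..}|lborel. a s) * z x - conv a z x\<bar> \<le> (LINT s|lborel. \<bar>(indicator {0<..} s * a s) * z x - (indicator {0<..} s * a s) * k s\<bar>)"
        unfolding eq using integral_norm_bound[of lborel "\<lambda>s. (indicator {0<..} s * a s) * z x - (indicator {0<..} s * a s) * k s"] by simp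
      also have "\<dots> \<le> (LINT s|lborel. \<bar>indicator {0<..} s * (exp (\<alpha> * s) * a s)\<bar> * (2 * \<mu> * M / \<alpha> + 2 * exp (- (\<alpha> * x))))"
      proof (rule integral_mono)
        show "integrable lborel (\<lambda>s. \<bar>(indicator {0<..} s * a s) * z x - (indicator {0<..} s * a s) * k s\<bar>)"
          using i1 i2 by (intro integrable_abs Bochner_Integration.integrable_diff)
        show "integrable lborel (\<lambda>s. \<bar>indicator {0<..} s * (exp (\<alpha> * s) * a s)\<bar> * (2 * \<mu> * M / \<alpha> + 2 * exp (- (\<alpha> * x))))"
          by (intro integrable_mult_left integrable_abs conv_L1_kernel[OF E])
        fix s :: real
        show "\<bar>(indicator {0<..} s * a s) * z x - (indicator {0<..} s * a s) * k s\<bar>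
          \<le> \<bar>indicator {0<..} s * (exp (\<alpha> * s) * a s)\<bar> * (2 * \<mu> * M / \<alpha> + 2 * exp (- (\<alpha> * x)))"
        proof (cases "s > 0")
          case True
          have "\<bar>z x - k s\<bar> \<le> exp (\<alpha> * s) * (2 * \<mu> * M / \<alpha> + 2 * exp (- (\<alpha> * x)))"
          proof (cases "s < x")
            case sx: True
            have "\<alpha> * s \<le> exp (\<alpha> * s)" using exp_ge_add_one_self[of "\<alpha> * s"] by linarith
            then have "s \<le> exp (\<alpha> * s) / \<alpha>" using \<alpha> by (simp add: le_divide_eq mult.commute)
            then have "2 * \<mu> * M * s \<le> 2 * \<mu> * M * (exp (\<alpha> * s) / \<alpha>)" using \<mu> M by (intro mult_left_mono) auto
            moreover have "\<bar>z x - k s\<bar> \<le> 2 * \<mu> * M * s" using zlip[OF True sx] sx by (simp add: k_def abs_minus_commute)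
            moreover have "0 \<le> exp (\<alpha> * s) * (2 * exp (- (\<alpha> * x)))" by simp
            moreover have "2 * \<mu> * M * (exp (\<alpha> * s) / \<alpha>) = exp (\<alpha> * s) * (2 * \<mu> * M / \<alpha>)" by simp
            ultimately show ?thesis unfolding distrib_left by linarith
          next
            case False
            have "\<bar>z x - k s\<bar> \<le> 2" using False zB[of x] x by (simp add: k_def)
            also have "2 \<le> 2 * exp (\<alpha> * (s - x))" using False \<alpha> by simp
            also have "\<dots> = exp (\<alpha> * s) * (2 * exp (- (\<alpha> * x)))" by (simp add: right_diff_distrib exp_diff exp_minus field_simps)
            also have "\<dots> \<le> exp (\<alpha> * s) * (2 * \<mu> * M / \<alpha> + 2 * exp (- (\<alpha> * x)))"
              using \<mu> M \<alpha> by (intro mult_left_mono) auto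
            finally show ?thesis .
          qed
          then have "\<bar>a s\<bar> * \<bar>z x - k s\<bar> \<le> \<bar>a s\<bar> * (exp (\<alpha> * s) * (2 * \<mu> * M / \<alpha> + 2 * exp (- (\<alpha> * x))))"
            by (intro mult_left_mono) auto
          then show ?thesis using True by (simp add: abs_mult mult_ac flip: right_diff_distrib)
        qed simp
      qed
      also have "\<dots> = N * (2 * \<mu> * M / \<alpha> + 2 * exp (- (\<alpha> * x)))"
        by (simp add: N_def set_lebesgue_integral_def abs_mult)
      also have "\<dots> = \<mu> * C1 + C2 * exp (- (\<alpha> * x))" by (simp add: C1_def C2_def algebra_simps)
      finally show ?thesis .
    qed
    define \<Phi> where "\<Phi> x = z x * exp (\<mu> * J * x) - 1" for x
    \<comment> \<open>An explicit function with derivative at least |\<Phi>'|: the term C1 / J is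
      the primitive of \<mu> C1 against the integrating factor, and the last factor is the primitive
      of the initial layer. Comparing derivatives replaces integrating the error bound.\<close>
    define \<Psi> where "\<Psi> x = \<mu> * exp (\<mu> * J * x) * (C1 / J + C2 / \<alpha> * (1 - exp (- (\<alpha> * x))))" for x
    have Pc: "continuous_on {0..t} \<Phi>" "continuous_on {0..t} \<Psi>"
      unfolding \<Phi>_def \<Psi>_def by (intro continuous_intros continuous_on_subset[OF zc]; auto)+
    have P0: "\<Phi> 0 = 0" "\<Psi> 0 \<ge> 0" using volt_sol_0[OF V, of \<mu>] \<mu> C12 J by (auto simp: \<Phi>_def \<Psi>_def z_def)
    define \<Phi>' where "\<Phi>' x = \<mu> * exp (\<mu> * J * x) * ((LINT s:{0<..}|lborel. a s) * z x - conv a z x)" for x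
    define \<Psi>' where "\<Psi>' x = \<mu> * exp (\<mu> * J * x) * (\<mu> * C1 + \<mu> * J * (C2 / \<alpha> * (1 - exp (- (\<alpha> * x)))) + C2 * exp (- (\<alpha> * x)))" for x
    have D\<Phi>: "(\<Phi> has_real_derivative \<Phi>' x) (at x)" if "x > 0" for x
    proof -
      have "(\<Phi> has_real_derivative (- \<mu> * volt a\<^sub>0 a z x) * exp (\<mu> * J * x) + z x * (exp (\<mu> * J * x) * (\<mu> * J)) - 0) (at x)"
        unfolding \<Phi>_def by (rule derivative_eq_intros zd[OF that] refl | simp)+
      also have "(- \<mu> * volt a\<^sub>0 a z x) * exp (\<mu> * J * x) + z x * (exp (\<mu> * J * x) * (\<mu> * J)) - 0 = \<Phi>' x"
        by (simp add: \<Phi>'_def volt_def J_def algebra_simps)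
      finally show ?thesis .
    qed
    have D\<Psi>: "(\<Psi> has_real_derivative \<Psi>' x) (at x)" for x
    proof -
      have "(\<Psi> has_real_derivative \<mu> * (exp (\<mu> * J * x) * (\<mu> * J)) * (C1 / J + C2 / \<alpha> * (1 - exp (- (\<alpha> * x))))
          + \<mu> * exp (\<mu> * J * x) * (C2 / \<alpha> * (exp (- (\<alpha> * x)) * \<alpha>))) (at x)"
        unfolding \<Psi>_def by (auto intro!: derivative_eq_intros)
      also have "\<mu> * (exp (\<mu> * J * x) * (\<mu> * J)) * (C1 / J + C2 / \<alpha> * (1 - exp (- (\<alpha> * x))))
          + \<mu> * exp (\<mu> * J * x) * (C2 / \<alpha> * (exp (- (\<alpha> * x)) * \<alpha>))
        = \<mu> * exp (\<mu> * J * x) * (\<mu> * (J * (C1 / J)) + \<mu> * J * (C2 / \<alpha> * (1 - exp (- (\<alpha> * x)))) + (C2 / \<alpha> * \<alpha>) * exp (- (\<alpha> * x)))"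
        by (simp only: distrib_left mult_ac)
      also have "\<dots> = \<Psi>' x" using J \<alpha> by (simp add: \<Psi>'_def)
      finally show ?thesis .
    qed
    have bd: "\<bar>\<Phi>' x\<bar> \<le> \<Psi>' x" if x: "x > 0" for x
    proof -
      have "\<bar>\<Phi>' x\<bar> \<le> \<mu> * exp (\<mu> * J * x) * (\<mu> * C1 + C2 * exp (- (\<alpha> * x)))"
        unfolding \<Phi>'_def abs_mult using err[OF x] \<mu> by (simp add: mult_left_mono)
      also have "\<dots> \<le> \<Psi>' x"
        unfolding \<Psi>'_def using \<mu> J C12 \<alpha> x by (intro mult_left_mono) auto
      finally show ?thesis .
    qed
    have "\<Psi> 0 - \<Phi> 0 \<le> \<Psi> t - \<Phi> t"
    proof (rule DERIV_nonneg_imp_increasing_open[OF t])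
      fix x assume "0 < x" "x < t"
      then show "\<exists>y. ((\<lambda>x. \<Psi> x - \<Phi> x) has_real_derivative y) (at x) \<and> 0 \<le> y"
        using bd[of x] by (intro exI[of _ "\<Psi>' x - \<Phi>' x"] conjI DERIV_diff D\<Phi> D\<Psi>) auto
    qed (intro continuous_intros Pc)
    moreover have "\<Psi> 0 + \<Phi> 0 \<le> \<Psi> t + \<Phi> t"
    proof (rule DERIV_nonneg_imp_increasing_open[OF t])
      fix x assume "0 < x" "x < t"
      then show "\<exists>y. ((\<lambda>x. \<Psi> x + \<Phi> x) has_real_derivative y) (at x) \<and> 0 \<le> y"
        using bd[of x] by (intro exI[of _ "\<Psi>' x + \<Phi>' x"] conjI DERIV_add D\<Phi> D\<Psi>) auto
    qed (intro continuous_intros Pc)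
    ultimately have le: "\<bar>\<Phi> t\<bar> \<le> \<Psi> t" using P0 by linarith
    have "z t - exp (- (\<mu> * J * t)) = exp (- (\<mu> * J * t)) * \<Phi> t"
      by (simp add: \<Phi>_def right_diff_distrib exp_minus field_simps)
    then have "\<bar>z t - exp (- (\<mu> * J * t))\<bar> \<le> exp (- (\<mu> * J * t)) * \<Psi> t"
      using le by (simp add: abs_mult)
    also have "\<dots> = \<mu> * (C1 / J + C2 / \<alpha> * (1 - exp (- (\<alpha> * t))))"
      by (simp add: \<Psi>_def exp_minus field_simps)
    also have "\<dots> \<le> \<mu> * (C1 / J + C2 / \<alpha> * 1)"
      using \<mu> C12 \<alpha> by (intro mult_left_mono add_left_mono) (auto simp: divide_nonneg_pos)
    finally show ?thesis by (simp add: z_def mult.commute)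
  qed
  have "C1 / J + C2 / \<alpha> \<ge> 0" using C12 J \<alpha> by simp
  then show ?thesis by (rule that[OF _ main])
qed

section \<open>Smooth functions\<close>

lemma dir_deriv_eq: "(f has_derivative f') (at p) \<Longrightarrow> dir_deriv v f p = f' v"
  unfolding dir_deriv_def using frechet_derivative_at by metis

lemma has_derivative_dir_deriv: "f differentiable (at p) \<Longrightarrow> (f has_derivative (\<lambda>v. dir_deriv v f p)) (at p)"
  unfolding dir_deriv_def by (simp add: frechet_derivative_works eta_contract_eq)

lemma cont_differentiable_mono: "cont_differentiable (Suc m) f \<Longrightarrow> cont_differentiable m f"
proof (induction m arbitrary: f)
  case 0
  then show ?case
    by (auto intro!: continuous_at_imp_continuous_on differentiable_imp_continuous_within)
qed simp

text \<open>Suits families such as \<open>flat_exp\<close> or transforms of functions with bounded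
  support, whose partial derivatives stay in the family: every order is reached by induction, with
  no formula for higher derivatives.\<close>

lemma cont_differentiable_coinduct:
  assumes "f \<in> S" and "\<And>g p. g \<in> S \<Longrightarrow> g differentiable (at p)"
    and "\<And>g b. g \<in> S \<Longrightarrow> b \<in> Basis \<Longrightarrow> dir_deriv b g \<in> S"
  shows "cont_differentiable m f"
  using assms(1)
proof (induction m arbitrary: f)
  case 0
  then show ?case
    by (auto intro!: continuous_at_imp_continuous_on differentiable_imp_continuous_within assms(2))
qed (auto intro: assms)

lemma dir_deriv_const [simp]: "dir_deriv v (\<lambda>_. c) = (\<lambda>_. 0)"
  by (rule ext) (simp add: dir_deriv_eq[OF has_derivative_const])

lemma cont_differentiable_const: "cont_differentiable m (\<lambda>_. c)"
proof (rule cont_differentiable_coinduct[where S="range (\<lambda>c _. c)"])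
  show "dir_deriv b g \<in> range (\<lambda>c _. c)" if g: "g \<in> range (\<lambda>c _. c)" for g b
  proof -
    from g obtain c where "g = (\<lambda>_. c)" by blast
    then show ?thesis by auto
  qed
qed auto

lemma cont_differentiable_bounded_linear:
  assumes "bounded_linear f"
  shows "cont_differentiable m f"
proof (rule cont_differentiable_coinduct[where S="insert f (range (\<lambda>c _. c))"])
  have d: "(f has_derivative f) (at p)" for p by (rule bounded_linear_imp_has_derivative[OF assms])
  fix g assume "g \<in> insert f (range (\<lambda>c _. c))"
  then consider "g = f" | c where "g = (\<lambda>_. c)" by blast
  note g = this
  show "g differentiable (at p)" for p
    using g by cases (use d in \<open>auto simp: differentiable_def intro: has_derivative_const\<close>)
  show "dir_deriv b g \<in> insert f (range (\<lambda>c _. c))" for b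
  proof (cases rule: g)
    case 1
    have "dir_deriv b f = (\<lambda>_. f b)" by (rule ext) (rule dir_deriv_eq[OF d])
    then show ?thesis using 1 by auto
  qed auto
qed simp

lemma dir_deriv_add:
  "f differentiable (at p) \<Longrightarrow> g differentiable (at p) \<Longrightarrow>
    dir_deriv v (\<lambda>p. f p + g p) p = dir_deriv v f p + dir_deriv v g p"
  by (rule dir_deriv_eq, rule has_derivative_add) (auto intro: has_derivative_dir_deriv)

lemma cont_differentiable_add:
  "cont_differentiable m f \<Longrightarrow> cont_differentiable m g \<Longrightarrow> cont_differentiable m (\<lambda>p. f p + g p)"
proof (induction m arbitrary: f g)
  case (Suc m)
  then have "dir_deriv b (\<lambda>p. f p + g p) = (\<lambda>p. dir_deriv b f p + dir_deriv b g p)" for b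
    by (auto simp: dir_deriv_add)
  with Suc show ?case by auto
qed (auto intro: continuous_intros)

lemma dir_deriv_scaleR:
  fixes f :: "'a::real_normed_vector \<Rightarrow> real"
  assumes "f differentiable (at p)" "g differentiable (at p)"
  shows "dir_deriv v (\<lambda>p. f p *\<^sub>R g p) p = f p *\<^sub>R dir_deriv v g p + dir_deriv v f p *\<^sub>R g p"
  by (rule dir_deriv_eq, rule has_derivative_scaleR) (auto intro: has_derivative_dir_deriv assms)

lemma cont_differentiable_scaleR:
  "cont_differentiable m f \<Longrightarrow> cont_differentiable m g \<Longrightarrow> cont_differentiable m (\<lambda>p. f p *\<^sub>R g p)"
proof (induction m arbitrary: f g)
  case (Suc m)
  then have "dir_deriv b (\<lambda>p. f p *\<^sub>R g p) = (\<lambda>p. f p *\<^sub>R dir_deriv b g p + dir_deriv b f p *\<^sub>R g p)" for b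
    by (auto simp: dir_deriv_scaleR)
  moreover have "cont_differentiable m f" "cont_differentiable m g"
    using Suc.prems by (auto intro: cont_differentiable_mono)
  ultimately show ?case using Suc by (auto intro!: cont_differentiable_add)
qed (auto intro: continuous_intros)

lemma dir_deriv_compose:
  fixes r :: "'a::real_normed_vector \<Rightarrow> real"
  assumes "r differentiable (at p)" "h differentiable (at (r p))"
  shows "dir_deriv v (\<lambda>p. h (r p)) p = dir_deriv v r p *\<^sub>R dir_deriv 1 h (r p)"
proof -
  note h = has_derivative_dir_deriv[OF assms(2)]
  have "dir_deriv v (\<lambda>p. h (r p)) p = dir_deriv (dir_deriv v r p) h (r p)"
    by (rule dir_deriv_eq, rule has_derivative_compose[OF has_derivative_dir_deriv[OF assms(1)] h])
  also have "\<dots> = dir_deriv (dir_deriv v r p *\<^sub>R 1) h (r p)" by simp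
  also have "\<dots> = dir_deriv v r p *\<^sub>R dir_deriv 1 h (r p)"
    by (rule linear_scale[OF has_derivative_linear[OF h]])
  finally show ?thesis .
qed

lemma cont_differentiable_compose:
  "cont_differentiable m h \<Longrightarrow> cont_differentiable m r \<Longrightarrow> cont_differentiable m (\<lambda>p. h (r p :: real))"
proof (induction m arbitrary: h)
  case 0
  then show ?case using continuous_on_compose2[of UNIV h UNIV r] by auto
next
  case (Suc m)
  then have "dir_deriv b (\<lambda>p. h (r p)) = (\<lambda>p. dir_deriv b r p *\<^sub>R dir_deriv 1 h (r p))" for b
    by (auto simp: dir_deriv_compose)
  moreover have "(\<lambda>p. h (r p)) differentiable (at p)" for p
  proof -
    have "((\<lambda>p. h (r p)) has_derivative (\<lambda>v. dir_deriv (dir_deriv v r p) h (r p))) (at p)"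
      by (rule has_derivative_compose[where f=r and g=h, OF has_derivative_dir_deriv has_derivative_dir_deriv])
         (use Suc.prems in auto)
    then show ?thesis by (auto simp: differentiable_def)
  qed
  moreover have "cont_differentiable m r" using Suc.prems(2) by (rule cont_differentiable_mono)
  ultimately show ?case using Suc by (auto intro!: cont_differentiable_scaleR)
qed

lemma dir_deriv_snd:
  assumes "g differentiable (at (snd p))"
  shows "dir_deriv v (\<lambda>p. g (snd p)) p = dir_deriv (snd v) g (snd p)"
  by (rule dir_deriv_eq, rule has_derivative_compose[where f=snd and g=g, OF _ has_derivative_dir_deriv[OF assms]])
     (rule bounded_linear_imp_has_derivative[OF bounded_linear_snd])

lemma cont_differentiable_snd:
  "cont_differentiable m g \<Longrightarrow> cont_differentiable m (\<lambda>p :: 'a::euclidean_space \<times> 'b::euclidean_space. g (snd p))"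
proof (induction m arbitrary: g)
  case 0
  then show ?case using continuous_on_compose2[of UNIV g UNIV snd] continuous_on_snd[OF continuous_on_id] by auto
next
  case (Suc m)
  then have eq: "dir_deriv b (\<lambda>p. g (snd p)) = (\<lambda>p :: 'a \<times> 'b. dir_deriv (snd b) g (snd p))" for b :: "'a \<times> 'b"
    by (auto simp: dir_deriv_snd)
  have "(\<lambda>p :: 'a \<times> 'b. g (snd p)) differentiable (at p)" for p
  proof -
    have "((\<lambda>p :: 'a \<times> 'b. g (snd p)) has_derivative (\<lambda>v. dir_deriv (snd v) g (snd p))) (at p)"
      by (rule has_derivative_compose[where f=snd and g=g, OF _ has_derivative_dir_deriv])
         (use Suc.prems in \<open>auto intro: bounded_linear_imp_has_derivative bounded_linear_snd\<close>)
    then show ?thesis by (auto simp: differentiable_def)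
  qed
  moreover have "cont_differentiable m (dir_deriv b (\<lambda>p. g (snd p)))" if "b \<in> Basis" for b :: "'a \<times> 'b"
  proof -
    have "dir_deriv 0 g = (\<lambda>_. 0)"
      using Suc.prems has_derivative_linear[OF has_derivative_dir_deriv] linear_0
      by (fastforce simp: fun_eq_iff)
    then show ?thesis
      unfolding eq using that Suc by (auto simp: Basis_prod_def cont_differentiable_const)
  qed
  ultimately show ?case by simp
qed

section \<open>Flat functions, bumps and smooth steps\<close>

lemma dir_deriv_real: "(f has_real_derivative D) (at x) \<Longrightarrow> dir_deriv v f x = v * D"
  by (rule dir_deriv_eq[where f'="\<lambda>v. v * D"]) (simp add: has_field_derivative_def mult_commute_abs)

text \<open>The polynomial factor closes the family under differentiation: in the variable y = 1/x,
  the derivative acts on the polynomial as p to y^2 (p - p').\<close>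

definition flat_exp :: "real poly \<Rightarrow> real \<Rightarrow> real" where
  "flat_exp p x = (if x > 0 then poly p (1 / x) * exp (- (1 / x)) else 0)"

lemma flat_tendsto_0: "((\<lambda>x. flat_exp p x) \<longlongrightarrow> 0) (at 0)"
proof -
  have poly: "((\<lambda>y. poly p y * exp (- y)) \<longlongrightarrow> 0) at_top"
  proof (induction p)
    case (pCons c p)
    have "((\<lambda>y. poly q y * exp (- y)) \<longlongrightarrow> 0) at_top" for q :: "real poly"
    proof -
      have "((\<lambda>y. \<Sum>i\<le>degree q. coeff q i * (y ^ i * exp (- y))) \<longlongrightarrow> (\<Sum>i\<le>degree q. coeff q i * 0)) at_top"
      proof (intro tendsto_sum tendsto_mult tendsto_const)
        fix i
        show "((\<lambda>y::real. y ^ i * exp (- y)) \<longlongrightarrow> 0) at_top"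
          using tendsto_power_div_exp_0[of i] by (simp add: exp_minus divide_inverse)
      qed
      then show ?thesis by (simp add: poly_altdef sum_distrib_right mult.assoc)
    qed
    then show ?case .
  qed simp
  have r: "((\<lambda>x. flat_exp p x) \<longlongrightarrow> 0) (at_right 0)"
  proof (rule Lim_transform_eventually)
    have "filterlim (\<lambda>x::real. 1 / x) at_top (at_right 0)"
      using filterlim_inverse_at_top_right by (simp add: inverse_eq_divide)
    from filterlim_compose[OF poly this]
    show "((\<lambda>x. poly p (1 / x) * exp (- (1 / x))) \<longlongrightarrow> 0) (at_right 0)" .
    show "\<forall>\<^sub>F x in at_right 0. poly p (1 / x) * exp (- (1 / x)) = flat_exp p x"
      by (auto simp: flat_exp_def eventually_at_filter)
  qed
  moreover have "((\<lambda>x. flat_exp p x) \<longlongrightarrow> 0) (at_left 0)"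
    by (rule tendsto_eventually) (auto simp: flat_exp_def eventually_at_filter)
  ultimately show ?thesis by (simp add: filterlim_at_split)
qed

lemma flat_has_derivative:
  "(flat_exp p has_real_derivative flat_exp ([:0, 0, 1:] * (p - pderiv p)) x) (at x)"
proof -
  consider "x > 0" | "x < 0" | "x = 0" by linarith
  then show ?thesis
  proof cases
    case 1
    have "((\<lambda>x. poly p (1 / x) * exp (- (1 / x))) has_real_derivative
       poly (pderiv p) (1 / x) * (- 1 / x\<^sup>2) * exp (- (1 / x)) + poly p (1 / x) * (exp (- (1 / x)) * (1 / x\<^sup>2))) (at x)"
      using 1 by (auto intro!: derivative_eq_intros DERIV_chain2[OF poly_DERIV] simp: power2_eq_square)
    also have "poly (pderiv p) (1 / x) * (- 1 / x\<^sup>2) * exp (- (1 / x)) + poly p (1 / x) * (exp (- (1 / x)) * (1 / x\<^sup>2))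
       = flat_exp ([:0, 0, 1:] * (p - pderiv p)) x"
      using 1 by (simp add: flat_exp_def power2_eq_square field_simps)
    finally show ?thesis
      by (rule DERIV_cong_ev[THEN iffD1, rotated -1])
         (use 1 eventually_nhds_in_open[OF open_greaterThan, of x 0] in \<open>auto elim!: eventually_mono simp: flat_exp_def\<close>)
  next
    case 2
    have "((\<lambda>_. 0::real) has_real_derivative 0) (at x)" by simp
    also have "0 = flat_exp ([:0, 0, 1:] * (p - pderiv p)) x" using 2 by (simp add: flat_exp_def)
    finally show ?thesis
      by (rule DERIV_cong_ev[THEN iffD1, rotated -1])
         (use 2 eventually_nhds_in_open[OF open_lessThan, of x 0] in \<open>auto elim!: eventually_mono simp: flat_exp_def\<close>)
  next
    case 3
    \<comment> \<open>Dividing by y multiplies the polynomial in 1/y by its variable, so the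
      difference quotient is again a flat function and tends to 0.\<close>
    have "((\<lambda>y. (flat_exp p y - flat_exp p 0) / (y - 0)) \<longlongrightarrow> 0) (at 0)"
    proof (rule Lim_transform_eventually[OF flat_tendsto_0[of "[:0, 1:] * p"]])
      show "\<forall>\<^sub>F y in at 0. flat_exp ([:0, 1:] * p) y = (flat_exp p y - flat_exp p 0) / (y - 0)"
        by (auto simp: flat_exp_def eventually_at_filter)
    qed
    then show ?thesis using 3 by (simp add: has_field_derivative_iff flat_exp_def)
  qed
qed

lemma cont_differentiable_flat: "cont_differentiable m (flat_exp p)"
proof (rule cont_differentiable_coinduct[where S="range flat_exp"])
  show "g differentiable (at p)" if "g \<in> range flat_exp" for g p
    using that flat_has_derivative by (auto simp: real_differentiable_def)
  show "dir_deriv b g \<in> range flat_exp" if "g \<in> range flat_exp" "b \<in> Basis" for g and b :: real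
  proof -
    have "dir_deriv 1 (flat_exp q) = flat_exp ([:0, 0, 1:] * (q - pderiv q))" for q
      by (rule ext) (simp only: dir_deriv_real[OF flat_has_derivative] mult_1)
    then show ?thesis using that by auto
  qed
qed simp

lemma bump_function_exists:
  obtains \<rho> :: "real \<Rightarrow> real" where "\<And>m. cont_differentiable m \<rho>" "\<And>x. \<rho> x \<ge> 0"
    "\<And>x. x \<le> 0 \<or> x \<ge> 1 \<Longrightarrow> \<rho> x = 0" "(\<rho> has_integral 1) {0..1}"
proof -
  define q where "q x = flat_exp 1 x * flat_exp 1 (1 - x)" for x
  have qs: "cont_differentiable m q" for m
  proof -
    have "cont_differentiable m (\<lambda>x::real. (-1) *\<^sub>R x)" by (intro cont_differentiable_bounded_linear bounded_linear_scaleR_right)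
    then have "cont_differentiable m (\<lambda>x::real. 1 + (-1) *\<^sub>R x)" by (intro cont_differentiable_add cont_differentiable_const)
    then have "cont_differentiable m (\<lambda>x. flat_exp 1 (1 + (-1) *\<^sub>R x))" by (rule cont_differentiable_compose[OF cont_differentiable_flat])
    then have "cont_differentiable m (\<lambda>x. flat_exp 1 x *\<^sub>R flat_exp 1 (1 + (-1) *\<^sub>R x))" by (rule cont_differentiable_scaleR[OF cont_differentiable_flat])
    then show ?thesis by (simp add: q_def[abs_def])
  qed
  have qc: "continuous_on UNIV q" using qs[of 0] by simp
  have q0: "q x \<ge> 0" for x by (simp add: q_def flat_exp_def)
  have qpos: "q (1/2) > 0" by (simp add: q_def flat_exp_def)
  define I where "I = integral {0..1} q"
  have qi: "q integrable_on {0..1}" by (intro integrable_continuous_real continuous_on_subset[OF qc]) simp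
  have "I \<noteq> 0"
    using integral_eq_0_iff[of 0 1 q] q0 qpos continuous_on_subset[OF qc, of "{0..1}"] by (force simp: I_def)
  moreover have "I \<ge> 0" unfolding I_def using q0 by (intro integral_nonneg qi) auto
  ultimately have I: "I > 0" by simp
  show ?thesis
  proof (rule that[of "\<lambda>x. (1 / I) *\<^sub>R q x"])
    show "cont_differentiable m (\<lambda>x. (1 / I) *\<^sub>R q x)" for m
      by (intro cont_differentiable_scaleR cont_differentiable_const qs)
    show "(1 / I) *\<^sub>R q x \<ge> 0" for x using I q0 by simp
    show "(1 / I) *\<^sub>R q x = 0" if "x \<le> 0 \<or> x \<ge> 1" for x using that by (auto simp: q_def flat_exp_def)
    have "((\<lambda>x. (1 / I) *\<^sub>R q x) has_integral (1 / I) *\<^sub>R I) {0..1}"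
      unfolding I_def by (intro has_integral_cmul integrable_integral qi)
    then show "((\<lambda>x. (1 / I) *\<^sub>R q x) has_integral 1) {0..1}" using I by simp
  qed
qed

text \<open>A step with its bump-shaped derivative of unit mass. Rescaled differences of steps
  approximate indicators of intervals, their derivatives differences of Dirac masses; composed with
  the squared norm, a step gives a radial cutoff.\<close>

definition smooth_step :: "(real \<Rightarrow> real) \<Rightarrow> (real \<Rightarrow> real) \<Rightarrow> bool" where
  "smooth_step \<sigma> \<rho> \<longleftrightarrow> (\<forall>m. cont_differentiable m \<sigma>) \<and> (\<forall>x. (\<sigma> has_real_derivative \<rho> x) (at x)) \<and>
    continuous_on UNIV \<rho> \<and> (\<forall>x. \<rho> x \<ge> 0) \<and> (\<forall>x. x \<le> 0 \<or> x \<ge> 1 \<longrightarrow> \<rho> x = 0) \<and> (LINT x|lborel. \<rho> x) = 1 \<and>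
    (\<forall>x\<le>0. \<sigma> x = 0) \<and> (\<forall>x\<ge>1. \<sigma> x = 1) \<and> (\<forall>x. 0 \<le> \<sigma> x) \<and> (\<forall>x. \<sigma> x \<le> 1)"

lemma smooth_stepD:
  assumes "smooth_step \<sigma> \<rho>"
  shows "\<And>m. cont_differentiable m \<sigma>" "\<And>x. (\<sigma> has_real_derivative \<rho> x) (at x)"
    "continuous_on UNIV \<rho>" "\<And>x. \<rho> x \<ge> 0" "\<And>x. x \<le> 0 \<or> x \<ge> 1 \<Longrightarrow> \<rho> x = 0" "(LINT x|lborel. \<rho> x) = 1"
    "\<And>x. x \<le> 0 \<Longrightarrow> \<sigma> x = 0" "\<And>x. x \<ge> 1 \<Longrightarrow> \<sigma> x = 1" "\<And>x. 0 \<le> \<sigma> x" "\<And>x. \<sigma> x \<le> 1"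
  using assms unfolding smooth_step_def by blast+

lemma smooth_step_exists: "\<exists>\<sigma> \<rho>. smooth_step \<sigma> \<rho>"
proof -
  obtain \<rho> :: "real \<Rightarrow> real" where \<rho>: "\<And>m. cont_differentiable m \<rho>" "\<And>x. \<rho> x \<ge> 0"
    "\<And>x. x \<le> 0 \<or> x \<ge> 1 \<Longrightarrow> \<rho> x = 0" "(\<rho> has_integral 1) {0..1}"
    by (rule bump_function_exists, rule that; blast)
  have c: "continuous_on UNIV \<rho>" using \<rho>(1)[of 0] by simp
  have "\<exists>F. \<forall>x::real. (-\<infinity> < ereal x \<longrightarrow> ereal x < \<infinity> \<longrightarrow> (F has_vector_derivative \<rho> x) (at x))"
    using einterval_antiderivative[of "-\<infinity>" \<infinity> \<rho>] c by (auto simp: continuous_on_eq_continuous_at)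
  then obtain F where F: "\<And>x. (F has_real_derivative \<rho> x) (at x)"
    by (auto simp: has_real_derivative_iff_has_vector_derivative)
  define \<sigma> where "\<sigma> x = F x - F 0" for x
  have d: "(\<sigma> has_real_derivative \<rho> x) (at x)" for x
    unfolding \<sigma>_def by (rule derivative_eq_intros F refl | simp)+
  have dd: "\<sigma> differentiable (at x)" "dir_deriv 1 \<sigma> = \<rho>" for x
    using d by (auto simp: real_differentiable_def dir_deriv_real[OF d])
  have sm: "cont_differentiable m \<sigma>" for m
    using dd \<rho>(1) by (cases m) (auto intro!: continuous_at_imp_continuous_on differentiable_imp_continuous_within)
  have mono: "\<sigma> x \<le> \<sigma> y" if "x \<le> y" for x y
    by (rule DERIV_nonneg_imp_nondecreasing[OF that]) (use d \<rho>(2) in blast)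
  have c0: "\<sigma> x = 0" if "x \<le> 0" for x
  proof -
    have "\<sigma> 0 \<le> \<sigma> x"
      by (rule DERIV_nonpos_imp_nonincreasing[OF that]) (use d \<rho>(3) in force)
    then show ?thesis using mono[OF that] by (simp add: \<sigma>_def)
  qed
  have "(\<rho> has_integral \<sigma> 1 - \<sigma> 0) {0..1}"
    by (rule fundamental_theorem_of_calculus)
       (auto simp flip: has_real_derivative_iff_has_vector_derivative intro: has_field_derivative_at_within d)
  then have s1: "\<sigma> 1 = 1" using has_integral_unique[OF \<rho>(4)] by (simp add: \<sigma>_def)
  have c1: "\<sigma> x = 1" if "x \<ge> 1" for x
  proof -
    have "\<sigma> x \<le> \<sigma> 1"
      by (rule DERIV_nonpos_imp_nonincreasing[OF that]) (use d \<rho>(3) in force)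
    then show ?thesis using mono[OF that] s1 by simp
  qed
  have "(LINT x|lborel. \<rho> x) = (LINT x:{0..1}|lborel. \<rho> x)"
    unfolding set_lebesgue_integral_def
  proof (intro Bochner_Integration.integral_cong refl)
    fix x show "\<rho> x = indicator {0..1} x *\<^sub>R \<rho> x" by (cases "x \<in> {0..1}") (auto simp: \<rho>(3))
  qed
  also have "\<dots> = integral {0..1} \<rho>" by (intro set_integral_Icc_eq_integral continuous_on_subset[OF c]) simp
  also have "\<dots> = 1" using \<rho>(4) by (rule integral_unique)
  finally have r1: "(LINT x|lborel. \<rho> x) = 1" .
  have "0 \<le> \<sigma> x" "\<sigma> x \<le> 1" for x
    using mono[of 0 x] c0[of x] c0[of 0] mono[of x 1] c1[of x] s1 by (cases "x \<le> 0"; cases "x \<ge> 1"; force)+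
  then show ?thesis unfolding smooth_step_def using sm d c \<rho>(2,3) r1 c0 c1 by blast
qed

text \<open>The lemma of du Bois-Reymond, with differences of smooth steps as test functions.\<close>

lemma weak_derivative_imp_integral:
  fixes G K :: "real \<Rightarrow> complex"
  assumes G: "continuous_on {0..} G" and K: "continuous_on {0..} K"
    and w: "\<And>\<theta> s T. (\<And>m. cont_differentiable m \<theta>) \<Longrightarrow> 0 < s \<Longrightarrow> (\<And>t. t \<notin> {s..T} \<Longrightarrow> \<theta> t = 0) \<Longrightarrow>
      - (LINT t:{0<..}|lborel. dir_deriv 1 \<theta> t *\<^sub>R G t) = (LINT t:{0<..}|lborel. (\<theta> t :: real) *\<^sub>R K t)"
    and t: "t \<ge> 0"
  shows "G t = G 0 + integral {0..t} K"
proof -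
  obtain \<sigma> \<rho> where "smooth_step \<sigma> \<rho>" using smooth_step_exists by blast
  note sg = smooth_stepD[OF this]
  have [measurable]: "\<rho> \<in> borel_measurable borel" using sg(3) by (rule borel_measurable_continuous_onI)
  have [measurable]: "\<sigma> \<in> borel_measurable borel"
    using sg(1)[of 0] by (intro borel_measurable_continuous_onI) simp
  have \<rho>i: "integrable lborel \<rho>"
    using sg(6) not_integrable_integral_eq[of lborel \<rho>] by (cases "integrable lborel \<rho>") simp_all
  have KT: "K integrable_on {0..T}" for T
    by (intro integrable_continuous_real continuous_on_subset[OF K]) auto
  have main: "G T - G s = integral {s..T} K" if s: "0 < s" "s < T" for s T
  proof -
    define Gc where "Gc = clamped (T + 1) G"
    define Kc where "Kc = clamped (T + 1) K"
    have T1: "0 \<le> T + 1" using s by simp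
    have Gt: "continuous_on {0..T + 1} G" and Kt: "continuous_on {0..T + 1} K"
      using G K by (auto intro: continuous_on_subset)
    have Gcc: "continuous_on UNIV Gc" and Kcc: "continuous_on UNIV Kc"
      unfolding Gc_def Kc_def by (intro continuous_clamped Gt Kt T1)+
    note [measurable] = borel_measurable_continuous_onI[OF Gcc] borel_measurable_continuous_onI[OF Kcc]
    obtain BG where BG: "\<And>r. norm (Gc r) \<le> BG" using bounded_clamped[OF Gt T1] unfolding Gc_def by blast
    obtain BK where BK: "BK \<ge> 0" "\<And>r. norm (Kc r) \<le> BK" using bounded_clamped[OF Kt T1] unfolding Kc_def by blast
    define e :: "nat \<Rightarrow> real" where "e n = 1 / Suc n" for n
    have e: "e \<longlonglongrightarrow> 0" "\<And>n. e n > 0" "\<And>n. e n \<le> 1"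
      unfolding e_def using LIMSEQ_inverse_real_of_nat by (auto simp: inverse_eq_divide)
    \<comment> \<open>Approximates the indicator of (s,T]. The steps rise to the right of s and T
      within length e n \<le> 1, so the support stays in [s,T + 1] and away from 0. Sums and scalar
      multiples are used so that the closure lemmas for smooth functions apply.\<close>
    define \<theta> where "\<theta> n r = \<sigma> ((1 / e n) *\<^sub>R r + (- s / e n)) + (-1) *\<^sub>R \<sigma> ((1 / e n) *\<^sub>R r + (- T / e n))" for n r
    have lin: "(1 / e n) *\<^sub>R r + (- x / e n) = (r - x) / e n" for n r x by (simp add: diff_divide_distrib)
    have \<theta>s: "cont_differentiable m (\<theta> n)" for m n
      unfolding \<theta>_def
      by (intro cont_differentiable_add cont_differentiable_scaleR cont_differentiable_const
          cont_differentiable_compose[OF sg(1)] cont_differentiable_bounded_linear bounded_linear_ident)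
    have \<theta>d: "dir_deriv 1 (\<theta> n) r = (1 / e n) * (\<rho> ((r - s) / e n) - \<rho> ((r - T) / e n))" for n r
    proof -
      have "(\<theta> n has_real_derivative \<rho> ((r - s) / e n) * (1 / e n) - \<rho> ((r - T) / e n) * (1 / e n)) (at r)"
        unfolding \<theta>_def lin using e(2)[of n]
        by (auto intro!: derivative_eq_intros DERIV_chain2[OF sg(2)])
      from dir_deriv_real[OF this, of 1] show ?thesis by (simp add: algebra_simps)
    qed
    have supp: "\<theta> n r = 0" if "r \<notin> {s..T + 1}" for n r
    proof (cases "r < s")
      case True
      then have "(r - s) / e n \<le> 0" "(r - T) / e n \<le> 0" using s e(2)[of n] by (auto simp: divide_le_0_iff)
      then show ?thesis unfolding \<theta>_def lin by (simp add: sg)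
    next
      case False
      then have "(r - s) / e n \<ge> 1" "(r - T) / e n \<ge> 1" using that s e(2,3)[of n] by (auto simp: le_divide_eq)
      then show ?thesis unfolding \<theta>_def lin by (simp add: sg)
    qed
    have suppd: "dir_deriv 1 (\<theta> n) r = 0" if "r \<notin> {0<..T + 1}" for n r
    proof (cases "r \<le> 0")
      case True
      then have "(r - s) / e n \<le> 0" "(r - T) / e n \<le> 0" using s e(2)[of n] by (auto simp: divide_le_0_iff)
      then show ?thesis unfolding \<theta>d by (simp add: sg)
    next
      case False
      then have "(r - s) / e n \<ge> 1" "(r - T) / e n \<ge> 1" using that s e(2,3)[of n] by (auto simp: le_divide_eq)
      then show ?thesis unfolding \<theta>d by (simp add: sg)
    qed
    have eqn: "- (LINT r|lborel. dir_deriv 1 (\<theta> n) r *\<^sub>R Gc r) = (LINT r|lborel. \<theta> n r *\<^sub>R Kc r)" for n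
    proof -
      have "(LINT r:{0<..}|lborel. dir_deriv 1 (\<theta> n) r *\<^sub>R G r) = (LINT r|lborel. dir_deriv 1 (\<theta> n) r *\<^sub>R Gc r)"
        unfolding set_lebesgue_integral_def Gc_def
      proof (intro Bochner_Integration.integral_cong refl)
        fix r
        show "indicator {0<..} r *\<^sub>R dir_deriv 1 (\<theta> n) r *\<^sub>R G r = dir_deriv 1 (\<theta> n) r *\<^sub>R clamped (T + 1) G r"
          by (cases "r \<in> {0<..T + 1}") (auto simp: suppd clamped_eq)
      qed
      moreover have "(LINT r:{0<..}|lborel. \<theta> n r *\<^sub>R K r) = (LINT r|lborel. \<theta> n r *\<^sub>R Kc r)"
        unfolding set_lebesgue_integral_def Kc_def
      proof (intro Bochner_Integration.integral_cong refl)
        fix r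
        show "indicator {0<..} r *\<^sub>R \<theta> n r *\<^sub>R K r = \<theta> n r *\<^sub>R clamped (T + 1) K r"
          using s by (cases "r \<in> {s..T + 1}") (auto simp: supp clamped_eq)
      qed
      ultimately show ?thesis using w[of "\<theta> n" s "T + 1", OF \<theta>s s(1) supp] by simp
    qed
    \<comment> \<open>A one-sided mollifier: substituting r = x + e n r' turns the shrinking bump
      into the fixed weight \<rho>, and continuity of \<open>Gc\<close> gives the limit.\<close>
    have mol: "(\<lambda>n. LINT r|lborel. ((1 / e n) * \<rho> ((r - x) / e n)) *\<^sub>R Gc r) \<longlonglongrightarrow> Gc x" for x
    proof -
      have "(LINT r|lborel. ((1 / e n) * \<rho> ((r - x) / e n)) *\<^sub>R Gc r) = (LINT r|lborel. \<rho> r *\<^sub>R Gc (x + e n * r))" for n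
      proof -
        have "(LINT r|lborel. ((1 / e n) * \<rho> ((r - x) / e n)) *\<^sub>R Gc r)
          = \<bar>e n\<bar> *\<^sub>R (LINT r|lborel. ((1 / e n) * \<rho> ((x + e n * r - x) / e n)) *\<^sub>R Gc (x + e n * r))"
          by (rule lborel_integral_real_affine) (use e(2)[of n] in simp)
        also have "\<dots> = (LINT r|lborel. \<bar>e n\<bar> *\<^sub>R (((1 / e n) * \<rho> ((x + e n * r - x) / e n)) *\<^sub>R Gc (x + e n * r)))"
          by (rule integral_scaleR_right[symmetric])
        also have "\<dots> = (LINT r|lborel. \<rho> r *\<^sub>R Gc (x + e n * r))"
          using e(2)[of n] by (intro Bochner_Integration.integral_cong refl) simp
        finally show ?thesis .
      qed
      moreover have "(\<lambda>n. LINT r|lborel. \<rho> r *\<^sub>R Gc (x + e n * r)) \<longlonglongrightarrow> (LINT r|lborel. \<rho> r *\<^sub>R Gc x)"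
      proof (rule integral_dominated_convergence[where w="\<lambda>r. \<rho> r * BG"])
        show "AE r in lborel. (\<lambda>n. \<rho> r *\<^sub>R Gc (x + e n * r)) \<longlonglongrightarrow> \<rho> r *\<^sub>R Gc x"
        proof (intro AE_I2 tendsto_scaleR tendsto_const)
          fix r
          have "(\<lambda>n. x + e n * r) \<longlonglongrightarrow> x + 0 * r" by (intro tendsto_intros e)
          then show "(\<lambda>n. Gc (x + e n * r)) \<longlonglongrightarrow> Gc x"
            using Gcc by (intro isCont_tendsto_compose[of x Gc]) (auto simp: continuous_on_eq_continuous_at)
        qed
      qed (use \<rho>i BG sg(4) in \<open>auto intro!: mult_left_mono\<close>)
      moreover have "(LINT r|lborel. \<rho> r *\<^sub>R Gc x) = Gc x" using \<rho>i sg(6) by simp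
      ultimately show ?thesis by simp
    qed
    have gi: "integrable lborel (\<lambda>r. ((1 / e n) * \<rho> ((r - x) / e n)) *\<^sub>R Gc r)" for n x
    proof (rule Bochner_Integration.integrable_bound)
      show "integrable lborel (\<lambda>r. BG * ((1 / e n) * \<rho> ((r - x) / e n)))"
        using lborel_integrable_real_affine[OF \<rho>i, of "1 / e n" "- x / e n"] e(2)[of n]
        by (intro integrable_mult_right) (simp add: diff_divide_distrib)
      show "AE r in lborel. norm (((1 / e n) * \<rho> ((r - x) / e n)) *\<^sub>R Gc r) \<le> norm (BG * ((1 / e n) * \<rho> ((r - x) / e n)))"
      proof (rule AE_I2)
        fix r
        have "norm (((1 / e n) * \<rho> ((r - x) / e n)) *\<^sub>R Gc r) \<le> ((1 / e n) * \<rho> ((r - x) / e n)) * BG"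
          using e(2)[of n] sg(4) BG by (simp add: mult_left_mono divide_right_mono)
        then show "norm (((1 / e n) * \<rho> ((r - x) / e n)) *\<^sub>R Gc r) \<le> norm (BG * ((1 / e n) * \<rho> ((r - x) / e n)))"
          unfolding real_norm_def by (simp only: mult.commute[of BG])
      qed
    qed measurable
    have L1: "(\<lambda>n. - (LINT r|lborel. dir_deriv 1 (\<theta> n) r *\<^sub>R Gc r)) \<longlonglongrightarrow> - (Gc s - Gc T)"
    proof -
      have "(LINT r|lborel. dir_deriv 1 (\<theta> n) r *\<^sub>R Gc r) = (LINT r|lborel. ((1 / e n) * \<rho> ((r - s) / e n)) *\<^sub>R Gc r)
          - (LINT r|lborel. ((1 / e n) * \<rho> ((r - T) / e n)) *\<^sub>R Gc r)" for n
        unfolding \<theta>d right_diff_distrib scaleR_diff_left by (rule Bochner_Integration.integral_diff[OF gi gi])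
      then show ?thesis by (simp only:) (intro tendsto_intros mol)
    qed
    have L2: "(\<lambda>n. LINT r|lborel. \<theta> n r *\<^sub>R Kc r) \<longlonglongrightarrow> (LINT r|lborel. indicator {s<..T} r *\<^sub>R Kc r)"
    proof (rule integral_dominated_convergence[where w="\<lambda>r. BK * indicator {s..T + 1} r"])
      show "integrable lborel (\<lambda>r. BK * indicator {s..T + 1} r)"
        by (intro integrable_mult_right integrable_real_indicator) (use s in auto)
      show "(\<lambda>r. \<theta> n r *\<^sub>R Kc r) \<in> borel_measurable lborel" for n unfolding \<theta>_def by measurable
      have "\<bar>\<theta> n r\<bar> \<le> indicator {s..T + 1} r" for n r
      proof (cases "r \<in> {s..T + 1}")
        case True
        have "\<bar>\<theta> n r\<bar> \<le> 1"
          unfolding \<theta>_def using sg(9,10)[of "(1 / e n) *\<^sub>R r + (- s / e n)"] sg(9,10)[of "(1 / e n) *\<^sub>R r + (- T / e n)"]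
          by (simp only: real_scaleR_def abs_le_iff) linarith
        then show ?thesis using True by simp
      qed (simp add: supp)
      then have "norm (\<theta> n r *\<^sub>R Kc r) \<le> indicator {s..T + 1} r * BK" for n r
        using BK by (simp add: mult_mono)
      then show "AE r in lborel. norm (\<theta> n r *\<^sub>R Kc r) \<le> BK * indicator {s..T + 1} r" for n
        by (simp add: mult.commute)
      show "AE r in lborel. (\<lambda>n. \<theta> n r *\<^sub>R Kc r) \<longlonglongrightarrow> indicator {s<..T} r *\<^sub>R Kc r"
      proof (intro AE_I2 tendsto_scaleR tendsto_const)
        fix r
        have st: "(\<lambda>n. \<sigma> ((r - x) / e n)) \<longlonglongrightarrow> (if x < r then 1 else 0)" for x
        proof (cases "x < r")
          case True
          have "\<forall>\<^sub>F n in sequentially. e n < r - x" using e(1) True by (intro order_tendstoD) auto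
          then have "\<forall>\<^sub>F n in sequentially. \<sigma> ((r - x) / e n) = 1"
            by eventually_elim (use e(2) in \<open>auto intro!: sg simp: le_divide_eq\<close>)
          then show ?thesis using True by (simp add: tendsto_eventually)
        next
          case False
          then have "(r - x) / e n \<le> 0" for n using e(2)[of n] by (simp add: divide_le_0_iff)
          then show ?thesis using False sg(7) by simp
        qed
        have "(\<lambda>n. \<theta> n r) \<longlonglongrightarrow> (if s < r then 1 else 0) + (-1) *\<^sub>R (if T < r then 1 else 0)"
          unfolding \<theta>_def lin by (intro tendsto_intros st)
        then show "(\<lambda>n. \<theta> n r) \<longlonglongrightarrow> indicator {s<..T} r"
          using s by (auto simp: indicator_def split: if_splits)
      qed
    qed measurable
    have "- (Gc s - Gc T) = (LINT r|lborel. indicator {s<..T} r *\<^sub>R Kc r)"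
      using L1 L2 unfolding eqn by (rule LIMSEQ_unique)
    also have "\<dots> = (LINT r:{s..T}|lborel. K r)"
      unfolding set_lebesgue_integral_def
    proof (rule integral_cong_AE)
      have "continuous_on {s..T} K" using K by (rule continuous_on_subset) (use s in auto)
      from borel_measurable_continuous_on_indicator[OF _ this]
      show "(\<lambda>r. indicator {s..T} r *\<^sub>R K r) \<in> borel_measurable lborel" by simp
      show "AE r in lborel. indicator {s<..T} r *\<^sub>R Kc r = indicator {s..T} r *\<^sub>R K r"
        using AE_lborel_singleton[of s]
      proof eventually_elim
        fix r assume "r \<noteq> s"
        then show "indicator {s<..T} r *\<^sub>R Kc r = indicator {s..T} r *\<^sub>R K r"
          using s by (cases "r \<in> {s<..T}") (auto simp: Kc_def clamped_eq indicator_def)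
      qed
    qed measurable
    also have "\<dots> = integral {s..T} K"
    proof (rule set_borel_integral_eq_integral(2))
      have "continuous_on {s..T} K" using K by (rule continuous_on_subset) (use s in auto)
      from borel_integrable_atLeastAtMost'[OF this] show "set_integrable lborel {s..T} K" .
    qed
    finally show ?thesis using s by (simp add: Gc_def clamped_eq)
  qed
  \<comment> \<open>The test functions live on t > 0, so F is first seen to be constant there;
    continuity of G and of the primitive carries the value to t = 0.\<close>
  define F where "F t = G t - integral {0..t} K" for t
  have eqF: "F s = F T" if s: "0 < s" "s < T" for s T
  proof -
    have "integral {0..s} K + integral {s..T} K = integral {0..T} K"
      using s KT by (intro Henstock_Kurzweil_Integration.integral_combine) auto
    then show ?thesis using main[OF s] by (simp add: F_def algebra_simps)
  qed
  show ?thesis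
  proof (cases "t = 0")
    case False
    with t have t0: "t > 0" by simp
    have "continuous_on {0..t} F"
      unfolding F_def by (intro continuous_intros continuous_on_subset[OF G] indefinite_integral_continuous_1 KT) auto
    then have "(F \<longlongrightarrow> F 0) (at 0 within {0..t})" using t by (simp add: continuous_on_def)
    then have lim: "(F \<longlongrightarrow> F 0) (at 0 within {0<..<t})" by (rule tendsto_within_subset) auto
    have "\<forall>\<^sub>F s in at 0 within {0<..<t}. F s = F t"
      unfolding eventually_at_filter using eqF by (intro always_eventually) auto
    then have "(F \<longlongrightarrow> F t) (at 0 within {0<..<t})" by (rule tendsto_eventually)
    moreover have "at 0 within {0<..<t} \<noteq> bot" using t0 by (simp add: at_within_eq_bot_iff)
    ultimately have "F 0 = F t" using lim tendsto_unique by blast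
    then show ?thesis by (simp add: F_def algebra_simps)
  qed simp
qed

section \<open>The equation on the Fourier side\<close>

text \<open>Minkowski's inequality, by pairing the sum with its own conjugate and applying
  Cauchy-Schwarz to each term.\<close>

lemma nrm2_add_le:
  assumes f: "f \<in> L2" and g: "g \<in> L2"
  shows "nrm2 (\<lambda>x. f x + g x) \<le> nrm2 f + nrm2 g"
proof -
  define w where "w x = f x + g x" for x
  have w: "w \<in> L2" unfolding w_def by (rule L2_add[OF f g])
  have c: "(\<lambda>x. cnj (w x)) \<in> L2" by (rule L2_cnj[OF w])
  have nc: "nrm2 (\<lambda>x. cnj (w x)) = nrm2 w" by (simp add: nrm2_def)
  have "complex_of_real ((nrm2 w)\<^sup>2) = (LINT x|lborel. w x * cnj (w x))"
    unfolding nrm2_sq by (simp flip: complex_norm_square integral_complex_of_real)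
  also have "\<dots> = (LINT x|lborel. f x * cnj (w x)) + (LINT x|lborel. g x * cnj (w x))"
    unfolding w_def[of "_"] distrib_right[of "f _"]
    by (rule Bochner_Integration.integral_add) (use L2_pairing(1)[OF f c] L2_pairing(1)[OF g c] in \<open>simp_all add: w_def\<close>)
  finally have eq: "complex_of_real ((nrm2 w)\<^sup>2) = (LINT x|lborel. f x * cnj (w x)) + (LINT x|lborel. g x * cnj (w x))" .
  have "(nrm2 w)\<^sup>2 = norm (complex_of_real ((nrm2 w)\<^sup>2))" by (simp only: norm_of_real) simp
  also have "\<dots> \<le> norm (LINT x|lborel. f x * cnj (w x)) + norm (LINT x|lborel. g x * cnj (w x))"
    unfolding eq by (rule norm_triangle_ineq)
  also have "\<dots> \<le> nrm2 f * nrm2 w + nrm2 g * nrm2 w"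
    using L2_pairing(2)[OF f c] L2_pairing(2)[OF g c] unfolding nc by (rule add_mono)
  finally have "nrm2 w * nrm2 w \<le> (nrm2 f + nrm2 g) * nrm2 w" by (simp add: power2_eq_square distrib_right)
  then show ?thesis
    using nrm2_nonneg[of w] nrm2_nonneg[of f] nrm2_nonneg[of g] unfolding w_def[symmetric]
    by (cases "nrm2 w = 0") (simp_all add: mult_le_cancel_right)
qed

lemma nrm2_diff_commute: "nrm2 (\<lambda>x. f x - g x) = nrm2 (\<lambda>x. g x - f x)"
  by (simp add: nrm2_def norm_minus_commute)

lemma abs_nrm2_diff_le:
  assumes f: "f \<in> L2" and g: "g \<in> L2"
  shows "\<bar>nrm2 f - nrm2 g\<bar> \<le> nrm2 (\<lambda>x. f x - g x)"
  using nrm2_add_le[OF g L2_diff[OF f g]] nrm2_add_le[OF f L2_diff[OF g f]] nrm2_diff_commute[of f g] by simp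

lemma L2_sum: "(\<And>i. i \<in> I \<Longrightarrow> f i \<in> L2) \<Longrightarrow> (\<lambda>x. \<Sum>i\<in>I. f i x) \<in> L2"
proof (induction I rule: infinite_finite_induct)
  case (insert i I)
  then show ?case using L2_add[of "f i" "\<lambda>x. \<Sum>i\<in>I. f i x"] by simp
qed (simp_all add: L2_def)

lemma L2_norm: "f \<in> L2 \<Longrightarrow> (\<lambda>x. complex_of_real (norm (f x))) \<in> L2"
  by (auto simp: L2_def)

text \<open>Test objects on the frequency side: stable under multiplication by continuous functions,
  in particular by |\<xi>|^2, and with smooth transforms. Continuity is not imposed, so that a
  truncated defect can be inserted as such an object in \<open>fourier_solution\<close>.\<close>

definition bsupp :: "(real ^ 'n \<Rightarrow> complex) \<Rightarrow> bool" where
  "bsupp h \<longleftrightarrow> h \<in> L2 \<and> (\<exists>R. \<forall>\<xi>. norm \<xi> > R \<longrightarrow> h \<xi> = 0)"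

lemma bsupp_integrable: "bsupp h \<Longrightarrow> integrable lborel h"
  unfolding bsupp_def using L2_bounded_support_integrable by blast

lemma bsupp_mult:
  assumes h: "bsupp h" and m: "continuous_on UNIV m"
  shows "bsupp (\<lambda>\<xi>. m \<xi> * h \<xi>)"
proof -
  obtain R where R: "\<And>\<xi>. norm \<xi> > R \<Longrightarrow> h \<xi> = 0" and hL: "h \<in> L2" using h by (auto simp: bsupp_def)
  have "bounded (m ` cball 0 R)"
    by (intro compact_imp_bounded compact_continuous_image continuous_on_subset[OF m]) auto
  then obtain B where B: "\<forall>\<xi>\<in>cball 0 R. norm (m \<xi>) \<le> B" unfolding bounded_iff by blast
  have [measurable]: "m \<in> borel_measurable borel" using m by (rule borel_measurable_continuous_onI)
  have "(\<lambda>\<xi>. (indicator (cball 0 R) \<xi> *\<^sub>R m \<xi>) * h \<xi>) \<in> L2"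
  proof (rule L2_bounded_mult[OF hL])
    show "norm (indicator (cball 0 R) \<xi> *\<^sub>R m \<xi>) \<le> max B 0" for \<xi>
      using B by (auto simp: indicator_def intro: max.coboundedI1)
  qed measurable
  also have "(\<lambda>\<xi>. (indicator (cball 0 R) \<xi> *\<^sub>R m \<xi>) * h \<xi>) = (\<lambda>\<xi>. m \<xi> * h \<xi>)"
    using R by (force simp: indicator_def fun_eq_iff)
  finally show ?thesis using R by (auto simp: bsupp_def)
qed

section \<open>Smooth transforms, with the Laplacian as a multiplier\<close>

lemma norm_cis_taylor: "norm (cis x - 1 - \<i> * of_real x) \<le> x\<^sup>2"
proof -
  have "norm (iexp x - (\<Sum>k\<le>1. (\<i> * x) ^ k / fact k)) \<le> \<bar>x\<bar> ^ Suc 1 / fact (Suc 1)" by (rule iexp_approx1)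
  then have "norm (cis x - 1 - \<i> * of_real x) \<le> x\<^sup>2 / 2"
    by (simp add: cis_conv_exp algebra_simps numeral_2_eq_2)
  then show ?thesis by (rule order_trans) simp
qed

text \<open>Bounded support provides moments of all orders. The first moment bounds the candidate
  derivative, the second moment together with the quadratic remainder of \<open>cis\<close> bounds
  the error.\<close>

lemma ft_has_derivative:
  assumes h: "bsupp h"
  shows "(ft h has_derivative (\<lambda>v. ft (\<lambda>\<xi>. - \<i> * of_real (\<xi> \<bullet> v) * h \<xi>) x)) (at x)"
proof -
  have m1: "integrable lborel (\<lambda>\<xi>. - \<i> * of_real (\<xi> \<bullet> v) * h \<xi>)" for v
    by (intro bsupp_integrable bsupp_mult h continuous_intros)
  have n1: "integrable lborel (\<lambda>\<xi>. norm \<xi> * norm (h \<xi>))"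
    using integrable_norm[OF bsupp_integrable[OF bsupp_mult[OF h, of "\<lambda>\<xi>. of_real (norm \<xi>)"]]]
    by (simp add: norm_mult continuous_intros)
  have n2: "integrable lborel (\<lambda>\<xi>. (norm \<xi>)\<^sup>2 * norm (h \<xi>))"
    using integrable_norm[OF bsupp_integrable[OF bsupp_mult[OF h, of "\<lambda>\<xi>. of_real ((norm \<xi>)\<^sup>2)"]]]
    by (simp add: norm_mult norm_power continuous_intros)
  have hi: "integrable lborel h" by (rule bsupp_integrable[OF h])
  define N1 where "N1 = (LINT \<xi>|lborel. norm \<xi> * norm (h \<xi>))"
  define N2 where "N2 = (LINT \<xi>|lborel. (norm \<xi>)\<^sup>2 * norm (h \<xi>))"
  define D where "D v = ft (\<lambda>\<xi>. - \<i> * of_real (\<xi> \<bullet> v) * h \<xi>) x" for v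
  have lin: "bounded_linear D"
  proof (rule bounded_linear_intro)
    fix v w
    show "D (v + w) = D v + D w"
      unfolding D_def by (subst ft_add[symmetric, OF m1 m1]) (simp add: inner_add_right algebra_simps)
    show "D (r *\<^sub>R v) = r *\<^sub>R D v" for r
      unfolding D_def scaleR_conv_of_real[of r "ft _ _"] ft_cmult[symmetric] by (simp add: mult_ac)
    have "norm (D v) \<le> (LINT \<xi>|lborel. norm (- \<i> * of_real (\<xi> \<bullet> v) * h \<xi>))" unfolding D_def by (rule norm_ft_le)
    also have "\<dots> \<le> (LINT \<xi>|lborel. norm v * (norm \<xi> * norm (h \<xi>)))"
    proof (intro integral_mono integrable_norm m1 integrable_mult_right n1)
      fix \<xi>
      have "\<bar>\<xi> \<bullet> v\<bar> * norm (h \<xi>) \<le> (norm \<xi> * norm v) * norm (h \<xi>)"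
        by (intro mult_right_mono Cauchy_Schwarz_ineq2) simp
      then show "norm (- \<i> * of_real (\<xi> \<bullet> v) * h \<xi>) \<le> norm v * (norm \<xi> * norm (h \<xi>))"
        by (simp add: norm_mult mult_ac)
    qed
    finally show "norm (D v) \<le> norm v * N1" by (simp add: N1_def)
  qed
  have rem: "norm (ft h (x + v) - ft h x - D v) \<le> N2 * (norm v)\<^sup>2" for v
  proof -
    have eq: "ft h (x + v) - ft h x - D v = (LINT \<xi>|lborel. cis (- (\<xi> \<bullet> (x + v))) * h \<xi> - cis (- (\<xi> \<bullet> x)) * h \<xi>
        - cis (- (\<xi> \<bullet> x)) * (- \<i> * of_real (\<xi> \<bullet> v) * h \<xi>))"
      unfolding D_def ft_def using integrable_cis_mult(2)[OF hi] integrable_cis_mult(2)[OF m1] by simp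
    have "norm (ft h (x + v) - ft h x - D v) \<le> (LINT \<xi>|lborel. norm (cis (- (\<xi> \<bullet> (x + v))) * h \<xi> - cis (- (\<xi> \<bullet> x)) * h \<xi>
        - cis (- (\<xi> \<bullet> x)) * (- \<i> * of_real (\<xi> \<bullet> v) * h \<xi>)))"
      unfolding eq by (rule integral_norm_bound)
    also have "\<dots> \<le> (LINT \<xi>|lborel. (norm v)\<^sup>2 * ((norm \<xi>)\<^sup>2 * norm (h \<xi>)))"
    proof (intro integral_mono' integrable_mult_right n2)
      fix \<xi>
      have "cis (- (\<xi> \<bullet> (x + v))) * h \<xi> - cis (- (\<xi> \<bullet> x)) * h \<xi> - cis (- (\<xi> \<bullet> x)) * (- \<i> * of_real (\<xi> \<bullet> v) * h \<xi>)
         = cis (- (\<xi> \<bullet> x)) * (cis (- (\<xi> \<bullet> v)) - 1 - \<i> * of_real (- (\<xi> \<bullet> v))) * h \<xi>"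
      proof -
        have "cis (- (\<xi> \<bullet> (x + v))) = cis (- (\<xi> \<bullet> x)) * cis (- (\<xi> \<bullet> v))"
          by (simp add: inner_add_right cis_mult)
        then show ?thesis by (simp only:) (simp add: algebra_simps)
      qed
      also have "norm \<dots> \<le> (\<xi> \<bullet> v)\<^sup>2 * norm (h \<xi>)"
        using norm_cis_taylor[of "- (\<xi> \<bullet> v)"] by (simp add: norm_mult mult_right_mono)
      also have "\<dots> \<le> (norm \<xi> * norm v)\<^sup>2 * norm (h \<xi>)"
        using Cauchy_Schwarz_ineq2[of \<xi> v] power_mono[OF Cauchy_Schwarz_ineq2[of \<xi> v], of 2]
        by (intro mult_right_mono) auto
      finally show "norm (cis (- (\<xi> \<bullet> (x + v))) * h \<xi> - cis (- (\<xi> \<bullet> x)) * h \<xi>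
        - cis (- (\<xi> \<bullet> x)) * (- \<i> * of_real (\<xi> \<bullet> v) * h \<xi>)) \<le> (norm v)\<^sup>2 * ((norm \<xi>)\<^sup>2 * norm (h \<xi>))"
        by (simp add: power_mult_distrib mult_ac)
    qed simp
    finally show ?thesis by (simp add: N2_def mult.commute)
  qed
  have "(ft h has_derivative D) (at x)"
  proof (rule has_derivativeI_sandwich[of 1])
    show "norm (ft h y - ft h x - D (y - x)) / norm (y - x) \<le> N2 * norm (y - x)" if "y \<noteq> x" for y
      using rem[of "y - x"] that by (simp add: divide_le_eq power2_eq_square mult.assoc)
    have "((\<lambda>y. N2 * norm (y - x)) \<longlongrightarrow> N2 * norm (x - x)) (at x)" by (intro tendsto_intros)
    then show "((\<lambda>y. N2 * norm (y - x)) \<longlongrightarrow> 0) (at x)" by simp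
  qed (use lin in auto)
  then show ?thesis by (simp add: D_def[abs_def])
qed

lemma dir_deriv_ft: "bsupp h \<Longrightarrow> dir_deriv b (ft h) = ft (\<lambda>\<xi>. - \<i> * of_real (\<xi> \<bullet> b) * h \<xi>)"
  by (rule ext, rule dir_deriv_eq[OF ft_has_derivative])

lemma bsupp_inner: "bsupp h \<Longrightarrow> bsupp (\<lambda>\<xi>. - \<i> * of_real (\<xi> \<bullet> b) * h \<xi>)"
  by (intro bsupp_mult continuous_intros)

lemma cont_differentiable_ft:
  assumes "bsupp h"
  shows "cont_differentiable m (ft h)"
proof (rule cont_differentiable_coinduct[where S="ft ` {h. bsupp h}"])
  show "g differentiable (at p)" if "g \<in> ft ` {h. bsupp h}" for g p
    using that ft_has_derivative by (auto simp: differentiable_def)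
  show "dir_deriv b g \<in> ft ` {h. bsupp h}" if "g \<in> ft ` {h. bsupp h}" for g b
  proof -
    from that obtain h where g: "g = ft h" and h: "bsupp h" by (elim imageE CollectE)
    have "dir_deriv b g = ft (\<lambda>\<xi>. - \<i> * of_real (\<xi> \<bullet> b) * h \<xi>)" unfolding g by (rule dir_deriv_ft[OF h])
    then show ?thesis using bsupp_inner[OF h, of b] by (simp only:) (intro imageI CollectI)
  qed
qed (use assms in auto)

definition lap :: "(real ^ 'n \<Rightarrow> complex) \<Rightarrow> real ^ 'n \<Rightarrow> complex" where
  "lap g x = (\<Sum>b\<in>Basis. dir_deriv b (dir_deriv b g) x)"

lemma lap_ft:
  assumes h: "bsupp h"
  shows "lap (ft h) x = - ft (\<lambda>\<xi>. of_real ((norm \<xi>)\<^sup>2) * h \<xi>) x"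
proof -
  have "lap (ft h) x = (\<Sum>b\<in>Basis. ft (\<lambda>\<xi>. - \<i> * of_real (\<xi> \<bullet> b) * (- \<i> * of_real (\<xi> \<bullet> b) * h \<xi>)) x)"
    unfolding lap_def by (simp only: dir_deriv_ft[OF h] dir_deriv_ft[OF bsupp_inner[OF h]])
  also have "\<dots> = (LINT \<xi>|lborel. (\<Sum>b\<in>Basis. cis (- (\<xi> \<bullet> x)) * (- \<i> * of_real (\<xi> \<bullet> b) * (- \<i> * of_real (\<xi> \<bullet> b) * h \<xi>))))"
    unfolding ft_def
    by (rule Bochner_Integration.integral_sum[symmetric]) (intro integrable_cis_mult bsupp_integrable bsupp_inner h)
  also have "\<dots> = (LINT \<xi>|lborel. - (cis (- (\<xi> \<bullet> x)) * (of_real ((norm \<xi>)\<^sup>2) * h \<xi>)))"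
  proof (intro Bochner_Integration.integral_cong refl)
    fix \<xi> :: "real ^ 'a"
    have "(norm \<xi>)\<^sup>2 = (\<Sum>b\<in>Basis. (\<xi> \<bullet> b) * (\<xi> \<bullet> b))"
      unfolding power2_norm_eq_inner by (rule euclidean_inner)
    then have "cis (- (\<xi> \<bullet> x)) * (of_real ((norm \<xi>)\<^sup>2) * h \<xi>) = (\<Sum>b\<in>Basis. cis (- (\<xi> \<bullet> x)) * (of_real ((\<xi> \<bullet> b) * (\<xi> \<bullet> b)) * h \<xi>))"
      by (simp add: sum_distrib_left sum_distrib_right)
    moreover have "cis (- (\<xi> \<bullet> x)) * (- \<i> * of_real (\<xi> \<bullet> b) * (- \<i> * of_real (\<xi> \<bullet> b) * h \<xi>))
        = - (cis (- (\<xi> \<bullet> x)) * (of_real ((\<xi> \<bullet> b) * (\<xi> \<bullet> b)) * h \<xi>))" for b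
    proof -
      have "- \<i> * z * (- \<i> * z * y) = - (z * z * y)" for z y by (simp add: algebra_simps)
      then show ?thesis by simp
    qed
    ultimately show "(\<Sum>b\<in>Basis. cis (- (\<xi> \<bullet> x)) * (- \<i> * of_real (\<xi> \<bullet> b) * (- \<i> * of_real (\<xi> \<bullet> b) * h \<xi>)))
      = - (cis (- (\<xi> \<bullet> x)) * (of_real ((norm \<xi>)\<^sup>2) * h \<xi>))"
      by (simp only: sum_negf)
  qed
  finally show ?thesis by (simp add: ft_def)
qed

subsection \<open>Cutoffs\<close>

lemma dir_deriv_locally_const:
  assumes "open U" "p \<in> U" "\<And>x. x \<in> U \<Longrightarrow> g x = c"
  shows "dir_deriv b g p = 0"
proof (rule dir_deriv_eq[where f'="\<lambda>_. 0"])
  show "(g has_derivative (\<lambda>_. 0)) (at p)"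
    by (rule has_derivative_transform_within_open[OF has_derivative_const assms(1,2)]) (simp add: assms(3))
qed

lemma dir_deriv_scale_arg:
  assumes "g differentiable (at (c *\<^sub>R p))"
  shows "dir_deriv v (\<lambda>p. g (c *\<^sub>R p)) p = c *\<^sub>R dir_deriv v g (c *\<^sub>R p)"
proof -
  note g = has_derivative_dir_deriv[OF assms]
  have "dir_deriv v (\<lambda>p. g (c *\<^sub>R p)) p = dir_deriv (c *\<^sub>R v) g (c *\<^sub>R p)"
    by (rule dir_deriv_eq, rule has_derivative_compose[where f="\<lambda>p. c *\<^sub>R p" and g=g, OF _ g])
       (intro bounded_linear_imp_has_derivative bounded_linear_scaleR_right)
  also have "\<dots> = c *\<^sub>R dir_deriv v g (c *\<^sub>R p)"
    by (rule linear_scale[OF has_derivative_linear[OF g]])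
  finally show ?thesis .
qed

lemma differentiable_scale_arg:
  assumes "g differentiable (at (c *\<^sub>R p))"
  shows "(\<lambda>p. g (c *\<^sub>R p)) differentiable (at p)"
proof -
  have "((\<lambda>p. g (c *\<^sub>R p)) has_derivative (\<lambda>v. dir_deriv (c *\<^sub>R v) g (c *\<^sub>R p))) (at p)"
    by (rule has_derivative_compose[where f="\<lambda>p. c *\<^sub>R p" and g=g, OF _ has_derivative_dir_deriv[OF assms]])
       (intro bounded_linear_imp_has_derivative bounded_linear_scaleR_right)
  then show ?thesis by (auto simp: differentiable_def)
qed

lemma cont_differentiable_scale_arg:
  "cont_differentiable m g \<Longrightarrow> cont_differentiable m (\<lambda>p. g (c *\<^sub>R p))"
proof (induction m arbitrary: g)
  case 0
  have "continuous_on UNIV (\<lambda>p::'a. c *\<^sub>R p)" by (intro continuous_intros)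
  then show ?case using 0 continuous_on_compose2[of UNIV g UNIV "\<lambda>p. c *\<^sub>R p"] by simp
next
  case (Suc m)
  then have "dir_deriv b (\<lambda>p. g (c *\<^sub>R p)) = (\<lambda>p. c *\<^sub>R dir_deriv b g (c *\<^sub>R p))" for b
    by (auto simp: dir_deriv_scale_arg)
  with Suc show ?case
    by (auto intro!: differentiable_scale_arg cont_differentiable_scaleR cont_differentiable_const)
qed

lemma cont_differentiable_inner_self: "cont_differentiable m (\<lambda>x::'a::euclidean_space. x \<bullet> x)"
proof (cases m)
  case (Suc k)
  have d: "((\<lambda>x::'a. x \<bullet> x) has_derivative (\<lambda>v. p \<bullet> v + v \<bullet> p)) (at p)" for p
    by (rule has_derivative_inner) (rule has_derivative_ident)+
  have "dir_deriv b (\<lambda>x::'a. x \<bullet> x) = (\<lambda>p. 2 *\<^sub>R (p \<bullet> b))" for b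
    by (rule ext) (simp add: dir_deriv_eq[OF d] inner_commute)
  moreover have "cont_differentiable k (\<lambda>p::'a. 2 *\<^sub>R (p \<bullet> b))" for b
    by (intro cont_differentiable_scaleR cont_differentiable_const cont_differentiable_bounded_linear bounded_linear_inner_left)
  ultimately show ?thesis using Suc d by (auto simp: differentiable_def simp del: real_scaleR_def)
qed (auto intro: continuous_intros)

definition cutoff :: "(real ^ 'n \<Rightarrow> real) \<Rightarrow> bool" where
  "cutoff \<zeta> \<longleftrightarrow> (\<forall>m. cont_differentiable m \<zeta>) \<and> (\<forall>x. 0 \<le> \<zeta> x \<and> \<zeta> x \<le> 1) \<and>
    (\<forall>x. norm x \<le> 1 \<longrightarrow> \<zeta> x = 1) \<and> (\<forall>x. norm x \<ge> 2 \<longrightarrow> \<zeta> x = 0)"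

lemma cutoff_exists: "\<exists>\<zeta>. cutoff (\<zeta> :: real ^ 'n \<Rightarrow> real)"
proof -
  obtain \<sigma> \<rho> where "smooth_step \<sigma> \<rho>" using smooth_step_exists by blast
  note sg = smooth_stepD[OF this]
  \<comment> \<open>Using the squared norm avoids differentiating the norm at the origin; the shift
    by 1 places the descent between |x|^2 = 1 and |x|^2 = 2.\<close>
  define \<zeta> :: "real ^ 'n \<Rightarrow> real" where "\<zeta> x = 1 + (-1) *\<^sub>R \<sigma> (x \<bullet> x + (-1))" for x
  have "cont_differentiable m \<zeta>" for m
    unfolding \<zeta>_def
    by (intro cont_differentiable_add cont_differentiable_scaleR cont_differentiable_const
        cont_differentiable_compose[OF sg(1)] cont_differentiable_inner_self)
  moreover have "0 \<le> \<zeta> x" "\<zeta> x \<le> 1" for x using sg(9,10) by (simp_all add: \<zeta>_def)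
  moreover have "\<zeta> x = 1" if "norm x \<le> 1" for x
  proof -
    have "(norm x)\<^sup>2 \<le> 1" using that by (simp add: power_le_one)
    then show ?thesis by (simp add: \<zeta>_def sg(7) power2_norm_eq_inner)
  qed
  moreover have "\<zeta> x = 0" if "norm x \<ge> 2" for x
  proof -
    have "(norm x)\<^sup>2 \<ge> 2\<^sup>2" using that by (intro power_mono) auto
    then show ?thesis by (simp add: \<zeta>_def sg(8) power2_norm_eq_inner)
  qed
  ultimately show ?thesis unfolding cutoff_def by blast
qed

lemma dir_deriv2_scaleR:
  fixes f :: "'a::euclidean_space \<Rightarrow> real"
  assumes f: "\<And>m. cont_differentiable m f" and g: "\<And>m. cont_differentiable m g" and b: "b \<in> Basis"
  shows "dir_deriv b (dir_deriv b (\<lambda>x. f x *\<^sub>R g x)) x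
    = f x *\<^sub>R dir_deriv b (dir_deriv b g) x + 2 *\<^sub>R (dir_deriv b f x *\<^sub>R dir_deriv b g x) + dir_deriv b (dir_deriv b f) x *\<^sub>R g x"
proof -
  have d: "f differentiable (at p)" "g differentiable (at p)" "dir_deriv b f differentiable (at p)" "dir_deriv b g differentiable (at p)" for p
    using f[of "Suc (Suc 0)"] g[of "Suc (Suc 0)"] b by auto
  have "dir_deriv b (\<lambda>x. f x *\<^sub>R g x) = (\<lambda>x. f x *\<^sub>R dir_deriv b g x + dir_deriv b f x *\<^sub>R g x)"
    by (rule ext) (rule dir_deriv_scaleR[OF d(1,2)])
  then have "dir_deriv b (dir_deriv b (\<lambda>x. f x *\<^sub>R g x)) x
     = dir_deriv b (\<lambda>x. f x *\<^sub>R dir_deriv b g x) x + dir_deriv b (\<lambda>x. dir_deriv b f x *\<^sub>R g x) x"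
    using d by (simp add: dir_deriv_add)
  then show ?thesis by (simp only: dir_deriv_scaleR[OF d(1) d(4)] dir_deriv_scaleR[OF d(3) d(2)] scaleR_2 add.assoc)
qed

lemma continuous_lap:
  assumes "\<And>m. cont_differentiable m g"
  shows "continuous_on UNIV (lap g)"
  unfolding lap_def using assms[of "Suc (Suc 0)"] by (intro continuous_on_sum) auto

text \<open>The product rule produces terms with derivatives of the cutoff. At a fixed point every
  error term is 0 once the point lies inside the plateau, and W is a square integrable majorant
  independent of n, so dominated convergence suffices.\<close>

lemma cutoff_lap_tendsto:
  fixes \<psi> :: "real ^ 'n \<Rightarrow> complex"
  assumes \<zeta>: "cutoff \<zeta>" and \<psi>: "\<And>m. cont_differentiable m \<psi>" and \<psi>0: "\<psi> \<in> L2"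
    and \<psi>1: "\<And>b. b \<in> Basis \<Longrightarrow> dir_deriv b \<psi> \<in> L2" and \<psi>2: "lap \<psi> \<in> L2"
  defines "\<psi>' \<equiv> \<lambda>n x. \<zeta> ((1 / Suc n) *\<^sub>R x) *\<^sub>R \<psi> x"
  shows "(\<lambda>x. lap (\<psi>' n) x - lap \<psi> x) \<in> L2" and "(\<lambda>n. nrm2 (\<lambda>x. lap (\<psi>' n) x - lap \<psi> x)) \<longlonglongrightarrow> 0"
proof -
  have z: "\<And>m. cont_differentiable m \<zeta>" "\<And>x. \<bar>\<zeta> x\<bar> \<le> 1" "\<And>x. norm x \<le> 1 \<Longrightarrow> \<zeta> x = 1" "\<And>x. norm x \<ge> 2 \<Longrightarrow> \<zeta> x = 0"
    using \<zeta> by (auto simp: cutoff_def)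
  define E where "E x = (\<Sum>b\<in>Basis. \<bar>dir_deriv b \<zeta> x\<bar> + \<bar>dir_deriv b (dir_deriv b \<zeta>) x\<bar>)" for x
  have zd: "\<zeta> differentiable (at p)" "b \<in> Basis \<Longrightarrow> dir_deriv b \<zeta> differentiable (at p)" for b p
    using z(1)[of "Suc (Suc 0)"] by auto
  have Ec: "continuous_on UNIV E"
    unfolding E_def using z(1)[of "Suc 0"] z(1)[of "Suc (Suc 0)"] by (intro continuous_intros) auto
  have out: "dir_deriv b \<zeta> x = 0" "dir_deriv b (dir_deriv b \<zeta>) x = 0" if "norm x > 2" for b x
  proof -
    have o: "open {x::real ^ 'n. norm x > 2}" by (intro open_Collect_less continuous_intros)
    have 1: "dir_deriv b \<zeta> y = 0" if "norm y > 2" for y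
      by (rule dir_deriv_locally_const[OF o, of y _ 0]) (use that z(4) in auto)
    then show "dir_deriv b \<zeta> x = 0" using that by blast
    show "dir_deriv b (dir_deriv b \<zeta>) x = 0"
      by (rule dir_deriv_locally_const[OF o, of x _ 0]) (use that 1 in auto)
  qed
  have inn: "dir_deriv b \<zeta> x = 0" "dir_deriv b (dir_deriv b \<zeta>) x = 0" if "norm x < 1" for b x
  proof -
    have o: "open {x::real ^ 'n. norm x < 1}" by (intro open_Collect_less continuous_intros)
    have 1: "dir_deriv b \<zeta> y = 0" if "norm y < 1" for y
      by (rule dir_deriv_locally_const[OF o, of y _ 1]) (use that z(3) in auto)
    then show "dir_deriv b \<zeta> x = 0" using that by blast
    show "dir_deriv b (dir_deriv b \<zeta>) x = 0"
      by (rule dir_deriv_locally_const[OF o, of x _ 0]) (use that 1 in auto)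
  qed
  have "bounded (E ` cball 0 2)"
    by (intro compact_imp_bounded compact_continuous_image continuous_on_subset[OF Ec]) auto
  then obtain C0 where C0: "\<forall>x\<in>cball 0 2. norm (E x) \<le> C0" unfolding bounded_iff by blast
  define C where "C = max C0 0"
  have EC: "E x \<le> C" for x
  proof (cases "norm x > 2")
    case True then show ?thesis by (simp add: E_def out C_def)
  next
    case False then show ?thesis using C0[rule_format, of x] by (simp add: C_def)
  qed
  have C: "C \<ge> 0" by (simp add: C_def)
  have bC: "\<bar>dir_deriv b \<zeta> x\<bar> \<le> C" "\<bar>dir_deriv b (dir_deriv b \<zeta>) x\<bar> \<le> C" if b: "b \<in> Basis" for b x
  proof -
    have "\<bar>dir_deriv b \<zeta> x\<bar> + \<bar>dir_deriv b (dir_deriv b \<zeta>) x\<bar> \<le> E x"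
      unfolding E_def by (rule member_le_sum[OF b]) auto
    then show "\<bar>dir_deriv b \<zeta> x\<bar> \<le> C" "\<bar>dir_deriv b (dir_deriv b \<zeta>) x\<bar> \<le> C" using EC[of x] by auto
  qed
  define c :: "nat \<Rightarrow> real" where "c n = 1 / Suc n" for n
  have c: "0 < c n" "c n \<le> 1" for n by (auto simp: c_def)
  define \<zeta>n where "\<zeta>n n x = \<zeta> (c n *\<^sub>R x)" for n x
  have \<zeta>n: "cont_differentiable m (\<zeta>n n)" for m n unfolding \<zeta>n_def by (rule cont_differentiable_scale_arg[OF z(1)])
  have d1: "dir_deriv b (\<zeta>n n) = (\<lambda>x. c n *\<^sub>R dir_deriv b \<zeta> (c n *\<^sub>R x))" for b n
    unfolding \<zeta>n_def using zd(1) by (auto simp: dir_deriv_scale_arg)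
  have d2: "dir_deriv b (dir_deriv b (\<zeta>n n)) x = c n *\<^sub>R (c n *\<^sub>R dir_deriv b (dir_deriv b \<zeta>) (c n *\<^sub>R x))" if b: "b \<in> Basis" for b n x
    unfolding d1 using zd(2)[OF b] differentiable_scale_arg[OF zd(2)[OF b]]
    by (subst dir_deriv_scaleR) (auto simp: dir_deriv_scale_arg)
  have lap: "lap (\<psi>' n) x - lap \<psi> x = (\<zeta>n n x - 1) *\<^sub>R lap \<psi> x
     + (\<Sum>b\<in>Basis. (2 * dir_deriv b (\<zeta>n n) x) *\<^sub>R dir_deriv b \<psi> x + dir_deriv b (dir_deriv b (\<zeta>n n)) x *\<^sub>R \<psi> x)" for n x
  proof -
    have "lap (\<psi>' n) x = (\<Sum>b\<in>Basis. \<zeta>n n x *\<^sub>R dir_deriv b (dir_deriv b \<psi>) x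
        + ((2 * dir_deriv b (\<zeta>n n) x) *\<^sub>R dir_deriv b \<psi> x + dir_deriv b (dir_deriv b (\<zeta>n n)) x *\<^sub>R \<psi> x))"
      unfolding lap_def
    proof (intro sum.cong refl)
      fix b :: "real ^ 'n" assume b: "b \<in> Basis"
      have "\<psi>' n = (\<lambda>x. \<zeta>n n x *\<^sub>R \<psi> x)" by (simp add: \<psi>'_def \<zeta>n_def c_def)
      then show "dir_deriv b (dir_deriv b (\<psi>' n)) x = \<zeta>n n x *\<^sub>R dir_deriv b (dir_deriv b \<psi>) x
        + ((2 * dir_deriv b (\<zeta>n n) x) *\<^sub>R dir_deriv b \<psi> x + dir_deriv b (dir_deriv b (\<zeta>n n)) x *\<^sub>R \<psi> x)"
        using dir_deriv2_scaleR[OF \<zeta>n \<psi> b, of n x] by (simp add: add.assoc)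
    qed
    then show ?thesis
      unfolding lap_def by (simp add: sum.distrib scaleR_sum_right scaleR_diff_left sum_subtractf algebra_simps)
  qed
  define W where "W x = norm (lap \<psi> x) + (\<Sum>b\<in>Basis. (2 * C) * norm (dir_deriv b \<psi> x) + C * norm (\<psi> x))" for x
  have W: "norm (lap (\<psi>' n) x - lap \<psi> x) \<le> W x" for n x
  proof -
    have "norm (lap (\<psi>' n) x - lap \<psi> x) \<le> norm ((\<zeta>n n x - 1) *\<^sub>R lap \<psi> x)
      + (\<Sum>b\<in>Basis. norm ((2 * dir_deriv b (\<zeta>n n) x) *\<^sub>R dir_deriv b \<psi> x + dir_deriv b (dir_deriv b (\<zeta>n n)) x *\<^sub>R \<psi> x))"
      unfolding lap by (rule order_trans[OF norm_triangle_ineq]) (intro add_left_mono norm_sum)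
    also have "\<dots> \<le> W x"
      unfolding W_def
    proof (intro add_mono sum_mono)
      have "\<bar>\<zeta>n n x - 1\<bar> \<le> 1" using \<zeta> by (auto simp: \<zeta>n_def cutoff_def abs_le_iff algebra_simps)
      then show "norm ((\<zeta>n n x - 1) *\<^sub>R lap \<psi> x) \<le> norm (lap \<psi> x)" by (simp add: mult_left_le_one_le)
      fix b :: "real ^ 'n" assume b: "b \<in> Basis"
      have "\<bar>dir_deriv b (\<zeta>n n) x\<bar> \<le> 1 * C"
        unfolding d1 using c[of n] bC(1)[OF b] by (simp only: real_scaleR_def abs_mult) (intro mult_mono; simp)
      then have 1: "norm ((2 * dir_deriv b (\<zeta>n n) x) *\<^sub>R dir_deriv b \<psi> x) \<le> (2 * C) * norm (dir_deriv b \<psi> x)"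
        by (simp add: abs_mult mult_right_mono)
      have "\<bar>dir_deriv b (dir_deriv b (\<zeta>n n)) x\<bar> \<le> 1 * (1 * C)"
        unfolding d2[OF b] using c[of n] bC(2)[OF b] by (simp only: real_scaleR_def abs_mult) (intro mult_mono; simp)
      then have 2: "norm (dir_deriv b (dir_deriv b (\<zeta>n n)) x *\<^sub>R \<psi> x) \<le> C * norm (\<psi> x)"
        by (simp add: mult_right_mono)
      show "norm ((2 * dir_deriv b (\<zeta>n n) x) *\<^sub>R dir_deriv b \<psi> x + dir_deriv b (dir_deriv b (\<zeta>n n)) x *\<^sub>R \<psi> x)
         \<le> (2 * C) * norm (dir_deriv b \<psi> x) + C * norm (\<psi> x)"
        by (rule order_trans[OF norm_triangle_ineq add_mono[OF 1 2]])
    qed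
    finally show ?thesis .
  qed
  have "(\<lambda>x. complex_of_real (norm (lap \<psi> x)) + (\<Sum>b\<in>Basis. of_real (2 * C) * of_real (norm (dir_deriv b \<psi> x)) + of_real C * of_real (norm (\<psi> x)))) \<in> L2"
    by (intro L2_add L2_sum L2_cmult L2_norm \<psi>0 \<psi>1 \<psi>2)
  then have WL: "(\<lambda>x. complex_of_real (W x)) \<in> L2" by (simp add: W_def)
  have W2: "integrable lborel (\<lambda>x. (W x)\<^sup>2)" using L2D(2)[OF WL] by simp
  have s': "cont_differentiable m (\<psi>' n)" for m n
    unfolding \<psi>'_def by (intro cont_differentiable_scaleR cont_differentiable_scale_arg z(1) \<psi>)
  have cont: "continuous_on UNIV (\<lambda>x. lap (\<psi>' n) x - lap \<psi> x)" for n
    by (intro continuous_intros continuous_lap s' \<psi>)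
  note [measurable] = borel_measurable_continuous_onI[OF cont]
  have sq: "(norm (lap (\<psi>' n) x - lap \<psi> x))\<^sup>2 \<le> (W x)\<^sup>2" for n x by (intro power_mono W) simp
  show "(\<lambda>x. lap (\<psi>' n) x - lap \<psi> x) \<in> L2"
    by (intro L2I Bochner_Integration.integrable_bound[OF W2]; (measurable)?) (auto simp: sq)
  have "(\<lambda>n. LINT x|lborel. (norm (lap (\<psi>' n) x - lap \<psi> x))\<^sup>2) \<longlonglongrightarrow> (LINT x::real ^ 'n|lborel. 0)"
  proof (rule integral_dominated_convergence[where w="\<lambda>x. (W x)\<^sup>2"])
    show "AE x in lborel. (\<lambda>n. (norm (lap (\<psi>' n) x - lap \<psi> x))\<^sup>2) \<longlonglongrightarrow> 0"
    proof (intro AE_I2 tendsto_eventually)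
      fix x :: "real ^ 'n"
      have "\<forall>\<^sub>F n in sequentially. real (Suc n) > norm x" by real_asymp
      then show "\<forall>\<^sub>F n in sequentially. (norm (lap (\<psi>' n) x - lap \<psi> x))\<^sup>2 = 0"
      proof eventually_elim
        fix n assume n: "real (Suc n) > norm x"
        have "norm (c n *\<^sub>R x) = norm x / real (Suc n)" by (simp add: c_def)
        also have "\<dots> < 1" using n by (simp add: divide_less_eq)
        finally have lt: "norm (c n *\<^sub>R x) < 1" .
        have "(\<Sum>b\<in>Basis. (2 * dir_deriv b (\<zeta>n n) x) *\<^sub>R dir_deriv b \<psi> x + dir_deriv b (dir_deriv b (\<zeta>n n)) x *\<^sub>R \<psi> x) = 0"
        proof (intro sum.neutral ballI)
          fix b :: "real ^ 'n" assume b: "b \<in> Basis"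
          have "dir_deriv b (dir_deriv b (\<zeta>n n)) x = 0" by (simp add: d2[OF b] inn[OF lt])
          moreover have "dir_deriv b (\<zeta>n n) x = 0" by (simp add: d1 inn[OF lt])
          ultimately show "(2 * dir_deriv b (\<zeta>n n) x) *\<^sub>R dir_deriv b \<psi> x + dir_deriv b (dir_deriv b (\<zeta>n n)) x *\<^sub>R \<psi> x = 0" by simp
        qed
        moreover have "\<zeta>n n x = 1" using lt z(3) by (simp add: \<zeta>n_def)
        ultimately show "(norm (lap (\<psi>' n) x - lap \<psi> x))\<^sup>2 = 0" unfolding lap by simp
      qed
    qed
    show "AE x in lborel. norm ((norm (lap (\<psi>' n) x - lap \<psi> x))\<^sup>2) \<le> (W x)\<^sup>2" for n
      using sq by simp
  qed (use W2 in auto)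
  then have "(\<lambda>n. sqrt (LINT x|lborel. (norm (lap (\<psi>' n) x - lap \<psi> x))\<^sup>2)) \<longlonglongrightarrow> sqrt 0"
    by (intro tendsto_real_sqrt) simp
  then show "(\<lambda>n. nrm2 (\<lambda>x. lap (\<psi>' n) x - lap \<psi> x)) \<longlonglongrightarrow> 0" by (simp add: nrm2_def)
qed

section \<open>Sobolev norms expressed through transforms\<close>

lemma sobolev_weight:
  assumes f: "f \<in> sobolev s" and fg: "has_fourier_L2 f g"
  shows "integrable lborel (\<lambda>\<xi>. (1 + (norm \<xi>)\<^sup>2) powr s * (norm (g \<xi>))\<^sup>2)"
proof -
  obtain g' where g': "has_fourier_L2 f g'" and int: "integrable lborel (\<lambda>\<xi>. (1 + (norm \<xi>)\<^sup>2) powr s * (norm (g' \<xi>))\<^sup>2)"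
    using f by (auto simp: sobolev_def)
  note [measurable] = L2D(1)[OF has_fourier_L2_D(2)[OF g']] L2D(1)[OF has_fourier_L2_D(2)[OF fg]]
  have "AE \<xi> in lborel. (1 + (norm \<xi>)\<^sup>2) powr s * (norm (g \<xi>))\<^sup>2 = (1 + (norm \<xi>)\<^sup>2) powr s * (norm (g' \<xi>))\<^sup>2"
    using has_fourier_L2_unique[OF fg g'] by eventually_elim simp
  then show ?thesis by (subst integrable_cong_AE[where g="\<lambda>\<xi>. (1 + (norm \<xi>)\<^sup>2) powr s * (norm (g' \<xi>))\<^sup>2"]) (use int in simp_all)
qed

lemma sobolev_has_fourier: "f \<in> sobolev s \<Longrightarrow> has_fourier_L2 f (fourier_L2 f)"
  unfolding sobolev_def using has_fourier_L2_fourier_L2 by blast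

text \<open>The weight is at least 1 for s \<ge> 0. Integrability of the weighted difference has to
  be verified first, because a divergent integral would give \<open>sobolev_norm\<close> the value
  0.\<close>

lemma nrm2_le_sobolev_norm:
  assumes f: "f \<in> sobolev s" and f': "f' \<in> sobolev s" and s: "s \<ge> 0"
  shows "nrm2 (\<lambda>\<xi>. fourier_L2 f \<xi> - fourier_L2 f' \<xi>) \<le> sobolev_norm s (\<lambda>x. f x - f' x)"
proof -
  note F = sobolev_has_fourier[OF f] sobolev_has_fourier[OF f']
  note L = has_fourier_L2_D(2)[OF F(1)] has_fourier_L2_D(2)[OF F(2)]
  note [measurable] = L2D(1)[OF L(1)] L2D(1)[OF L(2)]
  let ?w = "\<lambda>\<xi>. (1 + (norm \<xi>)\<^sup>2) powr s"
  have i: "integrable lborel (\<lambda>\<xi>. ?w \<xi> * (norm (fourier_L2 f \<xi> - fourier_L2 f' \<xi>))\<^sup>2)"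
  proof (rule Bochner_Integration.integrable_bound)
    show "integrable lborel (\<lambda>\<xi>. 2 * (?w \<xi> * (norm (fourier_L2 f \<xi>))\<^sup>2) + 2 * (?w \<xi> * (norm (fourier_L2 f' \<xi>))\<^sup>2))"
      by (intro Bochner_Integration.integrable_add integrable_mult_right sobolev_weight[OF f F(1)] sobolev_weight[OF f' F(2)])
    show "AE \<xi> in lborel. norm (?w \<xi> * (norm (fourier_L2 f \<xi> - fourier_L2 f' \<xi>))\<^sup>2)
      \<le> norm (2 * (?w \<xi> * (norm (fourier_L2 f \<xi>))\<^sup>2) + 2 * (?w \<xi> * (norm (fourier_L2 f' \<xi>))\<^sup>2))"
    proof (intro AE_I2)
      fix \<xi> :: "real ^ 'a"
      have "?w \<xi> * (norm (fourier_L2 f \<xi> - fourier_L2 f' \<xi>))\<^sup>2 \<le> ?w \<xi> * (2 * (norm (fourier_L2 f \<xi>))\<^sup>2 + 2 * (norm (fourier_L2 f' \<xi>))\<^sup>2)"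
        by (intro mult_left_mono norm_diff_sq_le) simp
      then show "norm (?w \<xi> * (norm (fourier_L2 f \<xi> - fourier_L2 f' \<xi>))\<^sup>2)
        \<le> norm (2 * (?w \<xi> * (norm (fourier_L2 f \<xi>))\<^sup>2) + 2 * (?w \<xi> * (norm (fourier_L2 f' \<xi>))\<^sup>2))"
        by (simp add: distrib_left mult.left_commute[of 2])
    qed
  qed measurable
  show ?thesis
    unfolding sobolev_norm_eq[OF has_fourier_L2_diff[OF F]] nrm2_def
  proof (rule real_sqrt_le_mono, rule integral_mono[OF L2D(2)[OF L2_diff[OF L]] i])
    fix \<xi> :: "real ^ 'a"
    have "1 \<le> ?w \<xi>" using s by (intro ge_one_powr_ge_zero) auto
    then show "(norm (fourier_L2 f \<xi> - fourier_L2 f' \<xi>))\<^sup>2 \<le> ?w \<xi> * (norm (fourier_L2 f \<xi> - fourier_L2 f' \<xi>))\<^sup>2"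
      by (simp add: mult_le_cancel_right1)
  qed
qed

lemma continuous_bounded_support_L2:
  fixes g :: "real ^ 'n \<Rightarrow> complex"
  assumes g: "continuous_on UNIV g" and R: "\<And>x. norm x > R \<Longrightarrow> g x = 0"
  shows "g \<in> L2"
proof (rule L2I)
  show "g \<in> borel_measurable borel" by (rule borel_measurable_continuous_onI[OF g])
  have "integrable lborel (\<lambda>x. indicator (cball 0 R) x *\<^sub>R (norm (g x))\<^sup>2)"
    by (intro borel_integrable_compact continuous_intros continuous_on_subset[OF g]) auto
  also have "(\<lambda>x. indicator (cball 0 R) x *\<^sub>R (norm (g x))\<^sup>2) = (\<lambda>x. (norm (g x))\<^sup>2)"
    using R by (force simp: indicator_def fun_eq_iff)
  finally show "integrable lborel (\<lambda>x. (norm (g x))\<^sup>2)" .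
qed

lemma dir_deriv_product_space:
  fixes \<theta> :: "real \<Rightarrow> real" and g :: "real ^ 'n \<Rightarrow> complex"
  assumes \<theta>: "\<And>p. \<theta> differentiable (at p)" and g: "\<And>p. g differentiable (at p)"
  shows "dir_deriv (0, b) (\<lambda>p. \<theta> (fst p) *\<^sub>R g (snd p)) = (\<lambda>p. \<theta> (fst p) *\<^sub>R dir_deriv b g (snd p))" (is ?A)
    and "dir_deriv (1, 0) (\<lambda>p. \<theta> (fst p) *\<^sub>R g (snd p)) = (\<lambda>p. dir_deriv 1 \<theta> (fst p) *\<^sub>R g (snd p))" (is ?B)
proof -
  have f: "(fst has_derivative fst) (at p)" for p :: "real \<times> (real ^ 'n)"
    by (rule bounded_linear_imp_has_derivative[OF bounded_linear_fst])
  have sd: "(snd has_derivative snd) (at p)" for p :: "real \<times> (real ^ 'n)"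
    by (rule bounded_linear_imp_has_derivative[OF bounded_linear_snd])
  have df: "fst differentiable (at p)" for p :: "real \<times> (real ^ 'n)" unfolding differentiable_def using f by blast
  have d1: "(\<lambda>p. \<theta> (fst p)) differentiable (at p)" for p :: "real \<times> (real ^ 'n)"
    unfolding differentiable_def using has_derivative_compose[OF f has_derivative_dir_deriv[OF \<theta>]] by blast
  have d2: "(\<lambda>p. g (snd p)) differentiable (at p)" for p :: "real \<times> (real ^ 'n)"
    unfolding differentiable_def using has_derivative_compose[OF sd has_derivative_dir_deriv[OF g]] by blast
  have z: "dir_deriv 0 g x = 0" for x
    by (rule linear_0[OF has_derivative_linear[OF has_derivative_dir_deriv[OF g]]])
  have eq: "dir_deriv v (\<lambda>p. \<theta> (fst p) *\<^sub>R g (snd p)) p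
     = \<theta> (fst p) *\<^sub>R dir_deriv (snd v) g (snd p) + (fst v *\<^sub>R dir_deriv 1 \<theta> (fst p)) *\<^sub>R g (snd p)" for v and p :: "real \<times> (real ^ 'n)"
    unfolding dir_deriv_scaleR[OF d1 d2] dir_deriv_snd[OF g] dir_deriv_compose[OF df \<theta>] dir_deriv_eq[OF f] by simp
  show ?A ?B by (auto simp: eq z)
qed

section \<open>The weak solution on the Fourier side\<close>

context
  fixes a\<^sub>0 s :: real and a :: "real \<Rightarrow> real" and u :: "real \<Rightarrow> real ^ 'n \<Rightarrow> complex"
  assumes a: "set_integrable lborel {0<..} a" and a0: "0 \<le> a\<^sub>0" and s: "s \<ge> 0"
    and u: "continuous_sobolev s u" and sol: "distributional_solution a\<^sub>0 a u"
begin

lemma solution_fourier: "t \<ge> 0 \<Longrightarrow> has_fourier_L2 (u t) (fourier_L2 (u t))"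
  using u sobolev_has_fourier by (auto simp: continuous_sobolev_def)

lemma nrm2_solution_tendsto:
  assumes t: "t \<ge> 0"
  shows "((\<lambda>r. nrm2 (\<lambda>\<xi>. fourier_L2 (u r) \<xi> - fourier_L2 (u t) \<xi>)) \<longlongrightarrow> 0) (at t within {0..})"
proof (rule tendsto_sandwich[OF _ _ tendsto_const])
  show "((\<lambda>r. sobolev_norm s (\<lambda>x. u r x - u t x)) \<longlongrightarrow> 0) (at t within {0..})"
    using u t by (simp add: continuous_sobolev_def)
  show "\<forall>\<^sub>F r in at t within {0..}. nrm2 (\<lambda>\<xi>. fourier_L2 (u r) \<xi> - fourier_L2 (u t) \<xi>) \<le> sobolev_norm s (\<lambda>x. u r x - u t x)"
    using u t s by (auto simp: continuous_sobolev_def eventually_at_filter intro!: always_eventually nrm2_le_sobolev_norm)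
qed simp

lemma nrm2_solution_bounded:
  obtains S where "S \<ge> 0" "\<And>t. 0 \<le> t \<Longrightarrow> t \<le> T \<Longrightarrow> nrm2 (fourier_L2 (u t)) \<le> S"
proof -
  have "continuous_on {0..} (\<lambda>t. nrm2 (fourier_L2 (u t)))"
    unfolding continuous_on_def
  proof
    fix t :: real assume t: "t \<in> {0..}"
    show "((\<lambda>t. nrm2 (fourier_L2 (u t))) \<longlongrightarrow> nrm2 (fourier_L2 (u t))) (at t within {0..})"
    proof (rule LIM_zero_cancel, rule Lim_null_comparison)
      show "\<forall>\<^sub>F r in at t within {0..}. norm (nrm2 (fourier_L2 (u r)) - nrm2 (fourier_L2 (u t)))
        \<le> nrm2 (\<lambda>\<xi>. fourier_L2 (u r) \<xi> - fourier_L2 (u t) \<xi>)"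
        using t has_fourier_L2_D(2)[OF solution_fourier]
        by (auto simp: eventually_at_filter intro!: always_eventually abs_nrm2_diff_le)
    qed (use t in \<open>simp add: nrm2_solution_tendsto\<close>)
  qed
  then have "bounded ((\<lambda>t. nrm2 (fourier_L2 (u t))) ` {0..T})"
    by (intro compact_imp_bounded compact_continuous_image) (auto elim: continuous_on_subset)
  then obtain S where "\<forall>t\<in>{0..T}. norm (nrm2 (fourier_L2 (u t))) \<le> S" unfolding bounded_iff by blast
  then show ?thesis by (intro that[of "max S 0"]) (auto intro: max.coboundedI1)
qed

text \<open>Continuity in time is known in terms of transforms. The dual form of Plancherel's
  inequality brings it back to pairings in x, the form in which the equation is stated.\<close>

lemma pairing_solution_diff:
  assumes "r \<ge> 0" "t \<ge> 0" and \<phi>: "continuous_on UNIV \<phi>" "\<phi> \<in> L2"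
  shows "norm ((LINT x|lborel. u r x * \<phi> x) - (LINT x|lborel. u t x * \<phi> x))
    \<le> nrm2 (\<lambda>\<xi>. fourier_L2 (u r) \<xi> - fourier_L2 (u t) \<xi>) * nrm2 \<phi>"
proof -
  note F = solution_fourier[OF assms(1)] solution_fourier[OF assms(2)]
  have "(LINT x|lborel. u r x * \<phi> x) - (LINT x|lborel. u t x * \<phi> x) = (LINT x|lborel. (u r x - u t x) * \<phi> x)"
    using L2_pairing(1)[OF has_fourier_L2_D(1)[OF F(1)] \<phi>(2)] L2_pairing(1)[OF has_fourier_L2_D(1)[OF F(2)] \<phi>(2)]
    by (simp add: left_diff_distrib)
  then show ?thesis using pairing_le_fourier_norm[OF has_fourier_L2_diff[OF F] \<phi>] by simp
qed

lemma continuous_pairing_solution: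
  assumes \<phi>: "continuous_on UNIV \<phi>" "\<phi> \<in> L2"
  shows "continuous_on {0..} (\<lambda>t. LINT x|lborel. u t x * \<phi> x)"
  unfolding continuous_on_def
proof
  fix t :: real assume t: "t \<in> {0..}"
  have lim: "((\<lambda>r. nrm2 (\<lambda>\<xi>. fourier_L2 (u r) \<xi> - fourier_L2 (u t) \<xi>) * nrm2 \<phi>) \<longlongrightarrow> 0 * nrm2 \<phi>) (at t within {0..})"
    by (intro tendsto_intros nrm2_solution_tendsto) (use t in simp)
  show "((\<lambda>t. LINT x|lborel. u t x * \<phi> x) \<longlongrightarrow> (LINT x|lborel. u t x * \<phi> x)) (at t within {0..})"
  proof (rule LIM_zero_cancel, rule Lim_null_comparison[OF _ lim[unfolded mult_zero_left]])
    show "\<forall>\<^sub>F r in at t within {0..}. norm ((LINT x|lborel. u r x * \<phi> x) - (LINT x|lborel. u t x * \<phi> x))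
        \<le> nrm2 (\<lambda>\<xi>. fourier_L2 (u r) \<xi> - fourier_L2 (u t) \<xi>) * nrm2 \<phi>"
      using t by (auto simp: eventually_at_filter intro!: always_eventually pairing_solution_diff \<phi>)
  qed
qed

text \<open>Products \<theta>(t) g(x) are admissible test functions and leave a weak equation in t
  alone, to which the du Bois-Reymond lemma applies. The factor \<theta>(t) comes out of the memory
  integral because the test function is evaluated at the outer time t.\<close>

lemma solution_smooth_pairing:
  assumes g: "\<And>m. cont_differentiable m g" and R: "\<And>x. norm x > R \<Longrightarrow> g x = 0" and t: "t \<ge> 0"
  shows "(LINT x|lborel. u t x * g x) = (LINT x|lborel. u 0 x * g x) + volt_int a\<^sub>0 a (\<lambda>r. LINT x|lborel. u r x * lap g x) t"
proof -
  define G where "G t = (LINT x|lborel. u t x * g x)" for t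
  define H where "H t = (LINT x|lborel. u t x * lap g x)" for t
  have gc: "continuous_on UNIV g" using g[of 0] by simp
  have lc: "continuous_on UNIV (lap g)" by (rule continuous_lap[OF g])
  have lR: "lap g x = 0" if "norm x > R" for x
  proof -
    have o: "open {x::real ^ 'n. norm x > R}" by (intro open_Collect_less continuous_intros)
    have 1: "dir_deriv b g y = 0" if "norm y > R" for b y
      by (rule dir_deriv_locally_const[OF o, of y _ 0]) (use that R in auto)
    have "dir_deriv b (dir_deriv b g) x = 0" for b
      by (rule dir_deriv_locally_const[OF o, of x _ 0]) (use that 1 in auto)
    then show ?thesis by (simp add: lap_def)
  qed
  have Gc: "continuous_on {0..} G"
    unfolding G_def by (rule continuous_pairing_solution[OF gc continuous_bounded_support_L2[OF gc R]])
  have Hc: "continuous_on {0..} H"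
    unfolding H_def by (rule continuous_pairing_solution[OF lc continuous_bounded_support_L2[OF lc lR]])
  have "G t = G 0 + integral {0..t} (volt a\<^sub>0 a H)"
  proof (rule weak_derivative_imp_integral[OF Gc continuous_volt[OF a a0 refl Hc] _ t])
    fix \<theta> :: "real \<Rightarrow> real" and \<sigma> T :: real
    assume \<theta>: "\<And>m. cont_differentiable m \<theta>" and \<sigma>: "0 < \<sigma>" and supp: "\<And>t. t \<notin> {\<sigma>..T} \<Longrightarrow> \<theta> t = 0"
    define \<phi> where "\<phi> p = \<theta> (fst p) *\<^sub>R g (snd p)" for p
    have d\<theta>: "\<theta> differentiable (at p)" for p using \<theta>[of 1] by simp
    have dg: "g differentiable (at p)" for p using g[of 1] by simp
    have dg2: "dir_deriv b g differentiable (at p)" if "b \<in> Basis" for b p using g[of "Suc (Suc 0)"] that by simp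
    have "test_function \<phi>"
      unfolding test_function_def
    proof (intro conjI allI)
      show "cont_differentiable m \<phi>" for m
        unfolding \<phi>_def
        by (intro cont_differentiable_scaleR cont_differentiable_snd g cont_differentiable_compose[OF \<theta>]
            cont_differentiable_bounded_linear bounded_linear_fst)
      have sub: "{p. \<phi> p \<noteq> 0} \<subseteq> {\<sigma>..T} \<times> cball 0 R"
        using supp R by (force simp: \<phi>_def)
      have cp: "compact ({\<sigma>..T} \<times> cball (0::real ^ 'n) R)" by (intro compact_Times compact_cball compact_Icc)
      show "compact (closure {p. \<phi> p \<noteq> 0})"
        unfolding compact_closure by (rule bounded_subset[OF compact_imp_bounded[OF cp] sub])
      have "closure {p. \<phi> p \<noteq> 0} \<subseteq> {\<sigma>..T} \<times> cball 0 R"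
        by (rule closure_minimal[OF sub compact_imp_closed[OF cp]])
      then show "closure {p. \<phi> p \<noteq> 0} \<subseteq> {0<..} \<times> UNIV" using \<sigma> by auto
    qed
    moreover have "time_deriv \<phi> (t, x) = dir_deriv 1 \<theta> t *\<^sub>R g x" for t x
      unfolding time_deriv_def \<phi>_def dir_deriv_product_space(2)[OF d\<theta> dg] by simp
    moreover have "space_laplacian \<phi> (t, x) = \<theta> t *\<^sub>R lap g x" for t x
    proof -
      have "dir_deriv (0, b) (dir_deriv (0, b) \<phi>) (t, x) = \<theta> t *\<^sub>R dir_deriv b (dir_deriv b g) x" if "b \<in> Basis" for b
        unfolding \<phi>_def dir_deriv_product_space(1)[OF d\<theta> dg] dir_deriv_product_space(1)[OF d\<theta> dg2[OF that]] by simp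
      then have "(\<Sum>b\<in>Basis. dir_deriv (0, b) (dir_deriv (0, b) \<phi>) (t, x)) = (\<Sum>b\<in>Basis. \<theta> t *\<^sub>R dir_deriv b (dir_deriv b g) x)"
        by (rule sum.cong[OF refl])
      then show ?thesis unfolding space_laplacian_def lap_def scaleR_sum_right .
    qed
    ultimately have "- (LINT t:{0<..}|lborel. dir_deriv 1 \<theta> t *\<^sub>R G t)
       = (LINT t:{0<..}|lborel. a\<^sub>0 *\<^sub>R (\<theta> t *\<^sub>R H t) + (LINT r:{0<..<t}|lborel. a (t - r) *\<^sub>R (\<theta> t *\<^sub>R H r)))"
      using sol unfolding distributional_solution_def G_def H_def by (auto simp: mult_scaleR_right)
    also have "(\<lambda>t. a\<^sub>0 *\<^sub>R (\<theta> t *\<^sub>R H t) + (LINT r:{0<..<t}|lborel. a (t - r) *\<^sub>R (\<theta> t *\<^sub>R H r))) = (\<lambda>t. \<theta> t *\<^sub>R volt a\<^sub>0 a H t)"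
    proof
      fix t
      have "(LINT r:{0<..<t}|lborel. a (t - r) *\<^sub>R (\<theta> t *\<^sub>R H r)) = \<theta> t *\<^sub>R conv a H t"
        unfolding conv_def set_lebesgue_integral_def integral_scaleR_right[symmetric]
        by (simp add: scaleR_scaleR mult_ac)
      then show "a\<^sub>0 *\<^sub>R (\<theta> t *\<^sub>R H t) + (LINT r:{0<..<t}|lborel. a (t - r) *\<^sub>R (\<theta> t *\<^sub>R H r)) = \<theta> t *\<^sub>R volt a\<^sub>0 a H t"
        by (simp add: volt_def scaleR_add_right mult.commute)
    qed
    finally show "- (LINT t:{0<..}|lborel. dir_deriv 1 \<theta> t *\<^sub>R G t) = (LINT t:{0<..}|lborel. \<theta> t *\<^sub>R volt a\<^sub>0 a H t)" .
  qed
  then show ?thesis by (simp add: G_def H_def[abs_def] volt_int_def)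
qed

lemma continuous_fourier_pairing:
  assumes h: "bsupp h"
  shows "continuous_on {0..} (\<lambda>t. LINT \<xi>|lborel. fourier_L2 (u t) \<xi> * h \<xi>)"
proof -
  have hL: "h \<in> L2" "integrable lborel h" using h bsupp_integrable by (auto simp: bsupp_def)
  have "continuous_on {0..} (\<lambda>t. LINT x|lborel. u t x * ft h x)"
    by (intro continuous_pairing_solution continuous_ft ft_L2 hL)
  then show ?thesis
    by (rule continuous_on_eq) (use has_fourier_L2_pairing[OF solution_fourier hL] in auto)
qed

text \<open>The function \<open>ft h\<close> is smooth and square integrable but lacks compact
  support, so it is cut off. The pairings converge by dominated convergence, and the memory term
  converges because its error is bounded by M S \<epsilon> n t, uniformly over past times.\<close>

lemma solution_fourier_pairing:
  assumes h: "bsupp h" and t: "t \<ge> 0"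
  shows "(LINT \<xi>|lborel. fourier_L2 (u t) \<xi> * h \<xi>) = (LINT \<xi>|lborel. fourier_L2 (u 0) \<xi> * h \<xi>)
    - volt_int a\<^sub>0 a (\<lambda>r. LINT \<xi>|lborel. fourier_L2 (u r) \<xi> * (of_real ((norm \<xi>)\<^sup>2) * h \<xi>)) t"
proof -
  have h2: "bsupp (\<lambda>\<xi>. of_real ((norm \<xi>)\<^sup>2) * h \<xi>)" by (intro bsupp_mult h continuous_intros)
  have bL: "k \<in> L2 \<and> integrable lborel k" if "bsupp k" for k :: "real ^ 'n \<Rightarrow> complex"
    using that bsupp_integrable by (auto simp: bsupp_def)
  note hL = bL[OF h, THEN conjunct1] bL[OF h, THEN conjunct2] and h2L = bL[OF h2, THEN conjunct1] bL[OF h2, THEN conjunct2]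
  obtain \<zeta> :: "real ^ 'n \<Rightarrow> real" where \<zeta>: "cutoff \<zeta>" using cutoff_exists by blast
  define \<psi> where "\<psi> n x = \<zeta> ((1 / Suc n) *\<^sub>R x) *\<^sub>R ft h x" for n x
  have fL: "ft h \<in> L2" by (rule ft_L2[OF hL])
  have lapL: "lap (ft h) = (\<lambda>x. - ft (\<lambda>\<xi>. of_real ((norm \<xi>)\<^sup>2) * h \<xi>) x)" by (rule ext) (rule lap_ft[OF h])
  have lL: "lap (ft h) \<in> L2"
    unfolding lapL using L2_cmult[OF ft_L2(1)[OF h2L], of "-1"] by simp
  have d1L: "dir_deriv b (ft h) \<in> L2" for b
    unfolding dir_deriv_ft[OF h] using bL[OF bsupp_inner[OF h, of b]] by (intro ft_L2) auto
  have s: "cont_differentiable m (ft h)" for m by (rule cont_differentiable_ft[OF h])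
  note cl = cutoff_lap_tendsto[OF \<zeta> s fL d1L lL, folded \<psi>_def]
  have \<psi>s: "cont_differentiable m (\<psi> n)" for m n
    unfolding \<psi>_def using \<zeta> by (intro cont_differentiable_scaleR cont_differentiable_scale_arg s) (auto simp: cutoff_def)
  have \<psi>R: "\<psi> n x = 0" if "norm x > 2 * real (Suc n)" for n x
  proof -
    have "norm ((1 / Suc n) *\<^sub>R x) \<ge> 2" using that by (simp add: le_divide_eq del: of_nat_Suc)
    then show ?thesis using \<zeta> by (simp add: \<psi>_def cutoff_def)
  qed
  define G where "G r = (LINT x|lborel. u r x * ft h x)" for r
  define Gn where "Gn n r = (LINT x|lborel. u r x * \<psi> n x)" for n r
  define H where "H r = (LINT x|lborel. u r x * lap (ft h) x)" for r
  define Hn where "Hn n r = (LINT x|lborel. u r x * lap (\<psi> n) x)" for n r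
  define \<epsilon> where "\<epsilon> n = nrm2 (\<lambda>x. lap (\<psi> n) x - lap (ft h) x)" for n
  have eqn: "Gn n t = Gn n 0 + volt_int a\<^sub>0 a (Hn n) t" for n
    unfolding Gn_def Hn_def[abs_def] by (rule solution_smooth_pairing[OF \<psi>s \<psi>R t])
  have Gn_lim: "(\<lambda>n. Gn n r) \<longlonglongrightarrow> G r" if r: "r \<ge> 0" for r
    unfolding Gn_def G_def
  proof (rule integral_dominated_convergence[where w="\<lambda>x. norm (u r x * ft h x)"])
    have uL: "u r \<in> L2" by (rule has_fourier_L2_D(1)[OF solution_fourier[OF r]])
    note [measurable] = L2D(1)[OF uL] L2D(1)[OF fL]
    have [measurable]: "\<psi> n \<in> borel_measurable borel" for n
      using \<psi>s[of 0 n] by (intro borel_measurable_continuous_onI) simp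
    show "(\<lambda>x. u r x * ft h x) \<in> borel_measurable lborel" "(\<lambda>x. u r x * \<psi> n x) \<in> borel_measurable lborel" for n
      by measurable
    show "integrable lborel (\<lambda>x. norm (u r x * ft h x))" by (intro integrable_norm L2_pairing(1) uL fL)
    show "AE x in lborel. (\<lambda>n. u r x * \<psi> n x) \<longlonglongrightarrow> u r x * ft h x"
    proof (intro AE_I2 tendsto_eventually)
      fix x :: "real ^ 'n"
      have "\<forall>\<^sub>F n in sequentially. real (Suc n) \<ge> norm x" by real_asymp
      then show "\<forall>\<^sub>F n in sequentially. u r x * \<psi> n x = u r x * ft h x"
      proof eventually_elim
        fix n assume "real (Suc n) \<ge> norm x"
        then have "norm ((1 / Suc n) *\<^sub>R x) \<le> 1" by (simp add: field_simps del: of_nat_Suc)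
        then show "u r x * \<psi> n x = u r x * ft h x" using \<zeta> by (simp add: \<psi>_def cutoff_def)
      qed
    qed
    show "AE x in lborel. norm (u r x * \<psi> n x) \<le> norm (u r x * ft h x)" for n
    proof (intro AE_I2)
      fix x
      have "\<bar>\<zeta> y\<bar> \<le> 1" for y using \<zeta> by (simp add: cutoff_def)
      then have "norm (\<psi> n x) \<le> norm (ft h x)" by (simp add: \<psi>_def mult_left_le_one_le)
      then show "norm (u r x * \<psi> n x) \<le> norm (u r x * ft h x)" by (simp add: norm_mult mult_left_mono)
    qed
  qed
  have cd: "continuous_on UNIV (\<lambda>x. lap (\<psi> n) x - lap (ft h) x)" for n
    by (intro continuous_intros continuous_lap \<psi>s s)
  have Hd: "Hn n r - H r = (LINT x|lborel. u r x * (lap (\<psi> n) x - lap (ft h) x))" if "r \<ge> 0" for n r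
  proof -
    note uL = has_fourier_L2_D(1)[OF solution_fourier[OF that]]
    have "Hn n r = (LINT x|lborel. u r x * (lap (\<psi> n) x - lap (ft h) x) + u r x * lap (ft h) x)"
      by (simp add: Hn_def algebra_simps)
    then show ?thesis using L2_pairing(1)[OF uL cl(1)] L2_pairing(1)[OF uL lL] by (simp add: H_def)
  qed
  obtain S where S: "S \<ge> 0" "\<And>r. 0 \<le> r \<Longrightarrow> r \<le> t \<Longrightarrow> nrm2 (fourier_L2 (u r)) \<le> S"
    using nrm2_solution_bounded by blast
  have Hc: "continuous_on {0..} H"
    unfolding H_def by (intro continuous_pairing_solution continuous_lap s lL)
  have dc: "continuous_on {0..} (\<lambda>r. Hn n r - H r)" for n
    by (rule continuous_on_eq[OF continuous_pairing_solution[OF cd cl(1)]]) (use Hd in auto)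
  have Hnc: "continuous_on {0..} (Hn n)" for n
    using continuous_on_add[OF dc Hc] by simp
  define M where "M = a\<^sub>0 + (LINT s:{0<..}|lborel. \<bar>a s\<bar>)"
  have "norm (volt_int a\<^sub>0 a (Hn n) t - volt_int a\<^sub>0 a H t) \<le> M * (S * \<epsilon> n) * t" for n
  proof -
    have "norm (volt_int a\<^sub>0 a (\<lambda>r. Hn n r - H r) t) \<le> M * (S * \<epsilon> n) * t ^ Suc 0 / Suc 0"
    proof (rule norm_volt_int_le[OF a a0 M_def dc _ _ t])
      fix r assume r: "0 \<le> r" "r \<le> t"
      have "norm (Hn n r - H r) \<le> nrm2 (fourier_L2 (u r)) * \<epsilon> n"
        unfolding Hd[OF r(1)] \<epsilon>_def by (rule pairing_le_fourier_norm[OF solution_fourier[OF r(1)] cd cl(1)])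
      also have "\<dots> \<le> S * \<epsilon> n" using S(2)[OF r] by (intro mult_right_mono) (auto simp: \<epsilon>_def)
      finally show "norm (Hn n r - H r) \<le> S * \<epsilon> n * r ^ 0" by simp
    qed (use S in \<open>simp add: \<epsilon>_def\<close>)
    then show ?thesis by (simp add: volt_int_diff[OF a a0 refl Hnc Hc])
  qed
  then have "\<forall>\<^sub>F n in sequentially. norm (volt_int a\<^sub>0 a (Hn n) t - volt_int a\<^sub>0 a H t) \<le> M * (S * \<epsilon> n) * t" by simp
  moreover have "(\<lambda>n. M * (S * \<epsilon> n) * t) \<longlonglongrightarrow> M * (S * 0) * t"
    using cl(2) unfolding \<epsilon>_def by (intro tendsto_intros)
  ultimately have "(\<lambda>n. volt_int a\<^sub>0 a (Hn n) t - volt_int a\<^sub>0 a H t) \<longlonglongrightarrow> 0"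
    using Lim_null_comparison by fastforce
  then have "(\<lambda>n. volt_int a\<^sub>0 a (Hn n) t) \<longlonglongrightarrow> volt_int a\<^sub>0 a H t" by (rule LIM_zero_cancel)
  then have "(\<lambda>n. Gn n t) \<longlonglongrightarrow> G 0 + volt_int a\<^sub>0 a H t"
    unfolding eqn by (intro tendsto_intros Gn_lim) simp_all
  then have GH: "G t = G 0 + volt_int a\<^sub>0 a H t" using Gn_lim[OF t] LIMSEQ_unique by blast
  define F where "F r = (LINT \<xi>|lborel. fourier_L2 (u r) \<xi> * (of_real ((norm \<xi>)\<^sup>2) * h \<xi>))" for r
  \<comment> \<open>The minus sign is that of the symbol of the Laplacian; it is written as a
    difference so that \<open>volt_int_diff\<close> can extract it.\<close>
  have HF: "H r = 0 - F r" if "r \<ge> 0" for r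
    unfolding H_def F_def lapL using has_fourier_L2_pairing[OF solution_fourier[OF that] h2L] by simp
  have Fc: "continuous_on {0..} F" unfolding F_def by (rule continuous_fourier_pairing[OF h2])
  have "volt_int a\<^sub>0 a H t = volt_int a\<^sub>0 a (\<lambda>r. 0 - F r) t"
    unfolding volt_int_def
  proof (rule Henstock_Kurzweil_Integration.integral_cong)
    fix r assume "r \<in> {0..t}"
    then show "volt a\<^sub>0 a H r = volt a\<^sub>0 a (\<lambda>r. 0 - F r) r"
      unfolding volt_def by (intro arg_cong2[where f="(+)"] arg_cong2[where f="(*\<^sub>R)"] conv_cong HF refl) auto
  qed
  also have "\<dots> = volt_int a\<^sub>0 a (\<lambda>_. 0) t - volt_int a\<^sub>0 a F t"
    by (rule volt_int_diff[OF a a0 refl]) (auto intro: Fc continuous_intros)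
  also have "volt_int a\<^sub>0 a (\<lambda>_. 0::complex) t = 0"
    using volt_int_const[OF a a0 refl, of "0::complex" t] by simp
  finally have "G t = G 0 - volt_int a\<^sub>0 a F t" using GH by simp
  then show ?thesis
    unfolding G_def F_def[abs_def] using has_fourier_L2_pairing[OF solution_fourier hL] t by simp
qed

text \<open>On the support of h the factor |\<xi>|^(2m) is at most R^(2m), which is the geometric
  growth allowed in \<open>volt_expansion\<close>. The same bound permits summing the series under
  the integral, where it is the Neumann series at \<mu> = |\<xi>|^2.\<close>

lemma fourier_pairing_volt_sol:
  assumes h: "bsupp h" and t: "t \<ge> 0"
  shows "(LINT \<xi>|lborel. fourier_L2 (u t) \<xi> * h \<xi>)
    = (LINT \<xi>|lborel. volt_sol a\<^sub>0 a ((norm \<xi>)\<^sup>2) t *\<^sub>R (fourier_L2 (u 0) \<xi> * h \<xi>))"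
proof -
  obtain R0 where R0: "\<And>\<xi>. norm \<xi> > R0 \<Longrightarrow> h \<xi> = 0" using h by (auto simp: bsupp_def)
  define R where "R = max R0 0"
  have R: "R \<ge> 0" "\<And>\<xi>. norm \<xi> > R \<Longrightarrow> h \<xi> = 0" using R0 by (auto simp: R_def)
  define k where "k m \<xi> = of_real (((norm \<xi>)\<^sup>2) ^ m) * h \<xi>" for m \<xi>
  have k: "bsupp (k m)" for m unfolding k_def by (intro bsupp_mult h continuous_intros)
  have kS: "of_real ((norm \<xi>)\<^sup>2) * k m \<xi> = k (Suc m) \<xi>" for m \<xi> by (simp add: k_def mult_ac)
  have hL: "h \<in> L2" and kL: "k m \<in> L2" for m using h k by (auto simp: bsupp_def)
  have kn: "norm (k m \<xi>) \<le> (R\<^sup>2) ^ m * norm (h \<xi>)" for m \<xi>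
  proof (cases "norm \<xi> > R")
    case False
    then have "((norm \<xi>)\<^sup>2) ^ m \<le> (R\<^sup>2) ^ m" by (intro power_mono) auto
    then show ?thesis by (simp add: k_def norm_mult norm_power mult_right_mono)
  qed (simp add: R k_def)
  have kn2: "nrm2 (k m) \<le> (R\<^sup>2) ^ m * nrm2 h" for m
  proof -
    have "(nrm2 (k m))\<^sup>2 \<le> (LINT \<xi>|lborel. ((R\<^sup>2) ^ m)\<^sup>2 * (norm (h \<xi>))\<^sup>2)"
      unfolding nrm2_sq
    proof (intro integral_mono integrable_mult_right L2D(2) hL kL)
      show "(norm (k m \<xi>))\<^sup>2 \<le> ((R\<^sup>2) ^ m)\<^sup>2 * (norm (h \<xi>))\<^sup>2" for \<xi>
        using power_mono[OF kn[of m \<xi>], of 2] by (simp only: power_mult_distrib norm_ge_zero)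
    qed
    also have "\<dots> = ((R\<^sup>2) ^ m * nrm2 h)\<^sup>2" by (simp only: integral_mult_right_zero nrm2_sq[symmetric] power_mult_distrib)
    finally show ?thesis by (rule power2_le_imp_le) simp
  qed
  define f where "f m r = (LINT \<xi>|lborel. fourier_L2 (u r) \<xi> * k m \<xi>)" for m r
  obtain S where S: "S \<ge> 0" "\<And>r. 0 \<le> r \<Longrightarrow> r \<le> t \<Longrightarrow> nrm2 (fourier_L2 (u r)) \<le> S"
    using nrm2_solution_bounded by blast
  have f: "(\<lambda>m. ((-1) ^ m * volt_iter a\<^sub>0 a m t) *\<^sub>R f m 0) sums f 0 t"
  proof (rule volt_expansion[OF a a0 refl, where T=t and C="S * nrm2 h" and R="R\<^sup>2"])
    show "continuous_on {0..} (f m)" for m unfolding f_def by (rule continuous_fourier_pairing[OF k])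
    show "f m r = f m 0 - volt_int a\<^sub>0 a (f (Suc m)) r" if "r \<ge> 0" for m r
      using solution_fourier_pairing[OF k[of m] that] by (simp only: kS f_def[abs_def])
    fix m r assume r: "0 \<le> r" "r \<le> t"
    have "norm (f m r) \<le> nrm2 (fourier_L2 (u r)) * nrm2 (k m)"
      unfolding f_def by (rule L2_pairing(2)[OF has_fourier_L2_D(2)[OF solution_fourier[OF r(1)]] kL])
    also have "\<dots> \<le> S * ((R\<^sup>2) ^ m * nrm2 h)" using S(2)[OF r] S(1) by (intro mult_mono kn2) auto
    finally show "norm (f m r) \<le> S * nrm2 h * (R\<^sup>2) ^ m" by (simp add: mult_ac)
  qed (use S t in auto)
  define M where "M = a\<^sub>0 + (LINT s:{0<..}|lborel. \<bar>a s\<bar>)"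
  have M: "M \<ge> 0" by (rule M_nonneg[OF a a0 M_def])
  define e where "e m = (M * t) ^ m / fact m * (R\<^sup>2) ^ m" for m :: nat
  have e: "summable e"
    using summable_exp[of "M * t * R\<^sup>2"] by (simp add: e_def[abs_def] power_mult_distrib field_simps)
  let ?v = "fourier_L2 (u 0)"
  define F where "F m \<xi> = ((-1) ^ m * volt_iter a\<^sub>0 a m t) *\<^sub>R (?v \<xi> * k m \<xi>)" for m \<xi>
  note vL = has_fourier_L2_D(2)[OF solution_fourier[of 0]]
  have Fn: "norm (F m \<xi>) \<le> e m * norm (?v \<xi> * h \<xi>)" for m \<xi>
  proof -
    have "norm (F m \<xi>) = \<bar>volt_iter a\<^sub>0 a m t\<bar> * (norm (?v \<xi>) * norm (k m \<xi>))"
      by (simp add: F_def norm_mult abs_mult)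
    also have "\<dots> \<le> (M * t) ^ m / fact m * (norm (?v \<xi>) * ((R\<^sup>2) ^ m * norm (h \<xi>)))"
      using volt_iter_le[OF a a0 M_def t, of m] M t by (intro mult_mono kn mult_nonneg_nonneg) auto
    finally show ?thesis by (simp add: e_def norm_mult mult_ac)
  qed
  have Fi: "integrable lborel (F m)" for m
    unfolding F_def by (intro integrable_scaleR_right L2_pairing(1) vL kL) simp
  have vh: "integrable lborel (\<lambda>\<xi>. norm (?v \<xi> * h \<xi>))" by (intro integrable_norm L2_pairing(1) vL hL) simp
  have "(\<lambda>m. integral\<^sup>L lborel (F m)) sums (LINT \<xi>|lborel. (\<Sum>m. F m \<xi>))"
  proof (rule sums_integral[OF Fi])
    show "AE \<xi> in lborel. summable (\<lambda>m. norm (F m \<xi>))"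
    proof (intro AE_I2)
      fix \<xi>
      show "summable (\<lambda>m. norm (F m \<xi>))"
        by (rule summable_comparison_test'[OF summable_mult2[OF e, of "norm (?v \<xi> * h \<xi>)"], where N=0]) (use Fn in simp)
    qed
    show "summable (\<lambda>m. LINT \<xi>|lborel. norm (F m \<xi>))"
    proof (rule summable_comparison_test'[OF summable_mult2[OF e], where N=0])
      fix m
      have "(LINT \<xi>|lborel. norm (F m \<xi>)) \<le> (LINT \<xi>|lborel. e m * norm (?v \<xi> * h \<xi>))"
        by (intro integral_mono integrable_norm Fi integrable_mult_right vh Fn)
      then show "norm (LINT \<xi>|lborel. norm (F m \<xi>)) \<le> e m * (LINT \<xi>|lborel. norm (?v \<xi> * h \<xi>))" by simp
    qed
  qed
  moreover have "(\<Sum>m. F m \<xi>) = volt_sol a\<^sub>0 a ((norm \<xi>)\<^sup>2) t *\<^sub>R (?v \<xi> * h \<xi>)" for \<xi>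
  proof (rule sums_unique[symmetric])
    have "(\<lambda>m. ((- ((norm \<xi>)\<^sup>2)) ^ m * volt_iter a\<^sub>0 a m t) *\<^sub>R (?v \<xi> * h \<xi>)) sums (volt_sol a\<^sub>0 a ((norm \<xi>)\<^sup>2) t *\<^sub>R (?v \<xi> * h \<xi>))"
      by (rule sums_scaleR_left[OF volt_sol_sums[OF a a0 refl t]])
    moreover have "((- ((norm \<xi>)\<^sup>2)) ^ m * volt_iter a\<^sub>0 a m t) *\<^sub>R (?v \<xi> * h \<xi>) = F m \<xi>" for m
      unfolding F_def k_def power_minus[of "(norm \<xi>)\<^sup>2"] by (simp add: scaleR_conv_of_real mult_ac)
    ultimately show "(\<lambda>m. F m \<xi>) sums (volt_sol a\<^sub>0 a ((norm \<xi>)\<^sup>2) t *\<^sub>R (?v \<xi> * h \<xi>))" by simp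
  qed
  moreover have "integral\<^sup>L lborel (F m) = ((-1) ^ m * volt_iter a\<^sub>0 a m t) *\<^sub>R f m 0" for m
    by (simp add: F_def[abs_def] f_def)
  ultimately have "(\<lambda>m. ((-1) ^ m * volt_iter a\<^sub>0 a m t) *\<^sub>R f m 0) sums
      (LINT \<xi>|lborel. volt_sol a\<^sub>0 a ((norm \<xi>)\<^sup>2) t *\<^sub>R (?v \<xi> * h \<xi>))"
    by simp
  with f have "f 0 t = (LINT \<xi>|lborel. volt_sol a\<^sub>0 a ((norm \<xi>)\<^sup>2) t *\<^sub>R (?v \<xi> * h \<xi>))" by (rule sums_unique2)
  then show ?thesis by (simp add: f_def k_def)
qed

text \<open>The weak identity separates points: tested with the conjugate of the defect on a ball,
  it says that the square integral of the defect there is 0. Countably many balls cover the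
  space.\<close>

lemma fourier_solution:
  assumes t: "t \<ge> 0" and z: "\<And>\<mu>. \<mu> \<ge> 0 \<Longrightarrow> \<bar>volt_sol a\<^sub>0 a \<mu> t\<bar> \<le> 2"
  shows "AE \<xi> in lborel. fourier_L2 (u t) \<xi> = of_real (volt_sol a\<^sub>0 a ((norm \<xi>)\<^sup>2) t) * fourier_L2 (u 0) \<xi>"
proof -
  let ?z = "\<lambda>\<xi>::real ^ 'n. of_real (volt_sol a\<^sub>0 a ((norm \<xi>)\<^sup>2) t) :: complex"
  note vL = has_fourier_L2_D(2)[OF solution_fourier[OF t]] has_fourier_L2_D(2)[OF solution_fourier[OF order_refl]]
  have [measurable]: "(\<lambda>\<mu>. volt_sol a\<^sub>0 a \<mu> t) \<in> borel_measurable borel" by (rule borel_measurable_volt_sol[OF a a0 refl t])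
  have zL: "(\<lambda>\<xi>. ?z \<xi> * fourier_L2 (u 0) \<xi>) \<in> L2"
    by (rule L2_bounded_mult[OF vL(2), where B=2]) (measurable, simp add: z)
  define w where "w \<xi> = fourier_L2 (u t) \<xi> - ?z \<xi> * fourier_L2 (u 0) \<xi>" for \<xi>
  have wL: "w \<in> L2" unfolding w_def by (intro L2_diff vL zL)
  have "AE \<xi> in lborel. \<xi> \<in> ball 0 (real n) \<longrightarrow> w \<xi> = 0" for n
  proof -
    \<comment> \<open>The bound 2 on the scalar solutions puts w in L2; the truncation then makes
      its conjugate an admissible test object.\<close>
    define h where "h \<xi> = indicator (ball 0 (real n)) \<xi> *\<^sub>R cnj (w \<xi>)" for \<xi>
    have hL: "h \<in> L2" unfolding h_def by (rule trunc_L2(1)[OF L2_cnj[OF wL]])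
    have h: "bsupp h"
      unfolding bsupp_def using hL by (auto simp: h_def indicator_def intro!: exI[of _ "real n"])
    have "(LINT \<xi>|lborel. w \<xi> * h \<xi>) = (LINT \<xi>|lborel. fourier_L2 (u t) \<xi> * h \<xi>) - (LINT \<xi>|lborel. ?z \<xi> * fourier_L2 (u 0) \<xi> * h \<xi>)"
      unfolding w_def using L2_pairing(1)[OF vL(1) hL] L2_pairing(1)[OF zL hL] by (simp add: left_diff_distrib)
    also have "\<dots> = 0"
      unfolding fourier_pairing_volt_sol[OF h t] by (simp add: scaleR_conv_of_real mult.assoc)
    finally have "(LINT \<xi>|lborel. w \<xi> * h \<xi>) = 0" .
    moreover have "w \<xi> * h \<xi> = of_real (indicator (ball 0 (real n)) \<xi> * (norm (w \<xi>))\<^sup>2)" for \<xi>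
      by (simp add: h_def indicator_def complex_norm_square[symmetric])
    ultimately have 0: "(LINT \<xi>|lborel. indicator (ball 0 (real n)) \<xi> * (norm (w \<xi>))\<^sup>2) = 0"
      by (simp only: integral_complex_of_real of_real_eq_0_iff)
    have i: "integrable lborel (\<lambda>\<xi>. indicator (ball 0 (real n)) \<xi> * (norm (w \<xi>))\<^sup>2)"
      using integrable_real_mult_indicator[OF _ L2D(2)[OF wL], of "ball 0 (real n)"] by (simp add: mult.commute)
    have "AE \<xi> in lborel. indicator (ball 0 (real n)) \<xi> * (norm (w \<xi>))\<^sup>2 = 0"
      using integral_nonneg_eq_0_iff_AE[OF i] 0 by auto
    then show ?thesis by eventually_elim (auto simp: indicator_def)
  qed
  then have "AE \<xi> in lborel. \<forall>n. \<xi> \<in> ball 0 (real n) \<longrightarrow> w \<xi> = 0" unfolding AE_all_countable by blast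
  then show ?thesis
  proof eventually_elim
    fix \<xi> assume *: "\<forall>n. \<xi> \<in> ball 0 (real n) \<longrightarrow> w \<xi> = 0"
    obtain n where "norm \<xi> < real n" using reals_Archimedean2 by blast
    then have "w \<xi> = 0" using * by auto
    then show "fourier_L2 (u t) \<xi> = ?z \<xi> * fourier_L2 (u 0) \<xi>" by (simp add: w_def)
  qed
qed

end

section \<open>The scaling limit\<close>

text \<open>Apply x \<le> exp x to x = \<sigma> (1 + y) / s and raise to the power s; s = 0 is set
  apart because of the division.\<close>

lemma powr_le_exp:
  fixes s \<sigma> :: real
  assumes s: "s \<ge> 0" and \<sigma>: "\<sigma> > 0"
  obtains K where "K \<ge> 0" "\<And>y. y \<ge> 0 \<Longrightarrow> (1 + y) powr s \<le> K * exp (\<sigma> * y)"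
proof (cases "s = 0")
  case True
  then show ?thesis using \<sigma> by (intro that[of 1]) auto
next
  case False
  then have s0: "s > 0" using s by simp
  have "(1 + y) powr s \<le> ((s / \<sigma>) powr s * exp \<sigma>) * exp (\<sigma> * y)" if "y \<ge> 0" for y
  proof -
    have "\<sigma> / s * (1 + y) \<le> exp (\<sigma> / s * (1 + y))" using exp_ge_add_one_self[of "\<sigma> / s * (1 + y)"] by linarith
    then have "1 + y \<le> s / \<sigma> * exp (\<sigma> / s * (1 + y))" using s0 \<sigma> by (simp add: field_simps)
    then have "(1 + y) powr s \<le> (s / \<sigma> * exp (\<sigma> / s * (1 + y))) powr s" using that s by (intro powr_mono2) auto
    also have "\<dots> = (s / \<sigma>) powr s * exp (\<sigma> * (1 + y))"
    proof -
      have "(s / \<sigma> * exp (\<sigma> / s * (1 + y))) powr s = (s / \<sigma>) powr s * exp (\<sigma> / s * (1 + y)) powr s"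
        by (rule powr_mult)
      also have "exp (\<sigma> / s * (1 + y)) powr s = exp (\<sigma> * (1 + y))"
        using s0 unfolding exp_powr_real by simp
      finally show ?thesis .
    qed
    finally show ?thesis by (simp add: distrib_left exp_add mult_ac)
  qed
  then show ?thesis by (intro that[of "(s / \<sigma>) powr s * exp \<sigma>"]) auto
qed

lemma integrable_weight_gaussian:
  assumes s: "s \<ge> 0" and \<sigma>: "\<sigma> > 0"
  shows "integrable lborel (\<lambda>\<xi>::'a::euclidean_space. (1 + (norm \<xi>)\<^sup>2) powr s * exp (- (\<sigma> * (norm \<xi>)\<^sup>2)))"
proof -
  obtain K where K: "K \<ge> 0" "\<And>y. y \<ge> 0 \<Longrightarrow> (1 + y) powr s \<le> K * exp (\<sigma> / 2 * y)"
    using powr_le_exp[OF s, of "\<sigma> / 2"] \<sigma> by (metis half_gt_zero)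
  show ?thesis
  proof (rule Bochner_Integration.integrable_bound)
    show "integrable lborel (\<lambda>\<xi>::'a. K * gs \<sigma> \<xi>)" by (intro integrable_mult_right integrable_gs \<sigma>)
    show "AE \<xi>::'a in lborel. norm ((1 + (norm \<xi>)\<^sup>2) powr s * exp (- (\<sigma> * (norm \<xi>)\<^sup>2))) \<le> norm (K * gs \<sigma> \<xi>)"
    proof (intro AE_I2)
      fix \<xi> :: 'a
      have "(1 + (norm \<xi>)\<^sup>2) powr s * exp (- (\<sigma> * (norm \<xi>)\<^sup>2)) \<le> K * exp (\<sigma> / 2 * (norm \<xi>)\<^sup>2) * exp (- (\<sigma> * (norm \<xi>)\<^sup>2))"
        by (intro mult_right_mono K) auto
      also have "\<dots> = K * gs \<sigma> \<xi>" by (simp add: gs_def mult.assoc exp_add[symmetric])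
      finally show "norm ((1 + (norm \<xi>)\<^sup>2) powr s * exp (- (\<sigma> * (norm \<xi>)\<^sup>2))) \<le> norm (K * gs \<sigma> \<xi>)"
        using K(1) by simp
    qed
  qed measurable
qed

lemma abs_exp_minus_diff_le:
  fixes x y :: real
  assumes "x \<ge> 0" "y \<ge> 0"
  shows "\<bar>exp (- x) - exp (- y)\<bar> \<le> \<bar>x - y\<bar>"
proof -
  have *: "exp (- p) - exp (- q) \<le> q - p" if "0 \<le> p" "p \<le> q" for p q :: real
  proof -
    have "exp (- p) - exp (- q) = exp (- p) * (1 - exp (- (q - p)))"
      by (simp add: right_diff_distrib exp_add[symmetric])
    also have "\<dots> \<le> 1 * (1 - exp (- (q - p)))" using that by (intro mult_right_mono) auto
    also have "\<dots> \<le> q - p"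
    proof -
      define E where "E = exp (- (q - p))"
      have "1 + - (q - p) \<le> E" unfolding E_def by (rule exp_ge_add_one_self)
      then show ?thesis unfolding E_def[symmetric] by (simp add: algebra_simps)
    qed
    finally show ?thesis .
  qed
  show ?thesis
  proof (cases "x \<le> y")
    case True then show ?thesis using *[of x y] assms by (simp add: abs_if)
  next
    case False then show ?thesis using *[of y x] assms by (simp add: abs_if)
  qed
qed

text \<open>From 1 + |\<xi>|^2 \<le> k^2 (1 + |\<xi>/k|^2) and the Jacobian k^n, enlarged to k^(2n).
  The exponent is crude, but a polynomial loss in k is all that is needed where the solution decays
  exponentially in T.\<close>

lemma weight_scale:
  fixes g :: "'a::euclidean_space \<Rightarrow> complex"
  assumes k: "k \<ge> 1" and s: "s \<ge> 0"
    and g: "integrable lborel (\<lambda>\<xi>. (1 + (norm \<xi>)\<^sup>2) powr s * (norm (g \<xi>))\<^sup>2)" and gm: "g \<in> borel_measurable borel"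
  shows "integrable lborel (\<lambda>\<xi>. (1 + (norm \<xi>)\<^sup>2) powr s * (norm (g ((1 / k) *\<^sub>R \<xi>)))\<^sup>2)"
    and "(LINT \<xi>|lborel. (1 + (norm \<xi>)\<^sup>2) powr s * (norm (g ((1 / k) *\<^sub>R \<xi>)))\<^sup>2)
      \<le> (k\<^sup>2) powr (s + DIM('a)) * (LINT \<xi>|lborel. (1 + (norm \<xi>)\<^sup>2) powr s * (norm (g \<xi>))\<^sup>2)"
proof -
  define h where "h \<xi> = (1 + (norm \<xi>)\<^sup>2) powr s * (norm (g \<xi>))\<^sup>2" for \<xi>
  have hi: "integrable lborel (\<lambda>\<xi>. (k\<^sup>2) powr s * h ((1 / k) *\<^sub>R \<xi>))"
    using integrable_lborel_affine[of h "1 / k" 0] g k by (auto simp: h_def[abs_def])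
  have le: "(1 + (norm \<xi>)\<^sup>2) powr s * (norm (g ((1 / k) *\<^sub>R \<xi>)))\<^sup>2 \<le> (k\<^sup>2) powr s * h ((1 / k) *\<^sub>R \<xi>)" for \<xi>
  proof -
    have "k\<^sup>2 \<ge> 1" using k by simp
    then have "1 + (norm \<xi>)\<^sup>2 \<le> k\<^sup>2 * (1 + (norm ((1 / k) *\<^sub>R \<xi>))\<^sup>2)"
      using k by (simp add: distrib_left power_divide)
    then have "(1 + (norm \<xi>)\<^sup>2) powr s \<le> (k\<^sup>2 * (1 + (norm ((1 / k) *\<^sub>R \<xi>))\<^sup>2)) powr s"
      using s by (intro powr_mono2) auto
    also have "\<dots> = (k\<^sup>2) powr s * (1 + (norm ((1 / k) *\<^sub>R \<xi>))\<^sup>2) powr s" by (rule powr_mult)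
    finally show ?thesis unfolding h_def mult.assoc[symmetric] by (intro mult_right_mono) auto
  qed
  note [measurable] = gm
  show "integrable lborel (\<lambda>\<xi>. (1 + (norm \<xi>)\<^sup>2) powr s * (norm (g ((1 / k) *\<^sub>R \<xi>)))\<^sup>2)"
  proof (rule Bochner_Integration.integrable_bound[OF hi])
    show "AE \<xi> in lborel. norm ((1 + (norm \<xi>)\<^sup>2) powr s * (norm (g ((1 / k) *\<^sub>R \<xi>)))\<^sup>2) \<le> norm ((k\<^sup>2) powr s * h ((1 / k) *\<^sub>R \<xi>))"
    proof (intro AE_I2)
      fix \<xi> :: 'a
      have "0 \<le> h ((1 / k) *\<^sub>R \<xi>)" by (simp add: h_def)
      then show "norm ((1 + (norm \<xi>)\<^sup>2) powr s * (norm (g ((1 / k) *\<^sub>R \<xi>)))\<^sup>2) \<le> norm ((k\<^sup>2) powr s * h ((1 / k) *\<^sub>R \<xi>))"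
        using le[of \<xi>] by (simp del: norm_scaleR)
    qed
  qed measurable
  have h0: "0 \<le> integral\<^sup>L lborel h" by (rule integral_nonneg_AE) (simp add: h_def)
  have "(LINT \<xi>|lborel. (1 + (norm \<xi>)\<^sup>2) powr s * (norm (g ((1 / k) *\<^sub>R \<xi>)))\<^sup>2) \<le> (LINT \<xi>|lborel. (k\<^sup>2) powr s * h ((1 / k) *\<^sub>R \<xi>))"
    by (rule integral_mono'[OF hi le]) (simp add: h_def)
  also have "\<dots> = (k\<^sup>2) powr s * (k ^ DIM('a) * integral\<^sup>L lborel h)"
    using integral_lborel_affine[of "1 / k" h 0] k by (simp add: power_divide field_simps)
  also have "\<dots> \<le> (k\<^sup>2) powr s * ((k\<^sup>2) ^ DIM('a) * integral\<^sup>L lborel h)"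
    using k h0 by (intro mult_left_mono mult_right_mono power_mono) (auto simp: power2_eq_square)
  also have "\<dots> = (k\<^sup>2) powr (s + DIM('a)) * integral\<^sup>L lborel h"
    using k by (simp add: powr_add powr_realpow mult.assoc)
  finally show "(LINT \<xi>|lborel. (1 + (norm \<xi>)\<^sup>2) powr s * (norm (g ((1 / k) *\<^sub>R \<xi>)))\<^sup>2)
      \<le> (k\<^sup>2) powr (s + DIM('a)) * (LINT \<xi>|lborel. (1 + (norm \<xi>)\<^sup>2) powr s * (norm (g \<xi>))\<^sup>2)"
    by (simp add: h_def[abs_def])
qed

lemma exp_powr_tendsto_0:
  fixes q p :: real
  assumes "q > 0" "r > 0" "p \<ge> 0"
  shows "((\<lambda>T. exp (- (q * T)) * (r * T) powr p) \<longlongrightarrow> 0) at_top"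
  using assms by real_asymp

text \<open>The bound \<Psi> depends on T alone: t enters the estimates only through c \<le> t \<le>
  d, and this makes the convergence uniform in t. The division at |\<xi>| = k T is the point where
  \<mu> = 1 and the decay rate saturates.\<close>

lemma symbol_scaling_limit:
  fixes b :: "real ^ 'n \<Rightarrow> complex" and z :: "real \<Rightarrow> real \<Rightarrow> real" and A :: "real \<Rightarrow> real"
  assumes \<kappa>: "\<kappa> > 0" and C: "C \<ge> 0" and J: "J > 0" and s: "s \<ge> 0" and cd: "0 < c" "c \<le> d"
    and z1: "\<And>\<mu> t. \<mu> \<ge> 0 \<Longrightarrow> t \<ge> 0 \<Longrightarrow> \<bar>z \<mu> t\<bar> \<le> 2 * exp (- (\<kappa> * min 1 \<mu> * t))"
    and z2: "\<And>\<mu> t. \<mu> \<ge> 0 \<Longrightarrow> t \<ge> 0 \<Longrightarrow> \<bar>z \<mu> t - exp (- (\<mu> * J * t))\<bar> \<le> C * \<mu>"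
    and b: "continuous_on UNIV b" "\<And>\<xi>. norm (b \<xi>) \<le> B"
    and bs: "integrable lborel (\<lambda>\<xi>. (1 + (norm \<xi>)\<^sup>2) powr s * (norm (b \<xi>))\<^sup>2)"
    and A: "(A \<longlongrightarrow> J) at_top"
  defines "k \<equiv> \<lambda>T. sqrt (T * A T)"
  obtains \<Psi> where "(\<Psi> \<longlongrightarrow> 0) at_top"
    "\<forall>\<^sub>F T in at_top. \<forall>t\<in>{c..d}. (LINT \<xi>|lborel. (1 + (norm \<xi>)\<^sup>2) powr s *
        (norm (of_real (z ((norm ((1 / k T) *\<^sub>R \<xi>))\<^sup>2) (T * t)) * b ((1 / k T) *\<^sub>R \<xi>)
          - b 0 * of_real (exp (- ((norm \<xi>)\<^sup>2 * t)))))\<^sup>2) \<le> \<Psi> T"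
proof -
  have [measurable]: "b \<in> borel_measurable borel" by (rule borel_measurable_continuous_onI[OF b(1)])
  have B: "B \<ge> 0" using b(2)[of 0] norm_ge_zero[of "b 0"] by linarith
  \<comment> \<open>For \<mu> \<le> 1 the exponent \<kappa> \<mu> T t equals (\<kappa> t / A T)
    |\<xi>|^2, at least (\<kappa> c / (2 J)) |\<xi>|^2 as soon as A T \<le> 2 J. The entry c serves
    the heat symbol.\<close>
  define \<sigma> where "\<sigma> = min (\<kappa> * c / (2 * J)) c"
  have \<sigma>: "\<sigma> > 0" "\<sigma> \<le> c" "\<sigma> \<le> \<kappa> * c / (2 * J)" using \<kappa> cd J by (auto simp: \<sigma>_def)
  define w where "w \<xi> = (1 + (norm \<xi>)\<^sup>2) powr s" for \<xi> :: "real ^ 'n"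
  have w: "w \<xi> \<ge> 0" for \<xi> by (simp add: w_def)
  have [measurable]: "w \<in> borel_measurable borel" unfolding w_def by measurable
  \<comment> \<open>The 3 is 2 + 1: twice B from the scalar solution, once B from the heat
    symbol.\<close>
  define q where "q \<xi> = 3 * B * exp (- (\<sigma> * (norm \<xi>)\<^sup>2))" for \<xi> :: "real ^ 'n"
  have q: "q \<xi> \<ge> 0" for \<xi> using B by (simp add: q_def)
  have [measurable]: "q \<in> borel_measurable borel" unfolding q_def by measurable
  \<comment> \<open>Three errors: the scalar solution against its exponential, the scale built from
    A T against the one built from J, and the transform of the initial datum at \<xi> / k T against
    its value at 0.\<close>
  define E where "E T \<xi> = B * (C * ((norm \<xi>)\<^sup>2 / (T * A T)) + (norm \<xi>)\<^sup>2 * d * \<bar>J / A T - 1\<bar>)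
     + norm (b ((1 / k T) *\<^sub>R \<xi>) - b 0)" for T and \<xi> :: "real ^ 'n"
  \<comment> \<open>Taking the minimum keeps the fixed Gaussian majorant while E supplies pointwise
    convergence. At high frequency q^2 covers the heat symbol alone; the solution is treated
    separately.\<close>
  define D where "D T \<xi> = (if norm \<xi> \<le> k T then (min (q \<xi>) \<bar>E T \<xi>\<bar>)\<^sup>2 else (q \<xi>)\<^sup>2)" for T and \<xi> :: "real ^ 'n"
  have [measurable]: "D T \<in> borel_measurable borel" for T unfolding D_def E_def by measurable
  have Dq: "D T \<xi> \<le> (q \<xi>)\<^sup>2" and D0: "D T \<xi> \<ge> 0" for T \<xi> using q[of \<xi>] by (auto simp: D_def intro!: power_mono)
  have q2: "(q \<xi>)\<^sup>2 = 9 * B\<^sup>2 * exp (- (2 * \<sigma> * (norm \<xi>)\<^sup>2))" for \<xi>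
    by (simp add: q_def power_mult_distrib exp_double[symmetric])
  have wqi: "integrable lborel (\<lambda>\<xi>. w \<xi> * (q \<xi>)\<^sup>2)"
    using integrable_mult_right[OF integrable_weight_gaussian[OF s, of "2 * \<sigma>", where 'a="real ^ 'n"], of "9 * B\<^sup>2"] \<sigma>(1)
    by (simp add: w_def q2 mult_ac)
  have wD: "integrable lborel (\<lambda>\<xi>. w \<xi> * D T \<xi>)" for T
    by (rule Bochner_Integration.integrable_bound[OF wqi]) (measurable, use w Dq D0 in \<open>auto intro!: AE_I2 mult_left_mono simp: abs_mult\<close>)
  have TA: "filterlim (\<lambda>T. T * A T) at_top at_top"
    by (rule filterlim_at_top_mult_tendsto_pos[OF A J filterlim_ident, THEN filterlim_cong[THEN iffD1, OF refl refl, rotated]]) (simp add: mult.commute)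
  have klim: "filterlim k at_top at_top" unfolding k_def by (rule filterlim_compose[OF sqrt_at_top TA])
  have ik: "((\<lambda>T. 1 / k T) \<longlongrightarrow> 0) at_top"
    using tendsto_divide_0[OF tendsto_const filterlim_at_top_imp_at_infinity[OF klim]] .
  define h where "h = (LINT \<xi>|lborel. (1 + (norm \<xi>)\<^sup>2) powr s * (norm (b \<xi>))\<^sup>2)"
  have h: "h \<ge> 0" unfolding h_def by (rule integral_nonneg_AE) simp
  \<comment> \<open>The 8 is 2 from splitting the square of a difference times 4 from the squared
    bound of z; 2 J T bounds k^2 for large T.\<close>
  define \<Psi> where "\<Psi> T = (LINT \<xi>|lborel. w \<xi> * D T \<xi>) + 8 * h * (exp (- (2 * \<kappa> * c * T)) * (2 * J * T) powr (s + CARD('n)))" for T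
  show ?thesis
  proof (rule that[of \<Psi>])
    have "((\<lambda>T. LINT \<xi>|lborel. w \<xi> * D T \<xi>) \<longlongrightarrow> (LINT \<xi>::real ^ 'n|lborel. 0)) at_top"
    proof (rule integral_dominated_convergence_at_top[where w="\<lambda>\<xi>. w \<xi> * (q \<xi>)\<^sup>2"])
      show "\<forall>\<^sub>F T in at_top. AE \<xi> in lborel. norm (w \<xi> * D T \<xi>) \<le> w \<xi> * (q \<xi>)\<^sup>2"
        using w Dq D0 by (intro always_eventually allI AE_I2) (auto intro!: mult_left_mono)
      show "AE \<xi> in lborel. ((\<lambda>T. w \<xi> * D T \<xi>) \<longlongrightarrow> 0) at_top"
      proof (intro AE_I2)
        fix \<xi> :: "real ^ 'n"
        have "((\<lambda>T. b ((1 / k T) *\<^sub>R \<xi>)) \<longlongrightarrow> b 0) at_top"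
        proof (rule tendsto_compose[where g=b])
          show "b \<midarrow>0\<rightarrow> b 0" using b(1) by (simp add: continuous_on_def)
          show "((\<lambda>T. (1 / k T) *\<^sub>R \<xi>) \<longlongrightarrow> 0) at_top" using tendsto_scaleR[OF ik tendsto_const, of \<xi>] by simp
        qed
        moreover have "((\<lambda>T. (norm \<xi>)\<^sup>2 / (T * A T)) \<longlongrightarrow> 0) at_top"
          using tendsto_divide_0[OF tendsto_const filterlim_at_top_imp_at_infinity[OF TA]] .
        ultimately have "((\<lambda>T. (E T \<xi>)\<^sup>2) \<longlongrightarrow> (B * (C * 0 + (norm \<xi>)\<^sup>2 * d * \<bar>J / J - 1\<bar>) + norm (b 0 - b 0))\<^sup>2) at_top"
          unfolding E_def using J by (intro tendsto_intros A) auto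
        then have E0: "((\<lambda>T. (E T \<xi>)\<^sup>2) \<longlongrightarrow> 0) at_top" using J by simp
        have "((\<lambda>T. D T \<xi>) \<longlongrightarrow> 0) at_top"
        proof (rule tendsto_sandwich[OF _ _ tendsto_const E0])
          show "\<forall>\<^sub>F T in at_top. D T \<xi> \<le> (E T \<xi>)\<^sup>2"
            using filterlim_at_top[THEN iffD1, OF klim, rule_format, of "norm \<xi>"]
          proof eventually_elim
            fix T assume "norm \<xi> \<le> k T"
            then have "D T \<xi> = (min (q \<xi>) \<bar>E T \<xi>\<bar>)\<^sup>2" by (simp add: D_def)
            also have "\<dots> \<le> \<bar>E T \<xi>\<bar>\<^sup>2" using q[of \<xi>] by (intro power_mono) auto
            finally show "D T \<xi> \<le> (E T \<xi>)\<^sup>2" by simp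
          qed
        qed (simp add: D0)
        from tendsto_mult_left[OF this, of "w \<xi>"] show "((\<lambda>T. w \<xi> * D T \<xi>) \<longlongrightarrow> 0) at_top" by simp
      qed
    qed (use wqi in measurable)
    moreover have "((\<lambda>T. 8 * h * (exp (- (2 * \<kappa> * c * T)) * (2 * J * T) powr (s + CARD('n)))) \<longlongrightarrow> 8 * h * 0) at_top"
      using \<kappa> cd J s by (intro tendsto_mult_left exp_powr_tendsto_0) auto
    ultimately show "(\<Psi> \<longlongrightarrow> 0) at_top" unfolding \<Psi>_def[abs_def] using tendsto_add by fastforce
    have ev: "\<forall>\<^sub>F T in at_top. 1 \<le> T \<and> 1 \<le> T * A T \<and> 0 < A T \<and> A T \<le> 2 * J"
      using eventually_ge_at_top[of 1] filterlim_at_top[THEN iffD1, OF TA, rule_format, of 1]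
        order_tendstoD(1)[OF A J] order_tendstoD(2)[OF A, of "2 * J"] J
      by (simp add: eventually_conj_iff less_imp_le eventually_mono)
    then show "\<forall>\<^sub>F T in at_top. \<forall>t\<in>{c..d}. (LINT \<xi>|lborel. (1 + (norm \<xi>)\<^sup>2) powr s *
        (norm (of_real (z ((norm ((1 / k T) *\<^sub>R \<xi>))\<^sup>2) (T * t)) * b ((1 / k T) *\<^sub>R \<xi>)
          - b 0 * of_real (exp (- ((norm \<xi>)\<^sup>2 * t)))))\<^sup>2) \<le> \<Psi> T"
    proof eventually_elim
      fix T assume "1 \<le> T \<and> 1 \<le> T * A T \<and> 0 < A T \<and> A T \<le> 2 * J"
      then have T: "1 \<le> T" "1 \<le> T * A T" "0 < A T" "A T \<le> 2 * J" by auto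
      have k: "k T \<ge> 1" "(k T)\<^sup>2 = T * A T" using T by (auto simp: k_def)
      note sc = weight_scale[OF k(1) s bs \<open>b \<in> borel_measurable borel\<close>, folded w_def]
      show "\<forall>t\<in>{c..d}. (LINT \<xi>|lborel. (1 + (norm \<xi>)\<^sup>2) powr s *
        (norm (of_real (z ((norm ((1 / k T) *\<^sub>R \<xi>))\<^sup>2) (T * t)) * b ((1 / k T) *\<^sub>R \<xi>)
          - b 0 * of_real (exp (- ((norm \<xi>)\<^sup>2 * t)))))\<^sup>2) \<le> \<Psi> T"
      proof
        fix t assume t: "t \<in> {c..d}"
        then have t0: "t \<ge> 0" "T * t \<ge> 0" "c \<le> t" "t \<le> d" using cd T by auto
        define \<mu> where "\<mu> \<xi> = (norm ((1 / k T) *\<^sub>R \<xi>))\<^sup>2" for \<xi> :: "real ^ 'n"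
        have \<mu>: "\<mu> \<xi> = (norm \<xi>)\<^sup>2 / (T * A T)" "\<mu> \<xi> \<ge> 0" for \<xi>
          unfolding \<mu>_def k(2)[symmetric] by (simp_all add: power_divide)
        define \<beta> where "\<beta> \<xi> = b ((1 / k T) *\<^sub>R \<xi>)" for \<xi>
        define \<Phi> where "\<Phi> \<xi> = of_real (z (\<mu> \<xi>) (T * t)) * \<beta> \<xi> - b 0 * of_real (exp (- ((norm \<xi>)\<^sup>2 * t)))" for \<xi>
        have e2: "exp (- ((norm \<xi>)\<^sup>2 * t)) \<le> exp (- (\<sigma> * (norm \<xi>)\<^sup>2))" for \<xi> :: "real ^ 'n"
          using mult_left_mono[of \<sigma> t "(norm \<xi>)\<^sup>2"] \<sigma>(2) t0(3) by (simp add: mult.commute)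
        have second: "norm (b 0 * of_real (exp (- ((norm \<xi>)\<^sup>2 * t)))) \<le> B * exp (- (\<sigma> * (norm \<xi>)\<^sup>2))" for \<xi> :: "real ^ 'n"
          unfolding norm_mult norm_of_real abs_exp_cancel using b(2) B by (intro mult_mono e2) auto
        have key: "(norm (\<Phi> \<xi>))\<^sup>2 \<le> D T \<xi> + 8 * exp (- (2 * \<kappa> * c * T)) * (norm (\<beta> \<xi>))\<^sup>2" for \<xi>
        proof (cases "norm \<xi> \<le> k T")
          case True
          then have "(norm \<xi>)\<^sup>2 \<le> (k T)\<^sup>2" by (intro power_mono) auto
          then have m1: "\<mu> \<xi> \<le> 1" unfolding \<mu>(1) k(2) using T by simp
          have kt: "\<kappa> * min 1 (\<mu> \<xi>) * (T * t) = (\<kappa> * t / A T) * (norm \<xi>)\<^sup>2"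
            using m1 T by (simp add: \<mu>(1) min_def field_simps)
          have "\<kappa> * c / (2 * J) \<le> \<kappa> * t / A T"
            using \<kappa> cd T t0 by (intro frac_le mult_left_mono mult_nonneg_nonneg) auto
          then have "\<sigma> * (norm \<xi>)\<^sup>2 \<le> (\<kappa> * t / A T) * (norm \<xi>)\<^sup>2" using \<sigma>(3) by (intro mult_right_mono) auto
          then have "\<bar>z (\<mu> \<xi>) (T * t)\<bar> \<le> 2 * exp (- (\<sigma> * (norm \<xi>)\<^sup>2))"
            using z1[OF \<mu>(2)[of \<xi>] t0(2)] unfolding kt by (auto elim!: order_trans)
          then have "norm (of_real (z (\<mu> \<xi>) (T * t)) * \<beta> \<xi>) \<le> 2 * exp (- (\<sigma> * (norm \<xi>)\<^sup>2)) * B"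
            unfolding norm_mult norm_of_real \<beta>_def using b(2) by (intro mult_mono) auto
          then have P1: "norm (\<Phi> \<xi>) \<le> q \<xi>"
            unfolding \<Phi>_def q_def using second[of \<xi>] by (intro order_trans[OF norm_triangle_ineq4]) (simp add: algebra_simps)
          define e1 where "e1 = exp (- (\<mu> \<xi> * J * (T * t)))"
          define e2 where "e2 = exp (- ((norm \<xi>)\<^sup>2 * t))"
          have dec: "\<Phi> \<xi> = of_real (z (\<mu> \<xi>) (T * t) - e1) * \<beta> \<xi> + of_real (e1 - e2) * \<beta> \<xi> + of_real e2 * (\<beta> \<xi> - b 0)"
            by (simp add: \<Phi>_def e2_def algebra_simps)
          have n1: "norm (of_real (z (\<mu> \<xi>) (T * t) - e1) * \<beta> \<xi>) \<le> (C * \<mu> \<xi>) * B"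
            unfolding norm_mult norm_of_real \<beta>_def e1_def using b(2) z2[OF \<mu>(2) t0(2)] C \<mu>(2) by (intro mult_mono) auto
          have "\<bar>e1 - e2\<bar> \<le> \<bar>\<mu> \<xi> * J * (T * t) - (norm \<xi>)\<^sup>2 * t\<bar>"
            unfolding e1_def e2_def using J \<mu>(2) t0 by (intro abs_exp_minus_diff_le) auto
          also have "\<mu> \<xi> * J * (T * t) - (norm \<xi>)\<^sup>2 * t = (norm \<xi>)\<^sup>2 * t * (J / A T - 1)"
            using T by (simp add: \<mu>(1) field_simps)
          also have "\<bar>\<dots>\<bar> = (norm \<xi>)\<^sup>2 * t * \<bar>J / A T - 1\<bar>" using t0 by (simp add: abs_mult)
          also have "\<dots> \<le> (norm \<xi>)\<^sup>2 * d * \<bar>J / A T - 1\<bar>" using t0 by (intro mult_right_mono mult_left_mono) auto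
          finally have n2: "norm (of_real (e1 - e2) * \<beta> \<xi>) \<le> ((norm \<xi>)\<^sup>2 * d * \<bar>J / A T - 1\<bar>) * B"
            unfolding norm_mult norm_of_real \<beta>_def using b(2) t0 cd by (intro mult_mono) auto
          have n3: "norm (of_real e2 * (\<beta> \<xi> - b 0)) \<le> 1 * norm (\<beta> \<xi> - b 0)"
            unfolding norm_mult norm_of_real e2_def using t0 by (intro mult_right_mono) auto
          have "norm (\<Phi> \<xi>) \<le> E T \<xi>"
            unfolding dec E_def using n1 n2 n3 by (intro order_trans[OF norm_triangle_mono[OF norm_triangle_mono[OF n1 n2] n3]])
              (simp add: \<mu>(1) \<beta>_def algebra_simps)
          then have "norm (\<Phi> \<xi>) \<le> min (q \<xi>) \<bar>E T \<xi>\<bar>" using P1 by auto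
          then have "(norm (\<Phi> \<xi>))\<^sup>2 \<le> D T \<xi>" using True by (simp add: D_def power_mono)
          then show ?thesis by (rule order_trans) simp
        next
          case False
          then have "(norm \<xi>)\<^sup>2 \<ge> (k T)\<^sup>2" using k(1) by (intro power_mono) auto
          then have m1: "min 1 (\<mu> \<xi>) = 1" unfolding \<mu>(1) k(2) using T by simp
          have "\<bar>z (\<mu> \<xi>) (T * t)\<bar> \<le> 2 * exp (- (\<kappa> * (T * t)))" using z1[OF \<mu>(2)[of \<xi>] t0(2)] by (simp add: m1)
          also have "\<dots> \<le> 2 * exp (- (\<kappa> * c * T))"
            using \<kappa> T t0 mult_left_mono[of c t "\<kappa> * T"] by (simp add: mult_ac)
          finally have "\<bar>z (\<mu> \<xi>) (T * t)\<bar>\<^sup>2 \<le> (2 * exp (- (\<kappa> * c * T)))\<^sup>2" by (intro power_mono) auto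
          also have "\<dots> = 4 * exp (- (2 * \<kappa> * c * T))" by (simp add: power_mult_distrib exp_double[symmetric] mult.assoc)
          finally have zz: "(norm (of_real (z (\<mu> \<xi>) (T * t)) * \<beta> \<xi>))\<^sup>2 \<le> 4 * exp (- (2 * \<kappa> * c * T)) * (norm (\<beta> \<xi>))\<^sup>2"
            unfolding norm_mult norm_of_real power_mult_distrib by (intro mult_right_mono) auto
          have "(norm (b 0 * of_real (exp (- ((norm \<xi>)\<^sup>2 * t)))))\<^sup>2 \<le> (B * exp (- (\<sigma> * (norm \<xi>)\<^sup>2)))\<^sup>2"
            by (intro power_mono second) simp
          then have "2 * (norm (b 0 * of_real (exp (- ((norm \<xi>)\<^sup>2 * t)))))\<^sup>2 \<le> D T \<xi>"
          proof -
            have "D T \<xi> = 9 * (B * exp (- (\<sigma> * (norm \<xi>)\<^sup>2)))\<^sup>2" using False by (simp add: D_def q_def power_mult_distrib)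
            with \<open>_ \<le> (B * exp (- (\<sigma> * (norm \<xi>)\<^sup>2)))\<^sup>2\<close> show ?thesis
              using zero_le_power2[of "B * exp (- (\<sigma> * (norm \<xi>)\<^sup>2))"] by linarith
          qed
          moreover have "(norm (\<Phi> \<xi>))\<^sup>2 \<le> 2 * (norm (of_real (z (\<mu> \<xi>) (T * t)) * \<beta> \<xi>))\<^sup>2 + 2 * (norm (b 0 * of_real (exp (- ((norm \<xi>)\<^sup>2 * t)))))\<^sup>2"
            unfolding \<Phi>_def by (rule norm_diff_sq_le)
          ultimately show ?thesis using zz by linarith
        qed
        have i2: "integrable lborel (\<lambda>\<xi>. w \<xi> * (norm (\<beta> \<xi>))\<^sup>2)" unfolding \<beta>_def by (rule sc(1))
        have "(LINT \<xi>|lborel. w \<xi> * (norm (\<Phi> \<xi>))\<^sup>2) \<le>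
          (LINT \<xi>|lborel. w \<xi> * D T \<xi> + 8 * exp (- (2 * \<kappa> * c * T)) * (w \<xi> * (norm (\<beta> \<xi>))\<^sup>2))"
        proof (rule integral_mono')
          show "integrable lborel (\<lambda>\<xi>. w \<xi> * D T \<xi> + 8 * exp (- (2 * \<kappa> * c * T)) * (w \<xi> * (norm (\<beta> \<xi>))\<^sup>2))"
            by (intro Bochner_Integration.integrable_add integrable_mult_right wD i2)
          fix \<xi> :: "real ^ 'n"
          show "w \<xi> * (norm (\<Phi> \<xi>))\<^sup>2 \<le> w \<xi> * D T \<xi> + 8 * exp (- (2 * \<kappa> * c * T)) * (w \<xi> * (norm (\<beta> \<xi>))\<^sup>2)"
            using mult_left_mono[OF key w, of \<xi> \<xi>] by (simp add: distrib_left mult_ac)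
        qed (simp add: w D0)
        also have "\<dots> = (LINT \<xi>|lborel. w \<xi> * D T \<xi>) + 8 * exp (- (2 * \<kappa> * c * T)) * (LINT \<xi>|lborel. w \<xi> * (norm (\<beta> \<xi>))\<^sup>2)"
          using wD[of T] i2 by simp
        also have "\<dots> \<le> \<Psi> T"
        proof -
          have "(LINT \<xi>|lborel. w \<xi> * (norm (\<beta> \<xi>))\<^sup>2) \<le> (T * A T) powr (s + CARD('n)) * h"
            unfolding \<beta>_def using sc(2) by (simp add: k(2) h_def w_def)
          also have "\<dots> \<le> (2 * J * T) powr (s + CARD('n)) * h"
            using T s h mult_left_mono[OF T(4), of T] by (intro mult_right_mono powr_mono2) (auto simp: mult_ac)
          finally have "8 * exp (- (2 * \<kappa> * c * T)) * (LINT \<xi>|lborel. w \<xi> * (norm (\<beta> \<xi>))\<^sup>2)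
             \<le> 8 * exp (- (2 * \<kappa> * c * T)) * ((2 * J * T) powr (s + CARD('n)) * h)" by (intro mult_left_mono) auto
          then show ?thesis by (simp add: \<Psi>_def mult_ac)
        qed
        finally show "(LINT \<xi>|lborel. (1 + (norm \<xi>)\<^sup>2) powr s *
          (norm (of_real (z ((norm ((1 / k T) *\<^sub>R \<xi>))\<^sup>2) (T * t)) * b ((1 / k T) *\<^sub>R \<xi>)
          - b 0 * of_real (exp (- ((norm \<xi>)\<^sup>2 * t)))))\<^sup>2) \<le> \<Psi> T"
          by (simp only: \<Phi>_def \<mu>_def \<beta>_def w_def)
      qed
    qed
  qed
qed

section \<open>From the hypotheses to the scaling limit\<close>

lemma laplace_extends_D:
  assumes "laplace_extends a \<alpha>" and \<beta>: "\<beta> \<le> \<alpha>"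
  shows "set_integrable lborel {0<..} (\<lambda>s. exp (\<beta> * s) * a s)"
    and "Re (laplace a (- of_real \<beta> + \<i> * of_real \<omega>)) = costrans (\<lambda>s. exp (\<beta> * s) * a s) \<omega>"
proof -
  let ?F = "\<lambda>\<omega> t. indicator {0<..} t *\<^sub>R (exp (- (- of_real \<beta> + \<i> * of_real \<omega>) * of_real t) * complex_of_real (a t))"
  have F: "integrable lborel (?F \<omega>)" for \<omega>
    using assms(1)[unfolded laplace_extends_def, rule_format, of "- of_real \<beta> + \<i> * of_real \<omega>"] \<beta>
    by (simp add: set_integrable_def)
  have R: "Re (?F \<omega> t) = indicator {0<..} t *\<^sub>R (exp (\<beta> * t) * a t * cos (\<omega> * t))" for \<omega> t
    by (simp add: Re_exp algebra_simps)
  show "set_integrable lborel {0<..} (\<lambda>s. exp (\<beta> * s) * a s)"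
    using integrable_Re[OF F[of 0]] unfolding R by (simp add: set_integrable_def)
  show "Re (laplace a (- of_real \<beta> + \<i> * of_real \<omega>)) = costrans (\<lambda>s. exp (\<beta> * s) * a s) \<omega>"
    unfolding laplace_def costrans_def set_lebesgue_integral_def
    by (subst integral_Re[symmetric, OF F]) (simp only: R)
qed

lemma integrated_kernel_tendsto:
  assumes a: "set_integrable lborel {0<..} a"
  shows "(integrated_kernel a\<^sub>0 a \<longlongrightarrow> a\<^sub>0 + (LINT s:{0<..}|lborel. a s)) at_top"
  unfolding integrated_kernel_def
proof (intro tendsto_add tendsto_const)
  have I: "integrable lborel (\<lambda>r. indicator {0<..} r *\<^sub>R a r)" using a by (simp add: set_integrable_def)
  then have [measurable]: "(\<lambda>r. indicator {0<..} r *\<^sub>R a r) \<in> borel_measurable borel" by auto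
  have eq: "indicator {0<..<t} r *\<^sub>R a r = indicator {..<t} r *\<^sub>R (indicator {0<..} r *\<^sub>R a r)" for t r
    by (auto simp: indicator_def)
  show "((\<lambda>t. LINT r:{0<..<t}|lborel. a r) \<longlongrightarrow> (LINT r:{0<..}|lborel. a r)) at_top"
    unfolding set_lebesgue_integral_def
  proof (rule integral_dominated_convergence_at_top[where w="\<lambda>r. norm (indicator {0<..} r *\<^sub>R a r)"])
    show "(\<lambda>r. indicator {0<..<t} r *\<^sub>R a r) \<in> borel_measurable lborel" for t unfolding eq by measurable
    show "integrable lborel (\<lambda>r. norm (indicator {0<..} r *\<^sub>R a r))" by (rule integrable_norm[OF I])
    show "AE r in lborel. ((\<lambda>t. indicator {0<..<t} r *\<^sub>R a r) \<longlongrightarrow> indicator {0<..} r *\<^sub>R a r) at_top"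
    proof (intro AE_I2 tendsto_eventually)
      fix r :: real
      show "\<forall>\<^sub>F t in at_top. indicator {0<..<t} r *\<^sub>R a r = indicator {0<..} r *\<^sub>R a r"
        using eventually_gt_at_top[of r] by eventually_elim (simp add: indicator_def)
    qed
    show "(\<lambda>r. indicator {0<..} r *\<^sub>R a r) \<in> borel_measurable lborel" by measurable
  qed (auto simp: indicator_def)
qed

theorem theorem5p1:
  fixes a\<^sub>0 s \<alpha> :: real
    and a :: "real \<Rightarrow> real"
    and u\<^sub>0 :: "real ^ 'n \<Rightarrow> complex"
    and u u_inf :: "real \<Rightarrow> real ^ 'n \<Rightarrow> complex"
  assumes "a\<^sub>0 \<ge> 0"
    and "\<And>\<epsilon>. \<epsilon> > 0 \<Longrightarrow> bounded (a ` {\<epsilon>..})"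
    and "set_integrable lborel {0<..<1} a"
    and nondegenerate: "\<exists>t>0. integrated_kernel a\<^sub>0 a t \<noteq> 0"
    and "s \<ge> 0" and "integrable lborel u\<^sub>0" and "u\<^sub>0 \<in> sobolev s"
    and "\<alpha> > 0" and "laplace_extends a \<alpha>"
    and "(a\<^sub>0 > 0 \<and> (\<forall>\<omega>. a\<^sub>0 + Re (laplace a (\<i> * of_real \<omega>)) > 0)) \<or>
         (\<forall>\<omega>. Re (laplace a (- of_real \<alpha> + \<i> * of_real \<omega>)) \<ge> 0)"
    and "continuous_sobolev s u"
    and "distributional_solution a\<^sub>0 a u"
    and "AE x in lborel. u 0 x = u\<^sub>0 x"
    and "\<And>t. t > 0 \<Longrightarrow> has_fourier_L2 (u_inf t) (\<lambda>\<xi>. of_real (exp (- ((norm \<xi>)\<^sup>2 * t))))"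
  shows "(\<forall>t>0. (\<lambda>x. (LINT y|lborel. u\<^sub>0 y) * u_inf t x) \<in> sobolev s) \<and>
    (\<forall>c d. 0 < c \<and> c \<le> d \<longrightarrow>
       (\<forall>\<^sub>F T in at_top. \<forall>t\<in>{c..d}. rescaled (diffusion_scale a\<^sub>0 a) u T t \<in> sobolev s) \<and>
       uniform_limit {c..d}
         (\<lambda>T t. sobolev_norm s
            (\<lambda>x. rescaled (diffusion_scale a\<^sub>0 a) u T t x - (LINT y|lborel. u\<^sub>0 y) * u_inf t x))
         (\<lambda>_. 0) at_top)"
proof -
  note a0 = assms(1) and s = assms(5) and u0 = assms(6,7) and \<alpha> = assms(8)
    and u = assms(11) and sol = assms(12) and init = assms(13) and uinf = assms(14)
  have E: "set_integrable lborel {0<..} (\<lambda>s. exp (\<alpha> * s) * a s)"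
    by (rule laplace_extends_D(1)[OF assms(9) order_refl])
  have a: "set_integrable lborel {0<..} a" by (rule exp_weight_zero[OF E \<alpha>])
  have L0: "Re (laplace a (\<i> * of_real \<omega>)) = costrans a \<omega>" for \<omega>
    using laplace_extends_D(2)[OF assms(9), of 0 \<omega>] \<alpha> by simp
  define J where "J = a\<^sub>0 + (LINT s:{0<..}|lborel. a s)"
  have "\<exists>\<kappa>>0. (\<forall>\<mu>\<ge>0. \<forall>t\<ge>0. \<bar>volt_sol a\<^sub>0 a \<mu> t\<bar> \<le> 2 * exp (- (\<kappa> * min 1 \<mu> * t))) \<and> J > 0"
    using assms(10)
  proof
    assume *: "a\<^sub>0 > 0 \<and> (\<forall>\<omega>. a\<^sub>0 + Re (laplace a (\<i> * of_real \<omega>)) > 0)"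
    then have pos: "a\<^sub>0 > 0" "\<And>\<omega>. a\<^sub>0 + costrans a \<omega> > 0" by (auto simp: L0)
    moreover have "J > 0" using pos(2)[of 0] by (simp add: J_def costrans_def)
    ultimately show ?thesis using volt_sol_decay_case1[OF E \<alpha> assms(2)] by metis
  next
    assume *: "\<forall>\<omega>. Re (laplace a (- of_real \<alpha> + \<i> * of_real \<omega>)) \<ge> 0"
    then have "costrans (\<lambda>s. exp (\<alpha> * s) * a s) \<omega> \<ge> 0" for \<omega>
      unfolding laplace_extends_D(2)[OF assms(9) order_refl] by blast
    then show ?thesis using volt_sol_decay_case2[OF E \<alpha> a0 _ nondegenerate] unfolding J_def by metis
  qed
  then obtain \<kappa> where \<kappa>: "\<kappa> > 0" and J: "J > 0"
    and z1: "\<And>\<mu> t. \<mu> \<ge> 0 \<Longrightarrow> t \<ge> 0 \<Longrightarrow> \<bar>volt_sol a\<^sub>0 a \<mu> t\<bar> \<le> 2 * exp (- (\<kappa> * min 1 \<mu> * t))" by blast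
  have zb: "\<bar>volt_sol a\<^sub>0 a \<mu> t\<bar> \<le> 2" if "\<mu> \<ge> 0" "t \<ge> 0" for \<mu> t
  proof -
    have "exp (- (\<kappa> * min 1 \<mu> * t)) \<le> 1" using that \<kappa> by simp
    then show ?thesis using z1[OF that] by linarith
  qed
  obtain C where C: "C \<ge> 0" and z2: "\<And>\<mu> t. \<mu> \<ge> 0 \<Longrightarrow> t \<ge> 0 \<Longrightarrow> \<bar>volt_sol a\<^sub>0 a \<mu> t - exp (- (\<mu> * J * t))\<bar> \<le> C * \<mu>"
    using volt_sol_asymptotic[OF E \<alpha> a0 zb] J unfolding J_def by metis
  define b where "b = ft u\<^sub>0"
  define U where "U = (LINT y|lborel. u\<^sub>0 y)"
  \<comment> \<open>Rescaling samples b ever closer to frequency 0, where its value is the total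
    mass; this is the origin of the factor in front of the heat kernel.\<close>
  have b0: "b 0 = U" by (simp add: b_def U_def ft_def)
  have bc: "continuous_on UNIV b" unfolding b_def by (rule continuous_ft[OF u0(1)])
  have u0L: "u\<^sub>0 \<in> L2" by (rule has_fourier_L2_D(1)[OF sobolev_has_fourier[OF u0(2)]])
  have bF: "has_fourier_L2 u\<^sub>0 b" unfolding b_def by (rule has_fourier_L2_ft[OF u0L u0(1)])
  have bs: "integrable lborel (\<lambda>\<xi>. (1 + (norm \<xi>)\<^sup>2) powr s * (norm (b \<xi>))\<^sup>2)" by (rule sobolev_weight[OF u0(2) bF])
  note v = solution_fourier[OF a a0 s u sol order_refl]
  \<comment> \<open>The initial condition identifies u(0) and \<open>u\<^sub>0\<close> as classes
    only, so the chosen transform of u(0) equals the continuous function b almost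
    everywhere.\<close>
  have "has_fourier_L2 u\<^sub>0 (fourier_L2 (u 0))"
    by (rule has_fourier_L2_cong_AE[OF v u0L init has_fourier_L2_D(2)[OF v]]) simp
  then have v0: "AE \<xi> in lborel. fourier_L2 (u 0) \<xi> = b \<xi>" using has_fourier_L2_unique bF by blast
  have uF: "has_fourier_L2 (u t) (\<lambda>\<xi>. of_real (volt_sol a\<^sub>0 a ((norm \<xi>)\<^sup>2) t) * b \<xi>)" if t: "t \<ge> 0" for t
  proof (rule has_fourier_L2_cong_AE[OF solution_fourier[OF a a0 s u sol t]])
    show "u t \<in> L2" by (rule has_fourier_L2_D(1)[OF solution_fourier[OF a a0 s u sol t]])
    have [measurable]: "(\<lambda>\<mu>. volt_sol a\<^sub>0 a \<mu> t) \<in> borel_measurable borel" by (rule borel_measurable_volt_sol[OF a a0 refl t])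
    show "(\<lambda>\<xi>. of_real (volt_sol a\<^sub>0 a ((norm \<xi>)\<^sup>2) t) * b \<xi>) \<in> L2"
      by (rule L2_bounded_mult[OF has_fourier_L2_D(2)[OF bF], where B=2]) (measurable, simp add: zb t)
    show "AE \<xi> in lborel. fourier_L2 (u t) \<xi> = of_real (volt_sol a\<^sub>0 a ((norm \<xi>)\<^sup>2) t) * b \<xi>"
    proof -
      have "AE \<xi> in lborel. fourier_L2 (u t) \<xi> = of_real (volt_sol a\<^sub>0 a ((norm \<xi>)\<^sup>2) t) * fourier_L2 (u 0) \<xi>"
        by (rule fourier_solution[OF a a0 s u sol t]) (rule zb[OF _ t])
      with v0 show ?thesis by eventually_elim simp
    qed
  qed simp
  define k where "k = diffusion_scale a\<^sub>0 a"
  let ?g = "\<lambda>T t \<xi>. of_real (volt_sol a\<^sub>0 a ((norm ((1 / k T) *\<^sub>R \<xi>))\<^sup>2) (T * t)) * b ((1 / k T) *\<^sub>R \<xi>)"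
  have rF: "has_fourier_L2 (rescaled k u T t) (?g T t)" if "k T > 0" "T * t \<ge> 0" for T t
    using has_fourier_L2_scale[OF uF[OF that(2)] that(1)] by (simp only: rescaled_def[abs_def])
  have iF: "has_fourier_L2 (\<lambda>x. U * u_inf t x) (\<lambda>\<xi>. U * of_real (exp (- ((norm \<xi>)\<^sup>2 * t))))" if "t > 0" for t
    by (rule has_fourier_L2_cmult[OF uinf[OF that]])
  have A: "(integrated_kernel a\<^sub>0 a \<longlongrightarrow> J) at_top" unfolding J_def by (rule integrated_kernel_tendsto[OF a])
  have keq: "k = (\<lambda>T. sqrt (T * integrated_kernel a\<^sub>0 a T))" by (simp add: k_def diffusion_scale_def fun_eq_iff)
  have "filterlim (\<lambda>T. T * integrated_kernel a\<^sub>0 a T) at_top at_top"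
    using filterlim_at_top_mult_tendsto_pos[OF A J filterlim_ident] by simp
  then have klim: "filterlim k at_top at_top" unfolding keq by (rule filterlim_compose[OF sqrt_at_top])
  \<comment> \<open>Positivity of k T is required by the scaling of transforms, and k T \<ge> 1 by
    \<open>weight_scale\<close>; both hold once T A(T) is large.\<close>
  have ev: "\<forall>\<^sub>F T in at_top. 0 < T \<and> 1 \<le> k T"
    using eventually_gt_at_top[of 0] filterlim_at_top[THEN iffD1, OF klim, rule_format, of 1] by eventually_elim simp
  have "(\<lambda>x. U * u_inf t x) \<in> sobolev s" if t: "t > 0" for t
  proof -
    have "integrable lborel (\<lambda>\<xi>::real ^ 'n. (norm U)\<^sup>2 * ((1 + (norm \<xi>)\<^sup>2) powr s * exp (- (2 * t * (norm \<xi>)\<^sup>2))))"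
      by (intro integrable_mult_right integrable_weight_gaussian s) (use t in simp)
    then show ?thesis
      unfolding sobolev_def using iF[OF t]
      by (auto simp: norm_mult power_mult_distrib exp_double[symmetric] mult_ac)
  qed
  moreover have "\<forall>\<^sub>F T in at_top. \<forall>t\<in>{c..d}. rescaled k u T t \<in> sobolev s" if c: "0 < c" for c d
    using ev
  proof eventually_elim
    fix T assume T: "0 < T \<and> 1 \<le> k T"
    show "\<forall>t\<in>{c..d}. rescaled k u T t \<in> sobolev s"
    proof
      fix t assume "t \<in> {c..d}"
      then have t: "T * t \<ge> 0" using c T by simp
      have "u (T * t) \<in> sobolev s" using u t by (simp add: continuous_sobolev_def)
      note w = sobolev_weight[OF this uF[OF t]]
      note m = L2D(1)[OF has_fourier_L2_D(2)[OF uF[OF t]]]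
      have "k T \<ge> 1" "k T > 0" using T by auto
      then show "rescaled k u T t \<in> sobolev s"
        unfolding sobolev_def using weight_scale(1)[OF _ s w m] rF[OF _ t] by blast
    qed
  qed
  moreover have "uniform_limit {c..d} (\<lambda>T t. sobolev_norm s (\<lambda>x. rescaled k u T t x - U * u_inf t x)) (\<lambda>_. 0) at_top"
    if cd: "0 < c" "c \<le> d" for c d
  proof -
    obtain \<Psi> where \<Psi>: "(\<Psi> \<longlongrightarrow> 0) at_top"
      and le: "\<forall>\<^sub>F T in at_top. \<forall>t\<in>{c..d}. (LINT \<xi>|lborel. (1 + (norm \<xi>)\<^sup>2) powr s *
        (norm (?g T t \<xi> - b 0 * of_real (exp (- ((norm \<xi>)\<^sup>2 * t)))))\<^sup>2) \<le> \<Psi> T"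
      using symbol_scaling_limit[OF \<kappa> C J s cd z1 z2 bc norm_ft_le[of u\<^sub>0, folded b_def] bs A] unfolding keq by blast
    show ?thesis
      unfolding uniform_limit_iff
    proof (intro allI impI)
      fix e :: real assume e: "e > 0"
      then have "\<forall>\<^sub>F T in at_top. \<Psi> T < e\<^sup>2" by (intro order_tendstoD[OF \<Psi>]) simp
      then show "\<forall>\<^sub>F T in at_top. \<forall>t\<in>{c..d}. dist (sobolev_norm s (\<lambda>x. rescaled k u T t x - U * u_inf t x)) 0 < e"
        using ev le
      proof eventually_elim
        fix T assume T: "\<Psi> T < e\<^sup>2" "0 < T \<and> 1 \<le> k T"
          and le: "\<forall>t\<in>{c..d}. (LINT \<xi>|lborel. (1 + (norm \<xi>)\<^sup>2) powr s *
            (norm (?g T t \<xi> - b 0 * of_real (exp (- ((norm \<xi>)\<^sup>2 * t)))))\<^sup>2) \<le> \<Psi> T"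
        show "\<forall>t\<in>{c..d}. dist (sobolev_norm s (\<lambda>x. rescaled k u T t x - U * u_inf t x)) 0 < e"
        proof
          fix t assume t: "t \<in> {c..d}"
          then have t0: "t > 0" "T * t \<ge> 0" using cd T by auto
          have "k T > 0" using T by linarith
          note F = has_fourier_L2_diff[OF rF[OF this t0(2)] iF[OF t0(1)]]
          have "sobolev_norm s (\<lambda>x. rescaled k u T t x - U * u_inf t x) \<le> sqrt (\<Psi> T)"
            unfolding sobolev_norm_eq[OF F] using le[unfolded b0] t by (intro real_sqrt_le_mono) blast
          also have "\<dots> < sqrt (e\<^sup>2)" using T by (intro real_sqrt_less_mono)
          finally have "sobolev_norm s (\<lambda>x. rescaled k u T t x - U * u_inf t x) < e" using e by simp
          moreover have "sobolev_norm s (\<lambda>x. rescaled k u T t x - U * u_inf t x) \<ge> 0"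
            unfolding sobolev_norm_eq[OF F] by (intro real_sqrt_ge_zero integral_nonneg_AE) simp
          ultimately show "dist (sobolev_norm s (\<lambda>x. rescaled k u T t x - U * u_inf t x)) 0 < e" by simp
        qed
      qed
    qed
  qed
  ultimately show ?thesis unfolding U_def k_def by blast
qed

end
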